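(* Let $H$ be a Hopf algebra with bijective antipode over a field $k$, let $A$ be a right $H$-Galois object, and let $L=L(A,H)$. Then $$\mathrm{Pic}^H(A)\cong\mathrm{Pic}^{\square_H}(k)\cong\mathrm{Alg}(L,k).$$
   Context: $\otimes=\otimes_k$; $S$ is the antipode of $H$; right coactions are written $\rho(a)=a_{[0]}\otimes a_{[1]}$; $M^{\mathrm{co}H}=\{m:\rho(m)=m\otimes1\}$. $H$ is not assumed cocommutative. A right $H$-Galois object is a nonzero right $H$-comodule algebra $A$ with $A^{\mathrm{co}H}=k$ such that $\mathrm{can}:A\otimes A\to A\otimes H$, $a\otimes b\mapsto ab_{[0]}\otimes b_{[1]}$, is bijective; left Galois objects are defined symmetrically. Write $\mathrm{can}^{-1}(1\otimes h)=\sum_il_i(h)\otimes r_i(h)$. $L(A,H)$ is the Hopf algebra, unique up to isomorphism, such that $A$ is an $(L,H)$-bigalois object, i.e. a left $L$-Galois object and right $H$-Galois object that is an $(L,H)$-bicomodule (Schauenburg). $\mathrm{Alg}(L,k)$ is the group, under convolution, of $k$-algebra maps $L\to k$. ${}_A\mathcal M_A^H$ is the category of $A$-bimodules $P$ with right $H$-coaction such that $\rho(apb)=a_{[0]}p_{[0]}b_{[0]}\otimes a_{[1]}p_{[1]}b_{[1]}$. $\mathrm{Pic}^H(A)$ is the group of isomorphism classes of strict Morita contexts $(A,A,P,Q,\alpha,\beta)$ with $P,Q\in{}_A\mathcal M_A^H$ and $\alpha:P\otimes_AQ\to A$, $\beta:Q\otimes_AP\to A$ morphisms in ${}_A\mathcal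 M_A^H$; isomorphisms are pairs of $H$-colinear bimodule isomorphisms compatible with the structure maps, and multiplication is induced by $\otimes_A$. $A^{\mathrm{op}}$ is a left $H$-comodule via $\lambda(a)=S^{-1}(a_{[1]})\otimes a_{[0]}$, and $A\,\square_HA^{\mathrm{op}}=\{\sum_ka_k\otimes a'_k\in A\otimes A^{\mathrm{op}}:\sum_ka_{k[0]}\otimes a_{k[1]}\otimes a'_k=\sum_ka_k\otimes S^{-1}(a'_{k[1]})\otimes a'_{k[0]}\}$, a subalgebra of $A\otimes A^{\mathrm{op}}$. It acts on $k$ by $\sum_ka_k\otimes a'_k\mapsto\sum_ka_ka'_k\in k$, and on $M\otimes N$, for left $A\,\square_HA^{\mathrm{op}}$-modules $M,N$, by $(\sum_ka_k\otimes a'_k)(m\otimes n)=\sum_{i,k}(a_{k[0]}\otimes l_i(a_{k[1]}))m\otimes(r_i(a_{k[1]})\otimes a'_k)n$. $\mathrm{Pic}^{\square_H}(k)$ is the group of isomorphism classes of strict Morita contexts $(k,k,M,N,\alpha,\beta)$ with $M,N$ left $A\,\square_HA^{\mathrm{op}}$-modules and $\alpha:M\otimes N\to k$, $\beta:N\otimes M\to k$ being $A\,\square_HA^{\mathrm{op}}$-linear; isomorphisms are compatible pairs of $A\,\square_HA^{\mathrm{op}}$-linear isomorphisms, and multiplication is induced by $\otimes$. The symbols $\cong$ denote isomorphisms of groups. *)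

theory Defs
  imports "HOL-Algebra.Module"
begin

section \<open>Tensor products\<close>

text \<open>
  A tensor is an equivalence class of finite formal sums of pairs.  The list
  \<open>[(m\<^sub>1,n\<^sub>1),\<dots>,(m\<^sub>r,n\<^sub>r)]\<close> stands for the sum of the \<open>m\<^sub>i \<otimes> n\<^sub>i\<close>, and \<open>tensor_cong\<close> is the
  congruence generated by commutativity, biadditivity and balancedness over the scalars in
  \<open>S\<close>, which act on \<open>M\<close> from the right by \<open>r\<close> and on \<open>N\<close> from the left by \<open>l\<close>.
\<close>

type_synonym ('m, 'n) tensor = "('m \<times> 'n) list set"

inductive tensor_cong ::
  "'s set \<Rightarrow> ('m \<Rightarrow> 's \<Rightarrow> 'm) \<Rightarrow> ('s \<Rightarrow> 'n \<Rightarrow> 'n) \<Rightarrow> ('m, 'x) ring_scheme \<Rightarrow> ('n, 'y) ring_scheme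
    \<Rightarrow> ('m \<times> 'n) list \<Rightarrow> ('m \<times> 'n) list \<Rightarrow> bool"
  for S r l M N where
  tc_refl: "set xs \<subseteq> carrier M \<times> carrier N \<Longrightarrow> tensor_cong S r l M N xs xs"
| tc_sym: "tensor_cong S r l M N xs ys \<Longrightarrow> tensor_cong S r l M N ys xs"
| tc_trans: "tensor_cong S r l M N xs ys \<Longrightarrow> tensor_cong S r l M N ys zs
    \<Longrightarrow> tensor_cong S r l M N xs zs"
| tc_append: "tensor_cong S r l M N xs xs' \<Longrightarrow> tensor_cong S r l M N ys ys'
    \<Longrightarrow> tensor_cong S r l M N (xs @ ys) (xs' @ ys')"
| tc_comm: "set xs \<subseteq> carrier M \<times> carrier N \<Longrightarrow> set ys \<subseteq> carrier M \<times> carrier N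
    \<Longrightarrow> tensor_cong S r l M N (xs @ ys) (ys @ xs)"
| tc_zero_left: "n \<in> carrier N \<Longrightarrow> tensor_cong S r l M N [(\<zero>\<^bsub>M\<^esub>, n)] []"
| tc_zero_right: "m \<in> carrier M \<Longrightarrow> tensor_cong S r l M N [(m, \<zero>\<^bsub>N\<^esub>)] []"
| tc_add_left: "m \<in> carrier M \<Longrightarrow> m' \<in> carrier M \<Longrightarrow> n \<in> carrier N
    \<Longrightarrow> tensor_cong S r l M N [(m \<oplus>\<^bsub>M\<^esub> m', n)] [(m, n), (m', n)]"
| tc_add_right: "m \<in> carrier M \<Longrightarrow> n \<in> carrier N \<Longrightarrow> n' \<in> carrier N
    \<Longrightarrow> tensor_cong S r l M N [(m, n \<oplus>\<^bsub>N\<^esub> n')] [(m, n), (m, n')]"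
| tc_balanced: "m \<in> carrier M \<Longrightarrow> s \<in> S \<Longrightarrow> n \<in> carrier N
    \<Longrightarrow> tensor_cong S r l M N [(r m s, n)] [(m, l s n)]"

definition tensor_class ::
  "'s set \<Rightarrow> ('m \<Rightarrow> 's \<Rightarrow> 'm) \<Rightarrow> ('s \<Rightarrow> 'n \<Rightarrow> 'n) \<Rightarrow> ('m, 'x) ring_scheme \<Rightarrow> ('n, 'y) ring_scheme
    \<Rightarrow> ('m \<times> 'n) list \<Rightarrow> ('m, 'n) tensor" where
  "tensor_class S r l M N xs = {ys. tensor_cong S r l M N xs ys}"

definition tensor_rep :: "('m, 'n) tensor \<Rightarrow> ('m \<times> 'n) list" where
  "tensor_rep t = (SOME xs. xs \<in> t)"

text \<open>The value of \<open>\<Sum> f m\<^sub>i n\<^sub>i\<close> in \<open>G\<close> on a formal sum, and on a tensor \<open>\<Sum> m\<^sub>i \<otimes> n\<^sub>i\<close>.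
  The latter does not depend on the representative if \<open>f\<close> is biadditive and balanced, see
  \<open>tensor_lift_class\<close>.\<close>

definition pair_sum :: "('g, 'x) ring_scheme \<Rightarrow> ('m \<Rightarrow> 'n \<Rightarrow> 'g) \<Rightarrow> ('m \<times> 'n) list \<Rightarrow> 'g" where
  "pair_sum G f xs = foldr (\<lambda>(m, n) s. f m n \<oplus>\<^bsub>G\<^esub> s) xs \<zero>\<^bsub>G\<^esub>"

definition tensor_lift :: "('g, 'x) ring_scheme \<Rightarrow> ('m \<Rightarrow> 'n \<Rightarrow> 'g) \<Rightarrow> ('m, 'n) tensor \<Rightarrow> 'g" where
  "tensor_lift G f t = pair_sum G f (tensor_rep t)"

definition balanced_tensor ::
  "'s set \<Rightarrow> ('m \<Rightarrow> 's \<Rightarrow> 'm) \<Rightarrow> ('s \<Rightarrow> 'n \<Rightarrow> 'n) \<Rightarrow> ('k, 'm, 'x) module_scheme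
    \<Rightarrow> ('n, 'y) ring_scheme \<Rightarrow> ('k, ('m, 'n) tensor) module" where
  "balanced_tensor S r l M N =
    \<lparr>carrier = tensor_class S r l M N ` lists (carrier M \<times> carrier N),
     monoid.mult = undefined,
     one = undefined,
     zero = tensor_class S r l M N [],
     add = (\<lambda>s t. tensor_class S r l M N (tensor_rep s @ tensor_rep t)),
     smult = (\<lambda>c t. tensor_class S r l M N (map (\<lambda>(m, n). (c \<odot>\<^bsub>M\<^esub> m, n)) (tensor_rep t)))\<rparr>"

lemma pair_sum_closed:
  assumes "abelian_group G" "set xs \<subseteq> carrier M \<times> carrier N"
    and "\<And>m n. m \<in> carrier M \<Longrightarrow> n \<in> carrier N \<Longrightarrow> f m n \<in> carrier G"
  shows "pair_sum G f xs \<in> carrier G"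
proof -
  interpret abelian_group G by fact
  show ?thesis using assms(2) by (induction xs) (auto simp: pair_sum_def assms(3))
qed

lemma pair_sum_append:
  assumes "abelian_group G" "set xs \<subseteq> carrier M \<times> carrier N" "set ys \<subseteq> carrier M \<times> carrier N"
    and "\<And>m n. m \<in> carrier M \<Longrightarrow> n \<in> carrier N \<Longrightarrow> f m n \<in> carrier G"
  shows "pair_sum G f (xs @ ys) = pair_sum G f xs \<oplus>\<^bsub>G\<^esub> pair_sum G f ys"
proof -
  interpret abelian_group G by fact
  have ys: "pair_sum G f ys \<in> carrier G"
    by (rule pair_sum_closed[OF assms(1,3,4)])
  show ?thesis
    using assms(2)
  proof (induction xs)
    case Nil
    then show ?case using ys by (simp add: pair_sum_def)
  next
    case (Cons p xs)
    have "pair_sum G f xs \<in> carrier G"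
      by (rule pair_sum_closed[OF assms(1) _ assms(4)]) (use Cons in auto)
    then show ?case using Cons ys assms(4)
      by (cases p) (auto simp: pair_sum_def a_assoc)
  qed
qed

lemma tensor_cong_carrier:
  assumes "tensor_cong S r l M N xs ys" "abelian_group M" "abelian_group N"
    and "\<And>m s. m \<in> carrier M \<Longrightarrow> s \<in> S \<Longrightarrow> r m s \<in> carrier M"
    and "\<And>s n. s \<in> S \<Longrightarrow> n \<in> carrier N \<Longrightarrow> l s n \<in> carrier N"
  shows "set xs \<subseteq> carrier M \<times> carrier N \<and> set ys \<subseteq> carrier M \<times> carrier N"
proof -
  interpret M: abelian_group M by fact
  interpret N: abelian_group N by fact
  show ?thesis using assms(1) by (induction) (auto simp: assms(4,5))
qed

lemma tensor_lift_class:
  assumes G: "abelian_group G" and M: "abelian_group M" and N: "abelian_group N"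
    and r: "\<And>m s. m \<in> carrier M \<Longrightarrow> s \<in> S \<Longrightarrow> r m s \<in> carrier M"
    and l: "\<And>s n. s \<in> S \<Longrightarrow> n \<in> carrier N \<Longrightarrow> l s n \<in> carrier N"
    and f: "\<And>m n. m \<in> carrier M \<Longrightarrow> n \<in> carrier N \<Longrightarrow> f m n \<in> carrier G"
    and f_left: "\<And>m m' n. m \<in> carrier M \<Longrightarrow> m' \<in> carrier M \<Longrightarrow> n \<in> carrier N
      \<Longrightarrow> f (m \<oplus>\<^bsub>M\<^esub> m') n = f m n \<oplus>\<^bsub>G\<^esub> f m' n"
    and f_right: "\<And>m n n'. m \<in> carrier M \<Longrightarrow> n \<in> carrier N \<Longrightarrow> n' \<in> carrier N
      \<Longrightarrow> f m (n \<oplus>\<^bsub>N\<^esub> n') = f m n \<oplus>\<^bsub>G\<^esub> f m n'"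
    and f_bal: "\<And>m s n. m \<in> carrier M \<Longrightarrow> s \<in> S \<Longrightarrow> n \<in> carrier N
      \<Longrightarrow> f (r m s) n = f m (l s n)"
    and xs: "set xs \<subseteq> carrier M \<times> carrier N"
  shows "tensor_lift G f (tensor_class S r l M N xs) = pair_sum G f xs"
proof -
  interpret G: abelian_group G by fact
  interpret M: abelian_group M by fact
  interpret N: abelian_group N by fact
  have z1: "f \<zero>\<^bsub>M\<^esub> n = \<zero>\<^bsub>G\<^esub>" if "n \<in> carrier N" for n
    using f_left[of "\<zero>\<^bsub>M\<^esub>" "\<zero>\<^bsub>M\<^esub>" n] f[of "\<zero>\<^bsub>M\<^esub>" n] that by simp
  have z2: "f m \<zero>\<^bsub>N\<^esub> = \<zero>\<^bsub>G\<^esub>" if "m \<in> carrier M" for m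
    using f_right[of m "\<zero>\<^bsub>N\<^esub>" "\<zero>\<^bsub>N\<^esub>"] f[of m "\<zero>\<^bsub>N\<^esub>"] that by simp
  have inv: "pair_sum G f us = pair_sum G f vs" if "tensor_cong S r l M N us vs" for us vs
    using that
  proof induction
    case (tc_append us us' vs vs')
    have "set us \<subseteq> carrier M \<times> carrier N" "set us' \<subseteq> carrier M \<times> carrier N"
      "set vs \<subseteq> carrier M \<times> carrier N" "set vs' \<subseteq> carrier M \<times> carrier N"
      using tensor_cong_carrier[OF tc_append.hyps(1) M N r l]
        tensor_cong_carrier[OF tc_append.hyps(2) M N r l] by auto
    then show ?case
      using tc_append.IH by (simp add: pair_sum_append[OF G _ _ f])
  next
    case (tc_comm us vs)
    have "pair_sum G f us \<in> carrier G" "pair_sum G f vs \<in> carrier G"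
      using pair_sum_closed[OF G tc_comm(1) f] pair_sum_closed[OF G tc_comm(2) f] by auto
    then show ?case
      using tc_comm by (simp add: pair_sum_append[OF G _ _ f] G.a_comm)
  next
    case (tc_add_left m m' n)
    then show ?case by (simp add: pair_sum_def f f_left G.a_assoc)
  next
    case (tc_add_right m n n')
    then show ?case by (simp add: pair_sum_def f f_right G.a_assoc)
  qed (simp_all add: pair_sum_def z1 z2 f_bal)
  have "xs \<in> tensor_class S r l M N xs"
    using xs by (simp add: tensor_class_def tc_refl)
  then have "tensor_rep (tensor_class S r l M N xs) \<in> tensor_class S r l M N xs"
    unfolding tensor_rep_def by (rule someI)
  then show ?thesis
    using inv unfolding tensor_lift_def tensor_class_def by auto
qed

subsection \<open>Tensor products over the base field\<close>

definition pure :: "('k, 'z) ring_scheme \<Rightarrow> ('k, 'm, 'x) module_scheme \<Rightarrow> ('k, 'n, 'y) module_scheme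
    \<Rightarrow> 'm \<Rightarrow> 'n \<Rightarrow> ('m, 'n) tensor" where
  "pure K M N m n =
    tensor_class (carrier K) (\<lambda>m c. c \<odot>\<^bsub>M\<^esub> m) (\<lambda>c n. c \<odot>\<^bsub>N\<^esub> n) M N [(m, n)]"

text \<open>The multiplication of \<open>tens K M N\<close> is only meaningful if \<open>M\<close> and \<open>N\<close> are algebras; it is
  \<open>(a \<otimes> b)(a' \<otimes> b') = aa' \<otimes> bb'\<close>.\<close>

definition tens :: "('k, 'z) ring_scheme \<Rightarrow> ('k, 'm, 'x) module_scheme \<Rightarrow> ('k, 'n, 'y) module_scheme
    \<Rightarrow> ('k, ('m, 'n) tensor) module" where
  "tens K M N =
    (let T = balanced_tensor (carrier K) (\<lambda>m c. c \<odot>\<^bsub>M\<^esub> m) (\<lambda>c n. c \<odot>\<^bsub>N\<^esub> n) M N in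
     T\<lparr>monoid.mult := (\<lambda>s t. tensor_lift T (\<lambda>a b. tensor_lift T
           (\<lambda>a' b'. pure K M N (a \<otimes>\<^bsub>M\<^esub> a') (b \<otimes>\<^bsub>N\<^esub> b')) t) s),
       one := pure K M N \<one>\<^bsub>M\<^esub> \<one>\<^bsub>N\<^esub>\<rparr>)"

text \<open>\<open>f \<otimes> g\<close>, with codomain the tensor product of \<open>M'\<close> and \<open>N'\<close>.\<close>

definition tmap :: "('k, 'z) ring_scheme \<Rightarrow> ('k, 'm, 'x) module_scheme \<Rightarrow> ('k, 'n, 'y) module_scheme
    \<Rightarrow> ('p \<Rightarrow> 'm) \<Rightarrow> ('q \<Rightarrow> 'n) \<Rightarrow> ('p, 'q) tensor \<Rightarrow> ('m, 'n) tensor" where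
  "tmap K M' N' f g = tensor_lift (tens K M' N') (\<lambda>p q. pure K M' N' (f p) (g q))"

text \<open>\<open>(m \<otimes> n) \<otimes> p \<mapsto> m \<otimes> (n \<otimes> p)\<close>\<close>

definition tassoc :: "('k, 'z) ring_scheme \<Rightarrow> ('k, 'm, 'x) module_scheme
    \<Rightarrow> ('k, 'n, 'y) module_scheme \<Rightarrow> ('k, 'p, 'w) module_scheme
    \<Rightarrow> (('m, 'n) tensor, 'p) tensor \<Rightarrow> ('m, ('n, 'p) tensor) tensor" where
  "tassoc K M N P =
    (let T = tens K M (tens K N P) in
     tensor_lift T (\<lambda>t p. tensor_lift T (\<lambda>m n. pure K M (tens K N P) m (pure K N P n p)) t))"

section \<open>Algebras, Hopf algebras and comodule algebras\<close>

definition k_linear :: "('k, 'z) ring_scheme \<Rightarrow> ('k, 'm, 'x) module_scheme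
    \<Rightarrow> ('k, 'n, 'y) module_scheme \<Rightarrow> ('m \<Rightarrow> 'n) \<Rightarrow> bool" where
  "k_linear K M N f \<longleftrightarrow>
    f \<in> carrier M \<rightarrow> carrier N \<and>
    (\<forall>x\<in>carrier M. \<forall>y\<in>carrier M. f (x \<oplus>\<^bsub>M\<^esub> y) = f x \<oplus>\<^bsub>N\<^esub> f y) \<and>
    (\<forall>c\<in>carrier K. \<forall>x\<in>carrier M. f (c \<odot>\<^bsub>M\<^esub> x) = c \<odot>\<^bsub>N\<^esub> f x)"

text \<open>The library locale \<open>algebra\<close> covers commutative algebras only.\<close>

definition k_algebra :: "('k, 'z) ring_scheme \<Rightarrow> ('k, 'a, 'x) module_scheme \<Rightarrow> bool" where
  "k_algebra K A \<longleftrightarrow>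
    module K A \<and> ring A \<and>
    (\<forall>c\<in>carrier K. \<forall>x\<in>carrier A. \<forall>y\<in>carrier A.
      (c \<odot>\<^bsub>A\<^esub> x) \<otimes>\<^bsub>A\<^esub> y = c \<odot>\<^bsub>A\<^esub> (x \<otimes>\<^bsub>A\<^esub> y) \<and>
      x \<otimes>\<^bsub>A\<^esub> (c \<odot>\<^bsub>A\<^esub> y) = c \<odot>\<^bsub>A\<^esub> (x \<otimes>\<^bsub>A\<^esub> y))"

definition alg_hom :: "('k, 'z) ring_scheme \<Rightarrow> ('k, 'a, 'x) module_scheme
    \<Rightarrow> ('k, 'b, 'y) module_scheme \<Rightarrow> ('a \<Rightarrow> 'b) \<Rightarrow> bool" where
  "alg_hom K A B f \<longleftrightarrow>
    k_linear K A B f \<and>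
    (\<forall>x\<in>carrier A. \<forall>y\<in>carrier A. f (x \<otimes>\<^bsub>A\<^esub> y) = f x \<otimes>\<^bsub>B\<^esub> f y) \<and>
    f \<one>\<^bsub>A\<^esub> = \<one>\<^bsub>B\<^esub>"

definition base_mod :: "'k ring \<Rightarrow> ('k, 'k) module" where
  "base_mod K = ring.extend K (module.fields (monoid.mult K))"

record ('k, 'h) hopf = "('k, 'h) module" +
  comult :: "'h \<Rightarrow> ('h, 'h) tensor"
  counit :: "'h \<Rightarrow> 'k"
  antipode :: "'h \<Rightarrow> 'h"

definition hopf_algebra :: "'k ring \<Rightarrow> ('k, 'h) hopf \<Rightarrow> bool" where
  "hopf_algebra K H \<longleftrightarrow>
    k_algebra K H \<and>
    alg_hom K H (tens K H H) (comult H) \<and>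
    alg_hom K H (base_mod K) (counit H) \<and>
    k_linear K H H (antipode H) \<and>
    (\<forall>h\<in>carrier H.
      tassoc K H H H (tmap K (tens K H H) H (comult H) (\<lambda>x. x) (comult H h))
        = tmap K H (tens K H H) (\<lambda>x. x) (comult H) (comult H h) \<and>
      tensor_lift H (\<lambda>x y. counit H x \<odot>\<^bsub>H\<^esub> y) (comult H h) = h \<and>
      tensor_lift H (\<lambda>x y. counit H y \<odot>\<^bsub>H\<^esub> x) (comult H h) = h \<and>
      tensor_lift H (\<lambda>x y. antipode H x \<otimes>\<^bsub>H\<^esub> y) (comult H h) = counit H h \<odot>\<^bsub>H\<^esub> \<one>\<^bsub>H\<^esub> \<and>
      tensor_lift H (\<lambda>x y. x \<otimes>\<^bsub>H\<^esub> antipode H y) (comult H h) = counit H h \<odot>\<^bsub>H\<^esub> \<one>\<^bsub>H\<^esub>)"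

text \<open>\<open>Alg(L,k)\<close> with the convolution product.  Maps are normalised to be \<open>undefined\<close> outside
  the carrier of \<open>L\<close>.\<close>

definition Alg :: "'k ring \<Rightarrow> ('k, 'h) hopf \<Rightarrow> ('h \<Rightarrow> 'k) monoid" where
  "Alg K L =
    \<lparr>carrier = {f \<in> extensional (carrier L). alg_hom K L (base_mod K) f},
     monoid.mult = (\<lambda>f g. \<lambda>x\<in>carrier L. tensor_lift K (\<lambda>y z. f y \<otimes>\<^bsub>K\<^esub> g z) (comult L x)),
     one = restrict (counit L) (carrier L)\<rparr>"

definition right_comodule :: "'k ring \<Rightarrow> ('k, 'h) hopf \<Rightarrow> ('k, 'm, 'x) module_scheme
    \<Rightarrow> ('m \<Rightarrow> ('m, 'h) tensor) \<Rightarrow> bool" where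
  "right_comodule K H M \<rho> \<longleftrightarrow>
    module K M \<and>
    k_linear K M (tens K M H) \<rho> \<and>
    (\<forall>m\<in>carrier M.
      tassoc K M H H (tmap K (tens K M H) H \<rho> (\<lambda>h. h) (\<rho> m))
        = tmap K M (tens K H H) (\<lambda>m. m) (comult H) (\<rho> m) \<and>
      tensor_lift M (\<lambda>m' h. counit H h \<odot>\<^bsub>M\<^esub> m') (\<rho> m) = m)"

definition left_comodule :: "'k ring \<Rightarrow> ('k, 'h) hopf \<Rightarrow> ('k, 'm, 'x) module_scheme
    \<Rightarrow> ('m \<Rightarrow> ('h, 'm) tensor) \<Rightarrow> bool" where
  "left_comodule K H M lam \<longleftrightarrow>
    module K M \<and>
    k_linear K M (tens K H M) lam \<and>
    (\<forall>m\<in>carrier M.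
      tassoc K H H M (tmap K (tens K H H) M (comult H) (\<lambda>m. m) (lam m))
        = tmap K H (tens K H M) (\<lambda>h. h) lam (lam m) \<and>
      tensor_lift M (\<lambda>h m'. counit H h \<odot>\<^bsub>M\<^esub> m') (lam m) = m)"

section \<open>Galois objects\<close>

text \<open>\<open>a \<otimes> b \<mapsto> a b\<^sub>0 \<otimes> b\<^sub>1\<close> and \<open>a \<otimes> b \<mapsto> a\<^sub>-\<^sub>1 \<otimes> a\<^sub>0 b\<close>\<close>

definition right_can :: "'k ring \<Rightarrow> ('k, 'h) hopf \<Rightarrow> ('k, 'a) module
    \<Rightarrow> ('a \<Rightarrow> ('a, 'h) tensor) \<Rightarrow> ('a, 'a) tensor \<Rightarrow> ('a, 'h) tensor" where
  "right_can K H A \<rho> =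
    tensor_lift (tens K A H) (\<lambda>a b.
      tensor_lift (tens K A H) (\<lambda>b0 b1. pure K A H (a \<otimes>\<^bsub>A\<^esub> b0) b1) (\<rho> b))"

definition left_can :: "'k ring \<Rightarrow> ('k, 'l) hopf \<Rightarrow> ('k, 'a) module
    \<Rightarrow> ('a \<Rightarrow> ('l, 'a) tensor) \<Rightarrow> ('a, 'a) tensor \<Rightarrow> ('l, 'a) tensor" where
  "left_can K L A lam =
    tensor_lift (tens K L A) (\<lambda>a b.
      tensor_lift (tens K L A) (\<lambda>a1 a0. pure K L A a1 (a0 \<otimes>\<^bsub>A\<^esub> b)) (lam a))"

definition right_galois_object :: "'k ring \<Rightarrow> ('k, 'h) hopf \<Rightarrow> ('k, 'a) module
    \<Rightarrow> ('a \<Rightarrow> ('a, 'h) tensor) \<Rightarrow> bool" where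
  "right_galois_object K H A \<rho> \<longleftrightarrow>
    k_algebra K A \<and> carrier A \<noteq> {\<zero>\<^bsub>A\<^esub>} \<and>
    right_comodule K H A \<rho> \<and> alg_hom K A (tens K A H) \<rho> \<and>
    {a \<in> carrier A. \<rho> a = pure K A H a \<one>\<^bsub>H\<^esub>} = (\<lambda>c. c \<odot>\<^bsub>A\<^esub> \<one>\<^bsub>A\<^esub>) ` carrier K \<and>
    bij_betw (right_can K H A \<rho>) (carrier (tens K A A)) (carrier (tens K A H))"

definition left_galois_object :: "'k ring \<Rightarrow> ('k, 'l) hopf \<Rightarrow> ('k, 'a) module
    \<Rightarrow> ('a \<Rightarrow> ('l, 'a) tensor) \<Rightarrow> bool" where
  "left_galois_object K L A lam \<longleftrightarrow>
    k_algebra K A \<and> carrier A \<noteq> {\<zero>\<^bsub>A\<^esub>} \<and>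
    left_comodule K L A lam \<and> alg_hom K A (tens K L A) lam \<and>
    {a \<in> carrier A. lam a = pure K L A \<one>\<^bsub>L\<^esub> a} = (\<lambda>c. c \<odot>\<^bsub>A\<^esub> \<one>\<^bsub>A\<^esub>) ` carrier K \<and>
    bij_betw (left_can K L A lam) (carrier (tens K A A)) (carrier (tens K L A))"

text \<open>\<open>L\<close>, coacting by \<open>lam\<close>, is a Hopf algebra \<open>L(A,H)\<close>.\<close>

definition bigalois_object :: "'k ring \<Rightarrow> ('k, 'l) hopf \<Rightarrow> ('k, 'h) hopf \<Rightarrow> ('k, 'a) module
    \<Rightarrow> ('a \<Rightarrow> ('l, 'a) tensor) \<Rightarrow> ('a \<Rightarrow> ('a, 'h) tensor) \<Rightarrow> bool" where
  "bigalois_object K L H A lam \<rho> \<longleftrightarrow>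
    left_galois_object K L A lam \<and> right_galois_object K H A \<rho> \<and>
    (\<forall>a\<in>carrier A.
      tassoc K L A H (tmap K (tens K L A) H lam (\<lambda>h. h) (\<rho> a))
        = tmap K L (tens K A H) (\<lambda>x. x) \<rho> (lam a))"

section \<open>Morita contexts and the group \<open>Pic\<^sup>H(A)\<close>\<close>

text \<open>\<open>'o\<close> is the type of the modules, \<open>'m\<close> that of their elements, and \<open>'z\<close> that of the
  elements of the ring at both ends of the context.\<close>

record ('o, 'm, 'z) morita =
  mP :: 'o
  mQ :: 'o
  malpha :: "('m, 'm) tensor \<Rightarrow> 'z"
  mbeta :: "('m, 'm) tensor \<Rightarrow> 'z"

record ('k, 'a, 'h, 'm) hopf_bimod = "('k, 'm) module" +
  lact :: "'a \<Rightarrow> 'm \<Rightarrow> 'm"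
  ract :: "'m \<Rightarrow> 'a \<Rightarrow> 'm"
  coact :: "'m \<Rightarrow> ('m, 'h) tensor"

type_synonym ('k, 'a, 'h, 'm) bimod_morita = "(('k, 'a, 'h, 'm) hopf_bimod, 'm, 'a) morita"

text \<open>Bimodules over the \<open>k\<close>-algebra \<open>A\<close>, with both sides inducing the same action of \<open>k\<close>.\<close>

definition bimodule :: "'k ring \<Rightarrow> ('k, 'a) module \<Rightarrow> ('k, 'a, 'h, 'm) hopf_bimod \<Rightarrow> bool" where
  "bimodule K A P \<longleftrightarrow>
    module K P \<and>
    (\<forall>a\<in>carrier A. k_linear K P P (lact P a) \<and> k_linear K P P (\<lambda>p. ract P p a)) \<and>
    (\<forall>p\<in>carrier P. k_linear K A P (\<lambda>a. lact P a p) \<and> k_linear K A P (ract P p) \<and>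
      lact P \<one>\<^bsub>A\<^esub> p = p \<and> ract P p \<one>\<^bsub>A\<^esub> = p) \<and>
    (\<forall>a\<in>carrier A. \<forall>b\<in>carrier A. \<forall>p\<in>carrier P.
      lact P (a \<otimes>\<^bsub>A\<^esub> b) p = lact P a (lact P b p) \<and>
      ract P p (a \<otimes>\<^bsub>A\<^esub> b) = ract P (ract P p a) b \<and>
      ract P (lact P a p) b = lact P a (ract P p b))"

definition hopf_bimodule :: "'k ring \<Rightarrow> ('k, 'h) hopf \<Rightarrow> ('k, 'a) module
    \<Rightarrow> ('a \<Rightarrow> ('a, 'h) tensor) \<Rightarrow> ('k, 'a, 'h, 'm) hopf_bimod \<Rightarrow> bool" where
  "hopf_bimodule K H A \<rho> P \<longleftrightarrow>
    bimodule K A P \<and> right_comodule K H P (coact P) \<and>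
    (\<forall>a\<in>carrier A. \<forall>p\<in>carrier P. \<forall>b\<in>carrier A.
      coact P (ract P (lact P a p) b) =
        (let T = tens K P H in
         tensor_lift T (\<lambda>a0 a1. tensor_lift T (\<lambda>p0 p1. tensor_lift T (\<lambda>b0 b1.
           pure K P H (ract P (lact P a0 p0) b0) (a1 \<otimes>\<^bsub>H\<^esub> p1 \<otimes>\<^bsub>H\<^esub> b1))
             (\<rho> b)) (coact P p)) (\<rho> a)))"

definition hopf_bimod_hom :: "'k ring \<Rightarrow> ('k, 'h) hopf \<Rightarrow> ('k, 'a) module
    \<Rightarrow> ('k, 'a, 'h, 'm) hopf_bimod \<Rightarrow> ('k, 'a, 'h, 'n) hopf_bimod \<Rightarrow> ('m \<Rightarrow> 'n) \<Rightarrow> bool" where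
  "hopf_bimod_hom K H A P P' f \<longleftrightarrow>
    k_linear K P P' f \<and>
    (\<forall>a\<in>carrier A. \<forall>p\<in>carrier P.
      f (lact P a p) = lact P' a (f p) \<and> f (ract P p a) = ract P' (f p) a) \<and>
    (\<forall>p\<in>carrier P. coact P' (f p) = tmap K P' H f (\<lambda>h. h) (coact P p))"

definition regular_bimod :: "('k, 'a) module \<Rightarrow> ('a \<Rightarrow> ('a, 'h) tensor)
    \<Rightarrow> ('k, 'a, 'h, 'a) hopf_bimod" where
  "regular_bimod A \<rho> =
    module.extend A (hopf_bimod.fields (monoid.mult A) (monoid.mult A) \<rho>)"

definition pureA :: "('k, 'a) module \<Rightarrow> ('k, 'a, 'h, 'm) hopf_bimod
    \<Rightarrow> ('k, 'a, 'h, 'n) hopf_bimod \<Rightarrow> 'm \<Rightarrow> 'n \<Rightarrow> ('m, 'n) tensor" where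
  "pureA A P Q p q = tensor_class (carrier A) (ract P) (lact Q) P Q [(p, q)]"

text \<open>\<open>P \<otimes>\<^sub>A Q\<close> with the coaction \<open>p \<otimes> q \<mapsto> (p\<^sub>0 \<otimes> q\<^sub>0) \<otimes> p\<^sub>1 q\<^sub>1\<close>.\<close>

definition tensA :: "'k ring \<Rightarrow> ('k, 'h) hopf \<Rightarrow> ('k, 'a) module
    \<Rightarrow> ('k, 'a, 'h, 'm) hopf_bimod \<Rightarrow> ('k, 'a, 'h, 'n) hopf_bimod
    \<Rightarrow> ('k, 'a, 'h, ('m, 'n) tensor) hopf_bimod" where
  "tensA K H A P Q =
    (let B = balanced_tensor (carrier A) (ract P) (lact Q) P Q; T = tens K B H in
     module.extend B (hopf_bimod.fields
       (\<lambda>a. tensor_lift B (\<lambda>p q. pureA A P Q (lact P a p) q))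
       (\<lambda>t a. tensor_lift B (\<lambda>p q. pureA A P Q p (ract Q q a)) t)
       (tensor_lift T (\<lambda>p q. tensor_lift T (\<lambda>p0 p1. tensor_lift T (\<lambda>q0 q1.
          pure K B H (pureA A P Q p0 q0) (p1 \<otimes>\<^bsub>H\<^esub> q1)) (coact Q q)) (coact P p)))))"

definition strict_hopf_morita :: "'k ring \<Rightarrow> ('k, 'h) hopf \<Rightarrow> ('k, 'a) module
    \<Rightarrow> ('a \<Rightarrow> ('a, 'h) tensor) \<Rightarrow> ('k, 'a, 'h, 'm) bimod_morita \<Rightarrow> bool" where
  "strict_hopf_morita K H A \<rho> X \<longleftrightarrow>
    (let P = mP X; Q = mQ X; \<alpha> = malpha X; \<beta> = mbeta X in
     hopf_bimodule K H A \<rho> P \<and> hopf_bimodule K H A \<rho> Q \<and>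
     hopf_bimod_hom K H A (tensA K H A P Q) (regular_bimod A \<rho>) \<alpha> \<and>
     hopf_bimod_hom K H A (tensA K H A Q P) (regular_bimod A \<rho>) \<beta> \<and>
     (\<forall>p\<in>carrier P. \<forall>q\<in>carrier Q. \<forall>p'\<in>carrier P.
       lact P (\<alpha> (pureA A P Q p q)) p' = ract P p (\<beta> (pureA A Q P q p'))) \<and>
     (\<forall>q\<in>carrier Q. \<forall>p\<in>carrier P. \<forall>q'\<in>carrier Q.
       lact Q (\<beta> (pureA A Q P q p)) q' = ract Q q (\<alpha> (pureA A P Q p q'))) \<and>
     bij_betw \<alpha> (carrier (tensA K H A P Q)) (carrier A) \<and>
     bij_betw \<beta> (carrier (tensA K H A Q P)) (carrier A))"

text \<open>The element types of the two contexts may differ, so that a product can be compared with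
  a context over the fixed universe below.\<close>

definition hopf_morita_iso :: "'k ring \<Rightarrow> ('k, 'h) hopf \<Rightarrow> ('k, 'a) module
    \<Rightarrow> ('k, 'a, 'h, 'm) bimod_morita \<Rightarrow> ('k, 'a, 'h, 'n) bimod_morita \<Rightarrow> bool" where
  "hopf_morita_iso K H A X Y \<longleftrightarrow>
    (\<exists>f g. hopf_bimod_hom K H A (mP X) (mP Y) f \<and>
      bij_betw f (carrier (mP X)) (carrier (mP Y)) \<and>
      hopf_bimod_hom K H A (mQ X) (mQ Y) g \<and>
      bij_betw g (carrier (mQ X)) (carrier (mQ Y)) \<and>
      (\<forall>p\<in>carrier (mP X). \<forall>q\<in>carrier (mQ X).
        malpha Y (pureA A (mP Y) (mQ Y) (f p) (g q)) = malpha X (pureA A (mP X) (mQ X) p q) \<and>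
        mbeta Y (pureA A (mQ Y) (mP Y) (g q) (f p)) = mbeta X (pureA A (mQ X) (mP X) q p)))"

text \<open>The context on \<open>P \<otimes>\<^sub>A P'\<close> and \<open>Q' \<otimes>\<^sub>A Q\<close> with
  \<open>(p \<otimes> p') \<otimes> (q' \<otimes> q) \<mapsto> \<alpha>(p \<alpha>'(p' \<otimes> q') \<otimes> q)\<close> and
  \<open>(q' \<otimes> q) \<otimes> (p \<otimes> p') \<mapsto> \<beta>'(q' \<beta>(q \<otimes> p) \<otimes> p')\<close>.\<close>

definition hopf_morita_mult :: "'k ring \<Rightarrow> ('k, 'h) hopf \<Rightarrow> ('k, 'a) module
    \<Rightarrow> ('k, 'a, 'h, 'm) bimod_morita \<Rightarrow> ('k, 'a, 'h, 'm) bimod_morita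
    \<Rightarrow> ('k, 'a, 'h, ('m, 'm) tensor) bimod_morita" where
  "hopf_morita_mult K H A X Y =
    \<lparr>mP = tensA K H A (mP X) (mP Y),
     mQ = tensA K H A (mQ Y) (mQ X),
     malpha = tensor_lift A (\<lambda>s t. tensor_lift A (\<lambda>p p'. tensor_lift A (\<lambda>q' q.
       malpha X (pureA A (mP X) (mQ X)
         (ract (mP X) p (malpha Y (pureA A (mP Y) (mQ Y) p' q'))) q)) t) s),
     mbeta = tensor_lift A (\<lambda>t s. tensor_lift A (\<lambda>q' q. tensor_lift A (\<lambda>p p'.
       mbeta Y (pureA A (mQ Y) (mP Y)
         (ract (mQ Y) q' (mbeta X (pureA A (mQ X) (mP X) q p))) p')) s) t)\<rparr>"

definition hopf_morita_unit :: "('k, 'a) module \<Rightarrow> ('a \<Rightarrow> ('a, 'h) tensor)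
    \<Rightarrow> ('k, 'a, 'h, 'a) bimod_morita" where
  "hopf_morita_unit A \<rho> =
    \<lparr>mP = regular_bimod A \<rho>, mQ = regular_bimod A \<rho>,
     malpha = tensor_lift A (monoid.mult A), mbeta = tensor_lift A (monoid.mult A)\<rparr>"

text \<open>
  The contexts under consideration have their modules inside a type \<open>'u\<close>, the universe.  In a
  strict context \<open>P\<close> and \<open>Q\<close> are finitely generated over \<open>A\<close>, hence of size at most that
  of the set of finite lists over \<open>A\<close>, so every isomorphism class is represented as soon as that
  set embeds into \<open>'u\<close>.  The product of two classes consists of the contexts over \<open>'u\<close> which
  are isomorphic to a product of representatives.
\<close>

definition PicH :: "'k ring \<Rightarrow> ('k, 'h) hopf \<Rightarrow> ('k, 'a) module \<Rightarrow> ('a \<Rightarrow> ('a, 'h) tensor)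
    \<Rightarrow> ('k, 'a, 'h, 'u) bimod_morita set monoid" where
  "PicH K H A \<rho> =
    \<lparr>carrier = {X. strict_hopf_morita K H A \<rho> X} //
       {(X, Y). strict_hopf_morita K H A \<rho> X \<and> strict_hopf_morita K H A \<rho> Y \<and>
                hopf_morita_iso K H A X Y},
     monoid.mult = (\<lambda>C D. {Z. strict_hopf_morita K H A \<rho> Z \<and>
       (\<exists>X\<in>C. \<exists>Y\<in>D. hopf_morita_iso K H A (hopf_morita_mult K H A X Y) Z)}),
     one = {Z. strict_hopf_morita K H A \<rho> Z \<and> hopf_morita_iso K H A (hopf_morita_unit A \<rho>) Z}\<rparr>"

section \<open>The algebra \<open>A \<box>\<^sub>H A\<^sup>o\<^sup>p\<close>\<close>

definition opp :: "('k, 'a) module \<Rightarrow> ('k, 'a) module" where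
  "opp A = A\<lparr>monoid.mult := (\<lambda>x y. y \<otimes>\<^bsub>A\<^esub> x)\<rparr>"

definition antipode_inv :: "('k, 'h) hopf \<Rightarrow> 'h \<Rightarrow> 'h" where
  "antipode_inv H = inv_into (carrier H) (antipode H)"

text \<open>\<open>a \<mapsto> S\<^sup>-\<^sup>1(a\<^sub>1) \<otimes> a\<^sub>0\<close>\<close>

definition opp_coact :: "'k ring \<Rightarrow> ('k, 'h) hopf \<Rightarrow> ('k, 'a) module
    \<Rightarrow> ('a \<Rightarrow> ('a, 'h) tensor) \<Rightarrow> 'a \<Rightarrow> ('h, 'a) tensor" where
  "opp_coact K H A \<rho> a =
    tensor_lift (tens K H (opp A)) (\<lambda>a0 a1. pure K H (opp A) (antipode_inv H a1) a0) (\<rho> a)"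

definition cotens_alg :: "'k ring \<Rightarrow> ('k, 'h) hopf \<Rightarrow> ('k, 'a) module
    \<Rightarrow> ('a \<Rightarrow> ('a, 'h) tensor) \<Rightarrow> ('k, ('a, 'a) tensor) module" where
  "cotens_alg K H A \<rho> = (tens K A (opp A))\<lparr>carrier :=
    {t \<in> carrier (tens K A (opp A)).
       tassoc K A H (opp A) (tmap K (tens K A H) (opp A) \<rho> (\<lambda>a'. a') t)
         = tmap K A (tens K H (opp A)) (\<lambda>a. a) (opp_coact K H A \<rho>) t}\<rparr>"

text \<open>\<open>h \<mapsto> can\<^sup>-\<^sup>1(1 \<otimes> h) = \<Sum> l\<^sub>i(h) \<otimes> r\<^sub>i(h)\<close>\<close>

definition translation :: "'k ring \<Rightarrow> ('k, 'h) hopf \<Rightarrow> ('k, 'a) module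
    \<Rightarrow> ('a \<Rightarrow> ('a, 'h) tensor) \<Rightarrow> 'h \<Rightarrow> ('a, 'a) tensor" where
  "translation K H A \<rho> h =
    inv_into (carrier (tens K A A)) (right_can K H A \<rho>) (pure K A H \<one>\<^bsub>A\<^esub> h)"

text \<open>
  The formula for the action on \<open>M \<otimes> N\<close> involves
  \<open>\<Sum> (a\<^sub>0 \<otimes> l\<^sub>i(a\<^sub>1)) \<otimes> (r\<^sub>i(a\<^sub>1) \<otimes> a')\<close>.  The individual factors \<open>a\<^sub>0 \<otimes> l\<^sub>i(a\<^sub>1)\<close> and
  \<open>r\<^sub>i(a\<^sub>1) \<otimes> a'\<close> need not lie in \<open>E = A \<box>\<^sub>H A\<^sup>o\<^sup>p\<close>, which is all that acts on \<open>M\<close> and \<open>N\<close>;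
  only the sum lies in \<open>E \<otimes> E\<close>, seen as a subspace of the tensor square of \<open>A \<otimes> A\<^sup>o\<^sup>p\<close>.  So
  \<open>cotens_split\<close> is the element of \<open>E \<otimes> E\<close> with that image.
\<close>

definition cotens_split_raw :: "'k ring \<Rightarrow> ('k, 'h) hopf \<Rightarrow> ('k, 'a) module
    \<Rightarrow> ('a \<Rightarrow> ('a, 'h) tensor) \<Rightarrow> ('a, 'a) tensor \<Rightarrow> (('a, 'a) tensor, ('a, 'a) tensor) tensor" where
  "cotens_split_raw K H A \<rho> =
    (let T = tens K A (opp A); TT = tens K T T in
     tensor_lift TT (\<lambda>a a'. tensor_lift TT (\<lambda>a0 a1. tensor_lift TT (\<lambda>l r.
       pure K T T (pure K A (opp A) a0 l) (pure K A (opp A) r a'))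
         (translation K H A \<rho> a1)) (\<rho> a)))"

definition cotens_split :: "'k ring \<Rightarrow> ('k, 'h) hopf \<Rightarrow> ('k, 'a) module
    \<Rightarrow> ('a \<Rightarrow> ('a, 'h) tensor) \<Rightarrow> ('a, 'a) tensor \<Rightarrow> (('a, 'a) tensor, ('a, 'a) tensor) tensor" where
  "cotens_split K H A \<rho> z =
    (let E = cotens_alg K H A \<rho>; T = tens K A (opp A) in
     THE w. w \<in> carrier (tens K E E) \<and>
       tmap K T T (\<lambda>x. x) (\<lambda>x. x) w = cotens_split_raw K H A \<rho> z)"

text \<open>The scalar \<open>\<Sum> a a'\<close>, under the identification of \<open>k\<close> with \<open>k 1\<^sub>A\<close>.\<close>

definition cotens_eval :: "'k ring \<Rightarrow> ('k, 'a) module \<Rightarrow> ('a, 'a) tensor \<Rightarrow> 'k" where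
  "cotens_eval K A z =
    (THE c. c \<in> carrier K \<and> c \<odot>\<^bsub>A\<^esub> \<one>\<^bsub>A\<^esub> = tensor_lift A (monoid.mult A) z)"

section \<open>The group \<open>Pic\<^sup>\<box>\<^sup>H(k)\<close>\<close>

record ('k, 'e, 'm) left_mod = "('k, 'm) module" +
  eact :: "'e \<Rightarrow> 'm \<Rightarrow> 'm"

type_synonym ('k, 'a, 'm) cotens_mod = "('k, ('a, 'a) tensor, 'm) left_mod"
type_synonym ('k, 'a, 'm) cotens_morita = "(('k, 'a, 'm) cotens_mod, 'm, 'k) morita"

definition left_module :: "'k ring \<Rightarrow> ('k, 'e) module \<Rightarrow> ('k, 'e, 'm) left_mod \<Rightarrow> bool" where
  "left_module K E M \<longleftrightarrow>
    module K M \<and>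
    (\<forall>e\<in>carrier E. k_linear K M M (eact M e)) \<and>
    (\<forall>m\<in>carrier M. k_linear K E M (\<lambda>e. eact M e m) \<and> eact M \<one>\<^bsub>E\<^esub> m = m) \<and>
    (\<forall>e\<in>carrier E. \<forall>e'\<in>carrier E. \<forall>m\<in>carrier M.
      eact M (e \<otimes>\<^bsub>E\<^esub> e') m = eact M e (eact M e' m))"

definition left_module_hom :: "'k ring \<Rightarrow> ('k, 'e) module \<Rightarrow> ('k, 'e, 'm) left_mod
    \<Rightarrow> ('k, 'e, 'n) left_mod \<Rightarrow> ('m \<Rightarrow> 'n) \<Rightarrow> bool" where
  "left_module_hom K E M N f \<longleftrightarrow>
    k_linear K M N f \<and>
    (\<forall>e\<in>carrier E. \<forall>m\<in>carrier M. f (eact M e m) = eact N e (f m))"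

definition cotens_base :: "'k ring \<Rightarrow> ('k, 'a) module \<Rightarrow> ('k, 'a, 'k) cotens_mod" where
  "cotens_base K A =
    module.extend (base_mod K) (left_mod.fields (\<lambda>z c. cotens_eval K A z \<otimes>\<^bsub>K\<^esub> c))"

definition cotens_tens :: "'k ring \<Rightarrow> ('k, 'h) hopf \<Rightarrow> ('k, 'a) module
    \<Rightarrow> ('a \<Rightarrow> ('a, 'h) tensor) \<Rightarrow> ('k, 'a, 'm) cotens_mod \<Rightarrow> ('k, 'a, 'n) cotens_mod
    \<Rightarrow> ('k, 'a, ('m, 'n) tensor) cotens_mod" where
  "cotens_tens K H A \<rho> M N =
    module.extend (tens K M N) (left_mod.fields (\<lambda>z t.
      tensor_lift (tens K M N) (\<lambda>e e'. tmap K M N (eact M e) (eact N e') t)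
        (cotens_split K H A \<rho> z)))"

definition strict_cotens_morita :: "'k ring \<Rightarrow> ('k, 'h) hopf \<Rightarrow> ('k, 'a) module
    \<Rightarrow> ('a \<Rightarrow> ('a, 'h) tensor) \<Rightarrow> ('k, 'a, 'm) cotens_morita \<Rightarrow> bool" where
  "strict_cotens_morita K H A \<rho> X \<longleftrightarrow>
    (let M = mP X; N = mQ X; \<alpha> = malpha X; \<beta> = mbeta X; E = cotens_alg K H A \<rho> in
     left_module K E M \<and> left_module K E N \<and>
     left_module_hom K E (cotens_tens K H A \<rho> M N) (cotens_base K A) \<alpha> \<and>
     left_module_hom K E (cotens_tens K H A \<rho> N M) (cotens_base K A) \<beta> \<and>
     (\<forall>m\<in>carrier M. \<forall>n\<in>carrier N. \<forall>m'\<in>carrier M.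
       \<alpha> (pure K M N m n) \<odot>\<^bsub>M\<^esub> m' = \<beta> (pure K N M n m') \<odot>\<^bsub>M\<^esub> m) \<and>
     (\<forall>n\<in>carrier N. \<forall>m\<in>carrier M. \<forall>n'\<in>carrier N.
       \<beta> (pure K N M n m) \<odot>\<^bsub>N\<^esub> n' = \<alpha> (pure K M N m n') \<odot>\<^bsub>N\<^esub> n) \<and>
     bij_betw \<alpha> (carrier (tens K M N)) (carrier K) \<and>
     bij_betw \<beta> (carrier (tens K N M)) (carrier K))"

definition cotens_morita_iso :: "'k ring \<Rightarrow> ('k, 'h) hopf \<Rightarrow> ('k, 'a) module
    \<Rightarrow> ('a \<Rightarrow> ('a, 'h) tensor) \<Rightarrow> ('k, 'a, 'm) cotens_morita \<Rightarrow> ('k, 'a, 'n) cotens_morita \<Rightarrow> bool" where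
  "cotens_morita_iso K H A \<rho> X Y \<longleftrightarrow>
    (let E = cotens_alg K H A \<rho> in
     \<exists>f g. left_module_hom K E (mP X) (mP Y) f \<and>
      bij_betw f (carrier (mP X)) (carrier (mP Y)) \<and>
      left_module_hom K E (mQ X) (mQ Y) g \<and>
      bij_betw g (carrier (mQ X)) (carrier (mQ Y)) \<and>
      (\<forall>m\<in>carrier (mP X). \<forall>n\<in>carrier (mQ X).
        malpha Y (pure K (mP Y) (mQ Y) (f m) (g n)) = malpha X (pure K (mP X) (mQ X) m n) \<and>
        mbeta Y (pure K (mQ Y) (mP Y) (g n) (f m)) = mbeta X (pure K (mQ X) (mP X) n m)))"

definition cotens_morita_mult :: "'k ring \<Rightarrow> ('k, 'h) hopf \<Rightarrow> ('k, 'a) module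
    \<Rightarrow> ('a \<Rightarrow> ('a, 'h) tensor) \<Rightarrow> ('k, 'a, 'm) cotens_morita \<Rightarrow> ('k, 'a, 'm) cotens_morita
    \<Rightarrow> ('k, 'a, ('m, 'm) tensor) cotens_morita" where
  "cotens_morita_mult K H A \<rho> X Y =
    \<lparr>mP = cotens_tens K H A \<rho> (mP X) (mP Y),
     mQ = cotens_tens K H A \<rho> (mQ Y) (mQ X),
     malpha = tensor_lift K (\<lambda>s t. tensor_lift K (\<lambda>m m'. tensor_lift K (\<lambda>n' n.
       malpha X (pure K (mP X) (mQ X)
         (malpha Y (pure K (mP Y) (mQ Y) m' n') \<odot>\<^bsub>mP X\<^esub> m) n)) t) s),
     mbeta = tensor_lift K (\<lambda>t s. tensor_lift K (\<lambda>n' n. tensor_lift K (\<lambda>m m'.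
       mbeta Y (pure K (mQ Y) (mP Y)
         (mbeta X (pure K (mQ X) (mP X) n m) \<odot>\<^bsub>mQ Y\<^esub> n') m')) s) t)\<rparr>"

definition cotens_morita_unit :: "'k ring \<Rightarrow> ('k, 'a) module \<Rightarrow> ('k, 'a, 'k) cotens_morita" where
  "cotens_morita_unit K A =
    \<lparr>mP = cotens_base K A, mQ = cotens_base K A,
     malpha = tensor_lift K (monoid.mult K), mbeta = tensor_lift K (monoid.mult K)\<rparr>"

text \<open>As above, \<open>'u\<close> is the universe; here \<open>M \<otimes> N \<cong> k\<close> makes \<open>M\<close> and \<open>N\<close> one-dimensional, so it
  is large enough as soon as \<open>k\<close> embeds into it.\<close>

definition PicSq :: "'k ring \<Rightarrow> ('k, 'h) hopf \<Rightarrow> ('k, 'a) module \<Rightarrow> ('a \<Rightarrow> ('a, 'h) tensor)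
    \<Rightarrow> ('k, 'a, 'u) cotens_morita set monoid" where
  "PicSq K H A \<rho> =
    \<lparr>carrier = {X. strict_cotens_morita K H A \<rho> X} //
       {(X, Y). strict_cotens_morita K H A \<rho> X \<and> strict_cotens_morita K H A \<rho> Y \<and>
                cotens_morita_iso K H A \<rho> X Y},
     monoid.mult = (\<lambda>C D. {Z. strict_cotens_morita K H A \<rho> Z \<and>
       (\<exists>X\<in>C. \<exists>Y\<in>D. cotens_morita_iso K H A \<rho> (cotens_morita_mult K H A \<rho> X Y) Z)}),
     one = {Z. strict_cotens_morita K H A \<rho> Z \<and>
       cotens_morita_iso K H A \<rho> (cotens_morita_unit K A) Z}\<rparr>"

end

theory Submission
  imports Defs
begin

text \<open>
  All three groups are compared through \<open>Alg(L,k)\<close>. On either side a strict Morita context turns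
  out to consist of two lines twisted by a character of \<open>L\<close> and by its inverse, two contexts are
  isomorphic if and only if they have the same character, and the tensor product of two lines is a
  line twisted by the convolution product. A classification of this kind makes the isomorphism
  classes into a group isomorphic to \<open>Alg(L,k)\<close> (\<open>class_group_iso\<close>).

  The Hopf algebra \<open>L\<close> enters through \<open>\<delta>(l) = can\<^sup>-\<^sup>1(l \<otimes> 1)\<close>, where \<open>can\<close> is the canonical map
  \<open>a \<otimes> b \<mapsto> a\<^sub>-\<^sub>1 \<otimes> a\<^sub>0b\<close> of the left coaction. This \<open>\<delta>\<close> is an isomorphism from \<open>L\<close> onto the algebra
  \<open>E = A \<box>\<^sub>H A\<^sup>o\<^sup>p\<close> (\<open>delta_bij\<close>, \<open>E_mult\<close>). Indeed an element of \<open>A \<otimes> A\<close> lies in \<open>E\<close> if and only if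
  it is coinvariant for the codiagonal coaction of \<open>H\<close>. As the two coactions of \<open>A\<close> commute, \<open>can\<close>
  then sends it to a tensor in \<open>L \<otimes> A\<close> whose right factors may be taken coinvariant, that is, in
  \<open>L \<otimes> k\<close>. Under \<open>\<delta>\<close> the map \<open>a \<otimes> a' \<mapsto> a\<^sub>0 \<otimes> l(a\<^sub>1) \<otimes> r(a\<^sub>1) \<otimes> a'\<close> becomes the comultiplication
  of \<open>L\<close> (\<open>cotens_split_delta\<close>) and \<open>a \<otimes> a' \<mapsto> aa'\<close> becomes the counit (\<open>cotens_eval_delta\<close>). So
  \<open>Pic\<^sup>\<box>\<^sup>H(k)\<close> is about \<open>L\<close>-modules with their usual tensor product. The modules of a strict context
  over \<open>k\<close> are one-dimensional, and \<open>L\<close> acts on them by characters (\<open>strict_line_context\<close>).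

  For \<open>Pic\<^sup>H(A)\<close>, a character \<open>f\<close> acts on \<open>A\<close> by \<open>\<theta>\<^sub>f(a) = f(a\<^sub>-\<^sub>1) a\<^sub>0\<close>. These are exactly the
  colinear algebra endomorphisms of \<open>A\<close> (\<open>theta_surj\<close>): the coinvariance of \<open>\<delta>(l) = \<Sum> x \<otimes> y\<close> makes
  \<open>\<Sum> T(x) y\<close> a scalar for each colinear \<open>T\<close>, and this scalar is the value of the character at \<open>l\<close>.
  Let \<open>(P, Q, \<alpha>, \<beta>)\<close> be strict. By Galois descent the coinvariants of \<open>P\<close> and \<open>Q\<close> generate them over
  \<open>A\<close> (\<open>coinv_generate\<close>), and \<open>\<alpha>\<close> maps pairs of coinvariants to \<open>A\<^sup>c\<^sup>o\<^sup>H = k\<close>. Since \<open>\<alpha> \<noteq> 0\<close>, there are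
  coinvariants with \<open>\<alpha>(p \<otimes> q) = 1\<close>. The axioms of a context make \<open>p\<close> a free generator of the right
  module \<open>P\<close>, and \<open>q\<close> one of \<open>Q\<close>. Writing \<open>ap = pT(a)\<close> defines a colinear algebra endomorphism,
  which is some \<open>\<theta>\<^sub>f\<close>. Hence \<open>P\<close> is \<open>A\<close> with its left action twisted by \<open>\<theta>\<^sub>f\<close>, and \<open>Q\<close> is
  \<open>A\<close> twisted by the inverse (\<open>coinv_line\<close>, \<open>strict_line_hctx\<close>).

  Tensors are classes of formal sums of pairs, and Sweedler calculations are carried out on the
  values \<open>\<Sum> f(x,y)\<close> of bilinear maps on tensors \<open>\<Sum> x \<otimes> y\<close>. An identity between tensors is stated
  as the equality of such sums for an arbitrary multilinear \<open>f\<close>; thus it can be applied anywhere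
  inside a nested sum.
\<close>

section \<open>Balanced tensor products\<close>

lemma abelian_group_of_module: "module R M \<Longrightarrow> abelian_group M"
  by (simp add: module_def)

text \<open>The scalars in \<open>S\<close> may be noncommutative, so they do not act on the tensor product. It is a
  \<open>K\<close>-module because \<open>K\<close> acts on the left factor and this action commutes with \<open>S\<close>. The instances
  are \<open>S = K\<close> and \<open>S = A\<close>.\<close>

locale balanced_pair =
  fixes K :: "'k ring" and S :: "'s set" and r :: "'m \<Rightarrow> 's \<Rightarrow> 'm" and l :: "'s \<Rightarrow> 'n \<Rightarrow> 'n"
    and M :: "('k, 'm, 'x) module_scheme" and N :: "('n, 'y) ring_scheme"
  assumes M: "module K M" and N: "abelian_group N"
    and r_closed: "\<And>m s. m \<in> carrier M \<Longrightarrow> s \<in> S \<Longrightarrow> r m s \<in> carrier M"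
    and l_closed: "\<And>s n. s \<in> S \<Longrightarrow> n \<in> carrier N \<Longrightarrow> l s n \<in> carrier N"
    and r_smult: "\<And>c m s. c \<in> carrier K \<Longrightarrow> m \<in> carrier M \<Longrightarrow> s \<in> S
      \<Longrightarrow> c \<odot>\<^bsub>M\<^esub> r m s = r (c \<odot>\<^bsub>M\<^esub> m) s"
begin

sublocale M: module K M by (rule M)
sublocale N: abelian_group N by (rule N)

abbreviation "cls \<equiv> tensor_class S r l M N"
abbreviation "B \<equiv> balanced_tensor S r l M N"
abbreviation "pu m n \<equiv> cls [(m, n)]"
abbreviation "cong \<equiv> tensor_cong S r l M N"
abbreviation "C \<equiv> carrier M \<times> carrier N"

lemma cong_sets: "cong xs ys \<Longrightarrow> set xs \<subseteq> C \<and> set ys \<subseteq> C"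
  by (rule tensor_cong_carrier[OF _ M.abelian_group_axioms N r_closed l_closed])

lemma cls_eqI: "cong xs ys \<Longrightarrow> cls xs = cls ys"
  unfolding tensor_class_def
  by (rule Collect_cong, rule iffI, erule tc_trans[OF tc_sym], assumption, erule tc_trans, assumption)

lemma rep_in: "set xs \<subseteq> C \<Longrightarrow> tensor_rep (cls xs) \<in> cls xs"
  unfolding tensor_rep_def tensor_class_def
  by (rule someI[of _ xs]) (simp add: tc_refl)

lemma rep_cong: "set xs \<subseteq> C \<Longrightarrow> cong xs (tensor_rep (cls xs))"
  using rep_in by (simp add: tensor_class_def)

lemma carrier_B: "carrier B = cls ` lists C"
  and zero_B: "\<zero>\<^bsub>B\<^esub> = cls []"
  by (simp_all add: balanced_tensor_def)

lemma cls_in: "set xs \<subseteq> C \<Longrightarrow> cls xs \<in> carrier B"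
  by (auto simp: carrier_B)

lemma rep:
  assumes "t \<in> carrier B" shows "set (tensor_rep t) \<subseteq> C" "cls (tensor_rep t) = t"
proof -
  obtain xs where xs: "set xs \<subseteq> C" "t = cls xs" using assms by (auto simp: carrier_B)
  show "set (tensor_rep t) \<subseteq> C" using cong_sets[OF rep_cong[OF xs(1)]] xs(2) by simp
  show "cls (tensor_rep t) = t" using cls_eqI[OF rep_cong[OF xs(1)]] xs(2) by simp
qed

lemma add_cls: "set xs \<subseteq> C \<Longrightarrow> set ys \<subseteq> C \<Longrightarrow> cls xs \<oplus>\<^bsub>B\<^esub> cls ys = cls (xs @ ys)"
  by (auto simp: balanced_tensor_def intro!: cls_eqI[symmetric] tc_append rep_cong)

lemma smult_cong:
  assumes c: "c \<in> carrier K" and "cong xs ys"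
  shows "cong (map (\<lambda>(m, n). (c \<odot>\<^bsub>M\<^esub> m, n)) xs) (map (\<lambda>(m, n). (c \<odot>\<^bsub>M\<^esub> m, n)) ys)"
  using assms(2)
proof induction
  case (tc_refl xs)
  then show ?case using c by (intro tensor_cong.tc_refl) auto
next
  case (tc_sym xs ys)
  then show ?case by (rule_tac tensor_cong.tc_sym)
next
  case (tc_trans xs ys zs)
  show ?case by (rule tensor_cong.tc_trans[OF tc_trans.IH])
next
  case (tc_append xs xs' ys ys')
  then show ?case by (simp add: tensor_cong.tc_append)
next
  case (tc_zero_right m)
  then show ?case using c by (auto intro!: tensor_cong.tc_zero_right)
next
  case (tc_add_right m n n')
  then show ?case using c by (auto intro!: tensor_cong.tc_add_right)
next
  case (tc_comm xs ys)
  have "set (map (\<lambda>(m, n). (c \<odot>\<^bsub>M\<^esub> m, n)) zs) \<subseteq> C" if "set zs \<subseteq> C" for zs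
    using c that by auto
  from tensor_cong.tc_comm[OF this[OF tc_comm(1)] this[OF tc_comm(2)]]
  show ?case by simp
next
  case (tc_zero_left n)
  then show ?case using c by (auto intro!: tensor_cong.tc_zero_left)
next
  case (tc_add_left m m' n)
  then show ?case using c by (auto simp: M.smult_r_distr intro!: tensor_cong.tc_add_left)
next
  case (tc_balanced m s n)
  then show ?case using c by (auto simp: r_smult intro!: tensor_cong.tc_balanced)
qed

lemma smult_cls:
  assumes "c \<in> carrier K" "set xs \<subseteq> C"
  shows "c \<odot>\<^bsub>B\<^esub> cls xs = cls (map (\<lambda>(m, n). (c \<odot>\<^bsub>M\<^esub> m, n)) xs)"
  using cls_eqI[OF smult_cong[OF assms(1) rep_cong[OF assms(2)]]]
  by (simp add: balanced_tensor_def)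

lemma cls_Cons: "m \<in> carrier M \<Longrightarrow> n \<in> carrier N \<Longrightarrow> set xs \<subseteq> C
    \<Longrightarrow> cls ((m, n) # xs) = pu m n \<oplus>\<^bsub>B\<^esub> cls xs"
  by (subst add_cls) auto

lemma pu_add_left: "m \<in> carrier M \<Longrightarrow> m' \<in> carrier M \<Longrightarrow> n \<in> carrier N
    \<Longrightarrow> pu (m \<oplus>\<^bsub>M\<^esub> m') n = pu m n \<oplus>\<^bsub>B\<^esub> pu m' n"
  by (subst add_cls) (auto intro!: cls_eqI tc_add_left)

lemma pu_add_right: "m \<in> carrier M \<Longrightarrow> n \<in> carrier N \<Longrightarrow> n' \<in> carrier N
    \<Longrightarrow> pu m (n \<oplus>\<^bsub>N\<^esub> n') = pu m n \<oplus>\<^bsub>B\<^esub> pu m n'"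
  by (subst add_cls) (auto intro!: cls_eqI tc_add_right)

lemma pu_smult: "m \<in> carrier M \<Longrightarrow> n \<in> carrier N \<Longrightarrow> c \<in> carrier K
    \<Longrightarrow> pu (c \<odot>\<^bsub>M\<^esub> m) n = c \<odot>\<^bsub>B\<^esub> pu m n"
  by (subst smult_cls) auto

lemma pu_balanced: "m \<in> carrier M \<Longrightarrow> s \<in> S \<Longrightarrow> n \<in> carrier N \<Longrightarrow> pu (r m s) n = pu m (l s n)"
  by (auto intro!: cls_eqI tc_balanced)

lemma pu_in: "m \<in> carrier M \<Longrightarrow> n \<in> carrier N \<Longrightarrow> pu m n \<in> carrier B"
  by (rule cls_in) auto

lemma minus_cls: "set xs \<subseteq> C \<Longrightarrow> cong (map (\<lambda>(m, n). (\<ominus>\<^bsub>M\<^esub> m, n)) xs @ xs) []"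
proof (induction xs)
  case Nil then show ?case by (auto intro: tc_refl)
next
  case (Cons p xs)
  obtain m n where p: "p = (m, n)" "m \<in> carrier M" "n \<in> carrier N" using Cons by auto
  let ?neg = "map (\<lambda>(m, n). (\<ominus>\<^bsub>M\<^esub> m, n))"
  have s: "set xs \<subseteq> C" using Cons by auto
  then have ns: "set (?neg xs) \<subseteq> C" by auto
  have z: "\<ominus>\<^bsub>M\<^esub> m \<oplus>\<^bsub>M\<^esub> m = \<zero>\<^bsub>M\<^esub>" using p by (rule_tac M.l_neg)
  have "cong [(\<ominus>\<^bsub>M\<^esub> m \<oplus>\<^bsub>M\<^esub> m, n)] [(\<ominus>\<^bsub>M\<^esub> m, n), (m, n)]"
    using p by (intro tc_add_left) auto
  then have 1: "cong [(\<ominus>\<^bsub>M\<^esub> m, n), (m, n)] []"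
    unfolding z by (rule tc_trans[OF tc_sym tc_zero_left[OF p(3)]])
  have "cong (?neg xs @ [(m, n)]) ([(m, n)] @ ?neg xs)" using p s ns by (intro tc_comm) auto
  then have "cong ([(\<ominus>\<^bsub>M\<^esub> m, n)] @ (?neg xs @ [(m, n)]) @ xs) ([(\<ominus>\<^bsub>M\<^esub> m, n)] @ ([(m, n)] @ ?neg xs) @ xs)"
    using p s by (intro tc_append[OF tc_refl tc_append[OF _ tc_refl]]) auto
  then have 2: "cong (?neg (p # xs) @ p # xs) ([(\<ominus>\<^bsub>M\<^esub> m, n), (m, n)] @ (?neg xs @ xs))"
    using p(1) by simp
  have "cong ([(\<ominus>\<^bsub>M\<^esub> m, n), (m, n)] @ (?neg xs @ xs)) ([] @ [])"
    by (rule tc_append[OF 1 Cons.IH[OF s]])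
  then show ?case using tc_trans[OF 2] by simp
qed

lemma module_B: "module K B"
proof -
  have ab: "abelian_group B"
  proof (rule abelian_groupI)
    fix x y assume x: "x \<in> carrier B" and y: "y \<in> carrier B"
    note rx = rep[OF x] and ry = rep[OF y]
    show "x \<oplus>\<^bsub>B\<^esub> y \<in> carrier B"
      using add_cls[OF rx(1) ry(1)] cls_in[of "tensor_rep x @ tensor_rep y"] rx ry by auto
    show "x \<oplus>\<^bsub>B\<^esub> y = y \<oplus>\<^bsub>B\<^esub> x"
      using add_cls[OF rx(1) ry(1)] add_cls[OF ry(1) rx(1)] cls_eqI[OF tc_comm[OF rx(1) ry(1)]] rx ry
      by simp
    show "\<zero>\<^bsub>B\<^esub> \<oplus>\<^bsub>B\<^esub> x = x"
      using add_cls[of "[]", OF _ rx(1)] rx by (simp add: zero_B)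
    have "cls (map (\<lambda>(m, n). (\<ominus>\<^bsub>M\<^esub> m, n)) (tensor_rep x)) \<oplus>\<^bsub>B\<^esub> x = \<zero>\<^bsub>B\<^esub>"
      using add_cls[of "map (\<lambda>(m, n). (\<ominus>\<^bsub>M\<^esub> m, n)) (tensor_rep x)", OF _ rx(1)]
        cls_eqI[OF minus_cls[OF rx(1)]] rx by (force simp: zero_B)
    moreover have "cls (map (\<lambda>(m, n). (\<ominus>\<^bsub>M\<^esub> m, n)) (tensor_rep x)) \<in> carrier B"
      using rx by (intro cls_in) auto
    ultimately show "\<exists>y\<in>carrier B. y \<oplus>\<^bsub>B\<^esub> x = \<zero>\<^bsub>B\<^esub>" by (rule bexI)
    fix z assume z: "z \<in> carrier B"
    note rz = rep[OF z]
    show "x \<oplus>\<^bsub>B\<^esub> y \<oplus>\<^bsub>B\<^esub> z = x \<oplus>\<^bsub>B\<^esub> (y \<oplus>\<^bsub>B\<^esub> z)"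
      using add_cls[OF rx(1) ry(1)] add_cls[OF ry(1) rz(1)]
        add_cls[of "tensor_rep x @ tensor_rep y", OF _ rz(1)] add_cls[OF rx(1), of "tensor_rep y @ tensor_rep z"]
        rx ry rz by simp
  qed (use zero_B cls_in[of "[]"] in simp)
  interpret B: abelian_group B by (rule ab)
  have sm: "c \<odot>\<^bsub>B\<^esub> x \<in> carrier B" if "c \<in> carrier K" "x \<in> carrier B" for c x
    using smult_cls[OF that(1) rep(1)[OF that(2)]] rep[OF that(2)] that
    by (force intro!: cls_in)
  have addl: "(a \<oplus>\<^bsub>K\<^esub> b) \<odot>\<^bsub>B\<^esub> cls xs = a \<odot>\<^bsub>B\<^esub> cls xs \<oplus>\<^bsub>B\<^esub> b \<odot>\<^bsub>B\<^esub> cls xs"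
    if "a \<in> carrier K" "b \<in> carrier K" "set xs \<subseteq> C" for a b xs
    using that(3)
  proof (induction xs)
    case Nil
    then show ?case using that by (simp add: smult_cls add_cls)
  next
    case (Cons p xs)
    obtain m n where p: "p = (m, n)" "m \<in> carrier M" "n \<in> carrier N" using Cons by auto
    have xs: "set xs \<subseteq> C" using Cons by auto
    have e: "c \<odot>\<^bsub>B\<^esub> cls ((m, n) # xs) = pu (c \<odot>\<^bsub>M\<^esub> m) n \<oplus>\<^bsub>B\<^esub> c \<odot>\<^bsub>B\<^esub> cls xs" if "c \<in> carrier K" for c
    proof -
      have "set (map (\<lambda>(m, n). (c \<odot>\<^bsub>M\<^esub> m, n)) xs) \<subseteq> C" using xs that by auto
      then show ?thesis using that p xs cls_Cons[of "c \<odot>\<^bsub>M\<^esub> m" n "map (\<lambda>(m, n). (c \<odot>\<^bsub>M\<^esub> m, n)) xs"]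
        by (simp add: smult_cls)
    qed
    have in1: "c \<odot>\<^bsub>B\<^esub> cls xs \<in> carrier B" "pu (c \<odot>\<^bsub>M\<^esub> m) n \<in> carrier B" if "c \<in> carrier K" for c
      using sm[OF that cls_in[OF xs]] pu_in p that by auto
    show ?case unfolding p(1) using that p(2,3) in1[OF that(1)] in1[OF that(2)] Cons.IH[OF xs]
      by (simp add: e M.smult_l_distr pu_add_left B.a_ac M.R.add.m_closed)
  qed
  have one: "\<one>\<^bsub>K\<^esub> \<odot>\<^bsub>B\<^esub> x = x" if "x \<in> carrier B" for x
  proof -
    note rx = rep[OF that]
    have "map (\<lambda>(m, n). (\<one>\<^bsub>K\<^esub> \<odot>\<^bsub>M\<^esub> m, n)) (tensor_rep x) = tensor_rep x"
      using rx(1) by (auto intro!: map_idI)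
    then show ?thesis using smult_cls[OF _ rx(1), of "\<one>\<^bsub>K\<^esub>"] rx by simp
  qed
  have assoc: "(a \<otimes>\<^bsub>K\<^esub> b) \<odot>\<^bsub>B\<^esub> x = a \<odot>\<^bsub>B\<^esub> (b \<odot>\<^bsub>B\<^esub> x)"
    if a: "a \<in> carrier K" and b: "b \<in> carrier K" and x: "x \<in> carrier B" for a b x
  proof -
    note rx = rep[OF x]
    have s: "set (map (\<lambda>(m, n). (b \<odot>\<^bsub>M\<^esub> m, n)) (tensor_rep x)) \<subseteq> C" using rx b by auto
    have "map (\<lambda>(m, n). ((a \<otimes>\<^bsub>K\<^esub> b) \<odot>\<^bsub>M\<^esub> m, n)) (tensor_rep x)
       = map ((\<lambda>(m, n). (a \<odot>\<^bsub>M\<^esub> m, n)) \<circ> (\<lambda>(m, n). (b \<odot>\<^bsub>M\<^esub> m, n))) (tensor_rep x)"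
      using rx(1) a b by (auto simp: M.smult_assoc1)
    then show ?thesis
      using smult_cls[OF _ rx(1), of "a \<otimes>\<^bsub>K\<^esub> b"] smult_cls[OF b rx(1)] smult_cls[OF a s] rx a b
      by (simp del: map_eq_conv)
  qed
  have addr: "a \<odot>\<^bsub>B\<^esub> (x \<oplus>\<^bsub>B\<^esub> y) = a \<odot>\<^bsub>B\<^esub> x \<oplus>\<^bsub>B\<^esub> a \<odot>\<^bsub>B\<^esub> y"
    if a: "a \<in> carrier K" and x: "x \<in> carrier B" and y: "y \<in> carrier B" for a x y
  proof -
    note rx = rep[OF x] and ry = rep[OF y]
    let ?sm = "map (\<lambda>(m, n). (a \<odot>\<^bsub>M\<^esub> m, n))"
    have s: "set (?sm (tensor_rep x)) \<subseteq> C" "set (?sm (tensor_rep y)) \<subseteq> C" using rx(1) ry(1) a by auto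
    show ?thesis
      using add_cls[OF rx(1) ry(1)] smult_cls[OF a, of "tensor_rep x @ tensor_rep y"] rx ry
        smult_cls[OF a rx(1)] smult_cls[OF a ry(1)] add_cls[OF s]
      by simp
  qed
  have addl': "(a \<oplus>\<^bsub>K\<^esub> b) \<odot>\<^bsub>B\<^esub> x = a \<odot>\<^bsub>B\<^esub> x \<oplus>\<^bsub>B\<^esub> b \<odot>\<^bsub>B\<^esub> x"
    if "a \<in> carrier K" "b \<in> carrier K" "x \<in> carrier B" for a b x
    using addl[OF that(1,2) rep(1)[OF that(3)]] rep(2)[OF that(3)] by simp
  have "module_axioms K B"
    unfolding module_axioms_def using sm one assoc addr addl' by blast
  then show ?thesis using ab M.R.is_cring by (simp add: module_def)
qed

sublocale B: module K B by (rule module_B)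

lemma tensor_induct [consumes 1, case_names zero pure add]:
  assumes "t \<in> carrier B" and "P \<zero>\<^bsub>B\<^esub>"
    and "\<And>m n. m \<in> carrier M \<Longrightarrow> n \<in> carrier N \<Longrightarrow> P (pu m n)"
    and "\<And>s t. s \<in> carrier B \<Longrightarrow> t \<in> carrier B \<Longrightarrow> P s \<Longrightarrow> P t \<Longrightarrow> P (s \<oplus>\<^bsub>B\<^esub> t)"
  shows "P t"
proof -
  have "P (cls xs)" if "set xs \<subseteq> C" for xs
    using that
  proof (induction xs)
    case Nil show ?case using assms(2) unfolding zero_B .
  next
    case (Cons p xs)
    obtain m n where p: "p = (m, n)" "m \<in> carrier M" "n \<in> carrier N" using Cons by auto
    have xs: "set xs \<subseteq> C" using Cons by auto
    have "P (pu m n \<oplus>\<^bsub>B\<^esub> cls xs)"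
      by (rule assms(4)[OF pu_in[OF p(2,3)] cls_in[OF xs] assms(3)[OF p(2,3)] Cons.IH[OF xs]])
    then show ?case unfolding p(1) cls_Cons[OF p(2,3) xs] .
  qed
  from this[OF rep(1)[OF assms(1)]] show ?thesis by (simp add: rep(2)[OF assms(1)])
qed

definition balanced_map :: "('g, 'w) ring_scheme \<Rightarrow> ('m \<Rightarrow> 'n \<Rightarrow> 'g) \<Rightarrow> bool" where
  "balanced_map G f \<longleftrightarrow> abelian_group G \<and>
    (\<forall>m\<in>carrier M. \<forall>n\<in>carrier N. f m n \<in> carrier G) \<and>
    (\<forall>m\<in>carrier M. \<forall>m'\<in>carrier M. \<forall>n\<in>carrier N. f (m \<oplus>\<^bsub>M\<^esub> m') n = f m n \<oplus>\<^bsub>G\<^esub> f m' n) \<and>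
    (\<forall>m\<in>carrier M. \<forall>n\<in>carrier N. \<forall>n'\<in>carrier N. f m (n \<oplus>\<^bsub>N\<^esub> n') = f m n \<oplus>\<^bsub>G\<^esub> f m n') \<and>
    (\<forall>m\<in>carrier M. \<forall>s\<in>S. \<forall>n\<in>carrier N. f (r m s) n = f m (l s n))"

lemma lift_cls: "balanced_map G f \<Longrightarrow> set xs \<subseteq> C \<Longrightarrow> tensor_lift G f (cls xs) = pair_sum G f xs"
  unfolding balanced_map_def
  by (intro tensor_lift_class[OF _ M.abelian_group_axioms N r_closed l_closed]) blast+

lemma lift_pu: assumes "balanced_map G f" "m \<in> carrier M" "n \<in> carrier N"
  shows "tensor_lift G f (pu m n) = f m n"
proof -
  interpret G: abelian_group G using assms by (simp add: balanced_map_def)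
  show ?thesis using assms lift_cls[OF assms(1), of "[(m, n)]"]
    by (simp add: pair_sum_def balanced_map_def)
qed

lemma lift_closed: assumes "balanced_map G f" "t \<in> carrier B"
  shows "tensor_lift G f t \<in> carrier G"
  unfolding tensor_lift_def
  using assms(1) by (intro pair_sum_closed[OF _ rep(1)[OF assms(2)]]) (auto simp: balanced_map_def)

lemma lift_add: assumes "balanced_map G f" "s \<in> carrier B" "t \<in> carrier B"
  shows "tensor_lift G f (s \<oplus>\<^bsub>B\<^esub> t) = tensor_lift G f s \<oplus>\<^bsub>G\<^esub> tensor_lift G f t"
proof -
  note rs = rep[OF assms(2)] and rt = rep[OF assms(3)]
  have "tensor_lift G f (s \<oplus>\<^bsub>B\<^esub> t) = pair_sum G f (tensor_rep s @ tensor_rep t)"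
    using add_cls[OF rs(1) rt(1)] lift_cls[OF assms(1), of "tensor_rep s @ tensor_rep t"] rs rt by simp
  also have "\<dots> = pair_sum G f (tensor_rep s) \<oplus>\<^bsub>G\<^esub> pair_sum G f (tensor_rep t)"
    using assms(1) by (intro pair_sum_append[OF _ rs(1) rt(1)]) (auto simp: balanced_map_def)
  finally show ?thesis by (simp add: tensor_lift_def)
qed

lemma lift_zero: assumes "balanced_map G f" shows "tensor_lift G f \<zero>\<^bsub>B\<^esub> = \<zero>\<^bsub>G\<^esub>"
  using lift_cls[OF assms, of "[]"] by (simp add: zero_B pair_sum_def)

end

section \<open>Linear and multilinear maps over a field\<close>

lemma module_carrier_cong:
  assumes "module K M" "carrier M' = carrier M" "\<zero>\<^bsub>M'\<^esub> = \<zero>\<^bsub>M\<^esub>" "add M' = add M" "smult M' = smult M"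
  shows "module K M'"
proof -
  interpret M: module K M by fact
  have "abelian_group M'"
  proof (rule abelian_groupI, unfold assms(2-5))
    fix x assume x: "x \<in> carrier M"
    show "\<exists>y\<in>carrier M. y \<oplus>\<^bsub>M\<^esub> x = \<zero>\<^bsub>M\<^esub>"
      using M.l_neg[OF x] M.a_inv_closed[OF x] by blast
  qed (rule M.a_closed M.zero_closed M.a_assoc M.a_comm M.l_zero; assumption?)+
  moreover have "module_axioms K M'"
    unfolding module_axioms_def assms(2-5)
    using M.smult_closed M.smult_l_distr M.smult_r_distr M.smult_assoc1 M.smult_one by simp
  ultimately show ?thesis using M.R.is_cring by (simp add: module_def)
qed

text \<open>Rules for the multilinearity and the membership of composite expressions. They discharge the side
  conditions of every rewriting step below.\<close>

named_theorems lins

locale fieldK = field K for K :: "'k ring" (structure)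
begin

text \<open>The module structures are part of the predicates, so that one premise carries all that is known
  about a map.\<close>

definition lin where "lin M N f \<longleftrightarrow> module K M \<and> module K N \<and> k_linear K M N f"

definition bil where
  "bil M N G f \<longleftrightarrow> module K M \<and> module K N \<and> module K G \<and>
     (\<forall>m\<in>carrier M. lin N G (f m)) \<and> (\<forall>n\<in>carrier N. lin M G (\<lambda>m. f m n))"

definition tri where
  "tri M N P G f \<longleftrightarrow> module K M \<and> module K N \<and> module K P \<and> module K G \<and>
     (\<forall>m\<in>carrier M. bil N P G (f m)) \<and> (\<forall>n\<in>carrier N. \<forall>p\<in>carrier P. lin M G (\<lambda>m. f m n p))"

definition quad where
  "quad M N P Q G f \<longleftrightarrow> module K M \<and> module K N \<and> module K P \<and> module K Q \<and> module K G \<and>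
     (\<forall>m\<in>carrier M. tri N P Q G (f m)) \<and>
     (\<forall>n\<in>carrier N. \<forall>p\<in>carrier P. \<forall>q\<in>carrier Q. lin M G (\<lambda>m. f m n p q))"

abbreviation "tn \<equiv> tens K"
abbreviation "k \<equiv> base_mod K"

text \<open>The Sweedler sum \<open>\<Sum> f(x, y)\<close> over \<open>t = \<Sum> x \<otimes> y\<close>. The tensor comes first so that nested sums
  read from the outside to the inside.\<close>

abbreviation "sw G t f \<equiv> tensor_lift G f t"

lemma linI:
  assumes "module K M" "module K N" "\<And>x. x \<in> carrier M \<Longrightarrow> f x \<in> carrier N"
    and "\<And>x y. x \<in> carrier M \<Longrightarrow> y \<in> carrier M \<Longrightarrow> f (x \<oplus>\<^bsub>M\<^esub> y) = f x \<oplus>\<^bsub>N\<^esub> f y"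
    and "\<And>c x. c \<in> carrier K \<Longrightarrow> x \<in> carrier M \<Longrightarrow> f (c \<odot>\<^bsub>M\<^esub> x) = c \<odot>\<^bsub>N\<^esub> f x"
  shows "lin M N f"
  using assms by (auto simp: lin_def k_linear_def)

lemma linD:
  assumes "lin M N f"
  shows "module K M" "module K N" "x \<in> carrier M \<Longrightarrow> f x \<in> carrier N"
    and "x \<in> carrier M \<Longrightarrow> y \<in> carrier M \<Longrightarrow> f (x \<oplus>\<^bsub>M\<^esub> y) = f x \<oplus>\<^bsub>N\<^esub> f y"
    and "c \<in> carrier K \<Longrightarrow> x \<in> carrier M \<Longrightarrow> f (c \<odot>\<^bsub>M\<^esub> x) = c \<odot>\<^bsub>N\<^esub> f x"
  using assms by (auto simp: lin_def k_linear_def)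

lemma lin_zero: assumes "lin M N f" shows "f \<zero>\<^bsub>M\<^esub> = \<zero>\<^bsub>N\<^esub>"
proof -
  interpret M: module K M using linD(1)[OF assms] .
  interpret N: module K N using linD(2)[OF assms] .
  show ?thesis using linD(4)[OF assms, of "\<zero>\<^bsub>M\<^esub>" "\<zero>\<^bsub>M\<^esub>"] linD(3)[OF assms, of "\<zero>\<^bsub>M\<^esub>"] by simp
qed

lemma lin_cong: "lin M N f \<Longrightarrow> (\<And>x. x \<in> carrier M \<Longrightarrow> f x = g x) \<Longrightarrow> lin M N g"
proof -
  assume f: "lin M N f" and fg: "\<And>x. x \<in> carrier M \<Longrightarrow> f x = g x"
  interpret M: module K M using linD(1)[OF f] .
  show ?thesis using linD[OF f] by (auto intro!: linI simp: fg[symmetric])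
qed

lemma lin_id [lins]: "module K M \<Longrightarrow> lin M M (\<lambda>x. x)"
  by (auto intro: linI)

lemma lin_comp: "lin N P g \<Longrightarrow> lin M N f \<Longrightarrow> lin M P (\<lambda>x. g (f x))"
  by (auto simp: lin_def k_linear_def Pi_iff)

lemma base_simps [simp]: "carrier k = carrier K" "add k = add K" "\<zero>\<^bsub>k\<^esub> = \<zero>" "smult k = monoid.mult K"
   "monoid.mult k = monoid.mult K" "\<one>\<^bsub>k\<^esub> = \<one>"
  by (simp_all add: base_mod_def ring.defs module.defs)

lemma module_k [simp, lins]: "module K k"
proof -
  have "abelian_group k"
  proof (rule abelian_groupI)
    fix x assume "x \<in> carrier k"
    then show "\<exists>y\<in>carrier k. y \<oplus>\<^bsub>k\<^esub> x = \<zero>\<^bsub>k\<^esub>"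
      using l_neg[of x] a_inv_closed[of x] by auto
  qed (auto simp: a_ac)
  moreover have "module_axioms K k" by (auto simp: module_axioms_def m_assoc l_distr r_distr)
  ultimately show ?thesis by (simp add: module_def is_cring)
qed

lemma sw_K: "tensor_lift k = tensor_lift K"
  by (intro ext) (simp add: tensor_lift_def pair_sum_def)

lemma bilI [lins]:
  assumes "module K M" "module K N" "module K G"
    and "\<And>m. m \<in> carrier M \<Longrightarrow> lin N G (\<lambda>n. f m n)" "\<And>n. n \<in> carrier N \<Longrightarrow> lin M G (\<lambda>m. f m n)"
  shows "bil M N G (\<lambda>m n. f m n)"
  using assms by (simp add: bil_def)

lemma triI [lins]:
  assumes "module K M" "module K N" "module K P" "module K G"
    and "\<And>n p. n \<in> carrier N \<Longrightarrow> p \<in> carrier P \<Longrightarrow> lin M G (\<lambda>m. f m n p)"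
    and "\<And>m p. m \<in> carrier M \<Longrightarrow> p \<in> carrier P \<Longrightarrow> lin N G (\<lambda>n. f m n p)"
    and "\<And>m n. m \<in> carrier M \<Longrightarrow> n \<in> carrier N \<Longrightarrow> lin P G (\<lambda>p. f m n p)"
  shows "tri M N P G (\<lambda>m n p. f m n p)"
  using assms by (simp add: tri_def bil_def)

lemma quadI [lins]:
  assumes "module K M" "module K N" "module K P" "module K Q" "module K G"
    and "\<And>n p q. n \<in> carrier N \<Longrightarrow> p \<in> carrier P \<Longrightarrow> q \<in> carrier Q \<Longrightarrow> lin M G (\<lambda>m. f m n p q)"
    and "\<And>m p q. m \<in> carrier M \<Longrightarrow> p \<in> carrier P \<Longrightarrow> q \<in> carrier Q \<Longrightarrow> lin N G (\<lambda>n. f m n p q)"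
    and "\<And>m n q. m \<in> carrier M \<Longrightarrow> n \<in> carrier N \<Longrightarrow> q \<in> carrier Q \<Longrightarrow> lin P G (\<lambda>p. f m n p q)"
    and "\<And>m n p. m \<in> carrier M \<Longrightarrow> n \<in> carrier N \<Longrightarrow> p \<in> carrier P \<Longrightarrow> lin Q G (\<lambda>q. f m n p q)"
  shows "quad M N P Q G (\<lambda>m n p q. f m n p q)"
  using assms by (simp add: quad_def tri_def bil_def)

lemma bil_mods: "bil M N G f \<Longrightarrow> module K M" "bil M N G f \<Longrightarrow> module K N" "bil M N G f \<Longrightarrow> module K G"
  by (simp_all add: bil_def)

lemma bilD:
  assumes "bil M N G f"
  shows "lin X M u \<Longrightarrow> n \<in> carrier N \<Longrightarrow> lin X G (\<lambda>x. f (u x) n)"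
    and "m \<in> carrier M \<Longrightarrow> lin X N v \<Longrightarrow> lin X G (\<lambda>x. f m (v x))"
    and "m \<in> carrier M \<Longrightarrow> n \<in> carrier N \<Longrightarrow> f m n \<in> carrier G"
    and "module K G"
  using assms lin_comp[of N G "f m" X v] lin_comp[of M G "\<lambda>m. f m n" X u]
  by (auto simp: bil_def dest: linD)

lemma triD:
  assumes "tri M N P G f"
  shows "lin X M u \<Longrightarrow> n \<in> carrier N \<Longrightarrow> p \<in> carrier P \<Longrightarrow> lin X G (\<lambda>x. f (u x) n p)"
    and "m \<in> carrier M \<Longrightarrow> lin X N v \<Longrightarrow> p \<in> carrier P \<Longrightarrow> lin X G (\<lambda>x. f m (v x) p)"
    and "m \<in> carrier M \<Longrightarrow> n \<in> carrier N \<Longrightarrow> lin X P w \<Longrightarrow> lin X G (\<lambda>x. f m n (w x))"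
    and "m \<in> carrier M \<Longrightarrow> n \<in> carrier N \<Longrightarrow> p \<in> carrier P \<Longrightarrow> f m n p \<in> carrier G"
    and "module K G"
  using assms lin_comp[of M G "\<lambda>m. f m n p" X u] bilD[of N P G "f m"]
  by (auto simp: tri_def)

lemma quadD:
  assumes "quad M N P Q G f"
  shows "lin X M u \<Longrightarrow> n \<in> carrier N \<Longrightarrow> p \<in> carrier P \<Longrightarrow> q \<in> carrier Q \<Longrightarrow> lin X G (\<lambda>x. f (u x) n p q)"
    and "m \<in> carrier M \<Longrightarrow> lin X N v \<Longrightarrow> p \<in> carrier P \<Longrightarrow> q \<in> carrier Q \<Longrightarrow> lin X G (\<lambda>x. f m (v x) p q)"
    and "m \<in> carrier M \<Longrightarrow> n \<in> carrier N \<Longrightarrow> lin X P w \<Longrightarrow> q \<in> carrier Q \<Longrightarrow> lin X G (\<lambda>x. f m n (w x) q)"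
    and "m \<in> carrier M \<Longrightarrow> n \<in> carrier N \<Longrightarrow> p \<in> carrier P \<Longrightarrow> lin X Q z \<Longrightarrow> lin X G (\<lambda>x. f m n p (z x))"
    and "m \<in> carrier M \<Longrightarrow> n \<in> carrier N \<Longrightarrow> p \<in> carrier P \<Longrightarrow> q \<in> carrier Q \<Longrightarrow> f m n p q \<in> carrier G"
    and "module K G"
  using assms lin_comp[of M G "\<lambda>m. f m n p q" X u] triD[of N P Q G "f m"]
  by (auto simp: quad_def)

subsection \<open>Tensor products over the field\<close>

lemma tens_simps:
  "carrier (tn M N) = carrier (balanced_tensor (carrier K) (\<lambda>m c. c \<odot>\<^bsub>M\<^esub> m) (\<lambda>c n. c \<odot>\<^bsub>N\<^esub> n) M N)"
  "\<zero>\<^bsub>tn M N\<^esub> = \<zero>\<^bsub>balanced_tensor (carrier K) (\<lambda>m c. c \<odot>\<^bsub>M\<^esub> m) (\<lambda>c n. c \<odot>\<^bsub>N\<^esub> n) M N\<^esub>"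
  "add (tn M N) = add (balanced_tensor (carrier K) (\<lambda>m c. c \<odot>\<^bsub>M\<^esub> m) (\<lambda>c n. c \<odot>\<^bsub>N\<^esub> n) M N)"
  "smult (tn M N) = smult (balanced_tensor (carrier K) (\<lambda>m c. c \<odot>\<^bsub>M\<^esub> m) (\<lambda>c n. c \<odot>\<^bsub>N\<^esub> n) M N)"
  by (simp_all add: tens_def Let_def)

lemma balanced_K: assumes "module K M" "module K N"
  shows "balanced_pair K (carrier K) (\<lambda>m c. c \<odot>\<^bsub>M\<^esub> m) (\<lambda>c n. c \<odot>\<^bsub>N\<^esub> n) M N"
proof -
  interpret M: module K M by fact
  interpret N: module K N by fact
  have *: "c \<odot>\<^bsub>M\<^esub> (s \<odot>\<^bsub>M\<^esub> m) = s \<odot>\<^bsub>M\<^esub> (c \<odot>\<^bsub>M\<^esub> m)" if "c \<in> carrier K" "s \<in> carrier K" "m \<in> carrier M" for c s m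
    using that M.smult_assoc1[of c s m] M.smult_assoc1[of s c m] m_comm[of s c] by simp
  show ?thesis
    by (rule balanced_pair.intro[OF assms(1) N.abelian_group_axioms]) (simp_all add: *)
qed

lemma module_tens [simp, lins]: "module K M \<Longrightarrow> module K N \<Longrightarrow> module K (tn M N)"
  by (rule module_carrier_cong[OF balanced_pair.module_B[OF balanced_K]]) (simp_all add: tens_simps)

lemma bil_pure: "module K M \<Longrightarrow> module K N \<Longrightarrow> bil M N (tn M N) (pure K M N)"
proof -
  assume M: "module K M" and N: "module K N"
  interpret T: balanced_pair K "carrier K" "\<lambda>m c. c \<odot>\<^bsub>M\<^esub> m" "\<lambda>c n. c \<odot>\<^bsub>N\<^esub> n" M N
    by (rule balanced_K[OF M N])
  have s: "T.pu m (c \<odot>\<^bsub>N\<^esub> n) = c \<odot>\<^bsub>T.B\<^esub> T.pu m n" if "m \<in> carrier M" "n \<in> carrier N" "c \<in> carrier K" for c m n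
    using that T.pu_balanced[of m c n] T.pu_smult[of m n c] by simp
  show ?thesis
    by (intro bilI linI M N module_tens)
      (simp_all only: pure_def tens_simps T.pu_in T.pu_add_left T.pu_add_right T.pu_smult s)
qed

lemmas pure_lins [lins] = bilD(1,2)[OF bil_pure]

lemma pure_in [lins]: "module K M \<Longrightarrow> module K N \<Longrightarrow> m \<in> carrier M \<Longrightarrow> n \<in> carrier N \<Longrightarrow> pure K M N m n \<in> carrier (tn M N)"
  by (rule bilD(3)[OF bil_pure])

lemma tens_induct [consumes 3, case_names zero pure add]:
  assumes "module K M" "module K N" "t \<in> carrier (tn M N)" and "P \<zero>\<^bsub>tn M N\<^esub>"
    and "\<And>m n. m \<in> carrier M \<Longrightarrow> n \<in> carrier N \<Longrightarrow> P (pure K M N m n)"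
    and "\<And>s t. s \<in> carrier (tn M N) \<Longrightarrow> t \<in> carrier (tn M N) \<Longrightarrow> P s \<Longrightarrow> P t \<Longrightarrow> P (s \<oplus>\<^bsub>tn M N\<^esub> t)"
  shows "P t"
  using assms(3-6) unfolding tens_simps pure_def
  by (rule balanced_pair.tensor_induct[OF balanced_K[OF assms(1,2)]])

lemma bil_balanced: assumes "bil M N G f"
  shows "balanced_pair.balanced_map (carrier K) (\<lambda>m c. c \<odot>\<^bsub>M\<^esub> m) (\<lambda>c n. c \<odot>\<^bsub>N\<^esub> n) M N G f"
proof -
  interpret T: balanced_pair K "carrier K" "\<lambda>m c. c \<odot>\<^bsub>M\<^esub> m" "\<lambda>c n. c \<odot>\<^bsub>N\<^esub> n" M N
    using assms by (intro balanced_K) (simp_all add: bil_def)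
  have 1: "lin N G (f m)" if "m \<in> carrier M" for m using assms that by (simp add: bil_def)
  have 2: "lin M G (\<lambda>m. f m n)" if "n \<in> carrier N" for n using assms that by (simp add: bil_def)
  have "abelian_group G" by (rule abelian_group_of_module[OF bil_mods(3)[OF assms]])
  then show ?thesis unfolding T.balanced_map_def by (simp add: linD[OF 1] linD[OF 2])
qed

lemma sw_pure: assumes "bil M N G f" "m \<in> carrier M" "n \<in> carrier N"
  shows "sw G (pure K M N m n) f = f m n"
  unfolding pure_def
  using balanced_pair.lift_pu[OF balanced_K[OF bil_mods(1,2)[OF assms(1)]] bil_balanced[OF assms(1)] assms(2,3)]
    assms(1) by (simp add: bil_def)

lemma tens_rep:
  assumes "module K M" "module K N" "t \<in> carrier (tn M N)"
  shows "set (tensor_rep t) \<subseteq> carrier M \<times> carrier N"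
  using balanced_pair.rep(1)[OF balanced_K[OF assms(1,2)]] assms(3) by (simp add: tens_simps)

lemma pair_sum_simps: "pair_sum G f [] = \<zero>\<^bsub>G\<^esub>" "pair_sum G f ((m, n) # xs) = f m n \<oplus>\<^bsub>G\<^esub> pair_sum G f xs"
  by (simp_all add: pair_sum_def)

lemma pair_sum_in: "module K G \<Longrightarrow> (\<And>m n. (m, n) \<in> set xs \<Longrightarrow> f m n \<in> carrier G) \<Longrightarrow> pair_sum G f xs \<in> carrier G"
proof (induction xs)
  case Nil
  then interpret G: module K G by simp
  show ?case by (simp add: pair_sum_simps)
next
  case (Cons p xs)
  then interpret G: module K G by simp
  show ?case using Cons by (cases p) (simp add: pair_sum_simps)
qed

lemma sw_rep_cong: "(\<And>m n. (m, n) \<in> set (tensor_rep t) \<Longrightarrow> f m n = g m n) \<Longrightarrow> sw G t f = sw G t g"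
  unfolding tensor_lift_def pair_sum_def by (rule foldr_cong) auto

lemma sw_in [lins]: assumes "module K M" "module K N" "module K G" "t \<in> carrier (tn M N)"
    "\<And>m n. m \<in> carrier M \<Longrightarrow> n \<in> carrier N \<Longrightarrow> f m n \<in> carrier G"
  shows "sw G t f \<in> carrier G"
  unfolding tensor_lift_def using tens_rep[OF assms(1,2,4)] assms(3,5) by (auto intro!: pair_sum_in)

lemma sw_cong: assumes "module K M" "module K N" "t \<in> carrier (tn M N)"
    "\<And>m n. m \<in> carrier M \<Longrightarrow> n \<in> carrier N \<Longrightarrow> f m n = g m n"
  shows "sw G t f = sw G t g"
  using tens_rep[OF assms(1-3)] assms(4) by (auto intro!: sw_rep_cong)

lemma pair_sum_zero: "module K G \<Longrightarrow> (\<And>m n. (m, n) \<in> set xs \<Longrightarrow> f m n = \<zero>\<^bsub>G\<^esub>) \<Longrightarrow> pair_sum G f xs = \<zero>\<^bsub>G\<^esub>"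
proof (induction xs)
  case (Cons x xs)
  interpret G: module K G by (rule Cons(2))
  show ?case using Cons by (cases x) (simp add: pair_sum_simps)
qed (simp add: pair_sum_simps)

lemma pair_sum_push: "lin G G' F \<Longrightarrow> (\<And>m n. (m, n) \<in> set xs \<Longrightarrow> f m n \<in> carrier G)
   \<Longrightarrow> F (pair_sum G f xs) = pair_sum G' (\<lambda>m n. F (f m n)) xs"
proof (induction xs)
  case Nil then show ?case by (simp add: pair_sum_simps lin_zero)
next
  case (Cons p xs)
  have "pair_sum G f xs \<in> carrier G" using Cons(3) linD(1)[OF Cons(2)] by (intro pair_sum_in) auto
  then show ?case using Cons by (cases p) (simp add: pair_sum_simps linD)
qed

lemma sw_push: assumes "lin G G' F" "module K M" "module K N" "t \<in> carrier (tn M N)"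
    "\<And>m n. m \<in> carrier M \<Longrightarrow> n \<in> carrier N \<Longrightarrow> f m n \<in> carrier G"
  shows "F (sw G t f) = sw G' t (\<lambda>m n. F (f m n))"
  unfolding tensor_lift_def
  using tens_rep[OF assms(2-4)] assms(5) by (intro pair_sum_push[OF assms(1)]) auto

lemma pair_sum_lin: "module K X \<Longrightarrow> module K G \<Longrightarrow> (\<And>m n. (m, n) \<in> set xs \<Longrightarrow> lin X G (\<lambda>x. f x m n))
   \<Longrightarrow> lin X G (\<lambda>x. pair_sum G (f x) xs)"
proof (induction xs)
  case Nil
  interpret X: module K X using Nil by simp
  interpret G: module K G using Nil by simp
  show ?case using Nil by (auto intro!: linI simp: pair_sum_simps)
next
  case (Cons p xs)
  interpret X: module K X using Cons by simp
  interpret G: module K G using Cons by simp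
  obtain m n where p: "p = (m, n)" by (cases p)
  have 1: "lin X G (\<lambda>x. f x m n)" "lin X G (\<lambda>x. pair_sum G (f x) xs)" using Cons p by auto
  show ?case unfolding p pair_sum_simps
    using linD[OF 1(1)] linD[OF 1(2)]
    by (intro linI) (auto simp: G.a_ac G.smult_r_distr)
qed

lemma lin_sw_body [lins]: assumes "module K X" "module K G" "module K M" "module K N" "t \<in> carrier (tn M N)"
    "\<And>m n. m \<in> carrier M \<Longrightarrow> n \<in> carrier N \<Longrightarrow> lin X G (\<lambda>x. f x m n)"
  shows "lin X G (\<lambda>x. sw G t (\<lambda>m n. f x m n))"
  unfolding tensor_lift_def
  using tens_rep[OF assms(3-5)] assms(6) by (intro pair_sum_lin[OF assms(1,2)]) auto

lemma lin_sw: assumes "bil M N G f" shows "lin (tn M N) G (\<lambda>t. sw G t f)"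
proof (rule linI)
  note b = balanced_K[OF bil_mods(1,2)[OF assms]]
  note bb = bil_balanced[OF assms]
  interpret T: balanced_pair K "carrier K" "\<lambda>m c. c \<odot>\<^bsub>M\<^esub> m" "\<lambda>c n. c \<odot>\<^bsub>N\<^esub> n" M N by (rule b)
  interpret TT: module K "tn M N" using bil_mods[OF assms] by simp
  interpret G: module K G using bil_mods[OF assms] by simp
  note mods = bil_mods[OF assms]
  show "module K (tn M N)" "module K G" using bil_mods[OF assms] by simp_all
  show in1: "sw G t f \<in> carrier G" if "t \<in> carrier (tn M N)" for t
    using T.lift_closed[OF bb] that by (simp add: tens_simps)
  show add1: "sw G (s \<oplus>\<^bsub>tn M N\<^esub> t) f = sw G s f \<oplus>\<^bsub>G\<^esub> sw G t f"
    if "s \<in> carrier (tn M N)" "t \<in> carrier (tn M N)" for s t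
    using T.lift_add[OF bb] that by (simp add: tens_simps)
  fix c t assume c: "c \<in> carrier K" and t: "t \<in> carrier (tn M N)"
  show "sw G (c \<odot>\<^bsub>tn M N\<^esub> t) f = c \<odot>\<^bsub>G\<^esub> sw G t f"
    using mods(1,2) t
  proof (induction rule: tens_induct)
    case zero
    have "sw G \<zero>\<^bsub>tn M N\<^esub> f = \<zero>\<^bsub>G\<^esub>" using T.lift_zero[OF bb] by (simp add: tens_simps)
    then show ?case using c by simp
  next
    case (pure m n)
    have "c \<odot>\<^bsub>tn M N\<^esub> pure K M N m n = pure K M N (c \<odot>\<^bsub>M\<^esub> m) n"
      using T.pu_smult[OF pure c] by (simp add: tens_simps pure_def)
    moreover have "f (c \<odot>\<^bsub>M\<^esub> m) n = c \<odot>\<^bsub>G\<^esub> f m n"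
      using assms pure c linD(5)[of M G "\<lambda>m. f m n"] by (auto simp: bil_def)
    ultimately show ?case using sw_pure[OF assms] pure c T.M.smult_closed by simp
  next
    case (add s t)
    then show ?case using c by (simp add: TT.smult_r_distr add1 in1 G.smult_r_distr)
  qed
qed

lemma lin_sw_arg [lins]: "lin X (tn M N) T \<Longrightarrow> bil M N G f \<Longrightarrow> lin X G (\<lambda>x. sw G (T x) f)"
  by (rule lin_comp[OF lin_sw])

lemma tens_ext: assumes "module K M" "module K N" "lin (tn M N) G F" "lin (tn M N) G F'" "t \<in> carrier (tn M N)"
    "\<And>m n. m \<in> carrier M \<Longrightarrow> n \<in> carrier N \<Longrightarrow> F (pure K M N m n) = F' (pure K M N m n)"
  shows "F t = F' t"
  using assms(1,2,5)
  by (induction rule: tens_induct) (simp_all add: assms linD[OF assms(3)] linD[OF assms(4)] lin_zero[OF assms(3)] lin_zero[OF assms(4)])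

lemma sw_id: assumes "module K M" "module K N" "t \<in> carrier (tn M N)"
  shows "sw (tn M N) t (pure K M N) = t"
proof (rule tens_ext[where F = "\<lambda>t. sw (tn M N) t (pure K M N)" and F' = "\<lambda>t. t", OF assms(1,2) _ _ assms(3)])
  show "lin (tn M N) (tn M N) (\<lambda>t. sw (tn M N) t (pure K M N))"
    by (rule lin_sw[OF bil_pure[OF assms(1,2)]])
  show "lin (tn M N) (tn M N) (\<lambda>t. t)" using assms by (intro lin_id module_tens)
qed (rule sw_pure[OF bil_pure[OF assms(1,2)]])

text \<open>Substitution: a sum over a tensor which is itself a sum.\<close>

lemma sw_sw:
  assumes "bil M N G f" "module K P" "module K Q" "t \<in> carrier (tn P Q)"
    "\<And>p q. p \<in> carrier P \<Longrightarrow> q \<in> carrier Q \<Longrightarrow> g p q \<in> carrier (tn M N)"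
  shows "sw G (sw (tn M N) t g) f = sw G t (\<lambda>p q. sw G (g p q) f)"
  by (rule sw_push[OF lin_sw[OF assms(1)] assms(2-5)])

lemma pair_sum_swap: "module K G \<Longrightarrow>
   (\<And>m n p q. (m, n) \<in> set xs \<Longrightarrow> (p, q) \<in> set ys \<Longrightarrow> f m n p q \<in> carrier G) \<Longrightarrow>
   pair_sum G (\<lambda>m n. pair_sum G (\<lambda>p q. f m n p q) ys) xs = pair_sum G (\<lambda>p q. pair_sum G (\<lambda>m n. f m n p q) xs) ys"
proof (induction xs)
  case Nil
  then interpret G: module K G by simp
  have "pair_sum G (\<lambda>p q. \<zero>\<^bsub>G\<^esub>) ys = \<zero>\<^bsub>G\<^esub>"
    by (induction ys) (auto simp: pair_sum_simps)
  then show ?case by (simp add: pair_sum_simps)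
next
  case (Cons x xs)
  then interpret G: module K G by simp
  obtain m n where x: "x = (m, n)" by (cases x)
  have "pair_sum G (\<lambda>p q. g p q \<oplus>\<^bsub>G\<^esub> h p q) ys = pair_sum G g ys \<oplus>\<^bsub>G\<^esub> pair_sum G h ys"
    if "\<And>p q. (p, q) \<in> set ys \<Longrightarrow> g p q \<in> carrier G \<and> h p q \<in> carrier G" for g h
    using that
  proof (induction ys)
    case Nil then show ?case by (simp add: pair_sum_simps)
  next
    case (Cons y ys)
    obtain p q where y: "y = (p, q)" by (cases y)
    have "pair_sum G g ys \<in> carrier G" "pair_sum G h ys \<in> carrier G"
      using Cons G.module_axioms by (auto intro!: pair_sum_in)
    then show ?case using Cons y by (auto simp: pair_sum_simps G.a_ac)
  qed
  note this[of "f m n" "\<lambda>p q. pair_sum G (\<lambda>m n. f m n p q) xs"]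
  moreover have "f m n p q \<in> carrier G \<and> pair_sum G (\<lambda>m n. f m n p q) xs \<in> carrier G" if "(p, q) \<in> set ys" for p q
    using Cons x that by (auto intro!: pair_sum_in)
  ultimately show ?case using Cons x by (simp add: pair_sum_simps)
qed

lemma sw_swap: assumes "module K M" "module K N" "module K P" "module K Q" "module K G"
    "t \<in> carrier (tn M N)" "s \<in> carrier (tn P Q)"
    "\<And>m n p q. m \<in> carrier M \<Longrightarrow> n \<in> carrier N \<Longrightarrow> p \<in> carrier P \<Longrightarrow> q \<in> carrier Q \<Longrightarrow> f m n p q \<in> carrier G"
  shows "sw G t (\<lambda>m n. sw G s (\<lambda>p q. f m n p q)) = sw G s (\<lambda>p q. sw G t (\<lambda>m n. f m n p q))"
  unfolding tensor_lift_def
  using tens_rep[OF assms(1,2,6)] tens_rep[OF assms(3,4,7)] assms(8)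
  by (intro pair_sum_swap[OF assms(5)]) blast

subsection \<open>Maps of tensor products\<close>

lemma tmap_in [lins]: "lin M M' f \<Longrightarrow> lin N N' g \<Longrightarrow> t \<in> carrier (tn M N) \<Longrightarrow> tmap K M' N' f g t \<in> carrier (tn M' N')"
  unfolding tmap_def by (rule sw_in[OF linD(1) linD(1) module_tens[OF linD(2) linD(2)]])
    (auto intro!: pure_in simp: linD)

lemma bil_tmap: "lin M M' f \<Longrightarrow> lin N N' g \<Longrightarrow> bil M N (tn M' N') (\<lambda>m n. pure K M' N' (f m) (g n))"
  using linD[of M M' f] linD[of N N' g]
  by (intro bilI module_tens pure_lins) auto

lemma lin_tmap: "lin M M' f \<Longrightarrow> lin N N' g \<Longrightarrow> lin (tn M N) (tn M' N') (tmap K M' N' f g)"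
  using lin_sw[OF bil_tmap] by (simp add: tmap_def)

lemma tmap_pure: "lin M M' f \<Longrightarrow> lin N N' g \<Longrightarrow> m \<in> carrier M \<Longrightarrow> n \<in> carrier N
   \<Longrightarrow> tmap K M' N' f g (pure K M N m n) = pure K M' N' (f m) (g n)"
  unfolding tmap_def by (rule sw_pure[OF bil_tmap])

lemma sw_tmap: assumes "lin M M' f" "lin N N' g" "t \<in> carrier (tn M N)" "bil M' N' G h"
  shows "sw G (tmap K M' N' f g t) h = sw G t (\<lambda>m n. h (f m) (g n))"
proof -
  have "sw G (tmap K M' N' f g t) h = sw G t (\<lambda>m n. sw G (pure K M' N' (f m) (g n)) h)"
    unfolding tmap_def using assms linD[OF assms(1)] linD[OF assms(2)] by (intro sw_sw pure_in) auto
  also have "\<dots> = sw G t (\<lambda>m n. h (f m) (g n))"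
    using linD[OF assms(1)] linD[OF assms(2)]
    by (intro sw_cong[OF linD(1)[OF assms(1)] linD(1)[OF assms(2)] assms(3)] sw_pure[OF assms(4)]) auto
  finally show ?thesis .
qed

lemma tmap_cong: "module K M \<Longrightarrow> module K N \<Longrightarrow> t \<in> carrier (tn M N) \<Longrightarrow> (\<And>m. m \<in> carrier M \<Longrightarrow> f m = f' m)
   \<Longrightarrow> (\<And>n. n \<in> carrier N \<Longrightarrow> g n = g' n) \<Longrightarrow> tmap K M' N' f g t = tmap K M' N' f' g' t"
  unfolding tmap_def by (rule sw_cong[of M N]) auto

lemma tmap_tmap: assumes "lin M M' f" "lin N N' g" "lin M' M'' f'" "lin N' N'' g'" "t \<in> carrier (tn M N)"
  shows "tmap K M'' N'' f' g' (tmap K M' N' f g t) = tmap K M'' N'' (\<lambda>m. f' (f m)) (\<lambda>n. g' (g n)) t"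
  unfolding tmap_def[of K M'' N''] by (rule sw_tmap[OF assms(1,2,5) bil_tmap[OF assms(3,4)]])

lemma tmap_id: assumes "module K M" "module K N" "t \<in> carrier (tn M N)"
  shows "tmap K M N (\<lambda>m. m) (\<lambda>n. n) t = t"
  using sw_id[OF assms] by (simp add: tmap_def)

lemma tri_nest: "tri M N P G f \<Longrightarrow> bil M (tn N P) G (\<lambda>m t. sw G t (f m))"
  by (rule bilI) (auto simp: tri_def intro!: lin_sw lin_sw_body[where M = N and N = P])

lemma tri_nest': "tri M N P G f \<Longrightarrow> bil (tn M N) P G (\<lambda>t p. sw G t (\<lambda>m n. f m n p))"
  by (rule bilI) (auto simp: tri_def bil_def intro!: lin_sw lin_sw_body[where M = M and N = N])

lemma tri_pure: assumes "module K M" "module K N" "module K P"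
  shows "tri M N P (tn M (tn N P)) (\<lambda>m n p. pure K M (tn N P) m (pure K N P n p))"
  using assms by (intro triI module_tens pure_lins pure_in lin_id) auto

lemma sw_tassoc: assumes "tri M N P G f" "t \<in> carrier (tn (tn M N) P)"
  shows "sw G (tassoc K M N P t) (\<lambda>m s. sw G s (f m)) = sw G t (\<lambda>s p. sw G s (\<lambda>m n. f m n p))"
proof -
  have m: "module K M" "module K N" "module K P" using assms by (auto simp: tri_def)
  note tp = tri_pure[OF m] and b = tri_nest[OF assms(1)]
  have fl: "bil N P G (f x)" if "x \<in> carrier M" for x using assms(1) that by (simp add: tri_def)
  let ?T = "tn M (tn N P)" let ?p = "\<lambda>m n p. pure K M (tn N P) m (pure K N P n p)"
  have "sw G (tassoc K M N P t) (\<lambda>m s. sw G s (f m))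
     = sw G t (\<lambda>s p. sw G (sw ?T s (\<lambda>m n. ?p m n p)) (\<lambda>m s. sw G s (f m)))"
    unfolding tassoc_def Let_def
    using m assms(2) bilD(3)[OF tri_nest'[OF tp]] by (intro sw_sw[OF b]) auto
  also have "\<dots> = sw G t (\<lambda>s p. sw G s (\<lambda>m n. sw G (?p m n p) (\<lambda>m s. sw G s (f m))))"
    using m assms(2) by (intro sw_cong[of "tn M N" P] sw_sw[OF b]) (auto intro!: pure_in)
  also have "\<dots> = sw G t (\<lambda>s p. sw G s (\<lambda>m n. f m n p))"
  proof (intro sw_cong[of "tn M N" P] sw_cong[of M N])
    fix x y z assume x: "x \<in> carrier M" "y \<in> carrier N" "z \<in> carrier P"
    show "sw G (?p x y z) (\<lambda>m s. sw G s (f m)) = f x y z"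
      using sw_pure[OF b x(1) pure_in[OF m(2,3) x(2,3)]] sw_pure[OF fl[OF x(1)] x(2,3)] by simp
  qed (use m assms(2) in auto)
  finally show ?thesis .
qed

text \<open>An equation between the two bracketings of a triple tensor, such as coassociativity, is used in
  the form that the two iterated sums of any trilinear map agree.\<close>

lemma assoc_eqD:
  assumes F: "lin M (tn A B) F" and E: "lin N (tn B C) E" and t: "t \<in> carrier (tn M C)" and t': "t' \<in> carrier (tn A N)"
    and eq: "tassoc K A B C (tmap K (tn A B) C F (\<lambda>c. c) t) = tmap K A (tn B C) (\<lambda>a. a) E t'"
    and f: "tri A B C G f"
  shows "sw G t (\<lambda>m c. sw G (F m) (\<lambda>a b. f a b c)) = sw G t' (\<lambda>a n. sw G (E n) (f a))"
proof -
  have m: "module K A" "module K B" "module K C" using f by (auto simp: tri_def)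
  note i = lin_id[OF m(1)] lin_id[OF m(2)] lin_id[OF m(3)]
  have "sw G t (\<lambda>m c. sw G (F m) (\<lambda>a b. f a b c))
      = sw G (tmap K (tn A B) C F (\<lambda>c. c) t) (\<lambda>s p. sw G s (\<lambda>m n. f m n p))"
    by (rule sw_tmap[OF F i(3) t tri_nest'[OF f], symmetric])
  also have "\<dots> = sw G (tmap K A (tn B C) (\<lambda>a. a) E t') (\<lambda>m s. sw G s (f m))"
    unfolding eq[symmetric] by (rule sw_tassoc[OF f tmap_in[OF F i(3) t], symmetric])
  also have "\<dots> = sw G t' (\<lambda>a n. sw G (E n) (f a))"
    by (rule sw_tmap[OF i(1) E t' tri_nest[OF f]])
  finally show ?thesis .
qed

text \<open>Conversely, the two iterated sums of the universal trilinear map determine the two bracketings.\<close>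

lemma assoc_eqI:
  assumes F: "lin M (tn A B) F" and E: "lin N (tn B C) E" and t: "t \<in> carrier (tn M C)" and t': "t' \<in> carrier (tn A N)"
    and m: "module K A" "module K B" "module K C"
    and eq: "\<And>f. tri A B C (tn A (tn B C)) f \<Longrightarrow> sw (tn A (tn B C)) t (\<lambda>m c. sw (tn A (tn B C)) (F m) (\<lambda>a b. f a b c))
       = sw (tn A (tn B C)) t' (\<lambda>a n. sw (tn A (tn B C)) (E n) (f a))"
  shows "tassoc K A B C (tmap K (tn A B) C F (\<lambda>c. c) t) = tmap K A (tn B C) (\<lambda>a. a) E t'"
proof -
  let ?T = "tn A (tn B C)" let ?p = "\<lambda>m n p. pure K A (tn B C) m (pure K B C n p)"
  note i = lin_id[OF m(1)] lin_id[OF m(2)] lin_id[OF m(3)] and tp = tri_pure[OF m]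
  have "tassoc K A B C (tmap K (tn A B) C F (\<lambda>c. c) t) = sw ?T (tmap K (tn A B) C F (\<lambda>c. c) t) (\<lambda>s p. sw ?T s (\<lambda>a b. ?p a b p))"
    by (simp add: tassoc_def Let_def)
  also have "\<dots> = sw ?T t (\<lambda>m c. sw ?T (F m) (\<lambda>a b. ?p a b c))"
    by (rule sw_tmap[OF F i(3) t tri_nest'[OF tp]])
  also have "\<dots> = sw ?T t' (\<lambda>a n. sw ?T (E n) (?p a))" by (rule eq[OF tp])
  also have "\<dots> = sw ?T t' (\<lambda>a n. pure K A (tn B C) a (E n))"
  proof (rule sw_cong[OF m(1) linD(1)[OF E] t'])
    fix a n assume a: "a \<in> carrier A" "n \<in> carrier N"
    have "sw ?T (E n) (?p a) = pure K A (tn B C) a (sw (tn B C) (E n) (pure K B C))"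
      using a m linD(3)[OF E]
      by (intro sw_push[symmetric, of _ _ _ B C] pure_lins lin_id module_tens) (auto intro!: pure_in)
    then show "sw ?T (E n) (?p a) = pure K A (tn B C) a (E n)"
      using sw_id[OF m(2,3) linD(3)[OF E a(2)]] by simp
  qed
  finally show ?thesis by (simp add: tmap_def)
qed

end

section \<open>Linear functionals\<close>

context fieldK
begin

definition subsp where
  "subsp M U \<longleftrightarrow> U \<subseteq> carrier M \<and> \<zero>\<^bsub>M\<^esub> \<in> U \<and> (\<forall>x\<in>U. \<forall>y\<in>U. x \<oplus>\<^bsub>M\<^esub> y \<in> U) \<and>
     (\<forall>c\<in>carrier K. \<forall>x\<in>U. c \<odot>\<^bsub>M\<^esub> x \<in> U)"

lemma subspI: "U \<subseteq> carrier M \<Longrightarrow> \<zero>\<^bsub>M\<^esub> \<in> U \<Longrightarrow> (\<And>x y. x \<in> U \<Longrightarrow> y \<in> U \<Longrightarrow> x \<oplus>\<^bsub>M\<^esub> y \<in> U)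
  \<Longrightarrow> (\<And>c x. c \<in> carrier K \<Longrightarrow> x \<in> U \<Longrightarrow> c \<odot>\<^bsub>M\<^esub> x \<in> U) \<Longrightarrow> subsp M U"
  by (simp add: subsp_def)

lemma subspD: assumes "subsp M U" shows "x \<in> U \<Longrightarrow> x \<in> carrier M" "\<zero>\<^bsub>M\<^esub> \<in> U"
   "x \<in> U \<Longrightarrow> y \<in> U \<Longrightarrow> x \<oplus>\<^bsub>M\<^esub> y \<in> U" "c \<in> carrier K \<Longrightarrow> x \<in> U \<Longrightarrow> c \<odot>\<^bsub>M\<^esub> x \<in> U"
  using assms by (auto simp: subsp_def)

lemma subsp_add_line:
  assumes "module K M" "subsp M U" "x \<in> carrier M"
  shows "subsp M {u \<oplus>\<^bsub>M\<^esub> a \<odot>\<^bsub>M\<^esub> x | u a. u \<in> U \<and> a \<in> carrier K}" (is "subsp M ?W")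
proof -
  interpret M: module K M by fact
  note U = subspD[OF assms(2)]
  show ?thesis
  proof (rule subspI)
    show "?W \<subseteq> carrier M" using U(1) assms(3) by auto
    show "\<zero>\<^bsub>M\<^esub> \<in> ?W" using U(2) assms(3) by (auto intro!: exI[of _ "\<zero>\<^bsub>M\<^esub>"] exI[of _ "\<zero>"])
  next
    fix p q assume "p \<in> ?W" "q \<in> ?W"
    then obtain u a w b where h: "p = u \<oplus>\<^bsub>M\<^esub> a \<odot>\<^bsub>M\<^esub> x" "q = w \<oplus>\<^bsub>M\<^esub> b \<odot>\<^bsub>M\<^esub> x" "u \<in> U" "w \<in> U"
      "a \<in> carrier K" "b \<in> carrier K" by blast
    have "p \<oplus>\<^bsub>M\<^esub> q = (u \<oplus>\<^bsub>M\<^esub> w) \<oplus>\<^bsub>M\<^esub> (a \<oplus> b) \<odot>\<^bsub>M\<^esub> x"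
      using h U(1) assms(3) by (simp add: M.smult_l_distr M.a_ac)
    then show "p \<oplus>\<^bsub>M\<^esub> q \<in> ?W" using h U(3) by blast
  next
    fix c p assume c: "c \<in> carrier K" and "p \<in> ?W"
    then obtain u a where h: "p = u \<oplus>\<^bsub>M\<^esub> a \<odot>\<^bsub>M\<^esub> x" "u \<in> U" "a \<in> carrier K" by blast
    have "c \<odot>\<^bsub>M\<^esub> p = c \<odot>\<^bsub>M\<^esub> u \<oplus>\<^bsub>M\<^esub> (c \<otimes> a) \<odot>\<^bsub>M\<^esub> x"
      using h c U(1) assms(3) by (simp add: M.smult_r_distr M.smult_assoc1)
    then show "c \<odot>\<^bsub>M\<^esub> p \<in> ?W" using h c U(4) by blast
  qed
qed

text \<open>A maximal subspace that contains \<open>U\<close> but not \<open>v\<close> is a complement of the line through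
  \<open>v\<close>; the functional is the coordinate along this line.\<close>

lemma functional_exists:
  assumes mM: "module K M" and U: "subsp M U" and v: "v \<in> carrier M" "v \<notin> U"
  shows "\<exists>\<phi>. lin M k \<phi> \<and> (\<forall>u\<in>U. \<phi> u = \<zero>) \<and> \<phi> v = \<one>"
proof -
  interpret M: module K M by fact
  let ?A = "{W. subsp M W \<and> U \<subseteq> W \<and> v \<notin> W}"
  have "\<exists>W\<in>?A. \<forall>X\<in>?A. W \<subseteq> X \<longrightarrow> X = W"
  proof (rule subset_Zorn_nonempty)
    show "?A \<noteq> {}" using U v by blast
    fix C assume ne: "C \<noteq> {}" and ch: "subset.chain ?A C"
    have sub: "\<And>W. W \<in> C \<Longrightarrow> subsp M W \<and> U \<subseteq> W \<and> v \<notin> W" using ch by (auto simp: subset_chain_def)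
    have sC: "subsp M W" if "W \<in> C" for W using sub[OF that] by simp
    obtain W0 where W0: "W0 \<in> C" using ne by auto
    have "subsp M (\<Union>C)"
    proof (rule subspI)
      show "\<Union>C \<subseteq> carrier M" using subspD(1)[OF sC] by auto
      show "\<zero>\<^bsub>M\<^esub> \<in> \<Union>C" using subspD(2)[OF sC[OF W0]] W0 by auto
    next
      fix x y assume "x \<in> \<Union>C" "y \<in> \<Union>C"
      then obtain X Y where XY: "X \<in> C" "Y \<in> C" "x \<in> X" "y \<in> Y" by auto
      have "X \<subseteq> Y \<or> Y \<subseteq> X" using ch XY by (auto simp: subset_chain_def)
      then obtain Z where Z: "Z \<in> C" "x \<in> Z" "y \<in> Z" using XY by auto
      then show "x \<oplus>\<^bsub>M\<^esub> y \<in> \<Union>C" using subspD(3)[OF sC[OF Z(1)] Z(2,3)] by auto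
    next
      fix c x assume c: "c \<in> carrier K" and "x \<in> \<Union>C"
      then obtain X where X: "X \<in> C" "x \<in> X" by auto
      then show "c \<odot>\<^bsub>M\<^esub> x \<in> \<Union>C" using subspD(4)[OF sC[OF X(1)] c X(2)] by auto
    qed
    moreover have "U \<subseteq> \<Union>C" "v \<notin> \<Union>C" using sub W0 by auto
    ultimately show "\<Union>C \<in> ?A" by simp
  qed
  then obtain W where "W \<in> ?A" and mx: "\<forall>X\<in>?A. W \<subseteq> X \<longrightarrow> X = W" by (rule bexE)
  then have W: "subsp M W" "U \<subseteq> W" "v \<notin> W" by simp_all
  have max: "X = W" if "subsp M X" "W \<subseteq> X" "v \<notin> X" for X
    using mx that W(2) by simp
  note Ws = subspD[OF W(1)]
  have ex: "\<exists>c\<in>carrier K. \<exists>w\<in>W. x = w \<oplus>\<^bsub>M\<^esub> c \<odot>\<^bsub>M\<^esub> v" if x: "x \<in> carrier M" for x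
  proof (cases "x \<in> W")
    case True
    have "x = x \<oplus>\<^bsub>M\<^esub> \<zero> \<odot>\<^bsub>M\<^esub> v" using v x by simp
    then show ?thesis using True zero_closed by metis
  next
    case False
    let ?X = "{u \<oplus>\<^bsub>M\<^esub> a \<odot>\<^bsub>M\<^esub> x | u a. u \<in> W \<and> a \<in> carrier K}"
    have "w \<in> ?X" if "w \<in> W" for w
    proof -
      have "w = w \<oplus>\<^bsub>M\<^esub> \<zero> \<odot>\<^bsub>M\<^esub> x" using Ws(1)[OF that] x by simp
      then show ?thesis using that zero_closed by auto
    qed
    then have sub: "W \<subseteq> ?X" by (rule subsetI)
    have "x = \<zero>\<^bsub>M\<^esub> \<oplus>\<^bsub>M\<^esub> \<one> \<odot>\<^bsub>M\<^esub> x" using x by simp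
    then have "x \<in> ?X" using Ws(2) one_closed by auto
    then have "?X \<noteq> W" using False by metis
    then have "v \<in> ?X" using max[OF subsp_add_line[OF mM W(1) x] sub] by argo
    then obtain u a where h: "v = u \<oplus>\<^bsub>M\<^esub> a \<odot>\<^bsub>M\<^esub> x" "u \<in> W" "a \<in> carrier K" by auto
    have "a \<noteq> \<zero>" using h W(3) Ws(1) x by auto
    then have a: "inv a \<in> carrier K" "inv a \<otimes> a = \<one>" using h(3) field_Units by auto
    have "inv a \<odot>\<^bsub>M\<^esub> v = inv a \<odot>\<^bsub>M\<^esub> u \<oplus>\<^bsub>M\<^esub> x"
      using h Ws(1) x a by (simp add: M.smult_r_distr M.smult_assoc1[symmetric])
    then have "x = (\<ominus> (inv a)) \<odot>\<^bsub>M\<^esub> u \<oplus>\<^bsub>M\<^esub> inv a \<odot>\<^bsub>M\<^esub> v"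
      using Ws(1)[OF h(2)] x a(1) v by (simp add: M.smult_l_minus M.r_neg1)
    then show ?thesis using a(1) Ws(4)[OF a_inv_closed[OF a(1)] h(2)] by metis
  qed
  have uniq: "c = d" if "c \<in> carrier K" "d \<in> carrier K" "w \<in> W" "w' \<in> W" and
    e: "w \<oplus>\<^bsub>M\<^esub> c \<odot>\<^bsub>M\<^esub> v = w' \<oplus>\<^bsub>M\<^esub> d \<odot>\<^bsub>M\<^esub> v" for c d w w'
  proof (rule ccontr)
    assume "c \<noteq> d"
    then have "c \<ominus> d \<noteq> \<zero>" "c \<ominus> d \<in> carrier K" using that(1,2) minus_equality[of c "\<ominus> d"] by (auto simp: a_minus_def)
    then have a: "inv (c \<ominus> d) \<in> carrier K" "inv (c \<ominus> d) \<otimes> (c \<ominus> d) = \<one>" using field_Units by auto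
    have wM: "w \<in> carrier M" "w' \<in> carrier M" using Ws(1) that by auto
    have "(c \<ominus> d) \<odot>\<^bsub>M\<^esub> v = c \<odot>\<^bsub>M\<^esub> v \<oplus>\<^bsub>M\<^esub> \<ominus>\<^bsub>M\<^esub> (d \<odot>\<^bsub>M\<^esub> v)"
      using that(1-4) v by (simp add: a_minus_def M.smult_l_distr M.smult_l_minus)
    also have "\<dots> = \<ominus>\<^bsub>M\<^esub> w \<oplus>\<^bsub>M\<^esub> (w \<oplus>\<^bsub>M\<^esub> c \<odot>\<^bsub>M\<^esub> v) \<oplus>\<^bsub>M\<^esub> \<ominus>\<^bsub>M\<^esub> (d \<odot>\<^bsub>M\<^esub> v)"
      using that(1-4) v wM by (simp add: M.r_neg1)
    also have "\<dots> = \<ominus>\<^bsub>M\<^esub> w \<oplus>\<^bsub>M\<^esub> (w' \<oplus>\<^bsub>M\<^esub> d \<odot>\<^bsub>M\<^esub> v) \<oplus>\<^bsub>M\<^esub> \<ominus>\<^bsub>M\<^esub> (d \<odot>\<^bsub>M\<^esub> v)" unfolding e ..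
    also have "\<dots> = \<ominus>\<^bsub>M\<^esub> w \<oplus>\<^bsub>M\<^esub> w'"
      using that(1-4) v wM by (simp add: M.a_assoc M.r_neg)
    also have "\<dots> = (\<ominus> \<one>) \<odot>\<^bsub>M\<^esub> w \<oplus>\<^bsub>M\<^esub> w'" using wM by (simp add: M.smult_l_minus)
    finally have "(c \<ominus> d) \<odot>\<^bsub>M\<^esub> v \<in> W" using that(1-4) Ws by simp
    from Ws(4)[OF a(1) this] have "v \<in> W"
      using a v that(1,2) by (simp add: M.smult_assoc1[symmetric])
    then show False using W(3) by simp
  qed
  define \<phi> where "\<phi> x = (THE c. c \<in> carrier K \<and> (\<exists>w\<in>W. x = w \<oplus>\<^bsub>M\<^esub> c \<odot>\<^bsub>M\<^esub> v))" for x
  have \<phi>I: "\<phi> x = c" if "c \<in> carrier K" "w \<in> W" "x = w \<oplus>\<^bsub>M\<^esub> c \<odot>\<^bsub>M\<^esub> v" for x c w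
    unfolding \<phi>_def
  proof (rule the_equality)
    show "c \<in> carrier K \<and> (\<exists>w\<in>W. x = w \<oplus>\<^bsub>M\<^esub> c \<odot>\<^bsub>M\<^esub> v)" using that by auto
    fix d assume "d \<in> carrier K \<and> (\<exists>w\<in>W. x = w \<oplus>\<^bsub>M\<^esub> d \<odot>\<^bsub>M\<^esub> v)"
    then show "d = c" using uniq that by metis
  qed
  have "lin M k \<phi>"
  proof (rule linI)
    fix x assume x: "x \<in> carrier M"
    then obtain c w where h: "c \<in> carrier K" "w \<in> W" "x = w \<oplus>\<^bsub>M\<^esub> c \<odot>\<^bsub>M\<^esub> v" using ex by metis
    note wM = Ws(1)[OF h(2)]
    show "\<phi> x \<in> carrier k" using \<phi>I[OF h] h by simp
    fix y assume "y \<in> carrier M"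
    then obtain d u where g: "d \<in> carrier K" "u \<in> W" "y = u \<oplus>\<^bsub>M\<^esub> d \<odot>\<^bsub>M\<^esub> v" using ex by metis
    have "x \<oplus>\<^bsub>M\<^esub> y = (w \<oplus>\<^bsub>M\<^esub> u) \<oplus>\<^bsub>M\<^esub> (c \<oplus> d) \<odot>\<^bsub>M\<^esub> v"
      using h g wM Ws(1)[OF g(2)] v by (simp add: M.smult_l_distr M.a_ac)
    from \<phi>I[OF _ _ this] show "\<phi> (x \<oplus>\<^bsub>M\<^esub> y) = \<phi> x \<oplus>\<^bsub>k\<^esub> \<phi> y"
      using \<phi>I[OF h] \<phi>I[OF g] h g Ws by simp
  next
    fix a x assume a: "a \<in> carrier K" and x: "x \<in> carrier M"
    then obtain c w where h: "c \<in> carrier K" "w \<in> W" "x = w \<oplus>\<^bsub>M\<^esub> c \<odot>\<^bsub>M\<^esub> v" using ex by metis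
    have "a \<odot>\<^bsub>M\<^esub> x = a \<odot>\<^bsub>M\<^esub> w \<oplus>\<^bsub>M\<^esub> (a \<otimes> c) \<odot>\<^bsub>M\<^esub> v"
      using h a Ws(1)[OF h(2)] v by (simp add: M.smult_r_distr M.smult_assoc1)
    from \<phi>I[OF _ _ this] show "\<phi> (a \<odot>\<^bsub>M\<^esub> x) = a \<odot>\<^bsub>k\<^esub> \<phi> x"
      using \<phi>I[OF h] h a Ws by simp
  qed (rule mM module_k)+
  moreover have "\<phi> u = \<zero>" if "u \<in> U" for u
    using \<phi>I[of \<zero> u u] that W(2) Ws(1) v by auto
  moreover have "\<phi> v = \<one>" using \<phi>I[of \<one> "\<zero>\<^bsub>M\<^esub>" v] Ws(2) v by simp
  ultimately show ?thesis by blast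
qed

subsection \<open>Slices of tensors\<close>

fun spanl where
  "spanl M [] = {\<zero>\<^bsub>M\<^esub>}"
| "spanl M (n # ns) = {u \<oplus>\<^bsub>M\<^esub> a \<odot>\<^bsub>M\<^esub> n | u a. u \<in> spanl M ns \<and> a \<in> carrier K}"

lemma subsp_spanl: "module K M \<Longrightarrow> set ns \<subseteq> carrier M \<Longrightarrow> subsp M (spanl M ns)"
proof (induction ns)
  case Nil
  then interpret M: module K M by simp
  show ?case by (auto intro!: subspI)
next
  case (Cons n ns)
  then show ?case using subsp_add_line[of M "spanl M ns" n] by simp
qed

lemma spanl_mem: "module K M \<Longrightarrow> set ns \<subseteq> carrier M \<Longrightarrow> n \<in> set ns \<Longrightarrow> n \<in> spanl M ns"
proof (induction ns)
  case (Cons n' ns)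
  then interpret M: module K M by simp
  have s: "subsp M (spanl M ns)" using Cons by (intro subsp_spanl) auto
  show ?case
  proof (cases "n = n'")
    case True
    have "n = \<zero>\<^bsub>M\<^esub> \<oplus>\<^bsub>M\<^esub> \<one> \<odot>\<^bsub>M\<^esub> n'" using Cons True by simp
    then show ?thesis using subspD(2)[OF s] by auto
  next
    case False
    then have n: "n \<in> spanl M ns" using Cons by auto
    have "n = n \<oplus>\<^bsub>M\<^esub> \<zero> \<odot>\<^bsub>M\<^esub> n'" using Cons subspD(1)[OF s n] by simp
    then show ?thesis using n by auto
  qed
qed simp

text \<open>If \<open>n = \<Sum> c\<^sub>i n\<^sub>i\<close>, then \<open>m \<otimes> n + \<Sum> m\<^sub>i \<otimes> n\<^sub>i = \<Sum> (m\<^sub>i + c\<^sub>i m) \<otimes> n\<^sub>i\<close>, which has one term less.\<close>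

lemma absorb_dependent:
  assumes "module K M" "module K N" "set ys \<subseteq> carrier M \<times> carrier N" "m \<in> carrier M"
    "n \<in> spanl N (map snd ys)"
  shows "\<exists>ys'. length ys' = length ys \<and> set ys' \<subseteq> carrier M \<times> carrier N \<and>
     pure K M N m n \<oplus>\<^bsub>tn M N\<^esub> pair_sum (tn M N) (pure K M N) ys = pair_sum (tn M N) (pure K M N) ys'"
  using assms(3,5)
proof (induction ys arbitrary: n)
  case Nil
  interpret T: module K "tn M N" using assms by simp
  have "lin N (tn M N) (pure K M N m)" using bil_pure[OF assms(1,2)] assms(4) by (simp add: bil_def)
  from lin_zero[OF this] Nil show ?case by (intro exI[of _ "[]"]) (simp add: pair_sum_simps)
next
  case (Cons y ys)
  interpret M: module K M by fact
  interpret N: module K N by fact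
  interpret T: module K "tn M N" using assms by simp
  obtain m1 n1 where y: "y = (m1, n1)" "m1 \<in> carrier M" "n1 \<in> carrier N" using Cons by auto
  obtain u a where h: "n = u \<oplus>\<^bsub>N\<^esub> a \<odot>\<^bsub>N\<^esub> n1" "u \<in> spanl N (map snd ys)" "a \<in> carrier K"
    using Cons(3) y by auto
  have ys: "set ys \<subseteq> carrier M \<times> carrier N" using Cons by auto
  have "subsp N (spanl N (map snd ys))" using ys assms(2) by (intro subsp_spanl) auto
  note u = subspD(1)[OF this h(2)]
  obtain ys' where ys': "length ys' = length ys" "set ys' \<subseteq> carrier M \<times> carrier N"
    "pure K M N m u \<oplus>\<^bsub>tn M N\<^esub> pair_sum (tn M N) (pure K M N) ys = pair_sum (tn M N) (pure K M N) ys'"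
    using Cons.IH[OF ys h(2)] by blast
  have p: "lin N (tn M N) (pure K M N m')" if "m' \<in> carrier M" for m'
    using bil_pure[OF assms(1,2)] that by (simp add: bil_def)
  have q: "lin M (tn M N) (\<lambda>m'. pure K M N m' n')" if "n' \<in> carrier N" for n'
    using bil_pure[OF assms(1,2)] that by (simp add: bil_def)
  have "pure K M N m n = pure K M N m u \<oplus>\<^bsub>tn M N\<^esub> pure K M N (a \<odot>\<^bsub>M\<^esub> m) n1"
    using h u y assms(4) linD(4,5)[OF p[OF assms(4)]] linD(5)[OF q[OF y(3)]] by simp
  moreover have "pure K M N (a \<odot>\<^bsub>M\<^esub> m \<oplus>\<^bsub>M\<^esub> m1) n1 = pure K M N (a \<odot>\<^bsub>M\<^esub> m) n1 \<oplus>\<^bsub>tn M N\<^esub> pure K M N m1 n1"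
    using h y assms(4) linD(4)[OF q[OF y(3)]] by simp
  moreover have "pair_sum (tn M N) (pure K M N) ys \<in> carrier (tn M N)"
    using ys assms by (intro pair_sum_in) (auto intro!: pure_in)
  moreover have "pure K M N m u \<in> carrier (tn M N)" "pure K M N m1 n1 \<in> carrier (tn M N)"
    "pure K M N (a \<odot>\<^bsub>M\<^esub> m) n1 \<in> carrier (tn M N)"
    using assms u y h by (auto intro!: pure_in)
  ultimately have "pure K M N m n \<oplus>\<^bsub>tn M N\<^esub> pair_sum (tn M N) (pure K M N) (y # ys)
     = pair_sum (tn M N) (pure K M N) ((a \<odot>\<^bsub>M\<^esub> m \<oplus>\<^bsub>M\<^esub> m1, n1) # ys')"
    unfolding y(1) pair_sum_simps ys'(3)[symmetric] by (simp add: T.a_ac)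
  then show ?case using ys' y h assms(4)
    by (intro exI[of _ "(a \<odot>\<^bsub>M\<^esub> m \<oplus>\<^bsub>M\<^esub> m1, n1) # ys'"]) auto
qed

lemma sw_pair_sum:
  assumes "bil M N G f" "set ys \<subseteq> carrier M \<times> carrier N"
  shows "sw G (pair_sum (tn M N) (pure K M N) ys) f = pair_sum G f ys"
proof -
  have "sw G (pair_sum (tn M N) (pure K M N) ys) f = pair_sum G (\<lambda>m n. sw G (pure K M N m n) f) ys"
    using assms bil_mods[OF assms(1)] by (intro pair_sum_push[OF lin_sw[OF assms(1)]] pure_in) auto
  also have "\<dots> = pair_sum G f ys"
    unfolding pair_sum_def using assms by (intro foldr_cong) (auto simp: sw_pure)
  finally show ?thesis .
qed

text \<open>Induction on the number of terms. If the right factor of the first term is in the span of the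
  others, then this term is absorbed by them. Otherwise some functional is \<open>1\<close> on it and \<open>0\<close> on the
  others, and the slice along this functional is the left factor of the first term, which therefore
  lies in \<open>W\<close>.\<close>

lemma slice_list:
  assumes mM: "module K M" and mN: "module K N" and W: "subsp M W"
  shows "set xs \<subseteq> carrier M \<times> carrier N \<Longrightarrow>
    (\<And>\<phi>. lin N k \<phi> \<Longrightarrow> pair_sum M (\<lambda>m n. \<phi> n \<odot>\<^bsub>M\<^esub> m) xs \<in> W) \<Longrightarrow>
    \<exists>ys. set ys \<subseteq> W \<times> carrier N \<and> pair_sum (tn M N) (pure K M N) xs = pair_sum (tn M N) (pure K M N) ys"
proof (induction "length xs" arbitrary: xs rule: less_induct)
  case less
  interpret M: module K M by fact
  interpret N: module K N by fact
  let ?PS = "pair_sum (tn M N) (pure K M N)"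
  have sc: "a \<odot>\<^bsub>M\<^esub> (b \<odot>\<^bsub>M\<^esub> m) = b \<odot>\<^bsub>M\<^esub> (a \<odot>\<^bsub>M\<^esub> m)"
    if "a \<in> carrier K" "b \<in> carrier K" "m \<in> carrier M" for a b m
    using that M.smult_assoc1[of a b m] M.smult_assoc1[of b a m] m_comm[of a b] by simp
  have bil: "bil M N M (\<lambda>m n. \<phi> n \<odot>\<^bsub>M\<^esub> m)" if \<phi>: "lin N k \<phi>" for \<phi>
  proof (intro bilI mM mN)
    fix m assume "m \<in> carrier M"
    then show "lin N M (\<lambda>n. \<phi> n \<odot>\<^bsub>M\<^esub> m)"
      using linD[OF \<phi>] mM mN by (intro linI) (simp_all add: M.smult_l_distr M.smult_assoc1)
  next
    fix n assume n: "n \<in> carrier N"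
    then have "\<phi> n \<in> carrier K" using linD(3)[OF \<phi> n] by simp
    then show "lin M M (\<lambda>m. \<phi> n \<odot>\<^bsub>M\<^esub> m)"
      using mM by (intro linI) (simp_all add: M.smult_r_distr sc)
  qed
  show ?case
  proof (cases xs)
    case Nil then show ?thesis by (intro exI[of _ "[]"]) auto
  next
    case (Cons x xs')
    then obtain m n where x: "xs = (m, n) # xs'" "m \<in> carrier M" "n \<in> carrier N" "set xs' \<subseteq> carrier M \<times> carrier N"
      using less.prems(1) by (cases x) auto
    show ?thesis
    proof (cases "n \<in> spanl N (map snd xs')")
      case True
      from absorb_dependent[OF mM mN x(4,2) True] obtain ys where ys: "length ys = length xs'"
        "set ys \<subseteq> carrier M \<times> carrier N" "?PS xs = ?PS ys" using x(1) by (auto simp: pair_sum_simps)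
      have "pair_sum M (\<lambda>m n. \<phi> n \<odot>\<^bsub>M\<^esub> m) ys \<in> W" if "lin N k \<phi>" for \<phi>
        using less.prems(2)[OF that] sw_pair_sum[OF bil[OF that] less.prems(1)] sw_pair_sum[OF bil[OF that] ys(2)] ys(3)
        by simp
      then show ?thesis using less.hyps[of ys] ys x(1) by auto
    next
      case False
      have ns: "set (map snd xs') \<subseteq> carrier N" using x(4) by auto
      from functional_exists[OF mN subsp_spanl[OF mN ns] x(3) False]
      obtain \<phi> where \<phi>: "lin N k \<phi>" "\<And>u. u \<in> spanl N (map snd xs') \<Longrightarrow> \<phi> u = \<zero>" "\<phi> n = \<one>" by blast
      have "pair_sum M (\<lambda>m n. \<phi> n \<odot>\<^bsub>M\<^esub> m) zs = \<zero>\<^bsub>M\<^esub>" if "set zs \<subseteq> set xs'" for zs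
        using that
      proof (induction zs)
        case (Cons z zs)
        obtain p q where z: "z = (p, q)" by (cases z)
        have "\<phi> q = \<zero>" using Cons z by (intro \<phi>(2) spanl_mem[OF mN ns]) force
        moreover have "p \<in> carrier M" using Cons z x(4) by auto
        ultimately show ?case using Cons z by (simp add: pair_sum_simps)
      qed (simp add: pair_sum_simps)
      then have mW: "m \<in> W" using less.prems(2)[OF \<phi>(1)] x \<phi>(3) by (simp add: pair_sum_simps)
      have "pair_sum M (\<lambda>m n. \<psi> n \<odot>\<^bsub>M\<^esub> m) xs' \<in> W" if \<psi>: "lin N k \<psi>" for \<psi>
      proof -
        have c: "\<psi> n \<in> carrier K" "\<ominus> (\<psi> n) \<in> carrier K" using linD(3)[OF \<psi> x(3)] by auto
        have r: "pair_sum M (\<lambda>m n. \<psi> n \<odot>\<^bsub>M\<^esub> m) xs' \<in> carrier M"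
          using x(4) linD(3)[OF \<psi>] by (intro pair_sum_in[OF mM]) auto
        have "(\<ominus> (\<psi> n)) \<odot>\<^bsub>M\<^esub> m \<oplus>\<^bsub>M\<^esub> pair_sum M (\<lambda>m n. \<psi> n \<odot>\<^bsub>M\<^esub> m) xs \<in> W"
          by (rule subspD(3)[OF W subspD(4)[OF W c(2) mW] less.prems(2)[OF \<psi>]])
        then show ?thesis using x c r by (simp add: pair_sum_simps M.smult_l_minus M.r_neg1)
      qed
      from less.hyps[OF _ x(4) this] obtain ys where "set ys \<subseteq> W \<times> carrier N" "?PS xs' = ?PS ys"
        using x(1) by auto
      then show ?thesis using x mW by (intro exI[of _ "(m, n) # ys"]) (auto simp: pair_sum_simps)
    qed
  qed
qed

text \<open>A tensor lies in \<open>W \<otimes> N\<close> if all its slices lie in \<open>W\<close>. This is how coinvariance of a tensor is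
  turned into coinvariance of its factors.\<close>

lemma slice_tensor:
  assumes "module K M" "module K N" "subsp M W" "t \<in> carrier (tn M N)"
    "\<And>\<phi>. lin N k \<phi> \<Longrightarrow> sw M t (\<lambda>m n. \<phi> n \<odot>\<^bsub>M\<^esub> m) \<in> W"
  obtains ys where "set ys \<subseteq> W \<times> carrier N" "t = pair_sum (tn M N) (pure K M N) ys"
proof -
  have t: "t = pair_sum (tn M N) (pure K M N) (tensor_rep t)"
    using sw_id[OF assms(1,2,4)] by (simp add: tensor_lift_def)
  obtain ys where "set ys \<subseteq> W \<times> carrier N"
    "pair_sum (tn M N) (pure K M N) (tensor_rep t) = pair_sum (tn M N) (pure K M N) ys"
    using slice_list[OF assms(1-3) tens_rep[OF assms(1,2,4)] assms(5)[unfolded tensor_lift_def]] by auto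
  then show ?thesis using that[of ys] t by simp
qed

end

section \<open>Algebras and Hopf algebras\<close>

context fieldK
begin

lemma lin_smult [lins]: assumes "lin X k u" "module K M" "m \<in> carrier M"
  shows "lin X M (\<lambda>x. u x \<odot>\<^bsub>M\<^esub> m)"
proof -
  interpret M: module K M by fact
  show ?thesis using linD[OF assms(1)] assms(2,3)
    by (intro linI) (simp_all add: M.smult_l_distr M.smult_assoc1)
qed

lemma lin_smult_right [lins]: assumes "c \<in> carrier K" "lin X M u"
  shows "lin X M (\<lambda>x. c \<odot>\<^bsub>M\<^esub> u x)"
proof -
  interpret M: module K M using linD(2)[OF assms(2)] .
  have sc: "a \<odot>\<^bsub>M\<^esub> (b \<odot>\<^bsub>M\<^esub> m) = b \<odot>\<^bsub>M\<^esub> (a \<odot>\<^bsub>M\<^esub> m)"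
    if "a \<in> carrier K" "b \<in> carrier K" "m \<in> carrier M" for a b m
    using that M.smult_assoc1[of a b m] M.smult_assoc1[of b a m] m_comm[of a b] by simp
  show ?thesis using linD[OF assms(2)] assms(1)
    by (intro linI) (simp_all add: M.smult_r_distr sc)
qed

lemma lin_mult_K [lins]: "lin X k u \<Longrightarrow> c \<in> carrier K \<Longrightarrow> lin X k (\<lambda>x. u x \<otimes> c)"
  "c \<in> carrier K \<Longrightarrow> lin X k u \<Longrightarrow> lin X k (\<lambda>x. c \<otimes> u x)"
  using lin_smult[of X u k c] lin_smult_right[of c X k u] by auto

lemma alg_mult: assumes "k_algebra K A"
  shows "lin X A u \<Longrightarrow> a \<in> carrier A \<Longrightarrow> lin X A (\<lambda>x. u x \<otimes>\<^bsub>A\<^esub> a)"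
    and "a \<in> carrier A \<Longrightarrow> lin X A u \<Longrightarrow> lin X A (\<lambda>x. a \<otimes>\<^bsub>A\<^esub> u x)"
proof -
  interpret A: ring A using assms by (simp add: k_algebra_def)
  have s: "(c \<odot>\<^bsub>A\<^esub> x) \<otimes>\<^bsub>A\<^esub> y = c \<odot>\<^bsub>A\<^esub> (x \<otimes>\<^bsub>A\<^esub> y) \<and> x \<otimes>\<^bsub>A\<^esub> (c \<odot>\<^bsub>A\<^esub> y) = c \<odot>\<^bsub>A\<^esub> (x \<otimes>\<^bsub>A\<^esub> y)"
    if "c \<in> carrier K" "x \<in> carrier A" "y \<in> carrier A" for c x y
    using assms that by (simp add: k_algebra_def)
  show "lin X A (\<lambda>x. u x \<otimes>\<^bsub>A\<^esub> a)" if "lin X A u" "a \<in> carrier A"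
    using linD[OF that(1)] that(2) s by (intro linI) (simp_all add: A.l_distr)
  show "lin X A (\<lambda>x. a \<otimes>\<^bsub>A\<^esub> u x)" if "a \<in> carrier A" "lin X A u"
    using linD[OF that(2)] that(1) s by (intro linI) (simp_all add: A.r_distr)
qed

lemma alg_module: "k_algebra K A \<Longrightarrow> module K A" "k_algebra K A \<Longrightarrow> ring A"
  by (simp_all add: k_algebra_def)

lemma tens_mult:
  "s \<otimes>\<^bsub>tn B C\<^esub> t = sw (tn B C) s (\<lambda>b c. sw (tn B C) t (\<lambda>b' c'. pure K B C (b \<otimes>\<^bsub>B\<^esub> b') (c \<otimes>\<^bsub>C\<^esub> c')))"
  "\<one>\<^bsub>tn B C\<^esub> = pure K B C \<one>\<^bsub>B\<^esub> \<one>\<^bsub>C\<^esub>"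
  by (simp_all add: tens_def Let_def tensor_lift_def pair_sum_def)

lemma sw_tens_mult:
  assumes B: "k_algebra K B" and C: "k_algebra K C" and f: "bil B C G f"
    and s: "s \<in> carrier (tn B C)" and t: "t \<in> carrier (tn B C)"
  shows "sw G (s \<otimes>\<^bsub>tn B C\<^esub> t) f = sw G s (\<lambda>b c. sw G t (\<lambda>b' c'. f (b \<otimes>\<^bsub>B\<^esub> b') (c \<otimes>\<^bsub>C\<^esub> c')))"
proof -
  interpret B: ring B using B by (simp add: k_algebra_def)
  interpret C: ring C using C by (simp add: k_algebra_def)
  have m: "module K B" "module K C" using alg_module B C by auto
  have "sw G (s \<otimes>\<^bsub>tn B C\<^esub> t) f
      = sw G s (\<lambda>b c. sw G (sw (tn B C) t (\<lambda>b' c'. pure K B C (b \<otimes>\<^bsub>B\<^esub> b') (c \<otimes>\<^bsub>C\<^esub> c'))) f)"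
    unfolding tens_mult by (rule sw_sw[OF f m s]) (use m t in \<open>auto intro!: sw_in[where M = B and N = C] pure_in\<close>)
  also have "\<dots> = sw G s (\<lambda>b c. sw G t (\<lambda>b' c'. sw G (pure K B C (b \<otimes>\<^bsub>B\<^esub> b') (c \<otimes>\<^bsub>C\<^esub> c')) f))"
    by (intro sw_cong[OF m s] sw_sw[OF f m t] pure_in m) auto
  also have "\<dots> = sw G s (\<lambda>b c. sw G t (\<lambda>b' c'. f (b \<otimes>\<^bsub>B\<^esub> b') (c \<otimes>\<^bsub>C\<^esub> c')))"
    by (intro sw_cong[OF m s] sw_cong[OF m t] sw_pure[OF f]) auto
  finally show ?thesis .
qed

lemma alg_hom_lin: "alg_hom K A B f \<Longrightarrow> module K A \<Longrightarrow> module K B \<Longrightarrow> lin A B f"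
  by (simp add: alg_hom_def lin_def)

lemma coaction_mult:
  assumes A: "k_algebra K A" and B: "k_algebra K B" and C: "k_algebra K C" and r: "alg_hom K A (tn B C) r"
    and f: "bil B C G f" and "x \<in> carrier A" "y \<in> carrier A"
  shows "sw G (r (x \<otimes>\<^bsub>A\<^esub> y)) f = sw G (r x) (\<lambda>b c. sw G (r y) (\<lambda>b' c'. f (b \<otimes>\<^bsub>B\<^esub> b') (c \<otimes>\<^bsub>C\<^esub> c')))"
proof -
  have "lin A (tn B C) r" using A B C r by (auto intro!: alg_hom_lin simp: alg_module)
  note l = linD(3)[OF this]
  show ?thesis using sw_tens_mult[OF B C f l[OF assms(6)] l[OF assms(7)]] r assms(6,7) by (simp add: alg_hom_def)
qed

lemma coaction_one:
  assumes B: "k_algebra K B" and C: "k_algebra K C" and r: "alg_hom K A (tn B C) r" and f: "bil B C G f"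
  shows "sw G (r \<one>\<^bsub>A\<^esub>) f = f \<one>\<^bsub>B\<^esub> \<one>\<^bsub>C\<^esub>"
proof -
  interpret B: ring B using B by (simp add: k_algebra_def)
  interpret C: ring C using C by (simp add: k_algebra_def)
  show ?thesis using r sw_pure[OF f] by (simp add: alg_hom_def tens_mult)
qed

end

locale algK = fieldK K for K :: "'k ring" (structure) +
  fixes A :: "('k, 'a, 'x) module_scheme"
  assumes k_alg: "k_algebra K A"
begin

sublocale A: ring A using k_alg by (simp add: k_algebra_def)
sublocale Am: module K A using k_alg by (simp add: k_algebra_def)

lemma A_module [simp, lins]: "module K A" by (rule Am.module_axioms)

lemmas A_mult [lins] = alg_mult[OF k_alg]

lemmas A_closed [lins] = A.m_closed A.one_closed Am.smult_closed

lemma A_smult: assumes "c \<in> carrier K" "x \<in> carrier A" "y \<in> carrier A"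
  shows "(c \<odot>\<^bsub>A\<^esub> x) \<otimes>\<^bsub>A\<^esub> y = c \<odot>\<^bsub>A\<^esub> (x \<otimes>\<^bsub>A\<^esub> y)" "x \<otimes>\<^bsub>A\<^esub> (c \<odot>\<^bsub>A\<^esub> y) = c \<odot>\<^bsub>A\<^esub> (x \<otimes>\<^bsub>A\<^esub> y)"
  using k_alg assms by (auto simp: k_algebra_def)

end

locale hopfK = fieldK K for K :: "'k ring" (structure) +
  fixes H :: "('k, 'h) hopf"
  assumes hopf: "hopf_algebra K H"
begin

sublocale H: algK K H
  using hopf by unfold_locales (simp add: hopf_algebra_def)

abbreviation "\<Delta> \<equiv> comult H"
abbreviation "\<epsilon> \<equiv> counit H"
abbreviation "S \<equiv> antipode H"

lemma comult_hom: "alg_hom K H (tn H H) \<Delta>" using hopf by (simp add: hopf_algebra_def)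
lemma comult_lin: "lin H (tn H H) \<Delta>" using comult_hom by (simp add: alg_hom_lin)
lemma counit_hom: "alg_hom K H k \<epsilon>" using hopf by (simp add: hopf_algebra_def)
lemma counit_lin: "lin H k \<epsilon>" using counit_hom by (simp add: alg_hom_lin)
lemma S_lin: "lin H H S" using hopf by (simp add: hopf_algebra_def lin_def)

lemmas hopf_lins [lins] = lin_comp[OF comult_lin] lin_comp[OF counit_lin] lin_comp[OF S_lin]

lemma comult_in [simp, lins]: "h \<in> carrier H \<Longrightarrow> \<Delta> h \<in> carrier (tn H H)" using linD(3)[OF comult_lin] .
lemma counit_in [simp, lins]: "h \<in> carrier H \<Longrightarrow> \<epsilon> h \<in> carrier K" using linD(3)[OF counit_lin] by simp
lemma S_in [simp, lins]: "h \<in> carrier H \<Longrightarrow> S h \<in> carrier H" using linD(3)[OF S_lin] .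

lemma counit_mult: "x \<in> carrier H \<Longrightarrow> y \<in> carrier H \<Longrightarrow> \<epsilon> (x \<otimes>\<^bsub>H\<^esub> y) = \<epsilon> x \<otimes> \<epsilon> y"
  and counit_one [simp]: "\<epsilon> \<one>\<^bsub>H\<^esub> = \<one>"
  using counit_hom by (auto simp: alg_hom_def)

lemmas D_cong = sw_cong[OF H.A_module H.A_module comult_in]
lemmas D_push = sw_push[OF _ H.A_module H.A_module comult_in]
lemmas D_mult = coaction_mult[OF H.k_alg H.k_alg H.k_alg comult_hom]
lemmas D_one = coaction_one[OF H.k_alg H.k_alg comult_hom]

lemma coassoc: assumes "tri H H H G f" "h \<in> carrier H"
  shows "sw G (\<Delta> h) (\<lambda>x c. sw G (\<Delta> x) (\<lambda>a b. f a b c)) = sw G (\<Delta> h) (\<lambda>a x. sw G (\<Delta> x) (\<lambda>b c. f a b c))"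
  using hopf assms by (intro assoc_eqD[OF comult_lin comult_lin]) (auto simp: hopf_algebra_def)

lemma counit_left: assumes "lin H G f" "h \<in> carrier H" shows "sw G (\<Delta> h) (\<lambda>x y. \<epsilon> x \<odot>\<^bsub>G\<^esub> f y) = f h"
proof -
  have "f h = f (sw H (\<Delta> h) (\<lambda>x y. \<epsilon> x \<odot>\<^bsub>H\<^esub> y))" using hopf assms by (simp add: hopf_algebra_def)
  also have "\<dots> = sw G (\<Delta> h) (\<lambda>x y. f (\<epsilon> x \<odot>\<^bsub>H\<^esub> y))" using assms by (intro D_push) auto
  also have "\<dots> = sw G (\<Delta> h) (\<lambda>x y. \<epsilon> x \<odot>\<^bsub>G\<^esub> f y)" using assms linD[OF assms(1)] by (intro D_cong) auto
  finally show ?thesis ..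
qed

lemma counit_right: assumes "lin H G f" "h \<in> carrier H" shows "sw G (\<Delta> h) (\<lambda>x y. \<epsilon> y \<odot>\<^bsub>G\<^esub> f x) = f h"
proof -
  have "f h = f (sw H (\<Delta> h) (\<lambda>x y. \<epsilon> y \<odot>\<^bsub>H\<^esub> x))" using hopf assms by (simp add: hopf_algebra_def)
  also have "\<dots> = sw G (\<Delta> h) (\<lambda>x y. f (\<epsilon> y \<odot>\<^bsub>H\<^esub> x))" using assms by (intro D_push) auto
  also have "\<dots> = sw G (\<Delta> h) (\<lambda>x y. \<epsilon> y \<odot>\<^bsub>G\<^esub> f x)" using assms linD[OF assms(1)] by (intro D_cong) auto
  finally show ?thesis ..
qed

lemma antipode_left: assumes "lin H G f" "h \<in> carrier H"
  shows "sw G (\<Delta> h) (\<lambda>x y. f (S x \<otimes>\<^bsub>H\<^esub> y)) = \<epsilon> h \<odot>\<^bsub>G\<^esub> f \<one>\<^bsub>H\<^esub>"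
proof -
  have "sw G (\<Delta> h) (\<lambda>x y. f (S x \<otimes>\<^bsub>H\<^esub> y)) = f (sw H (\<Delta> h) (\<lambda>x y. S x \<otimes>\<^bsub>H\<^esub> y))"
    using assms by (intro D_push[symmetric]) auto
  also have "\<dots> = f (\<epsilon> h \<odot>\<^bsub>H\<^esub> \<one>\<^bsub>H\<^esub>)" using hopf assms by (simp add: hopf_algebra_def)
  finally show ?thesis using assms by (simp add: linD(5)[OF assms(1)])
qed

lemma antipode_right: assumes "lin H G f" "h \<in> carrier H"
  shows "sw G (\<Delta> h) (\<lambda>x y. f (x \<otimes>\<^bsub>H\<^esub> S y)) = \<epsilon> h \<odot>\<^bsub>G\<^esub> f \<one>\<^bsub>H\<^esub>"
proof -
  have "sw G (\<Delta> h) (\<lambda>x y. f (x \<otimes>\<^bsub>H\<^esub> S y)) = f (sw H (\<Delta> h) (\<lambda>x y. x \<otimes>\<^bsub>H\<^esub> S y))"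
    using assms by (intro D_push[symmetric]) auto
  also have "\<dots> = f (\<epsilon> h \<odot>\<^bsub>H\<^esub> \<one>\<^bsub>H\<^esub>)" using hopf assms by (simp add: hopf_algebra_def)
  finally show ?thesis using assms by (simp add: linD(5)[OF assms(1)])
qed

lemma S_one: "S \<one>\<^bsub>H\<^esub> = \<one>\<^bsub>H\<^esub>"
proof -
  have b: "bil H H H (\<lambda>x y. S x \<otimes>\<^bsub>H\<^esub> y)" by (auto intro!: lins)
  have "sw H (\<Delta> \<one>\<^bsub>H\<^esub>) (\<lambda>x y. S x \<otimes>\<^bsub>H\<^esub> y) = \<epsilon> \<one>\<^bsub>H\<^esub> \<odot>\<^bsub>H\<^esub> \<one>\<^bsub>H\<^esub>"
    using hopf by (simp add: hopf_algebra_def)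
  then show ?thesis using D_one[OF b] by simp
qed

text \<open>The two sides are the left and the right convolution inverse of the multiplication
  \<open>H \<otimes> H \<rightarrow> H\<close>: the sum of the \<open>S(x\<^sub>1y\<^sub>1) x\<^sub>2y\<^sub>2 S(y\<^sub>3) S(x\<^sub>3)\<close> is evaluated in two ways.\<close>

lemma S_mult:
  assumes x: "x \<in> carrier H" and y: "y \<in> carrier H"
  shows "S (x \<otimes>\<^bsub>H\<^esub> y) = S y \<otimes>\<^bsub>H\<^esub> S x"
proof -
  define g where "g x1 x2 x3 y1 y2 y3 =
    (S (x1 \<otimes>\<^bsub>H\<^esub> y1) \<otimes>\<^bsub>H\<^esub> (x2 \<otimes>\<^bsub>H\<^esub> y2)) \<otimes>\<^bsub>H\<^esub> (S y3 \<otimes>\<^bsub>H\<^esub> S x3)" for x1 x2 x3 y1 y2 y3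
  have inner: "sw H (\<Delta> x') (\<lambda>x2 x3. sw H (\<Delta> y') (\<lambda>y2 y3. g x1 x2 x3 y1 y2 y3))
      = \<epsilon> x' \<odot>\<^bsub>H\<^esub> (\<epsilon> y' \<odot>\<^bsub>H\<^esub> S (x1 \<otimes>\<^bsub>H\<^esub> y1))"
    if h: "x1 \<in> carrier H" "x' \<in> carrier H" "y1 \<in> carrier H" "y' \<in> carrier H" for x1 x' y1 y'
  proof -
    have 1: "sw H (\<Delta> y') (\<lambda>y2 y3. g x1 x2 x3 y1 y2 y3)
       = \<epsilon> y' \<odot>\<^bsub>H\<^esub> (S (x1 \<otimes>\<^bsub>H\<^esub> y1) \<otimes>\<^bsub>H\<^esub> (x2 \<otimes>\<^bsub>H\<^esub> S x3))" if "x2 \<in> carrier H" "x3 \<in> carrier H" for x2 x3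
    proof -
      have "sw H (\<Delta> y') (\<lambda>y2 y3. g x1 x2 x3 y1 y2 y3)
        = sw H (\<Delta> y') (\<lambda>y2 y3. (\<lambda>z. S (x1 \<otimes>\<^bsub>H\<^esub> y1) \<otimes>\<^bsub>H\<^esub> (x2 \<otimes>\<^bsub>H\<^esub> (z \<otimes>\<^bsub>H\<^esub> S x3))) (y2 \<otimes>\<^bsub>H\<^esub> S y3))"
        using that h by (intro D_cong) (simp_all add: g_def H.A.m_assoc)
      also have "\<dots> = \<epsilon> y' \<odot>\<^bsub>H\<^esub> (S (x1 \<otimes>\<^bsub>H\<^esub> y1) \<otimes>\<^bsub>H\<^esub> (x2 \<otimes>\<^bsub>H\<^esub> (\<one>\<^bsub>H\<^esub> \<otimes>\<^bsub>H\<^esub> S x3)))"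
        using that h by (intro antipode_right) (auto intro!: lins)
      finally show ?thesis using that h by simp
    qed
    have "sw H (\<Delta> x') (\<lambda>x2 x3. sw H (\<Delta> y') (\<lambda>y2 y3. g x1 x2 x3 y1 y2 y3))
      = sw H (\<Delta> x') (\<lambda>x2 x3. (\<lambda>z. \<epsilon> y' \<odot>\<^bsub>H\<^esub> (S (x1 \<otimes>\<^bsub>H\<^esub> y1) \<otimes>\<^bsub>H\<^esub> z)) (x2 \<otimes>\<^bsub>H\<^esub> S x3))"
      using h by (intro D_cong) (simp_all add: 1)
    also have "\<dots> = \<epsilon> x' \<odot>\<^bsub>H\<^esub> (\<epsilon> y' \<odot>\<^bsub>H\<^esub> (S (x1 \<otimes>\<^bsub>H\<^esub> y1) \<otimes>\<^bsub>H\<^esub> \<one>\<^bsub>H\<^esub>))"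
      using h by (intro antipode_right) (auto intro!: lins)
    finally show ?thesis using h by simp
  qed
  have g_in: "g x1 x2 x3 y1 y2 y3 \<in> carrier H" if "x1 \<in> carrier H" "x2 \<in> carrier H" "x3 \<in> carrier H"
    "y1 \<in> carrier H" "y2 \<in> carrier H" "y3 \<in> carrier H" for x1 x2 x3 y1 y2 y3
    using that by (simp add: g_def)
  have "S (x \<otimes>\<^bsub>H\<^esub> y) = sw H (\<Delta> x) (\<lambda>x1 x'. \<epsilon> x' \<odot>\<^bsub>H\<^esub> S (x1 \<otimes>\<^bsub>H\<^esub> y))"
    using x y by (intro counit_right[symmetric]) (auto intro!: lins)
  also have "\<dots> = sw H (\<Delta> x) (\<lambda>x1 x'. sw H (\<Delta> y) (\<lambda>y1 y'. \<epsilon> y' \<odot>\<^bsub>H\<^esub> (\<epsilon> x' \<odot>\<^bsub>H\<^esub> S (x1 \<otimes>\<^bsub>H\<^esub> y1))))"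
    using x y by (intro D_cong counit_right[symmetric]) (auto intro!: lins)
  also have "\<dots> = sw H (\<Delta> x) (\<lambda>x1 x'. sw H (\<Delta> y) (\<lambda>y1 y'. sw H (\<Delta> x') (\<lambda>x2 x3. sw H (\<Delta> y') (\<lambda>y2 y3. g x1 x2 x3 y1 y2 y3))))"
    using x y by (intro D_cong) (simp_all add: inner H.Am.smult_assoc1[symmetric] m_comm)
  also have "\<dots> = sw H (\<Delta> x) (\<lambda>x1 x'. sw H (\<Delta> x') (\<lambda>x2 x3. sw H (\<Delta> y) (\<lambda>y1 y'. sw H (\<Delta> y') (\<lambda>y2 y3. g x1 x2 x3 y1 y2 y3))))"
    using x y by (intro D_cong sw_swap[of H H H H]) (auto intro!: sw_in[of H H] g_in)
  also have "\<dots> = sw H (\<Delta> x) (\<lambda>x1 x'. sw H (\<Delta> x') (\<lambda>x2 x3. sw H (\<Delta> y) (\<lambda>y' y3. sw H (\<Delta> y') (\<lambda>y1 y2. g x1 x2 x3 y1 y2 y3))))"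
    using x y by (intro D_cong coassoc[symmetric]) (auto intro!: lins simp: g_def)
  also have "\<dots> = sw H (\<Delta> x) (\<lambda>x' x3. sw H (\<Delta> x') (\<lambda>x1 x2. sw H (\<Delta> y) (\<lambda>y' y3. sw H (\<Delta> y') (\<lambda>y1 y2. g x1 x2 x3 y1 y2 y3))))"
    using x y by (intro coassoc[symmetric]) (auto intro!: lins simp: g_def)
  also have "\<dots> = sw H (\<Delta> x) (\<lambda>x' x3. sw H (\<Delta> y) (\<lambda>y' y3. sw H (\<Delta> x') (\<lambda>x1 x2. sw H (\<Delta> y') (\<lambda>y1 y2. g x1 x2 x3 y1 y2 y3))))"
    using x y by (intro D_cong sw_swap[of H H H H]) (auto intro!: sw_in[of H H] g_in)
  also have "\<dots> = sw H (\<Delta> x) (\<lambda>x' x3. sw H (\<Delta> y) (\<lambda>y' y3. \<epsilon> x' \<odot>\<^bsub>H\<^esub> (\<epsilon> y' \<odot>\<^bsub>H\<^esub> (S y3 \<otimes>\<^bsub>H\<^esub> S x3))))"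
  proof (intro D_cong x y)
    fix x' x3 y' y3 assume h: "x' \<in> carrier H" "x3 \<in> carrier H" "y' \<in> carrier H" "y3 \<in> carrier H"
    have "sw H (\<Delta> x') (\<lambda>x1 x2. sw H (\<Delta> y') (\<lambda>y1 y2. g x1 x2 x3 y1 y2 y3))
        = sw H (\<Delta> (x' \<otimes>\<^bsub>H\<^esub> y')) (\<lambda>a b. (S a \<otimes>\<^bsub>H\<^esub> b) \<otimes>\<^bsub>H\<^esub> (S y3 \<otimes>\<^bsub>H\<^esub> S x3))"
      unfolding g_def using h by (intro D_mult[symmetric]) (auto intro!: lins)
    also have "\<dots> = \<epsilon> (x' \<otimes>\<^bsub>H\<^esub> y') \<odot>\<^bsub>H\<^esub> (\<one>\<^bsub>H\<^esub> \<otimes>\<^bsub>H\<^esub> (S y3 \<otimes>\<^bsub>H\<^esub> S x3))"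
      using h by (intro antipode_left) (auto intro!: lins)
    finally show "sw H (\<Delta> x') (\<lambda>x1 x2. sw H (\<Delta> y') (\<lambda>y1 y2. g x1 x2 x3 y1 y2 y3))
        = \<epsilon> x' \<odot>\<^bsub>H\<^esub> (\<epsilon> y' \<odot>\<^bsub>H\<^esub> (S y3 \<otimes>\<^bsub>H\<^esub> S x3))"
      using h by (simp add: counit_mult H.Am.smult_assoc1)
  qed
  also have "\<dots> = sw H (\<Delta> x) (\<lambda>x' x3. \<epsilon> x' \<odot>\<^bsub>H\<^esub> (S y \<otimes>\<^bsub>H\<^esub> S x3))"
  proof (intro D_cong x)
    fix x' x3 assume h: "x' \<in> carrier H" "x3 \<in> carrier H"
    have "sw H (\<Delta> y) (\<lambda>y' y3. \<epsilon> x' \<odot>\<^bsub>H\<^esub> (\<epsilon> y' \<odot>\<^bsub>H\<^esub> (S y3 \<otimes>\<^bsub>H\<^esub> S x3)))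
      = sw H (\<Delta> y) (\<lambda>y' y3. \<epsilon> y' \<odot>\<^bsub>H\<^esub> (\<epsilon> x' \<odot>\<^bsub>H\<^esub> (S y3 \<otimes>\<^bsub>H\<^esub> S x3)))"
      using h y by (intro D_cong) (simp_all add: H.Am.smult_assoc1[symmetric] m_comm)
    also have "\<dots> = \<epsilon> x' \<odot>\<^bsub>H\<^esub> (S y \<otimes>\<^bsub>H\<^esub> S x3)"
      using h y by (intro counit_left) (auto intro!: lins)
    finally show "sw H (\<Delta> y) (\<lambda>y' y3. \<epsilon> x' \<odot>\<^bsub>H\<^esub> (\<epsilon> y' \<odot>\<^bsub>H\<^esub> (S y3 \<otimes>\<^bsub>H\<^esub> S x3))) = \<dots>" .
  qed
  also have "\<dots> = S y \<otimes>\<^bsub>H\<^esub> S x"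
    using x y by (intro counit_left) (auto intro!: lins)
  finally show ?thesis .
qed

subsection \<open>The group of characters\<close>

lemma AlgD: assumes "f \<in> carrier (Alg K H)"
  shows "lin H k f" "f \<in> extensional (carrier H)" "x \<in> carrier H \<Longrightarrow> f x \<in> carrier K"
    "x \<in> carrier H \<Longrightarrow> y \<in> carrier H \<Longrightarrow> f (x \<otimes>\<^bsub>H\<^esub> y) = f x \<otimes> f y" "f \<one>\<^bsub>H\<^esub> = \<one>"
proof -
  have h: "alg_hom K H k f" using assms by (simp add: Alg_def)
  show l: "lin H k f" by (rule alg_hom_lin[OF h]) simp_all
  show "f \<in> extensional (carrier H)" using assms by (simp add: Alg_def)
  show "x \<in> carrier H \<Longrightarrow> f x \<in> carrier K" using linD(3)[OF l] by simp
  show "x \<in> carrier H \<Longrightarrow> y \<in> carrier H \<Longrightarrow> f (x \<otimes>\<^bsub>H\<^esub> y) = f x \<otimes> f y" "f \<one>\<^bsub>H\<^esub> = \<one>"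
    using h by (simp_all add: alg_hom_def)
qed

lemma AlgI: assumes "lin H k f" "\<And>x y. x \<in> carrier H \<Longrightarrow> y \<in> carrier H \<Longrightarrow> f (x \<otimes>\<^bsub>H\<^esub> y) = f x \<otimes> f y" "f \<one>\<^bsub>H\<^esub> = \<one>"
  shows "restrict f (carrier H) \<in> carrier (Alg K H)"
proof -
  have "lin H k (restrict f (carrier H))" by (rule lin_cong[OF assms(1)]) simp
  then show ?thesis using assms(2,3) by (simp add: Alg_def alg_hom_def lin_def)
qed

lemma Alg_mult: "x \<in> carrier H \<Longrightarrow> (f \<otimes>\<^bsub>Alg K H\<^esub> g) x = sw k (\<Delta> x) (\<lambda>y z. f y \<otimes> g z)"
  by (simp add: Alg_def sw_K)

lemma Alg_one: "x \<in> carrier H \<Longrightarrow> \<one>\<^bsub>Alg K H\<^esub> x = \<epsilon> x"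
  by (simp add: Alg_def)

lemma Alg_mult_in: assumes f: "f \<in> carrier (Alg K H)" and g: "g \<in> carrier (Alg K H)"
  shows "f \<otimes>\<^bsub>Alg K H\<^esub> g \<in> carrier (Alg K H)"
proof -
  note [simp] = AlgD(3)[OF f] AlgD(3)[OF g] and [lins] = lin_comp[OF AlgD(1)[OF f]] lin_comp[OF AlgD(1)[OF g]]
  let ?c = "\<lambda>x. sw k (\<Delta> x) (\<lambda>y z. f y \<otimes> g z)"
  have b: "bil H H k (\<lambda>y z. f y \<otimes> g z)" by (auto intro!: lins)
  have m: "?c (x \<otimes>\<^bsub>H\<^esub> y) = ?c x \<otimes> ?c y" if h: "x \<in> carrier H" "y \<in> carrier H" for x y
  proof -
    have cy: "?c y \<in> carrier K" using linD(3)[OF lin_sw[OF b] comult_in[OF h(2)]] by simp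
    have "?c (x \<otimes>\<^bsub>H\<^esub> y) = sw k (\<Delta> x) (\<lambda>x1 x2. sw k (\<Delta> y) (\<lambda>y1 y2. f (x1 \<otimes>\<^bsub>H\<^esub> y1) \<otimes> g (x2 \<otimes>\<^bsub>H\<^esub> y2)))"
      by (rule D_mult[OF b h])
    also have "\<dots> = sw k (\<Delta> x) (\<lambda>x1 x2. sw k (\<Delta> y) (\<lambda>y1 y2. (f x1 \<otimes> g x2) \<otimes> (f y1 \<otimes> g y2)))"
      using h by (intro D_cong) (simp_all add: AlgD(4)[OF f] AlgD(4)[OF g] m_ac)
    also have "\<dots> = sw k (\<Delta> x) (\<lambda>x1 x2. (f x1 \<otimes> g x2) \<otimes> ?c y)"
      using h by (intro D_cong D_push[symmetric]) (auto intro!: lins)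
    also have "\<dots> = ?c x \<otimes> ?c y"
      using h cy by (intro D_push[symmetric, where F = "\<lambda>z. z \<otimes> ?c y"]) (auto intro!: lins)
    finally show ?thesis .
  qed
  have "restrict ?c (carrier H) \<in> carrier (Alg K H)"
    using m D_one[OF b] AlgD(5)[OF f] AlgD(5)[OF g]
    by (intro AlgI lin_comp[OF lin_sw[OF b] comult_lin]) simp_all
  then show ?thesis by (simp add: Alg_def sw_K)
qed

lemma Alg_eqI: assumes "f \<in> carrier (Alg K H)" "g \<in> carrier (Alg K H)" "\<And>x. x \<in> carrier H \<Longrightarrow> f x = g x"
  shows "f = g"
  by (rule extensionalityI[OF AlgD(2)[OF assms(1)] AlgD(2)[OF assms(2)] assms(3)])

text \<open>The inverse of a character \<open>f\<close> is \<open>f \<circ> S\<close>, which is multiplicative because \<open>S\<close> reverses products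
  and the values of \<open>f\<close> commute.\<close>

lemma Alg_group: "group (Alg K H)"
proof (rule groupI)
  have one: "\<one>\<^bsub>Alg K H\<^esub> \<in> carrier (Alg K H)"
    using AlgI[OF counit_lin counit_mult counit_one] by (simp add: Alg_def)
  then show "\<one>\<^bsub>Alg K H\<^esub> \<in> carrier (Alg K H)" .
  fix f assume f: "f \<in> carrier (Alg K H)"
  note [simp] = AlgD(3)[OF f] and [lins] = lin_comp[OF AlgD(1)[OF f]]
  show "\<one>\<^bsub>Alg K H\<^esub> \<otimes>\<^bsub>Alg K H\<^esub> f = f"
  proof (rule Alg_eqI[OF Alg_mult_in[OF one f] f])
    fix x assume x: "x \<in> carrier H"
    have "(\<one>\<^bsub>Alg K H\<^esub> \<otimes>\<^bsub>Alg K H\<^esub> f) x = sw k (\<Delta> x) (\<lambda>y z. \<epsilon> y \<odot>\<^bsub>k\<^esub> f z)"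
      unfolding Alg_mult[OF x] using x by (intro D_cong) (simp_all add: Alg_one)
    also have "\<dots> = f x" by (rule counit_left[OF AlgD(1)[OF f] x])
    finally show "(\<one>\<^bsub>Alg K H\<^esub> \<otimes>\<^bsub>Alg K H\<^esub> f) x = f x" .
  qed
  let ?i = "restrict (\<lambda>x. f (S x)) (carrier H)"
  have i: "?i \<in> carrier (Alg K H)"
    by (rule AlgI) (auto intro!: lins simp: S_one S_mult AlgD(4,5)[OF f] m_comm)
  have "?i \<otimes>\<^bsub>Alg K H\<^esub> f = \<one>\<^bsub>Alg K H\<^esub>"
  proof (rule Alg_eqI[OF Alg_mult_in[OF i f] one])
    fix x assume x: "x \<in> carrier H"
    have "(?i \<otimes>\<^bsub>Alg K H\<^esub> f) x = sw k (\<Delta> x) (\<lambda>y z. f (S y \<otimes>\<^bsub>H\<^esub> z))"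
      unfolding Alg_mult[OF x] using x by (intro D_cong) (simp_all add: AlgD(4)[OF f])
    also have "\<dots> = \<epsilon> x" using antipode_left[OF AlgD(1)[OF f] x] x AlgD(5)[OF f] by simp
    finally show "(?i \<otimes>\<^bsub>Alg K H\<^esub> f) x = \<one>\<^bsub>Alg K H\<^esub> x" using x by (simp add: Alg_one)
  qed
  then show "\<exists>y\<in>carrier (Alg K H). y \<otimes>\<^bsub>Alg K H\<^esub> f = \<one>\<^bsub>Alg K H\<^esub>" using i by (rule bexI)
  fix g assume g: "g \<in> carrier (Alg K H)"
  show "f \<otimes>\<^bsub>Alg K H\<^esub> g \<in> carrier (Alg K H)" by (rule Alg_mult_in[OF f g])
  note [simp] = AlgD(3)[OF g] and [lins] = lin_comp[OF AlgD(1)[OF g]]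
  fix h assume h: "h \<in> carrier (Alg K H)"
  note [simp] = AlgD(3)[OF h] and [lins] = lin_comp[OF AlgD(1)[OF h]]
  show "f \<otimes>\<^bsub>Alg K H\<^esub> g \<otimes>\<^bsub>Alg K H\<^esub> h = f \<otimes>\<^bsub>Alg K H\<^esub> (g \<otimes>\<^bsub>Alg K H\<^esub> h)"
  proof (rule Alg_eqI[OF Alg_mult_in[OF Alg_mult_in[OF f g] h] Alg_mult_in[OF f Alg_mult_in[OF g h]]])
    fix x assume x: "x \<in> carrier H"
    have "(f \<otimes>\<^bsub>Alg K H\<^esub> g \<otimes>\<^bsub>Alg K H\<^esub> h) x = sw k (\<Delta> x) (\<lambda>y c. sw k (\<Delta> y) (\<lambda>a b. f a \<otimes> g b) \<otimes> h c)"
      unfolding Alg_mult[OF x] using x by (intro D_cong) (simp_all add: Alg_mult)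
    also have "\<dots> = sw k (\<Delta> x) (\<lambda>y c. sw k (\<Delta> y) (\<lambda>a b. (f a \<otimes> g b) \<otimes> h c))"
      using x by (intro D_cong D_push[where F = "\<lambda>z. z \<otimes> h _"]) (auto intro!: lins)
    also have "\<dots> = sw k (\<Delta> x) (\<lambda>a y. sw k (\<Delta> y) (\<lambda>b c. (f a \<otimes> g b) \<otimes> h c))"
      using x by (intro coassoc) (auto intro!: lins)
    also have "\<dots> = sw k (\<Delta> x) (\<lambda>a y. sw k (\<Delta> y) (\<lambda>b c. f a \<otimes> (g b \<otimes> h c)))"
      using x by (intro D_cong) (simp_all add: m_assoc)
    also have "\<dots> = sw k (\<Delta> x) (\<lambda>a y. f a \<otimes> sw k (\<Delta> y) (\<lambda>b c. g b \<otimes> h c))"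
      using x by (intro D_cong D_push[symmetric, where F = "\<lambda>z. f _ \<otimes> z"]) (auto intro!: lins)
    also have "\<dots> = (f \<otimes>\<^bsub>Alg K H\<^esub> (g \<otimes>\<^bsub>Alg K H\<^esub> h)) x"
      unfolding Alg_mult[OF x] using x by (intro D_cong) (simp_all add: Alg_mult)
    finally show "(f \<otimes>\<^bsub>Alg K H\<^esub> g \<otimes>\<^bsub>Alg K H\<^esub> h) x = (f \<otimes>\<^bsub>Alg K H\<^esub> (g \<otimes>\<^bsub>Alg K H\<^esub> h)) x" .
  qed
qed

end

section \<open>Galois objects\<close>

lemma (in fieldK) lin_inv_into:
  assumes "lin M N f" "bij_betw f (carrier M) (carrier N)"
  shows "lin N M (inv_into (carrier M) f)"
proof -
  interpret M: module K M by (rule linD(1)[OF assms(1)])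
  interpret N: module K N by (rule linD(2)[OF assms(1)])
  let ?g = "inv_into (carrier M) f"
  have g: "?g y \<in> carrier M" "f (?g y) = y" if "y \<in> carrier N" for y
    using that assms(2) by (auto simp: bij_betw_def inv_into_into f_inv_into_f)
  have u: "?g y = x" if "x \<in> carrier M" "f x = y" for x y
    using that assms(2) by (auto simp: bij_betw_def inv_into_f_f)
  show ?thesis
    using linD[OF assms(1)] g by (intro linI u) simp_all
qed

lemma (in fieldK) scalar_inj:
  assumes "module K M" "m \<in> carrier M" "m \<noteq> \<zero>\<^bsub>M\<^esub>" "c \<in> carrier K" "d \<in> carrier K" "c \<odot>\<^bsub>M\<^esub> m = d \<odot>\<^bsub>M\<^esub> m"
  shows "c = d"
proof (rule ccontr)
  interpret M: module K M by fact
  assume "c \<noteq> d"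
  then have "c \<ominus> d \<noteq> \<zero>" "c \<ominus> d \<in> carrier K"
    using assms(4,5) minus_equality[of c "\<ominus> d"] by (auto simp: a_minus_def)
  then have a: "inv (c \<ominus> d) \<in> carrier K" "inv (c \<ominus> d) \<otimes> (c \<ominus> d) = \<one>" using field_Units by auto
  have "(c \<ominus> d) \<odot>\<^bsub>M\<^esub> m = c \<odot>\<^bsub>M\<^esub> m \<oplus>\<^bsub>M\<^esub> \<ominus>\<^bsub>M\<^esub> (d \<odot>\<^bsub>M\<^esub> m)"
    using assms(2,4,5) by (simp add: a_minus_def M.smult_l_distr M.smult_l_minus)
  then have z: "(c \<ominus> d) \<odot>\<^bsub>M\<^esub> m = \<zero>\<^bsub>M\<^esub>" using assms by (simp add: M.r_neg)
  have "m = (inv (c \<ominus> d) \<otimes> (c \<ominus> d)) \<odot>\<^bsub>M\<^esub> m" using a(2) assms(2) by simp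
  also have "\<dots> = \<zero>\<^bsub>M\<^esub>" using a(1) assms(2,4,5) z by (simp add: M.smult_assoc1)
  finally show False using assms(3) by simp
qed

locale galoisK = fieldK K + H: hopfK K H + L: hopfK K L + A: algK K A
  for K :: "'k ring" (structure) and H :: "('k, 'h) hopf" and L :: "('k, 'l) hopf" and A :: "('k, 'a) module" +
  fixes \<rho> :: "'a \<Rightarrow> ('a, 'h) tensor" and lam :: "'a \<Rightarrow> ('l, 'a) tensor"
  assumes S_bij: "bij_betw (antipode H) (carrier H) (carrier H)"
    and bigal: "bigalois_object K L H A lam \<rho>"
begin

lemma right_gal: "right_galois_object K H A \<rho>" and left_gal: "left_galois_object K L A lam"
  using bigal by (simp_all add: bigalois_object_def)

lemma rho_com: "right_comodule K H A \<rho>" and rho_hom: "alg_hom K A (tn A H) \<rho>"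
  and rho_coinv: "{a \<in> carrier A. \<rho> a = pure K A H a \<one>\<^bsub>H\<^esub>} = (\<lambda>c. c \<odot>\<^bsub>A\<^esub> \<one>\<^bsub>A\<^esub>) ` carrier K"
  and rcan_bij: "bij_betw (right_can K H A \<rho>) (carrier (tn A A)) (carrier (tn A H))"
  using right_gal by (simp_all add: right_galois_object_def)

lemma lam_com: "left_comodule K L A lam" and lam_hom: "alg_hom K A (tn L A) lam"
  and lcan_bij: "bij_betw (left_can K L A lam) (carrier (tn A A)) (carrier (tn L A))"
  using left_gal by (simp_all add: left_galois_object_def)

lemma A_nontrivial: "\<one>\<^bsub>A\<^esub> \<noteq> \<zero>\<^bsub>A\<^esub>"
proof
  assume "\<one>\<^bsub>A\<^esub> = \<zero>\<^bsub>A\<^esub>"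
  then have "x = \<zero>\<^bsub>A\<^esub>" if "x \<in> carrier A" for x
    using that A.A.l_one[of x] A.A.l_null[of x] by simp
  then have "carrier A = {\<zero>\<^bsub>A\<^esub>}" using A.A.zero_closed by auto
  then show False using right_gal by (simp add: right_galois_object_def)
qed

lemma scalar_one_inj: "c \<in> carrier K \<Longrightarrow> d \<in> carrier K \<Longrightarrow> c \<odot>\<^bsub>A\<^esub> \<one>\<^bsub>A\<^esub> = d \<odot>\<^bsub>A\<^esub> \<one>\<^bsub>A\<^esub> \<Longrightarrow> c = d"
  by (rule scalar_inj[OF A.A_module A.A.one_closed A_nontrivial])

lemma rho_lin: "lin A (tn A H) \<rho>" using rho_hom by (simp add: alg_hom_lin)
lemma lam_lin: "lin A (tn L A) lam" using lam_hom by (simp add: alg_hom_lin)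
lemmas gal_lins [lins] = lin_comp[OF rho_lin] lin_comp[OF lam_lin]

lemma rho_in [simp, lins]: "a \<in> carrier A \<Longrightarrow> \<rho> a \<in> carrier (tn A H)" using linD(3)[OF rho_lin] .
lemma lam_in [simp, lins]: "a \<in> carrier A \<Longrightarrow> lam a \<in> carrier (tn L A)" using linD(3)[OF lam_lin] .

lemmas rho_cong = sw_cong[OF A.A_module H.H.A_module rho_in]
lemmas rho_push = sw_push[OF _ A.A_module H.H.A_module rho_in]
lemmas lam_cong = sw_cong[OF L.H.A_module A.A_module lam_in]
lemmas lam_push = sw_push[OF _ L.H.A_module A.A_module lam_in]
lemmas rho_mult = coaction_mult[OF A.k_alg A.k_alg H.H.k_alg rho_hom]
lemmas rho_one = coaction_one[OF A.k_alg H.H.k_alg rho_hom]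
lemmas lam_mult = coaction_mult[OF A.k_alg L.H.k_alg A.k_alg lam_hom]
lemmas lam_one = coaction_one[OF L.H.k_alg A.k_alg lam_hom]

lemma rho_coassoc: assumes "tri A H H G f" "a \<in> carrier A"
  shows "sw G (\<rho> a) (\<lambda>x c. sw G (\<rho> x) (\<lambda>a b. f a b c)) = sw G (\<rho> a) (\<lambda>a x. sw G (comult H x) (\<lambda>b c. f a b c))"
  using rho_com assms by (intro assoc_eqD[OF rho_lin H.comult_lin]) (auto simp: right_comodule_def)

lemma lam_coassoc: assumes "tri L L A G f" "a \<in> carrier A"
  shows "sw G (lam a) (\<lambda>x c. sw G (comult L x) (\<lambda>a b. f a b c)) = sw G (lam a) (\<lambda>a x. sw G (lam x) (\<lambda>b c. f a b c))"
  using lam_com assms by (intro assoc_eqD[OF L.comult_lin lam_lin]) (auto simp: left_comodule_def)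

lemma bicomod: assumes "tri L A H G f" "a \<in> carrier A"
  shows "sw G (\<rho> a) (\<lambda>x c. sw G (lam x) (\<lambda>a b. f a b c)) = sw G (lam a) (\<lambda>a x. sw G (\<rho> x) (\<lambda>b c. f a b c))"
  using bigal assms by (intro assoc_eqD[OF lam_lin rho_lin]) (auto simp: bigalois_object_def)

lemma rho_counit: assumes "lin A G f" "a \<in> carrier A" shows "sw G (\<rho> a) (\<lambda>x h. counit H h \<odot>\<^bsub>G\<^esub> f x) = f a"
proof -
  have "f a = f (sw A (\<rho> a) (\<lambda>x h. counit H h \<odot>\<^bsub>A\<^esub> x))" using rho_com assms by (simp add: right_comodule_def)
  also have "\<dots> = sw G (\<rho> a) (\<lambda>x h. f (counit H h \<odot>\<^bsub>A\<^esub> x))" using assms by (intro rho_push) auto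
  also have "\<dots> = sw G (\<rho> a) (\<lambda>x h. counit H h \<odot>\<^bsub>G\<^esub> f x)" using assms linD[OF assms(1)] by (intro rho_cong) auto
  finally show ?thesis ..
qed

lemma lam_counit: assumes "lin A G f" "a \<in> carrier A" shows "sw G (lam a) (\<lambda>h x. counit L h \<odot>\<^bsub>G\<^esub> f x) = f a"
proof -
  have "f a = f (sw A (lam a) (\<lambda>h x. counit L h \<odot>\<^bsub>A\<^esub> x))" using lam_com assms by (simp add: left_comodule_def)
  also have "\<dots> = sw G (lam a) (\<lambda>h x. f (counit L h \<odot>\<^bsub>A\<^esub> x))" using assms by (intro lam_push) auto
  also have "\<dots> = sw G (lam a) (\<lambda>h x. counit L h \<odot>\<^bsub>G\<^esub> f x)" using assms linD[OF assms(1)] by (intro lam_cong) auto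
  finally show ?thesis ..
qed

subsection \<open>The translation map of the right coaction\<close>

lemma rcan_lin: "lin (tn A A) (tn A H) (right_can K H A \<rho>)"
  unfolding right_can_def by (auto intro!: lins)

lemma sw_rcan: assumes "bil A H G B" "t \<in> carrier (tn A A)"
  shows "sw G (right_can K H A \<rho> t) B = sw G t (\<lambda>a b. sw G (\<rho> b) (\<lambda>b0 b1. B (a \<otimes>\<^bsub>A\<^esub> b0) b1))"
proof -
  have "sw G (right_can K H A \<rho> t) B
     = sw G t (\<lambda>a b. sw G (sw (tn A H) (\<rho> b) (\<lambda>b0 b1. pure K A H (a \<otimes>\<^bsub>A\<^esub> b0) b1)) B)"
    unfolding right_can_def using assms by (intro sw_sw) (auto intro!: lins)
  also have "\<dots> = sw G t (\<lambda>a b. sw G (\<rho> b) (\<lambda>b0 b1. sw G (pure K A H (a \<otimes>\<^bsub>A\<^esub> b0) b1) B))"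
    using assms by (intro sw_cong[of A A] sw_sw[of A H _ _ A H]) (auto intro!: pure_in)
  also have "\<dots> = sw G t (\<lambda>a b. sw G (\<rho> b) (\<lambda>b0 b1. B (a \<otimes>\<^bsub>A\<^esub> b0) b1))"
    using assms by (intro sw_cong[of A A] rho_cong sw_pure) auto
  finally show ?thesis .
qed

abbreviation "\<tau> \<equiv> translation K H A \<rho>"

lemma tau_lin: "lin H (tn A A) \<tau>"
  unfolding translation_def by (rule lin_comp[OF lin_inv_into[OF rcan_lin rcan_bij]]) (auto intro!: lins)

lemmas tau_lins [lins] = lin_comp[OF tau_lin]

lemma tau_in [simp, lins]: "h \<in> carrier H \<Longrightarrow> \<tau> h \<in> carrier (tn A A)" using linD(3)[OF tau_lin] .

lemmas tau_cong = sw_cong[OF A.A_module A.A_module tau_in]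
lemmas tau_push = sw_push[OF _ A.A_module A.A_module tau_in]

lemma rcan_tau: "h \<in> carrier H \<Longrightarrow> right_can K H A \<rho> (\<tau> h) = pure K A H \<one>\<^bsub>A\<^esub> h"
  unfolding translation_def using rcan_bij
  by (intro f_inv_into_f) (auto simp: bij_betw_def intro!: pure_in)

lemma rcan_inj: "s \<in> carrier (tn A A) \<Longrightarrow> t \<in> carrier (tn A A) \<Longrightarrow> right_can K H A \<rho> s = right_can K H A \<rho> t \<Longrightarrow> s = t"
  using rcan_bij by (auto simp: bij_betw_def dest: inj_onD)

text \<open>The definition of \<open>\<tau>(h) = \<Sum> l \<otimes> r\<close> as a preimage: \<open>\<Sum> l r\<^sub>0 \<otimes> r\<^sub>1 = 1 \<otimes> h\<close>.\<close>

lemma tau_can: assumes "bil A H G B" "h \<in> carrier H"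
  shows "sw G (\<tau> h) (\<lambda>l r. sw G (\<rho> r) (\<lambda>r0 r1. B (l \<otimes>\<^bsub>A\<^esub> r0) r1)) = B \<one>\<^bsub>A\<^esub> h"
  using sw_rcan[OF assms(1) tau_in[OF assms(2)]] rcan_tau[OF assms(2)] sw_pure[OF assms(1) _ assms(2)] by simp

text \<open>Both \<open>\<Sum> a\<^sub>0 l(a\<^sub>1) \<otimes> r(a\<^sub>1)\<close> and \<open>1 \<otimes> a\<close> are sent to \<open>a\<^sub>0 \<otimes> a\<^sub>1\<close> by the canonical map, which is
  injective.\<close>

lemma tau_rho: assumes f: "bil A A G f" and a: "a \<in> carrier A"
  shows "sw G (\<rho> a) (\<lambda>a0 a1. sw G (\<tau> a1) (\<lambda>l r. f (a0 \<otimes>\<^bsub>A\<^esub> l) r)) = f \<one>\<^bsub>A\<^esub> a"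
proof -
  let ?p = "\<lambda>a0 a1. sw (tn A A) (\<tau> a1) (\<lambda>l r. pure K A A (a0 \<otimes>\<^bsub>A\<^esub> l) r)"
  let ?t = "sw (tn A A) (\<rho> a) ?p"
  let ?b = "\<lambda>a b. sw (tn A H) (\<rho> b) (\<lambda>b0 b1. pure K A H (a \<otimes>\<^bsub>A\<^esub> b0) b1)"
  have p: "?p a0 a1 \<in> carrier (tn A A)" if "a0 \<in> carrier A" "a1 \<in> carrier H" for a0 a1
    using that by (auto intro!: lins)
  have t: "?t \<in> carrier (tn A A)" using a p by (auto intro!: sw_in[of A H])
  have b: "bil A A (tn A H) ?b" by (auto intro!: lins)
  have "right_can K H A \<rho> ?t = sw (tn A H) (\<rho> a) (\<lambda>a0 a1. sw (tn A H) (?p a0 a1) ?b)"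
    unfolding right_can_def using a p b by (intro sw_sw) auto
  also have "\<dots> = sw (tn A H) (\<rho> a) (\<lambda>a0 a1. sw (tn A H) (\<tau> a1) (\<lambda>l r. sw (tn A H) (pure K A A (a0 \<otimes>\<^bsub>A\<^esub> l) r) ?b))"
    using a b by (intro rho_cong sw_sw[OF b, of A A]) (auto intro!: pure_in)
  also have "\<dots> = sw (tn A H) (\<rho> a) (\<lambda>a0 a1. sw (tn A H) (\<tau> a1) (\<lambda>l r. ?b (a0 \<otimes>\<^bsub>A\<^esub> l) r))"
    using a by (intro rho_cong tau_cong sw_pure[OF b]) auto
  also have "\<dots> = sw (tn A H) (\<rho> a) (\<lambda>a0 a1. sw (tn A H) (\<tau> a1) (\<lambda>l r. sw (tn A H) (\<rho> r)
      (\<lambda>r0 r1. pure K A H (a0 \<otimes>\<^bsub>A\<^esub> (l \<otimes>\<^bsub>A\<^esub> r0)) r1)))"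
    using a by (intro rho_cong tau_cong) (simp_all add: A.A.m_assoc)
  also have "\<dots> = sw (tn A H) (\<rho> a) (\<lambda>a0 a1. pure K A H (a0 \<otimes>\<^bsub>A\<^esub> \<one>\<^bsub>A\<^esub>) a1)"
    using a by (intro rho_cong tau_can) (auto intro!: lins)
  also have "\<dots> = sw (tn A H) (\<rho> a) (\<lambda>a0 a1. pure K A H (\<one>\<^bsub>A\<^esub> \<otimes>\<^bsub>A\<^esub> a0) a1)"
    using a by (intro rho_cong) simp_all
  also have "\<dots> = right_can K H A \<rho> (pure K A A \<one>\<^bsub>A\<^esub> a)"
    unfolding right_can_def using a by (intro sw_pure[OF b, symmetric]) simp_all
  finally have "?t = pure K A A \<one>\<^bsub>A\<^esub> a"
    using t a by (intro rcan_inj) (auto intro!: pure_in)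
  then have "f \<one>\<^bsub>A\<^esub> a = sw G ?t f" using sw_pure[OF f] a by simp
  also have "\<dots> = sw G (\<rho> a) (\<lambda>a0 a1. sw G (?p a0 a1) f)"
    using a p f by (intro sw_sw) auto
  also have "\<dots> = sw G (\<rho> a) (\<lambda>a0 a1. sw G (\<tau> a1) (\<lambda>l r. sw G (pure K A A (a0 \<otimes>\<^bsub>A\<^esub> l) r) f))"
    using a by (intro rho_cong sw_sw[OF f, of A A]) (auto intro!: pure_in)
  also have "\<dots> = sw G (\<rho> a) (\<lambda>a0 a1. sw G (\<tau> a1) (\<lambda>l r. f (a0 \<otimes>\<^bsub>A\<^esub> l) r))"
    using a by (intro rho_cong tau_cong sw_pure[OF f]) auto
  finally show ?thesis ..
qed

text \<open>In Sweedler notation: \<open>l(h\<^sub>2)\<^sub>0 \<otimes> h\<^sub>1 l(h\<^sub>2)\<^sub>1 \<otimes> r(h\<^sub>2) = l(h) \<otimes> 1 \<otimes> r(h)\<close>. The coaction on the left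
  leg is given by the antipode, \<open>l(h)\<^sub>0 \<otimes> l(h)\<^sub>1 \<otimes> r(h) = l(h\<^sub>2) \<otimes> S(h\<^sub>1) \<otimes> r(h\<^sub>2)\<close>, and cancels
  against the factor in front of it.\<close>

lemma tau_coinv: assumes g: "tri A H A G g" and h: "h \<in> carrier H"
  shows "sw G (comult H h) (\<lambda>h1 h2. sw G (\<tau> h2) (\<lambda>l r. sw G (\<rho> l) (\<lambda>l0 l1. g l0 (h1 \<otimes>\<^bsub>H\<^esub> l1) r)))
     = sw G (\<tau> h) (\<lambda>l r. g l \<one>\<^bsub>H\<^esub> r)"
proof -
  note [lins] = triD[OF g] and [simp] = triD(5)[OF g]
  \<comment> \<open>by \<open>tau_rho\<close> every value of \<open>g\<close> is a sum of values of \<open>F\<close>, to which \<open>tau_can\<close> applies\<close>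
  define F where "F u c v = sw G (\<tau> v) (\<lambda>l r. g (u \<otimes>\<^bsub>A\<^esub> l) c r)" for u c v
  have F: "tri A H H G F" unfolding F_def by (auto intro!: lins)
  note [lins] = triD[OF F]
  have expand: "g x c y = sw G (\<rho> y) (\<lambda>y0 y1. F (x \<otimes>\<^bsub>A\<^esub> y0) c y1)"
    if "x \<in> carrier A" "c \<in> carrier H" "y \<in> carrier A" for x c y
  proof -
    have "sw G (\<rho> y) (\<lambda>y0 y1. F (x \<otimes>\<^bsub>A\<^esub> y0) c y1) = sw G (\<rho> y) (\<lambda>y0 y1. sw G (\<tau> y1) (\<lambda>l r. g (x \<otimes>\<^bsub>A\<^esub> (y0 \<otimes>\<^bsub>A\<^esub> l)) c r))"
      using that unfolding F_def by (intro rho_cong tau_cong) (simp_all add: A.A.m_assoc)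
    also have "\<dots> = g (x \<otimes>\<^bsub>A\<^esub> \<one>\<^bsub>A\<^esub>) c y" using that by (intro tau_rho) (auto intro!: lins)
    finally show ?thesis using that by simp
  qed
  have step: "sw G (\<tau> h2) (\<lambda>l r. sw G (\<rho> l) (\<lambda>l0 l1. g l0 (h1 \<otimes>\<^bsub>H\<^esub> l1) r))
      = sw G (comult H h2) (\<lambda>k1 k2. F \<one>\<^bsub>A\<^esub> (h1 \<otimes>\<^bsub>H\<^esub> antipode H k1) k2)"
    if hh: "h1 \<in> carrier H" "h2 \<in> carrier H" for h1 h2
  proof -
    define B where "B a v = sw G (\<rho> a) (\<lambda>a0 a1. sw G (comult H v) (\<lambda>k1 k2. F a0 (h1 \<otimes>\<^bsub>H\<^esub> (a1 \<otimes>\<^bsub>H\<^esub> antipode H k1)) k2))" for a v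
    have B: "bil A H G B" unfolding B_def using hh by (auto intro!: lins)
    have pt: "sw G (\<rho> l) (\<lambda>l0 l1. g l0 (h1 \<otimes>\<^bsub>H\<^esub> l1) r) = sw G (\<rho> r) (\<lambda>r0 r1. B (l \<otimes>\<^bsub>A\<^esub> r0) r1)"
      if lr: "l \<in> carrier A" "r \<in> carrier A" for l r
    proof -
      have "sw G (\<rho> r) (\<lambda>r0 r1. B (l \<otimes>\<^bsub>A\<^esub> r0) r1) = sw G (\<rho> r) (\<lambda>r0 r1. sw G (\<rho> l) (\<lambda>l0 l1. sw G (\<rho> r0) (\<lambda>s0 s1.
          sw G (comult H r1) (\<lambda>k1 k2. F (l0 \<otimes>\<^bsub>A\<^esub> s0) (h1 \<otimes>\<^bsub>H\<^esub> ((l1 \<otimes>\<^bsub>H\<^esub> s1) \<otimes>\<^bsub>H\<^esub> antipode H k1)) k2))))"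
        unfolding B_def using hh lr by (intro rho_cong rho_mult) (auto intro!: lins)
      also have "\<dots> = sw G (\<rho> l) (\<lambda>l0 l1. sw G (\<rho> r) (\<lambda>r0 r1. sw G (\<rho> r0) (\<lambda>s0 s1.
          sw G (comult H r1) (\<lambda>k1 k2. F (l0 \<otimes>\<^bsub>A\<^esub> s0) (h1 \<otimes>\<^bsub>H\<^esub> ((l1 \<otimes>\<^bsub>H\<^esub> s1) \<otimes>\<^bsub>H\<^esub> antipode H k1)) k2))))"
        using hh lr by (intro sw_swap[of A H A H]) (auto intro!: lins)
      also have "\<dots> = sw G (\<rho> l) (\<lambda>l0 l1. sw G (\<rho> r) (\<lambda>s0 v. sw G (comult H v) (\<lambda>s1 r1.
          sw G (comult H r1) (\<lambda>k1 k2. F (l0 \<otimes>\<^bsub>A\<^esub> s0) (h1 \<otimes>\<^bsub>H\<^esub> ((l1 \<otimes>\<^bsub>H\<^esub> s1) \<otimes>\<^bsub>H\<^esub> antipode H k1)) k2))))"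
        using hh lr by (intro rho_cong rho_coassoc) (auto intro!: lins)
      also have "\<dots> = sw G (\<rho> l) (\<lambda>l0 l1. sw G (\<rho> r) (\<lambda>s0 v. sw G (comult H v) (\<lambda>m k2.
          sw G (comult H m) (\<lambda>s1 k1. F (l0 \<otimes>\<^bsub>A\<^esub> s0) (h1 \<otimes>\<^bsub>H\<^esub> ((l1 \<otimes>\<^bsub>H\<^esub> s1) \<otimes>\<^bsub>H\<^esub> antipode H k1)) k2))))"
        using hh lr by (intro rho_cong H.coassoc[symmetric]) (auto intro!: lins)
      also have "\<dots> = sw G (\<rho> l) (\<lambda>l0 l1. sw G (\<rho> r) (\<lambda>s0 v. sw G (comult H v) (\<lambda>m k2.
          sw G (comult H m) (\<lambda>s1 k1. F (l0 \<otimes>\<^bsub>A\<^esub> s0) (h1 \<otimes>\<^bsub>H\<^esub> (l1 \<otimes>\<^bsub>H\<^esub> (s1 \<otimes>\<^bsub>H\<^esub> antipode H k1))) k2))))"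
        using hh lr by (intro rho_cong H.D_cong) (simp_all add: H.H.A.m_assoc)
      also have "\<dots> = sw G (\<rho> l) (\<lambda>l0 l1. sw G (\<rho> r) (\<lambda>s0 v. sw G (comult H v) (\<lambda>m k2.
          counit H m \<odot>\<^bsub>G\<^esub> F (l0 \<otimes>\<^bsub>A\<^esub> s0) (h1 \<otimes>\<^bsub>H\<^esub> (l1 \<otimes>\<^bsub>H\<^esub> \<one>\<^bsub>H\<^esub>)) k2)))"
        using hh lr by (intro rho_cong H.D_cong H.antipode_right) (auto intro!: lins)
      also have "\<dots> = sw G (\<rho> l) (\<lambda>l0 l1. sw G (\<rho> r) (\<lambda>s0 v. F (l0 \<otimes>\<^bsub>A\<^esub> s0) (h1 \<otimes>\<^bsub>H\<^esub> (l1 \<otimes>\<^bsub>H\<^esub> \<one>\<^bsub>H\<^esub>)) v))"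
        using hh lr by (intro rho_cong H.counit_left) (auto intro!: lins)
      also have "\<dots> = sw G (\<rho> l) (\<lambda>l0 l1. g l0 (h1 \<otimes>\<^bsub>H\<^esub> l1) r)"
        using hh lr by (intro rho_cong) (simp_all add: expand)
      finally show ?thesis ..
    qed
    have "sw G (\<tau> h2) (\<lambda>l r. sw G (\<rho> l) (\<lambda>l0 l1. g l0 (h1 \<otimes>\<^bsub>H\<^esub> l1) r)) = B \<one>\<^bsub>A\<^esub> h2"
      unfolding tau_can[OF B hh(2), symmetric] using hh by (intro tau_cong pt) auto
    also have "\<dots> = sw G (comult H h2) (\<lambda>k1 k2. F \<one>\<^bsub>A\<^esub> (h1 \<otimes>\<^bsub>H\<^esub> (\<one>\<^bsub>H\<^esub> \<otimes>\<^bsub>H\<^esub> antipode H k1)) k2)"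
      unfolding B_def using hh by (intro rho_one) (auto intro!: lins)
    also have "\<dots> = sw G (comult H h2) (\<lambda>k1 k2. F \<one>\<^bsub>A\<^esub> (h1 \<otimes>\<^bsub>H\<^esub> antipode H k1) k2)"
      using hh by (intro H.D_cong) simp_all
    finally show ?thesis .
  qed
  have "sw G (comult H h) (\<lambda>h1 h2. sw G (\<tau> h2) (\<lambda>l r. sw G (\<rho> l) (\<lambda>l0 l1. g l0 (h1 \<otimes>\<^bsub>H\<^esub> l1) r)))
    = sw G (comult H h) (\<lambda>h1 h2. sw G (comult H h2) (\<lambda>k1 k2. F \<one>\<^bsub>A\<^esub> (h1 \<otimes>\<^bsub>H\<^esub> antipode H k1) k2))"
    using h by (intro H.D_cong step) auto
  also have "\<dots> = sw G (comult H h) (\<lambda>m k2. sw G (comult H m) (\<lambda>h1 k1. F \<one>\<^bsub>A\<^esub> (h1 \<otimes>\<^bsub>H\<^esub> antipode H k1) k2))"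
    using h by (intro H.coassoc[symmetric]) (auto intro!: lins)
  also have "\<dots> = sw G (comult H h) (\<lambda>m k2. counit H m \<odot>\<^bsub>G\<^esub> F \<one>\<^bsub>A\<^esub> \<one>\<^bsub>H\<^esub> k2)"
    using h by (intro H.D_cong H.antipode_right) (auto intro!: lins)
  also have "\<dots> = F \<one>\<^bsub>A\<^esub> \<one>\<^bsub>H\<^esub> h"
    using h by (intro H.counit_left) (auto intro!: lins)
  also have "\<dots> = sw G (\<tau> h) (\<lambda>l r. g l \<one>\<^bsub>H\<^esub> r)"
    unfolding F_def using h by (intro tau_cong) simp_all
  finally show ?thesis .
qed

text \<open>Apply the counit to both sides of \<open>\<Sum> l r\<^sub>0 \<otimes> r\<^sub>1 = 1 \<otimes> h\<close>.\<close>

lemma tau_eval: assumes h: "h \<in> carrier H"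
  shows "sw A (\<tau> h) (\<lambda>l r. l \<otimes>\<^bsub>A\<^esub> r) = counit H h \<odot>\<^bsub>A\<^esub> \<one>\<^bsub>A\<^esub>"
proof -
  have "sw A (\<tau> h) (\<lambda>l r. l \<otimes>\<^bsub>A\<^esub> r) = sw A (\<tau> h) (\<lambda>l r. sw A (\<rho> r) (\<lambda>r0 r1. counit H r1 \<odot>\<^bsub>A\<^esub> (l \<otimes>\<^bsub>A\<^esub> r0)))"
    using h by (intro tau_cong rho_counit[symmetric]) (auto intro!: lins)
  also have "\<dots> = counit H h \<odot>\<^bsub>A\<^esub> \<one>\<^bsub>A\<^esub>"
    using h by (intro tau_can) (auto intro!: lins)
  finally show ?thesis .
qed

subsection \<open>The translation map of the left coaction\<close>

lemma lcan_lin: "lin (tn A A) (tn L A) (left_can K L A lam)"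
  unfolding left_can_def by (auto intro!: lins)

lemma sw_lcan: assumes "bil L A G B" "t \<in> carrier (tn A A)"
  shows "sw G (left_can K L A lam t) B = sw G t (\<lambda>a b. sw G (lam a) (\<lambda>a1 a0. B a1 (a0 \<otimes>\<^bsub>A\<^esub> b)))"
proof -
  have "sw G (left_can K L A lam t) B
     = sw G t (\<lambda>a b. sw G (sw (tn L A) (lam a) (\<lambda>a1 a0. pure K L A a1 (a0 \<otimes>\<^bsub>A\<^esub> b))) B)"
    unfolding left_can_def using assms by (intro sw_sw) (auto intro!: lins)
  also have "\<dots> = sw G t (\<lambda>a b. sw G (lam a) (\<lambda>a1 a0. sw G (pure K L A a1 (a0 \<otimes>\<^bsub>A\<^esub> b)) B))"
    using assms by (intro sw_cong[of A A] sw_sw[of L A _ _ L A]) (auto intro!: pure_in)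
  also have "\<dots> = sw G t (\<lambda>a b. sw G (lam a) (\<lambda>a1 a0. B a1 (a0 \<otimes>\<^bsub>A\<^esub> b)))"
    using assms by (intro sw_cong[of A A] lam_cong sw_pure) auto
  finally show ?thesis .
qed

text \<open>The counterpart of \<open>\<tau>\<close> for the left coaction; it will identify \<open>L\<close> with the cotensor product.\<close>

definition \<delta> where "\<delta> l = inv_into (carrier (tn A A)) (left_can K L A lam) (pure K L A l \<one>\<^bsub>A\<^esub>)"

lemma delta_lin: "lin L (tn A A) \<delta>"
  unfolding \<delta>_def by (rule lin_comp[OF lin_inv_into[OF lcan_lin lcan_bij]]) (auto intro!: lins)

lemmas delta_lins [lins] = lin_comp[OF delta_lin]

lemma delta_in [simp, lins]: "l \<in> carrier L \<Longrightarrow> \<delta> l \<in> carrier (tn A A)" using linD(3)[OF delta_lin] .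

lemmas delta_cong = sw_cong[OF A.A_module A.A_module delta_in]
lemmas delta_push = sw_push[OF _ A.A_module A.A_module delta_in]

lemma lcan_delta: "l \<in> carrier L \<Longrightarrow> left_can K L A lam (\<delta> l) = pure K L A l \<one>\<^bsub>A\<^esub>"
  unfolding \<delta>_def using lcan_bij
  by (intro f_inv_into_f) (auto simp: bij_betw_def intro!: pure_in)

lemma lcan_inj: "s \<in> carrier (tn A A) \<Longrightarrow> t \<in> carrier (tn A A) \<Longrightarrow> left_can K L A lam s = left_can K L A lam t \<Longrightarrow> s = t"
  using lcan_bij by (auto simp: bij_betw_def dest: inj_onD)

lemma delta_can: assumes "bil L A G B" "l \<in> carrier L"
  shows "sw G (\<delta> l) (\<lambda>x y. sw G (lam x) (\<lambda>x1 x0. B x1 (x0 \<otimes>\<^bsub>A\<^esub> y))) = B l \<one>\<^bsub>A\<^esub>"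
  using sw_lcan[OF assms(1) delta_in[OF assms(2)]] lcan_delta[OF assms(2)] sw_pure[OF assms(1,2)] by simp

text \<open>The mirror image of \<open>tau_rho\<close>.\<close>

lemma delta_lam: assumes f: "bil A A G f" and a: "a \<in> carrier A"
  shows "sw G (lam a) (\<lambda>a1 a0. sw G (\<delta> a1) (\<lambda>x y. f x (y \<otimes>\<^bsub>A\<^esub> a0))) = f a \<one>\<^bsub>A\<^esub>"
proof -
  let ?p = "\<lambda>a1 a0. sw (tn A A) (\<delta> a1) (\<lambda>x y. pure K A A x (y \<otimes>\<^bsub>A\<^esub> a0))"
  let ?t = "sw (tn A A) (lam a) ?p"
  let ?b = "\<lambda>a b. sw (tn L A) (lam a) (\<lambda>a1 a0. pure K L A a1 (a0 \<otimes>\<^bsub>A\<^esub> b))"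
  have p: "?p a1 a0 \<in> carrier (tn A A)" if "a0 \<in> carrier A" "a1 \<in> carrier L" for a0 a1
    using that by (auto intro!: lins)
  have t: "?t \<in> carrier (tn A A)" using a p by (auto intro!: sw_in[of L A])
  have b: "bil A A (tn L A) ?b" by (auto intro!: lins)
  have "left_can K L A lam ?t = sw (tn L A) (lam a) (\<lambda>a1 a0. sw (tn L A) (?p a1 a0) ?b)"
    unfolding left_can_def using a p b by (intro sw_sw) auto
  also have "\<dots> = sw (tn L A) (lam a) (\<lambda>a1 a0. sw (tn L A) (\<delta> a1) (\<lambda>x y. sw (tn L A) (pure K A A x (y \<otimes>\<^bsub>A\<^esub> a0)) ?b))"
    using a b by (intro lam_cong sw_sw[OF b, of A A]) (auto intro!: pure_in)
  also have "\<dots> = sw (tn L A) (lam a) (\<lambda>a1 a0. sw (tn L A) (\<delta> a1) (\<lambda>x y. ?b x (y \<otimes>\<^bsub>A\<^esub> a0)))"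
    using a by (intro lam_cong delta_cong sw_pure[OF b]) auto
  also have "\<dots> = sw (tn L A) (lam a) (\<lambda>a1 a0. sw (tn L A) (\<delta> a1) (\<lambda>x y. sw (tn L A) (lam x)
      (\<lambda>x1 x0. pure K L A x1 ((x0 \<otimes>\<^bsub>A\<^esub> y) \<otimes>\<^bsub>A\<^esub> a0))))"
    using a by (intro lam_cong delta_cong) (simp_all add: A.A.m_assoc)
  also have "\<dots> = sw (tn L A) (lam a) (\<lambda>a1 a0. pure K L A a1 (\<one>\<^bsub>A\<^esub> \<otimes>\<^bsub>A\<^esub> a0))"
    using a by (intro lam_cong delta_can) (auto intro!: lins)
  also have "\<dots> = sw (tn L A) (lam a) (\<lambda>a1 a0. pure K L A a1 (a0 \<otimes>\<^bsub>A\<^esub> \<one>\<^bsub>A\<^esub>))"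
    using a by (intro lam_cong) simp_all
  also have "\<dots> = left_can K L A lam (pure K A A a \<one>\<^bsub>A\<^esub>)"
    unfolding left_can_def using a by (intro sw_pure[OF b, symmetric]) simp_all
  finally have "?t = pure K A A a \<one>\<^bsub>A\<^esub>"
    using t a by (intro lcan_inj) (auto intro!: pure_in)
  then have "f a \<one>\<^bsub>A\<^esub> = sw G ?t f" using sw_pure[OF f] a by simp
  also have "\<dots> = sw G (lam a) (\<lambda>a1 a0. sw G (?p a1 a0) f)"
    using a p f by (intro sw_sw) auto
  also have "\<dots> = sw G (lam a) (\<lambda>a1 a0. sw G (\<delta> a1) (\<lambda>x y. sw G (pure K A A x (y \<otimes>\<^bsub>A\<^esub> a0)) f))"
    using a by (intro lam_cong sw_sw[OF f, of A A]) (auto intro!: pure_in)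
  also have "\<dots> = sw G (lam a) (\<lambda>a1 a0. sw G (\<delta> a1) (\<lambda>x y. f x (y \<otimes>\<^bsub>A\<^esub> a0)))"
    using a by (intro lam_cong delta_cong sw_pure[OF f]) auto
  finally show ?thesis ..
qed

lemma delta_one: "\<delta> \<one>\<^bsub>L\<^esub> = pure K A A \<one>\<^bsub>A\<^esub> \<one>\<^bsub>A\<^esub>"
proof (rule lcan_inj)
  have b: "bil A A (tn L A) (\<lambda>a b. sw (tn L A) (lam a) (\<lambda>a1 a0. pure K L A a1 (a0 \<otimes>\<^bsub>A\<^esub> b)))" by (auto intro!: lins)
  have "left_can K L A lam (pure K A A \<one>\<^bsub>A\<^esub> \<one>\<^bsub>A\<^esub>) = sw (tn L A) (lam \<one>\<^bsub>A\<^esub>) (\<lambda>a1 a0. pure K L A a1 (a0 \<otimes>\<^bsub>A\<^esub> \<one>\<^bsub>A\<^esub>))"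
    unfolding left_can_def by (rule sw_pure[OF b]) simp_all
  also have "\<dots> = pure K L A \<one>\<^bsub>L\<^esub> (\<one>\<^bsub>A\<^esub> \<otimes>\<^bsub>A\<^esub> \<one>\<^bsub>A\<^esub>)" by (rule lam_one) (auto intro!: lins)
  finally show "left_can K L A lam (\<delta> \<one>\<^bsub>L\<^esub>) = left_can K L A lam (pure K A A \<one>\<^bsub>A\<^esub> \<one>\<^bsub>A\<^esub>)"
    by (simp add: lcan_delta)
qed (auto intro!: pure_in)

text \<open>The product on the right is that of \<open>A \<otimes> A\<^sup>o\<^sup>p\<close>. The left canonical map sends it to \<open>ll' \<otimes> 1\<close>,
  since \<open>lam\<close> is multiplicative and \<open>delta_can\<close> evaluates the inner pair and then the outer one.\<close>

lemma delta_mult: assumes l: "l \<in> carrier L" "l' \<in> carrier L"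
  shows "\<delta> (l \<otimes>\<^bsub>L\<^esub> l') = sw (tn A A) (\<delta> l) (\<lambda>x y. sw (tn A A) (\<delta> l') (\<lambda>x' y'. pure K A A (x \<otimes>\<^bsub>A\<^esub> x') (y' \<otimes>\<^bsub>A\<^esub> y)))"
    (is "_ = ?t")
proof (rule lcan_inj)
  let ?b = "\<lambda>a b. sw (tn L A) (lam a) (\<lambda>a1 a0. pure K L A a1 (a0 \<otimes>\<^bsub>A\<^esub> b))"
  have b: "bil A A (tn L A) ?b" by (auto intro!: lins)
  show "?t \<in> carrier (tn A A)" "\<delta> (l \<otimes>\<^bsub>L\<^esub> l') \<in> carrier (tn A A)" using l by (auto intro!: lins)
  have "left_can K L A lam ?t = sw (tn L A) (\<delta> l) (\<lambda>x y. sw (tn L A) (sw (tn A A) (\<delta> l') (\<lambda>x' y'. pure K A A (x \<otimes>\<^bsub>A\<^esub> x') (y' \<otimes>\<^bsub>A\<^esub> y))) ?b)"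
    unfolding left_can_def using l b by (intro sw_sw) (auto intro!: lins)
  also have "\<dots> = sw (tn L A) (\<delta> l) (\<lambda>x y. sw (tn L A) (\<delta> l') (\<lambda>x' y'. sw (tn L A) (pure K A A (x \<otimes>\<^bsub>A\<^esub> x') (y' \<otimes>\<^bsub>A\<^esub> y)) ?b))"
    using l by (intro delta_cong sw_sw[OF b, of A A]) (auto intro!: pure_in)
  also have "\<dots> = sw (tn L A) (\<delta> l) (\<lambda>x y. sw (tn L A) (\<delta> l') (\<lambda>x' y'. ?b (x \<otimes>\<^bsub>A\<^esub> x') (y' \<otimes>\<^bsub>A\<^esub> y)))"
    using l by (intro delta_cong sw_pure[OF b]) auto
  also have "\<dots> = sw (tn L A) (\<delta> l) (\<lambda>x y. sw (tn L A) (\<delta> l') (\<lambda>x' y'. sw (tn L A) (lam x) (\<lambda>x1 x0. sw (tn L A) (lam x') (\<lambda>z1 z0.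
      pure K L A (x1 \<otimes>\<^bsub>L\<^esub> z1) ((x0 \<otimes>\<^bsub>A\<^esub> z0) \<otimes>\<^bsub>A\<^esub> (y' \<otimes>\<^bsub>A\<^esub> y))))))"
    using l by (intro delta_cong lam_mult) (auto intro!: lins)
  also have "\<dots> = sw (tn L A) (\<delta> l) (\<lambda>x y. sw (tn L A) (lam x) (\<lambda>x1 x0. sw (tn L A) (\<delta> l') (\<lambda>x' y'. sw (tn L A) (lam x') (\<lambda>z1 z0.
      pure K L A (x1 \<otimes>\<^bsub>L\<^esub> z1) ((x0 \<otimes>\<^bsub>A\<^esub> z0) \<otimes>\<^bsub>A\<^esub> (y' \<otimes>\<^bsub>A\<^esub> y))))))"
    using l by (intro delta_cong sw_swap[of A A L A]) (auto intro!: lins)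
  also have "\<dots> = sw (tn L A) (\<delta> l) (\<lambda>x y. sw (tn L A) (lam x) (\<lambda>x1 x0. sw (tn L A) (\<delta> l') (\<lambda>x' y'. sw (tn L A) (lam x') (\<lambda>z1 z0.
      pure K L A (x1 \<otimes>\<^bsub>L\<^esub> z1) (x0 \<otimes>\<^bsub>A\<^esub> ((z0 \<otimes>\<^bsub>A\<^esub> y') \<otimes>\<^bsub>A\<^esub> y))))))"
    using l by (intro delta_cong lam_cong) (simp_all add: A.A.m_assoc)
  also have "\<dots> = sw (tn L A) (\<delta> l) (\<lambda>x y. sw (tn L A) (lam x) (\<lambda>x1 x0. pure K L A (x1 \<otimes>\<^bsub>L\<^esub> l') (x0 \<otimes>\<^bsub>A\<^esub> (\<one>\<^bsub>A\<^esub> \<otimes>\<^bsub>A\<^esub> y))))"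
    using l by (intro delta_cong lam_cong delta_can) (auto intro!: lins)
  also have "\<dots> = sw (tn L A) (\<delta> l) (\<lambda>x y. sw (tn L A) (lam x) (\<lambda>x1 x0. pure K L A (x1 \<otimes>\<^bsub>L\<^esub> l') (x0 \<otimes>\<^bsub>A\<^esub> y)))"
    using l by (intro delta_cong lam_cong) simp_all
  also have "\<dots> = pure K L A (l \<otimes>\<^bsub>L\<^esub> l') \<one>\<^bsub>A\<^esub>"
    using l by (intro delta_can) (auto intro!: lins)
  finally show "left_can K L A lam (\<delta> (l \<otimes>\<^bsub>L\<^esub> l')) = left_can K L A lam ?t"
    using l by (simp add: lcan_delta)
qed

lemma sw_delta_mult: assumes f: "bil A A G f" and l: "l \<in> carrier L" "l' \<in> carrier L"
  shows "sw G (\<delta> (l \<otimes>\<^bsub>L\<^esub> l')) f = sw G (\<delta> l) (\<lambda>x y. sw G (\<delta> l') (\<lambda>x' y'. f (x \<otimes>\<^bsub>A\<^esub> x') (y' \<otimes>\<^bsub>A\<^esub> y)))"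
proof -
  have "sw G (\<delta> (l \<otimes>\<^bsub>L\<^esub> l')) f = sw G (\<delta> l) (\<lambda>x y. sw G (sw (tn A A) (\<delta> l') (\<lambda>x' y'. pure K A A (x \<otimes>\<^bsub>A\<^esub> x') (y' \<otimes>\<^bsub>A\<^esub> y))) f)"
    unfolding delta_mult[OF l] using l f by (intro sw_sw) (auto intro!: lins)
  also have "\<dots> = sw G (\<delta> l) (\<lambda>x y. sw G (\<delta> l') (\<lambda>x' y'. sw G (pure K A A (x \<otimes>\<^bsub>A\<^esub> x') (y' \<otimes>\<^bsub>A\<^esub> y)) f))"
    using l by (intro delta_cong sw_sw[OF f, of A A]) (auto intro!: pure_in)
  also have "\<dots> = sw G (\<delta> l) (\<lambda>x y. sw G (\<delta> l') (\<lambda>x' y'. f (x \<otimes>\<^bsub>A\<^esub> x') (y' \<otimes>\<^bsub>A\<^esub> y)))"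
    using l by (intro delta_cong sw_pure[OF f]) auto
  finally show ?thesis .
qed

text \<open>The image of \<open>\<delta>\<close> is coinvariant under the codiagonal coaction of \<open>H\<close>. By \<open>delta_lam\<close> any
  expression in \<open>x \<otimes> y\<close> depends only on \<open>x\<^sub>-\<^sub>1 \<otimes> x\<^sub>0y\<close>. As the two coactions commute, the coaction
  of \<open>H\<close> is then that of \<open>x\<^sub>0y\<close>, and \<open>\<Sum> x\<^sub>-\<^sub>1 \<otimes> x\<^sub>0y = l \<otimes> 1\<close> has a coinvariant right factor.\<close>

lemma delta_coinv: assumes g: "tri A A H G g" and l: "l \<in> carrier L"
  shows "sw G (\<delta> l) (\<lambda>x y. sw G (\<rho> x) (\<lambda>x0 x1. sw G (\<rho> y) (\<lambda>y0 y1. g x0 y0 (x1 \<otimes>\<^bsub>H\<^esub> y1))))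
     = sw G (\<delta> l) (\<lambda>x y. g x y \<one>\<^bsub>H\<^esub>)"
proof -
  note [lins] = triD[OF g] and [simp] = triD(5)[OF g]
  define F where "F v u c = sw G (\<delta> v) (\<lambda>x y. g x (y \<otimes>\<^bsub>A\<^esub> u) c)" for v u c
  have F: "tri L A H G F" unfolding F_def by (auto intro!: lins)
  note [lins] = triD[OF F]
  have expand: "g x y c = sw G (lam x) (\<lambda>x1 x0. F x1 (x0 \<otimes>\<^bsub>A\<^esub> y) c)"
    if "x \<in> carrier A" "c \<in> carrier H" "y \<in> carrier A" for x y c
  proof -
    have "sw G (lam x) (\<lambda>x1 x0. F x1 (x0 \<otimes>\<^bsub>A\<^esub> y) c) = sw G (lam x) (\<lambda>x1 x0. sw G (\<delta> x1) (\<lambda>u v. g u ((v \<otimes>\<^bsub>A\<^esub> x0) \<otimes>\<^bsub>A\<^esub> y) c))"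
      using that unfolding F_def by (intro lam_cong delta_cong) (simp_all add: A.A.m_assoc)
    also have "\<dots> = g x (\<one>\<^bsub>A\<^esub> \<otimes>\<^bsub>A\<^esub> y) c" using that by (intro delta_lam) (auto intro!: lins)
    finally show ?thesis using that by simp
  qed
  have pt: "sw G (\<rho> x) (\<lambda>x0 x1. sw G (\<rho> y) (\<lambda>y0 y1. g x0 y0 (x1 \<otimes>\<^bsub>H\<^esub> y1)))
      = sw G (lam x) (\<lambda>x1 x0. sw G (\<rho> (x0 \<otimes>\<^bsub>A\<^esub> y)) (\<lambda>u0 u1. F x1 u0 u1))"
    if h: "x \<in> carrier A" "y \<in> carrier A" for x y
  proof -
    have "sw G (\<rho> x) (\<lambda>x0 x1. sw G (\<rho> y) (\<lambda>y0 y1. g x0 y0 (x1 \<otimes>\<^bsub>H\<^esub> y1)))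
      = sw G (\<rho> x) (\<lambda>x0 x1. sw G (\<rho> y) (\<lambda>y0 y1. sw G (lam x0) (\<lambda>z1 z0. F z1 (z0 \<otimes>\<^bsub>A\<^esub> y0) (x1 \<otimes>\<^bsub>H\<^esub> y1))))"
      using h by (intro rho_cong expand) auto
    also have "\<dots> = sw G (\<rho> x) (\<lambda>x0 x1. sw G (lam x0) (\<lambda>z1 z0. sw G (\<rho> y) (\<lambda>y0 y1. F z1 (z0 \<otimes>\<^bsub>A\<^esub> y0) (x1 \<otimes>\<^bsub>H\<^esub> y1))))"
      using h by (intro rho_cong sw_swap[of A H L A]) (auto intro!: lins)
    also have "\<dots> = sw G (lam x) (\<lambda>z1 x0. sw G (\<rho> x0) (\<lambda>z0 x1. sw G (\<rho> y) (\<lambda>y0 y1. F z1 (z0 \<otimes>\<^bsub>A\<^esub> y0) (x1 \<otimes>\<^bsub>H\<^esub> y1))))"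
      using h by (intro bicomod) (auto intro!: lins)
    also have "\<dots> = sw G (lam x) (\<lambda>z1 x0. sw G (\<rho> (x0 \<otimes>\<^bsub>A\<^esub> y)) (\<lambda>u0 u1. F z1 u0 u1))"
      using h by (intro lam_cong rho_mult[symmetric]) (auto intro!: lins)
    finally show ?thesis .
  qed
  have "sw G (\<delta> l) (\<lambda>x y. sw G (\<rho> x) (\<lambda>x0 x1. sw G (\<rho> y) (\<lambda>y0 y1. g x0 y0 (x1 \<otimes>\<^bsub>H\<^esub> y1))))
    = sw G (\<delta> l) (\<lambda>x y. sw G (lam x) (\<lambda>x1 x0. sw G (\<rho> (x0 \<otimes>\<^bsub>A\<^esub> y)) (\<lambda>u0 u1. F x1 u0 u1)))"
    using l by (intro delta_cong pt)
  also have "\<dots> = sw G (\<rho> \<one>\<^bsub>A\<^esub>) (\<lambda>u0 u1. F l u0 u1)"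
    using l by (intro delta_can[where B = "\<lambda>x1 v. sw G (\<rho> v) (\<lambda>u0 u1. F x1 u0 u1)"]) (auto intro!: lins)
  also have "\<dots> = F l \<one>\<^bsub>A\<^esub> \<one>\<^bsub>H\<^esub>" using l by (intro rho_one) (auto intro!: lins)
  also have "\<dots> = sw G (\<delta> l) (\<lambda>x y. g x y \<one>\<^bsub>H\<^esub>)" unfolding F_def using l by (intro delta_cong) simp_all
  finally show ?thesis .
qed

text \<open>\<open>\<delta>\<close> turns the comultiplication of \<open>L\<close> into \<open>a \<otimes> b \<mapsto> a\<^sub>0 \<otimes> l(a\<^sub>1) \<otimes> r(a\<^sub>1) \<otimes> b\<close>. Expanding the
  first leg by \<open>delta_lam\<close> brings \<open>a\<^sub>0\<close> next to \<open>l(a\<^sub>1)\<close>, where \<open>tau_rho\<close> removes \<open>\<tau>\<close>; expanding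
  the third leg in the same way leaves two successive coactions of \<open>L\<close>, hence its comultiplication.\<close>

lemma delta_comult: assumes g: "quad A A A A G g" and l: "l \<in> carrier L"
  shows "sw G (\<delta> l) (\<lambda>a b. sw G (\<rho> a) (\<lambda>a0 a1. sw G (\<tau> a1) (\<lambda>p q. g a0 p q b)))
     = sw G (comult L l) (\<lambda>l1 l2. sw G (\<delta> l1) (\<lambda>x y. sw G (\<delta> l2) (\<lambda>z w. g x y z w)))"
proof -
  note [lins] = quadD[OF g] and [simp] = quadD(6)[OF g]
  define F where "F v u z w = sw G (\<delta> v) (\<lambda>x y. g x (y \<otimes>\<^bsub>A\<^esub> u) z w)" for v u z w
  have F: "quad L A A A G F" unfolding F_def by (auto intro!: lins)
  note [lins] = quadD[OF F]
  define F' where "F' v v' u = sw G (\<delta> v') (\<lambda>z w. F v \<one>\<^bsub>A\<^esub> z (w \<otimes>\<^bsub>A\<^esub> u))" for v v' u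
  have F': "tri L L A G F'" unfolding F'_def by (auto intro!: lins)
  note [lins] = triD[OF F']
  have expand: "g x y z w = sw G (lam x) (\<lambda>x1 x0. F x1 (x0 \<otimes>\<^bsub>A\<^esub> y) z w)"
    if "x \<in> carrier A" "y \<in> carrier A" "z \<in> carrier A" "w \<in> carrier A" for x y z w
  proof -
    have "sw G (lam x) (\<lambda>x1 x0. F x1 (x0 \<otimes>\<^bsub>A\<^esub> y) z w) = sw G (lam x) (\<lambda>x1 x0. sw G (\<delta> x1) (\<lambda>u v. g u ((v \<otimes>\<^bsub>A\<^esub> x0) \<otimes>\<^bsub>A\<^esub> y) z w))"
      using that unfolding F_def by (intro lam_cong delta_cong) (simp_all add: A.A.m_assoc)
    also have "\<dots> = g x (\<one>\<^bsub>A\<^esub> \<otimes>\<^bsub>A\<^esub> y) z w" using that by (intro delta_lam) (auto intro!: lins)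
    finally show ?thesis using that by simp
  qed
  have expand': "F v \<one>\<^bsub>A\<^esub> z w = sw G (lam z) (\<lambda>z1 z0. F' v z1 (z0 \<otimes>\<^bsub>A\<^esub> w))"
    if "v \<in> carrier L" "z \<in> carrier A" "w \<in> carrier A" for v z w
  proof -
    have "sw G (lam z) (\<lambda>z1 z0. F' v z1 (z0 \<otimes>\<^bsub>A\<^esub> w)) = sw G (lam z) (\<lambda>z1 z0. sw G (\<delta> z1) (\<lambda>x y. F v \<one>\<^bsub>A\<^esub> x ((y \<otimes>\<^bsub>A\<^esub> z0) \<otimes>\<^bsub>A\<^esub> w)))"
      using that unfolding F'_def by (intro lam_cong delta_cong) (simp_all add: A.A.m_assoc)
    also have "\<dots> = F v \<one>\<^bsub>A\<^esub> z (\<one>\<^bsub>A\<^esub> \<otimes>\<^bsub>A\<^esub> w)" using that by (intro delta_lam) (auto intro!: lins)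
    finally show ?thesis using that by simp
  qed
  have pt: "sw G (\<rho> a) (\<lambda>a0 a1. sw G (\<tau> a1) (\<lambda>p q. g a0 p q b))
      = sw G (lam a) (\<lambda>v u. sw G (comult L v) (\<lambda>v1 v2. F' v1 v2 (u \<otimes>\<^bsub>A\<^esub> b)))"
    if h: "a \<in> carrier A" "b \<in> carrier A" for a b
  proof -
    have "sw G (\<rho> a) (\<lambda>a0 a1. sw G (\<tau> a1) (\<lambda>p q. g a0 p q b))
      = sw G (\<rho> a) (\<lambda>a0 a1. sw G (\<tau> a1) (\<lambda>p q. sw G (lam a0) (\<lambda>z1 z0. F z1 (z0 \<otimes>\<^bsub>A\<^esub> p) q b)))"
      using h by (intro rho_cong tau_cong expand) auto
    also have "\<dots> = sw G (\<rho> a) (\<lambda>a0 a1. sw G (lam a0) (\<lambda>z1 z0. sw G (\<tau> a1) (\<lambda>p q. F z1 (z0 \<otimes>\<^bsub>A\<^esub> p) q b)))"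
      using h by (intro rho_cong sw_swap[of A A L A]) (auto intro!: lins)
    also have "\<dots> = sw G (lam a) (\<lambda>z1 x. sw G (\<rho> x) (\<lambda>z0 a1. sw G (\<tau> a1) (\<lambda>p q. F z1 (z0 \<otimes>\<^bsub>A\<^esub> p) q b)))"
      using h by (intro bicomod) (auto intro!: lins)
    also have "\<dots> = sw G (lam a) (\<lambda>z1 x. F z1 \<one>\<^bsub>A\<^esub> x b)"
      using h by (intro lam_cong tau_rho) (auto intro!: lins)
    also have "\<dots> = sw G (lam a) (\<lambda>z1 x. sw G (lam x) (\<lambda>x1 x0. F' z1 x1 (x0 \<otimes>\<^bsub>A\<^esub> b)))"
      using h by (intro lam_cong expand')
    also have "\<dots> = sw G (lam a) (\<lambda>v u. sw G (comult L v) (\<lambda>v1 v2. F' v1 v2 (u \<otimes>\<^bsub>A\<^esub> b)))"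
      using h by (intro lam_coassoc[symmetric]) (auto intro!: lins)
    finally show ?thesis .
  qed
  have "sw G (\<delta> l) (\<lambda>a b. sw G (\<rho> a) (\<lambda>a0 a1. sw G (\<tau> a1) (\<lambda>p q. g a0 p q b)))
    = sw G (\<delta> l) (\<lambda>a b. sw G (lam a) (\<lambda>v u. sw G (comult L v) (\<lambda>v1 v2. F' v1 v2 (u \<otimes>\<^bsub>A\<^esub> b))))"
    using l by (intro delta_cong pt)
  also have "\<dots> = sw G (comult L l) (\<lambda>v1 v2. F' v1 v2 \<one>\<^bsub>A\<^esub>)"
    using l by (intro delta_can[where B = "\<lambda>v u. sw G (comult L v) (\<lambda>v1 v2. F' v1 v2 u)"]) (auto intro!: lins)
  also have "\<dots> = sw G (comult L l) (\<lambda>l1 l2. sw G (\<delta> l2) (\<lambda>z w. sw G (\<delta> l1) (\<lambda>x y. g x y z w)))"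
    unfolding F'_def F_def using l by (intro L.D_cong delta_cong) simp_all
  also have "\<dots> = sw G (comult L l) (\<lambda>l1 l2. sw G (\<delta> l1) (\<lambda>x y. sw G (\<delta> l2) (\<lambda>z w. g x y z w)))"
    using l by (intro L.D_cong sw_swap[of A A A A]) (auto intro!: lins)
  finally show ?thesis .
qed

text \<open>Apply the counit to both sides of \<open>\<Sum> x\<^sub>-\<^sub>1 \<otimes> x\<^sub>0y = l \<otimes> 1\<close>.\<close>

lemma delta_eval: assumes l: "l \<in> carrier L"
  shows "sw A (\<delta> l) (\<lambda>x y. x \<otimes>\<^bsub>A\<^esub> y) = counit L l \<odot>\<^bsub>A\<^esub> \<one>\<^bsub>A\<^esub>"
proof -
  have "sw A (\<delta> l) (\<lambda>x y. x \<otimes>\<^bsub>A\<^esub> y) = sw A (\<delta> l) (\<lambda>x y. sw A (lam x) (\<lambda>x1 x0. counit L x1 \<odot>\<^bsub>A\<^esub> (x0 \<otimes>\<^bsub>A\<^esub> y)))"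
    using l by (intro delta_cong lam_counit[symmetric]) (auto intro!: lins)
  also have "\<dots> = counit L l \<odot>\<^bsub>A\<^esub> \<one>\<^bsub>A\<^esub>"
    using l by (intro delta_can) (auto intro!: lins)
  finally show ?thesis .
qed

end

section \<open>Tensor products of modules with the same linear structure\<close>

lemma tensor_cong_fields:
  assumes "carrier M' = carrier M" "add M' = add M" "\<zero>\<^bsub>M'\<^esub> = \<zero>\<^bsub>M\<^esub>"
    and "carrier N' = carrier N" "add N' = add N" "\<zero>\<^bsub>N'\<^esub> = \<zero>\<^bsub>N\<^esub>"
    and "tensor_cong S r l M N xs ys"
  shows "tensor_cong S r l M' N' xs ys"
  using assms(7)
proof induction
  case (tc_sym xs ys) then show ?case by (rule_tac tensor_cong.tc_sym)
next
  case (tc_trans xs ys zs) show ?case by (rule tensor_cong.tc_trans[OF tc_trans.IH])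
next
  case (tc_append xs xs' ys ys') then show ?case by (rule_tac tensor_cong.tc_append)
next
  case (tc_zero_left n)
  then show ?case using tensor_cong.tc_zero_left[of n N' S r l M'] by (simp add: assms)
next
  case (tc_zero_right m)
  then show ?case using tensor_cong.tc_zero_right[of m M' S r l N'] by (simp add: assms)
next
  case (tc_add_left m m' n)
  then show ?case using tensor_cong.tc_add_left[of m M' m' n N' S r l] by (simp add: assms)
next
  case (tc_add_right m n n')
  then show ?case using tensor_cong.tc_add_right[of m M' n N' n' S r l] by (simp add: assms)
next
  case (tc_balanced m s n)
  then show ?case using tensor_cong.tc_balanced[of m M' s S n N' r l] by (simp add: assms)
qed (auto simp: assms intro!: tensor_cong.tc_refl tensor_cong.tc_comm)

text \<open>Tensor products and linear maps see only these components of a record. This identifies tensors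
  over \<open>A\<close> and \<open>A\<^sup>o\<^sup>p\<close>, and over a module and the same module with an action or a coaction.\<close>

definition same_sp where
  "same_sp M M' \<longleftrightarrow> carrier M' = carrier M \<and> add M' = add M \<and> \<zero>\<^bsub>M'\<^esub> = \<zero>\<^bsub>M\<^esub> \<and> smult M' = smult M"

lemma same_spD: assumes "same_sp M M'"
  shows "carrier M' = carrier M" "add M' = add M" "\<zero>\<^bsub>M'\<^esub> = \<zero>\<^bsub>M\<^esub>" "smult M' = smult M"
  using assms unfolding same_sp_def by auto

lemma tensor_class_fields:
  assumes "same_sp M M'" "same_sp N N'" shows "tensor_class S r l M' N' = tensor_class S r l M N"
proof -
  note M = same_spD[OF assms(1)] and N = same_spD[OF assms(2)]
  have "tensor_cong S r l M' N' xs ys = tensor_cong S r l M N xs ys" for xs ys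
    by (rule iffI; rule tensor_cong_fields; (assumption | rule M[symmetric] N[symmetric] M N))
  then have "tensor_cong S r l M' N' = tensor_cong S r l M N" by (intro ext)
  then show ?thesis unfolding tensor_class_def by simp
qed

context fieldK
begin

lemma same_pure: assumes "same_sp M M'" "same_sp N N'" shows "pure K M' N' = pure K M N"
  by (intro ext) (simp add: pure_def tensor_class_fields[OF assms] same_spD[OF assms(1)] same_spD[OF assms(2)])

lemma same_tens: assumes "same_sp M M'" "same_sp N N'" shows "same_sp (tn M N) (tn M' N')"
  unfolding same_sp_def tens_simps
  by (simp add: balanced_tensor_def tensor_class_fields[OF assms] same_spD[OF assms(1)] same_spD[OF assms(2)])

lemma same_lift: assumes "same_sp G G'" shows "tensor_lift G' = tensor_lift G"
  by (intro ext) (simp add: tensor_lift_def pair_sum_def same_spD[OF assms])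

lemma same_tmap: assumes "same_sp M M'" "same_sp N N'" shows "tmap K M' N' = tmap K M N"
  by (intro ext) (simp add: tmap_def same_pure[OF assms] same_lift[OF same_tens[OF assms]])

lemma same_refl: "same_sp M M" by (simp add: same_sp_def)

lemma same_tassoc: assumes "same_sp M M'" "same_sp N N'" "same_sp P P'"
  shows "tassoc K M' N' P' = tassoc K M N P"
proof -
  note t = same_tens[OF assms(1) same_tens[OF assms(2,3)]]
  show ?thesis
    by (intro ext) (simp add: tassoc_def Let_def same_lift[OF t] same_pure[OF assms(1) same_tens[OF assms(2,3)]]
        same_pure[OF assms(2,3)])
qed

lemma same_module: "same_sp M M' \<Longrightarrow> module K M \<Longrightarrow> module K M'"
  by (rule module_carrier_cong) (simp_all add: same_spD)

lemma same_lin: "same_sp M M' \<Longrightarrow> same_sp N N' \<Longrightarrow> lin M N f \<Longrightarrow> lin M' N' f"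
  using same_module[of M M'] same_module[of N N']
  by (simp add: lin_def k_linear_def same_spD[of M M'] same_spD[of N N'])

lemma subsp_module: assumes "module K M" "subsp M U" shows "module K (M\<lparr>carrier := U\<rparr>)"
proof -
  interpret M: module K M by fact
  note U = subspD[OF assms(2)]
  have "abelian_group (M\<lparr>carrier := U\<rparr>)"
  proof (rule abelian_groupI)
    fix x assume x: "x \<in> carrier (M\<lparr>carrier := U\<rparr>)"
    then have "(\<ominus> \<one>) \<odot>\<^bsub>M\<^esub> x \<in> U" using U(4) by simp
    moreover have "(\<ominus> \<one>) \<odot>\<^bsub>M\<^esub> x \<oplus>\<^bsub>M\<^esub> x = \<zero>\<^bsub>M\<^esub>" using x U(1) by (simp add: M.smult_l_minus M.l_neg)
    ultimately show "\<exists>y\<in>carrier (M\<lparr>carrier := U\<rparr>). y \<oplus>\<^bsub>M\<lparr>carrier := U\<rparr>\<^esub> x = \<zero>\<^bsub>M\<lparr>carrier := U\<rparr>\<^esub>" by auto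
  qed (use U in \<open>simp_all add: M.a_ac\<close>)
  moreover have "module_axioms K (M\<lparr>carrier := U\<rparr>)"
    using U by (auto simp: module_axioms_def M.smult_l_distr M.smult_r_distr M.smult_assoc1)
  ultimately show ?thesis using is_cring by (simp add: module_def)
qed

end

context galoisK
begin

section \<open>Colinear endomorphisms of a Galois object\<close>

subsection \<open>The inverse of the antipode\<close>

abbreviation "Si \<equiv> antipode_inv H"

lemma Si_lin: "lin H H Si"
  unfolding antipode_inv_def by (rule lin_inv_into[OF H.S_lin S_bij])

lemmas Si_lins [lins] = lin_comp[OF Si_lin]

lemma Si_in [simp, lins]: "h \<in> carrier H \<Longrightarrow> Si h \<in> carrier H" using linD(3)[OF Si_lin] .

lemma S_Si: "h \<in> carrier H \<Longrightarrow> antipode H (Si h) = h"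
  unfolding antipode_inv_def using S_bij by (intro f_inv_into_f) (auto simp: bij_betw_def)

lemma S_inj: "x \<in> carrier H \<Longrightarrow> y \<in> carrier H \<Longrightarrow> antipode H x = antipode H y \<Longrightarrow> x = y"
  using S_bij by (auto simp: bij_betw_def dest: inj_onD)

lemma S_scalar: "c \<in> carrier K \<Longrightarrow> antipode H (c \<odot>\<^bsub>H\<^esub> \<one>\<^bsub>H\<^esub>) = c \<odot>\<^bsub>H\<^esub> \<one>\<^bsub>H\<^esub>"
  by (simp add: linD(5)[OF H.S_lin] H.S_one)

text \<open>Applying the bijection \<open>S\<close>, which reverses products, turns the claim into an antipode axiom.\<close>

lemma Si_right: assumes f: "lin H G f" and h: "h \<in> carrier H"
  shows "sw G (comult H h) (\<lambda>x y. f (y \<otimes>\<^bsub>H\<^esub> Si x)) = counit H h \<odot>\<^bsub>G\<^esub> f \<one>\<^bsub>H\<^esub>"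
proof -
  let ?u = "sw H (comult H h) (\<lambda>x y. y \<otimes>\<^bsub>H\<^esub> Si x)"
  have u: "?u \<in> carrier H" using h by (auto intro!: lins)
  have "antipode H ?u = sw H (comult H h) (\<lambda>x y. antipode H (y \<otimes>\<^bsub>H\<^esub> Si x))"
    using h by (intro H.D_push[OF H.S_lin]) auto
  also have "\<dots> = sw H (comult H h) (\<lambda>x y. x \<otimes>\<^bsub>H\<^esub> antipode H y)"
    using h by (intro H.D_cong) (simp_all add: H.S_mult S_Si)
  also have "\<dots> = antipode H (counit H h \<odot>\<^bsub>H\<^esub> \<one>\<^bsub>H\<^esub>)"
    using H.antipode_right[OF lin_id[OF H.H.A_module] h] h by (simp add: S_scalar)
  finally have e: "antipode H ?u = antipode H (counit H h \<odot>\<^bsub>H\<^esub> \<one>\<^bsub>H\<^esub>)" .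
  have "?u = counit H h \<odot>\<^bsub>H\<^esub> \<one>\<^bsub>H\<^esub>" by (rule S_inj[OF u _ e]) (use h in simp)
  moreover have "f ?u = sw G (comult H h) (\<lambda>x y. f (y \<otimes>\<^bsub>H\<^esub> Si x))" using h by (intro H.D_push[OF f]) auto
  ultimately show ?thesis using h by (simp add: linD(5)[OF f])
qed

lemma Si_left: assumes f: "lin H G f" and h: "h \<in> carrier H"
  shows "sw G (comult H h) (\<lambda>x y. f (Si y \<otimes>\<^bsub>H\<^esub> x)) = counit H h \<odot>\<^bsub>G\<^esub> f \<one>\<^bsub>H\<^esub>"
proof -
  let ?u = "sw H (comult H h) (\<lambda>x y. Si y \<otimes>\<^bsub>H\<^esub> x)"
  have u: "?u \<in> carrier H" using h by (auto intro!: lins)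
  have "antipode H ?u = sw H (comult H h) (\<lambda>x y. antipode H (Si y \<otimes>\<^bsub>H\<^esub> x))"
    using h by (intro H.D_push[OF H.S_lin]) auto
  also have "\<dots> = sw H (comult H h) (\<lambda>x y. antipode H x \<otimes>\<^bsub>H\<^esub> y)"
    using h by (intro H.D_cong) (simp_all add: H.S_mult S_Si)
  also have "\<dots> = antipode H (counit H h \<odot>\<^bsub>H\<^esub> \<one>\<^bsub>H\<^esub>)"
    using H.antipode_left[OF lin_id[OF H.H.A_module] h] h by (simp add: S_scalar)
  finally have e: "antipode H ?u = antipode H (counit H h \<odot>\<^bsub>H\<^esub> \<one>\<^bsub>H\<^esub>)" .
  have "?u = counit H h \<odot>\<^bsub>H\<^esub> \<one>\<^bsub>H\<^esub>" by (rule S_inj[OF u _ e]) (use h in simp)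
  moreover have "f ?u = sw G (comult H h) (\<lambda>x y. f (Si y \<otimes>\<^bsub>H\<^esub> x))" using h by (intro H.D_push[OF f]) auto
  ultimately show ?thesis using h by (simp add: linD(5)[OF f])
qed

subsection \<open>Coinvariants\<close>

lemma coinv_scalar: "a \<in> carrier A \<Longrightarrow> \<rho> a = pure K A H a \<one>\<^bsub>H\<^esub> \<Longrightarrow> \<exists>c\<in>carrier K. a = c \<odot>\<^bsub>A\<^esub> \<one>\<^bsub>A\<^esub>"
  using rho_coinv by auto

definition sc where "sc a = (THE c. c \<in> carrier K \<and> c \<odot>\<^bsub>A\<^esub> \<one>\<^bsub>A\<^esub> = a)"

lemma sc_scalar: "c \<in> carrier K \<Longrightarrow> sc (c \<odot>\<^bsub>A\<^esub> \<one>\<^bsub>A\<^esub>) = c"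
  unfolding sc_def by (rule the_equality) (auto intro: scalar_one_inj)

lemma rho_sum: "a \<in> carrier A \<Longrightarrow> \<rho> a = sw (tn A H) (\<rho> a) (pure K A H)"
  by (rule sw_id[symmetric]) simp_all

subsection \<open>The endomorphism of a character\<close>

text \<open>The endomorphism \<open>a \<mapsto> f(a\<^sub>-\<^sub>1) a\<^sub>0\<close>.\<close>

definition \<theta> where "\<theta> f a = sw A (lam a) (\<lambda>l x. f l \<odot>\<^bsub>A\<^esub> x)"

lemma theta_lin: "f \<in> carrier (Alg K L) \<Longrightarrow> lin A A (\<theta> f)"
proof -
  assume f: "f \<in> carrier (Alg K L)"
  note [simp] = L.AlgD(3)[OF f] and [lins] = lin_comp[OF L.AlgD(1)[OF f]]
  show ?thesis unfolding \<theta>_def by (auto intro!: lins)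
qed

lemma theta_in: "f \<in> carrier (Alg K L) \<Longrightarrow> a \<in> carrier A \<Longrightarrow> \<theta> f a \<in> carrier A"
  by (rule linD(3)[OF theta_lin])

lemma theta_one: assumes f: "f \<in> carrier (Alg K L)" shows "\<theta> f \<one>\<^bsub>A\<^esub> = \<one>\<^bsub>A\<^esub>"
proof -
  note [simp] = L.AlgD(3)[OF f] and [lins] = lin_comp[OF L.AlgD(1)[OF f]]
  have "\<theta> f \<one>\<^bsub>A\<^esub> = f \<one>\<^bsub>L\<^esub> \<odot>\<^bsub>A\<^esub> \<one>\<^bsub>A\<^esub>" unfolding \<theta>_def by (rule lam_one) (auto intro!: lins)
  then show ?thesis using L.AlgD(5)[OF f] by simp
qed

lemma theta_mult: assumes f: "f \<in> carrier (Alg K L)" and h: "x \<in> carrier A" "y \<in> carrier A"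
  shows "\<theta> f (x \<otimes>\<^bsub>A\<^esub> y) = \<theta> f x \<otimes>\<^bsub>A\<^esub> \<theta> f y"
proof -
  note [simp] = L.AlgD(3)[OF f] and [lins] = lin_comp[OF L.AlgD(1)[OF f]]
  have "\<theta> f (x \<otimes>\<^bsub>A\<^esub> y) = sw A (lam x) (\<lambda>l u. sw A (lam y) (\<lambda>m v. f (l \<otimes>\<^bsub>L\<^esub> m) \<odot>\<^bsub>A\<^esub> (u \<otimes>\<^bsub>A\<^esub> v)))"
    unfolding \<theta>_def using h by (intro lam_mult) (auto intro!: lins)
  also have "\<dots> = sw A (lam x) (\<lambda>l u. sw A (lam y) (\<lambda>m v. (f l \<odot>\<^bsub>A\<^esub> u) \<otimes>\<^bsub>A\<^esub> (f m \<odot>\<^bsub>A\<^esub> v)))"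
    using h by (intro lam_cong) (simp_all add: A.A_smult L.AlgD(4)[OF f] A.Am.smult_assoc1[symmetric] m_comm)
  also have "\<dots> = sw A (lam x) (\<lambda>l u. (f l \<odot>\<^bsub>A\<^esub> u) \<otimes>\<^bsub>A\<^esub> \<theta> f y)"
    unfolding \<theta>_def using h by (intro lam_cong lam_push[symmetric, where F = "\<lambda>z. _ \<otimes>\<^bsub>A\<^esub> z"]) (auto intro!: lins)
  also have "\<dots> = \<theta> f x \<otimes>\<^bsub>A\<^esub> \<theta> f y"
    unfolding \<theta>_def[of f x] using h theta_in[OF f h(2)]
    by (intro lam_push[symmetric, where F = "\<lambda>z. z \<otimes>\<^bsub>A\<^esub> \<theta> f y"]) (auto intro!: lins)
  finally show ?thesis .
qed

text \<open>\<open>\<theta> f\<close> is \<open>H\<close>-colinear because the coactions of \<open>L\<close> and \<open>H\<close> commute.\<close>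

lemma sw_rho_theta: assumes f: "f \<in> carrier (Alg K L)" and B: "bil A H G B" and a: "a \<in> carrier A"
  shows "sw G (\<rho> (\<theta> f a)) B = sw G (\<rho> a) (\<lambda>x h. B (\<theta> f x) h)"
proof -
  note [simp] = L.AlgD(3)[OF f] bilD(4)[OF B] and [lins] = lin_comp[OF L.AlgD(1)[OF f]] bilD[OF B]
  have lB: "lin A G (\<lambda>u. sw G (\<rho> u) B)" using B by (intro lin_sw_arg[OF rho_lin])
  have "sw G (\<rho> (\<theta> f a)) B = sw G (lam a) (\<lambda>l x. sw G (\<rho> (f l \<odot>\<^bsub>A\<^esub> x)) B)"
    unfolding \<theta>_def using a by (intro lam_push[OF lB]) auto
  also have "\<dots> = sw G (lam a) (\<lambda>l x. f l \<odot>\<^bsub>G\<^esub> sw G (\<rho> x) B)"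
    using a by (intro lam_cong linD(5)[OF lB]) auto
  also have "\<dots> = sw G (lam a) (\<lambda>l x. sw G (\<rho> x) (\<lambda>y h. f l \<odot>\<^bsub>G\<^esub> B y h))"
    using a by (intro lam_cong rho_push[where F = "\<lambda>z. _ \<odot>\<^bsub>G\<^esub> z"]) (auto intro!: lins)
  also have "\<dots> = sw G (\<rho> a) (\<lambda>x h. sw G (lam x) (\<lambda>l y. f l \<odot>\<^bsub>G\<^esub> B y h))"
    using a by (intro bicomod[symmetric]) (auto intro!: lins)
  also have "\<dots> = sw G (\<rho> a) (\<lambda>x h. sw G (lam x) (\<lambda>l y. B (f l \<odot>\<^bsub>A\<^esub> y) h))"
    using a B by (intro rho_cong lam_cong) (auto simp: bil_def linD(5)[of A G "\<lambda>m. B m _"])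
  also have "\<dots> = sw G (\<rho> a) (\<lambda>x h. B (\<theta> f x) h)"
    unfolding \<theta>_def using a by (intro rho_cong lam_push[symmetric, where F = "\<lambda>z. B z _"]) (auto intro!: lins)
  finally show ?thesis .
qed

text \<open>The order of the factors is reversed: in \<open>\<theta> f (\<theta> g a)\<close> the character \<open>g\<close> takes the outermost leg
  of the iterated left coaction.\<close>

lemma theta_comp: assumes f: "f \<in> carrier (Alg K L)" and g: "g \<in> carrier (Alg K L)" and a: "a \<in> carrier A"
  shows "\<theta> f (\<theta> g a) = \<theta> (g \<otimes>\<^bsub>Alg K L\<^esub> f) a"
proof -
  note [simp] = L.AlgD(3)[OF f] L.AlgD(3)[OF g] theta_in[OF f]
    and [lins] = lin_comp[OF L.AlgD(1)[OF f]] lin_comp[OF L.AlgD(1)[OF g]]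
  have "\<theta> f (\<theta> g a) = sw A (lam a) (\<lambda>l x. \<theta> f (g l \<odot>\<^bsub>A\<^esub> x))"
    unfolding \<theta>_def[of g] using a by (intro lam_push[OF theta_lin[OF f]]) auto
  also have "\<dots> = sw A (lam a) (\<lambda>l x. g l \<odot>\<^bsub>A\<^esub> \<theta> f x)"
    using a by (intro lam_cong linD(5)[OF theta_lin[OF f]]) auto
  also have "\<dots> = sw A (lam a) (\<lambda>l x. sw A (lam x) (\<lambda>m y. g l \<odot>\<^bsub>A\<^esub> (f m \<odot>\<^bsub>A\<^esub> y)))"
    unfolding \<theta>_def using a by (intro lam_cong lam_push[where F = "\<lambda>z. _ \<odot>\<^bsub>A\<^esub> z"]) (auto intro!: lins)
  also have "\<dots> = sw A (lam a) (\<lambda>x y. sw A (comult L x) (\<lambda>l m. g l \<odot>\<^bsub>A\<^esub> (f m \<odot>\<^bsub>A\<^esub> y)))"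
    using a by (intro lam_coassoc[symmetric]) (auto intro!: lins)
  also have "\<dots> = sw A (lam a) (\<lambda>x y. sw A (comult L x) (\<lambda>l m. (g l \<otimes> f m) \<odot>\<^bsub>A\<^esub> y))"
    using a by (intro lam_cong L.D_cong) (simp_all add: A.Am.smult_assoc1)
  also have "\<dots> = sw A (lam a) (\<lambda>x y. (g \<otimes>\<^bsub>Alg K L\<^esub> f) x \<odot>\<^bsub>A\<^esub> y)"
  proof (intro lam_cong a)
    fix x y assume h: "x \<in> carrier L" "y \<in> carrier A"
    show "sw A (comult L x) (\<lambda>l m. (g l \<otimes> f m) \<odot>\<^bsub>A\<^esub> y) = (g \<otimes>\<^bsub>Alg K L\<^esub> f) x \<odot>\<^bsub>A\<^esub> y"
      unfolding L.Alg_mult[OF h(1)] using h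
      by (intro L.D_push[symmetric, where F = "\<lambda>z. z \<odot>\<^bsub>A\<^esub> y" and G = k]) (auto intro!: lins)
  qed
  finally show ?thesis by (simp add: \<theta>_def)
qed

lemma theta_id: "a \<in> carrier A \<Longrightarrow> \<theta> \<one>\<^bsub>Alg K L\<^esub> a = a"
proof -
  assume a: "a \<in> carrier A"
  have "\<theta> \<one>\<^bsub>Alg K L\<^esub> a = sw A (lam a) (\<lambda>l x. counit L l \<odot>\<^bsub>A\<^esub> x)"
    unfolding \<theta>_def using a by (intro lam_cong) (simp_all add: L.Alg_one)
  then show ?thesis using lam_counit[OF lin_id[OF A.A_module] a] by simp
qed

text \<open>Recovers \<open>f\<close> from \<open>\<theta> f\<close>.\<close>

lemma theta_delta: assumes f: "f \<in> carrier (Alg K L)" and l: "l \<in> carrier L"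
  shows "sw A (\<delta> l) (\<lambda>x y. \<theta> f x \<otimes>\<^bsub>A\<^esub> y) = f l \<odot>\<^bsub>A\<^esub> \<one>\<^bsub>A\<^esub>"
proof -
  note [simp] = L.AlgD(3)[OF f] and [lins] = lin_comp[OF L.AlgD(1)[OF f]]
  have "sw A (\<delta> l) (\<lambda>x y. \<theta> f x \<otimes>\<^bsub>A\<^esub> y) = sw A (\<delta> l) (\<lambda>x y. sw A (lam x) (\<lambda>m u. (f m \<odot>\<^bsub>A\<^esub> u) \<otimes>\<^bsub>A\<^esub> y))"
    unfolding \<theta>_def using l by (intro delta_cong lam_push[where F = "\<lambda>z. z \<otimes>\<^bsub>A\<^esub> _"]) (auto intro!: lins)
  also have "\<dots> = sw A (\<delta> l) (\<lambda>x y. sw A (lam x) (\<lambda>m u. f m \<odot>\<^bsub>A\<^esub> (u \<otimes>\<^bsub>A\<^esub> y)))"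
    using l by (intro delta_cong lam_cong) (simp_all add: A.A_smult)
  also have "\<dots> = f l \<odot>\<^bsub>A\<^esub> \<one>\<^bsub>A\<^esub>" using l by (intro delta_can) (auto intro!: lins)
  finally show ?thesis .
qed

lemma theta_inj: assumes f: "f \<in> carrier (Alg K L)" and g: "g \<in> carrier (Alg K L)"
    and eq: "\<And>a. a \<in> carrier A \<Longrightarrow> \<theta> f a = \<theta> g a"
  shows "f = g"
proof (rule L.Alg_eqI[OF f g])
  fix l assume l: "l \<in> carrier L"
  have "f l \<odot>\<^bsub>A\<^esub> \<one>\<^bsub>A\<^esub> = sw A (\<delta> l) (\<lambda>x y. \<theta> g x \<otimes>\<^bsub>A\<^esub> y)"
    unfolding theta_delta[OF f l, symmetric] using l eq by (intro delta_cong) simp_all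
  then show "f l = g l" using theta_delta[OF g l] L.AlgD(3)[OF f l] L.AlgD(3)[OF g l] by (intro scalar_one_inj) simp_all
qed

text \<open>The character of \<open>T\<close> is \<open>l \<mapsto> T(x) y\<close>, where \<open>\<delta>(l) = x \<otimes> y\<close>. These elements of \<open>A\<close> are
  coinvariant by \<open>delta_coinv\<close> and colinearity of \<open>T\<close>, hence scalars.\<close>

lemma theta_surj:
  assumes T: "lin A A T" and Tm: "\<And>x y. x \<in> carrier A \<Longrightarrow> y \<in> carrier A \<Longrightarrow> T (x \<otimes>\<^bsub>A\<^esub> y) = T x \<otimes>\<^bsub>A\<^esub> T y"
    and T1: "T \<one>\<^bsub>A\<^esub> = \<one>\<^bsub>A\<^esub>" and Tr: "\<And>a. a \<in> carrier A \<Longrightarrow> \<rho> (T a) = tmap K A H T (\<lambda>h. h) (\<rho> a)"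
  shows "\<exists>f\<in>carrier (Alg K L). \<forall>a\<in>carrier A. T a = \<theta> f a"
proof -
  note [simp] = linD(3)[OF T] and [lins] = lin_comp[OF T]
  define W where "W l = sw A (\<delta> l) (\<lambda>x y. T x \<otimes>\<^bsub>A\<^esub> y)" for l
  have W_lin: "lin L A W" unfolding W_def by (auto intro!: lins)
  have W_in: "W l \<in> carrier A" if "l \<in> carrier L" for l using linD(3)[OF W_lin that] .
  have "\<rho> (W l) = pure K A H (W l) \<one>\<^bsub>H\<^esub>" if l: "l \<in> carrier L" for l
  proof -
    have "\<rho> (W l) = sw (tn A H) (\<delta> l) (\<lambda>x y. \<rho> (T x \<otimes>\<^bsub>A\<^esub> y))"
      unfolding W_def using l by (intro delta_push[OF rho_lin]) auto
    also have "\<dots> = sw (tn A H) (\<delta> l) (\<lambda>x y. sw (tn A H) (\<rho> (T x \<otimes>\<^bsub>A\<^esub> y)) (pure K A H))"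
      using l by (intro delta_cong rho_sum) auto
    also have "\<dots> = sw (tn A H) (\<delta> l) (\<lambda>x y. sw (tn A H) (\<rho> (T x)) (\<lambda>u h. sw (tn A H) (\<rho> y) (\<lambda>v h'. pure K A H (u \<otimes>\<^bsub>A\<^esub> v) (h \<otimes>\<^bsub>H\<^esub> h'))))"
      using l by (intro delta_cong rho_mult bil_pure) auto
    also have "\<dots> = sw (tn A H) (\<delta> l) (\<lambda>x y. sw (tn A H) (\<rho> x) (\<lambda>u h. sw (tn A H) (\<rho> y) (\<lambda>v h'. pure K A H (T u \<otimes>\<^bsub>A\<^esub> v) (h \<otimes>\<^bsub>H\<^esub> h'))))"
    proof (intro delta_cong l)
      fix x y assume h: "x \<in> carrier A" "y \<in> carrier A"
      show "sw (tn A H) (\<rho> (T x)) (\<lambda>u h. sw (tn A H) (\<rho> y) (\<lambda>v h'. pure K A H (u \<otimes>\<^bsub>A\<^esub> v) (h \<otimes>\<^bsub>H\<^esub> h')))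
         = sw (tn A H) (\<rho> x) (\<lambda>u h. sw (tn A H) (\<rho> y) (\<lambda>v h'. pure K A H (T u \<otimes>\<^bsub>A\<^esub> v) (h \<otimes>\<^bsub>H\<^esub> h')))"
        unfolding Tr[OF h(1)] using h by (intro sw_tmap[OF T lin_id]) (auto intro!: lins)
    qed
    also have "\<dots> = sw (tn A H) (\<delta> l) (\<lambda>x y. pure K A H (T x \<otimes>\<^bsub>A\<^esub> y) \<one>\<^bsub>H\<^esub>)"
      using l by (intro delta_coinv) (auto intro!: lins)
    also have "\<dots> = pure K A H (W l) \<one>\<^bsub>H\<^esub>"
      unfolding W_def using l by (intro delta_push[symmetric, where F = "\<lambda>z. pure K A H z \<one>\<^bsub>H\<^esub>"]) (auto intro!: lins)
    finally show ?thesis .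
  qed
  then have W_sc: "sc (W l) \<in> carrier K \<and> W l = sc (W l) \<odot>\<^bsub>A\<^esub> \<one>\<^bsub>A\<^esub>" if "l \<in> carrier L" for l
    using coinv_scalar[OF W_in[OF that]] that by (auto simp: sc_scalar)
  define f where "f l = sc (W l)" for l
  have f_in: "f l \<in> carrier K" and Wf: "W l = f l \<odot>\<^bsub>A\<^esub> \<one>\<^bsub>A\<^esub>" if "l \<in> carrier L" for l
    using W_sc[OF that] by (simp_all add: f_def)
  have f_lin: "lin L k f"
  proof (rule linI)
    fix x y assume h: "x \<in> carrier L" "y \<in> carrier L"
    have "f (x \<oplus>\<^bsub>L\<^esub> y) \<odot>\<^bsub>A\<^esub> \<one>\<^bsub>A\<^esub> = (f x \<oplus> f y) \<odot>\<^bsub>A\<^esub> \<one>\<^bsub>A\<^esub>"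
      using h linD(4)[OF W_lin h] f_in by (simp add: Wf[symmetric] A.Am.smult_l_distr)
    then show "f (x \<oplus>\<^bsub>L\<^esub> y) = f x \<oplus>\<^bsub>k\<^esub> f y" using h f_in by (auto intro!: scalar_one_inj)
  next
    fix c x assume h: "c \<in> carrier K" "x \<in> carrier L"
    have "f (c \<odot>\<^bsub>L\<^esub> x) \<odot>\<^bsub>A\<^esub> \<one>\<^bsub>A\<^esub> = (c \<otimes> f x) \<odot>\<^bsub>A\<^esub> \<one>\<^bsub>A\<^esub>"
      using h linD(5)[OF W_lin h] f_in by (simp add: Wf[symmetric] A.Am.smult_assoc1)
    then show "f (c \<odot>\<^bsub>L\<^esub> x) = c \<odot>\<^bsub>k\<^esub> f x" using h f_in by (auto intro!: scalar_one_inj)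
  qed (use f_in in simp_all)
  have f_mult: "f (l \<otimes>\<^bsub>L\<^esub> m) = f l \<otimes> f m" if h: "l \<in> carrier L" "m \<in> carrier L" for l m
  proof -
    have "W (l \<otimes>\<^bsub>L\<^esub> m) = sw A (\<delta> l) (\<lambda>x y. sw A (\<delta> m) (\<lambda>x' y'. T (x \<otimes>\<^bsub>A\<^esub> x') \<otimes>\<^bsub>A\<^esub> (y' \<otimes>\<^bsub>A\<^esub> y)))"
      unfolding W_def using h by (intro sw_delta_mult) (auto intro!: lins)
    also have "\<dots> = sw A (\<delta> l) (\<lambda>x y. sw A (\<delta> m) (\<lambda>x' y'. T x \<otimes>\<^bsub>A\<^esub> ((T x' \<otimes>\<^bsub>A\<^esub> y') \<otimes>\<^bsub>A\<^esub> y)))"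
      using h by (intro delta_cong) (simp_all add: Tm A.A.m_assoc)
    also have "\<dots> = sw A (\<delta> l) (\<lambda>x y. T x \<otimes>\<^bsub>A\<^esub> (W m \<otimes>\<^bsub>A\<^esub> y))"
      unfolding W_def using h by (intro delta_cong delta_push[symmetric, where F = "\<lambda>z. T _ \<otimes>\<^bsub>A\<^esub> (z \<otimes>\<^bsub>A\<^esub> _)"]) (auto intro!: lins)
    also have "\<dots> = sw A (\<delta> l) (\<lambda>x y. f m \<odot>\<^bsub>A\<^esub> (T x \<otimes>\<^bsub>A\<^esub> y))"
      using h f_in by (intro delta_cong) (simp_all add: Wf A.A_smult)
    also have "\<dots> = f m \<odot>\<^bsub>A\<^esub> W l"
      unfolding W_def using h f_in by (intro delta_push[symmetric, where F = "\<lambda>z. f m \<odot>\<^bsub>A\<^esub> z"]) (auto intro!: lins)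
    also have "\<dots> = (f l \<otimes> f m) \<odot>\<^bsub>A\<^esub> \<one>\<^bsub>A\<^esub>" using h f_in by (simp add: Wf A.Am.smult_assoc1[symmetric] m_comm)
    finally show ?thesis using h f_in by (intro scalar_one_inj) (simp_all add: Wf[symmetric])
  qed
  have b: "bil A A A (\<lambda>x y. T x \<otimes>\<^bsub>A\<^esub> y)" by (auto intro!: lins)
  have "W \<one>\<^bsub>L\<^esub> = \<one>\<^bsub>A\<^esub>" unfolding W_def delta_one using sw_pure[OF b] T1 by simp
  then have f_one: "f \<one>\<^bsub>L\<^esub> = \<one>" using sc_scalar[of \<one>] by (simp add: f_def)
  have rf: "restrict f (carrier L) \<in> carrier (Alg K L)" by (rule L.AlgI[OF f_lin f_mult f_one])
  have "T a = \<theta> (restrict f (carrier L)) a" if a: "a \<in> carrier A" for a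
  proof -
    have "\<theta> (restrict f (carrier L)) a = sw A (lam a) (\<lambda>l x. W l \<otimes>\<^bsub>A\<^esub> x)"
      unfolding \<theta>_def using a f_in by (intro lam_cong) (simp_all add: Wf A.A_smult)
    also have "\<dots> = sw A (lam a) (\<lambda>l x. sw A (\<delta> l) (\<lambda>u v. (T u \<otimes>\<^bsub>A\<^esub> v) \<otimes>\<^bsub>A\<^esub> x))"
      unfolding W_def using a by (intro lam_cong delta_push[where F = "\<lambda>z. z \<otimes>\<^bsub>A\<^esub> _"]) (auto intro!: lins)
    also have "\<dots> = sw A (lam a) (\<lambda>l x. sw A (\<delta> l) (\<lambda>u v. T u \<otimes>\<^bsub>A\<^esub> (v \<otimes>\<^bsub>A\<^esub> x)))"
      using a by (intro lam_cong delta_cong) (simp_all add: A.A.m_assoc)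
    also have "\<dots> = T a \<otimes>\<^bsub>A\<^esub> \<one>\<^bsub>A\<^esub>" using a by (intro delta_lam) (auto intro!: lins)
    finally show ?thesis using a by simp
  qed
  then show ?thesis using rf by auto
qed

section \<open>The cotensor product is the Hopf algebra \<open>L\<close>\<close>

abbreviation "E \<equiv> cotens_alg K H A \<rho>"
abbreviation "T \<equiv> tn A (opp A)"

lemma same_opp: "same_sp A (opp A)" by (simp add: same_sp_def opp_def)

lemma same_T: "same_sp (tn A A) T" by (rule same_tens[OF same_refl same_opp])

lemma opp_module [simp]: "module K (opp A)" by (rule same_module[OF same_opp A.A_module])

definition oc where "oc b = sw (tn H A) (\<rho> b) (\<lambda>b0 b1. pure K H A (Si b1) b0)"

lemma opp_coact_oc: "opp_coact K H A \<rho> = oc"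
  by (intro ext) (simp add: opp_coact_def oc_def same_lift[OF same_tens[OF same_refl same_opp]] same_pure[OF same_refl same_opp])

lemma oc_lin: "lin A (tn H A) oc" unfolding oc_def by (auto intro!: lins)

lemma sw_oc: assumes f: "bil H A G f" and b: "b \<in> carrier A"
  shows "sw G (oc b) f = sw G (\<rho> b) (\<lambda>b0 b1. f (Si b1) b0)"
proof -
  have "sw G (oc b) f = sw G (\<rho> b) (\<lambda>b0 b1. sw G (pure K H A (Si b1) b0) f)"
    unfolding oc_def using b by (intro sw_sw[OF f, of A H]) (auto intro!: pure_in)
  also have "\<dots> = sw G (\<rho> b) (\<lambda>b0 b1. f (Si b1) b0)"
    using b by (intro rho_cong sw_pure[OF f]) auto
  finally show ?thesis .
qed

lemma E_iff: "t \<in> carrier E \<longleftrightarrow> t \<in> carrier (tn A A) \<and>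
   tassoc K A H A (tmap K (tn A H) A \<rho> (\<lambda>a. a) t) = tmap K A (tn H A) (\<lambda>a. a) oc t"
  by (simp add: cotens_alg_def same_spD[OF same_T] opp_coact_oc same_tassoc[OF same_refl same_refl same_opp]
      same_tmap[OF same_refl same_opp] same_tmap[OF same_refl same_tens[OF same_refl same_opp]])

lemma E_fields: "add E = add (tn A A)" "\<zero>\<^bsub>E\<^esub> = \<zero>\<^bsub>tn A A\<^esub>" "smult E = smult (tn A A)"
  "monoid.mult E = monoid.mult T" "\<one>\<^bsub>E\<^esub> = pure K A A \<one>\<^bsub>A\<^esub> \<one>\<^bsub>A\<^esub>"
proof -
  show "add E = add (tn A A)" "\<zero>\<^bsub>E\<^esub> = \<zero>\<^bsub>tn A A\<^esub>" "smult E = smult (tn A A)" "monoid.mult E = monoid.mult T"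
    by (simp_all add: cotens_alg_def same_spD[OF same_T])
  show "\<one>\<^bsub>E\<^esub> = pure K A A \<one>\<^bsub>A\<^esub> \<one>\<^bsub>A\<^esub>"
    by (simp add: cotens_alg_def tens_mult(2) same_pure[OF same_refl same_opp]) (simp add: opp_def)
qed

text \<open>Multiplying the coinvariance of \<open>\<delta>(l) = x \<otimes> y\<close> by \<open>S\<^sup>-\<^sup>1\<close> of a further leg of \<open>y\<close> moves the
  coaction from \<open>x\<close> to \<open>y\<close>, which is the cotensor condition.\<close>

lemma delta_E: assumes l: "l \<in> carrier L" shows "\<delta> l \<in> carrier E"
proof -
  have "tassoc K A H A (tmap K (tn A H) A \<rho> (\<lambda>a. a) (\<delta> l)) = tmap K A (tn H A) (\<lambda>a. a) oc (\<delta> l)"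
  proof (rule assoc_eqI[OF rho_lin oc_lin delta_in[OF l] delta_in[OF l]])
    fix f assume f: "tri A H A (tn A (tn H A)) f"
    let ?G = "tn A (tn H A)"
    note [lins] = triD[OF f]
    have b: "bil H A ?G (f a)" if "a \<in> carrier A" for a using f that by (simp add: tri_def)
    have "sw ?G (\<delta> l) (\<lambda>a n. sw ?G (oc n) (f a)) = sw ?G (\<delta> l) (\<lambda>x y. sw ?G (\<rho> y) (\<lambda>y0 y1. f x (Si y1) y0))"
      using l by (intro delta_cong sw_oc b)
    also have "\<dots> = sw ?G (\<delta> l) (\<lambda>x y. sw ?G (\<rho> y) (\<lambda>y0 y1. f x (\<one>\<^bsub>H\<^esub> \<otimes>\<^bsub>H\<^esub> Si y1) y0))"
      using l by (intro delta_cong rho_cong) simp_all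
    also have "\<dots> = sw ?G (\<delta> l) (\<lambda>x y. sw ?G (\<rho> x) (\<lambda>x0 x1. sw ?G (\<rho> y) (\<lambda>u0 u1.
        sw ?G (\<rho> u0) (\<lambda>y0 y1. f x0 ((x1 \<otimes>\<^bsub>H\<^esub> u1) \<otimes>\<^bsub>H\<^esub> Si y1) y0))))"
      using l by (intro delta_coinv[symmetric, where g = "\<lambda>x y h. sw ?G (\<rho> y) (\<lambda>y0 y1. f x (h \<otimes>\<^bsub>H\<^esub> Si y1) y0)"]) (auto intro!: lins)
    also have "\<dots> = sw ?G (\<delta> l) (\<lambda>x y. sw ?G (\<rho> x) (\<lambda>x0 x1. sw ?G (\<rho> y) (\<lambda>y0 v.
        sw ?G (comult H v) (\<lambda>y1 u1. f x0 ((x1 \<otimes>\<^bsub>H\<^esub> u1) \<otimes>\<^bsub>H\<^esub> Si y1) y0))))"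
      using l by (intro delta_cong rho_cong rho_coassoc) (auto intro!: lins)
    also have "\<dots> = sw ?G (\<delta> l) (\<lambda>x y. sw ?G (\<rho> x) (\<lambda>x0 x1. sw ?G (\<rho> y) (\<lambda>y0 v.
        sw ?G (comult H v) (\<lambda>y1 u1. f x0 (x1 \<otimes>\<^bsub>H\<^esub> (u1 \<otimes>\<^bsub>H\<^esub> Si y1)) y0))))"
      using l by (intro delta_cong rho_cong H.D_cong) (simp_all add: H.H.A.m_assoc)
    also have "\<dots> = sw ?G (\<delta> l) (\<lambda>x y. sw ?G (\<rho> x) (\<lambda>x0 x1. sw ?G (\<rho> y) (\<lambda>y0 v.
        counit H v \<odot>\<^bsub>?G\<^esub> f x0 (x1 \<otimes>\<^bsub>H\<^esub> \<one>\<^bsub>H\<^esub>) y0)))"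
      using l by (intro delta_cong rho_cong Si_right) (auto intro!: lins)
    also have "\<dots> = sw ?G (\<delta> l) (\<lambda>x y. sw ?G (\<rho> x) (\<lambda>x0 x1. f x0 (x1 \<otimes>\<^bsub>H\<^esub> \<one>\<^bsub>H\<^esub>) y))"
      using l by (intro delta_cong rho_cong rho_counit) (auto intro!: lins)
    also have "\<dots> = sw ?G (\<delta> l) (\<lambda>m c. sw ?G (\<rho> m) (\<lambda>a b. f a b c))"
      using l by (intro delta_cong rho_cong) simp_all
    finally show "sw ?G (\<delta> l) (\<lambda>m c. sw ?G (\<rho> m) (\<lambda>a b. f a b c)) = sw ?G (\<delta> l) (\<lambda>a n. sw ?G (oc n) (f a))" ..
  qed simp_all
  then show ?thesis using l by (simp add: E_iff)
qed

text \<open>The converse passage, from the cotensor condition to coinvariance.\<close>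

lemma E_coinv: assumes t: "t \<in> carrier E" and g: "tri A A H G g"
  shows "sw G t (\<lambda>x y. sw G (\<rho> x) (\<lambda>x0 x1. sw G (\<rho> y) (\<lambda>y0 y1. g x0 y0 (x1 \<otimes>\<^bsub>H\<^esub> y1)))) = sw G t (\<lambda>x y. g x y \<one>\<^bsub>H\<^esub>)"
proof -
  note [lins] = triD[OF g] and [simp] = triD(5)[OF g]
  have tA: "t \<in> carrier (tn A A)" using t by (simp add: E_iff)
  note t_cong = sw_cong[OF A.A_module A.A_module tA]
  let ?f = "\<lambda>a h c. sw G (\<rho> c) (\<lambda>y0 y1. g a y0 (h \<otimes>\<^bsub>H\<^esub> y1))"
  have f: "tri A H A G ?f" by (auto intro!: lins)
  have "sw G t (\<lambda>x y. sw G (\<rho> x) (\<lambda>x0 x1. ?f x0 x1 y)) = sw G t (\<lambda>x y. sw G (oc y) (?f x))"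
    using t f by (intro assoc_eqD[OF rho_lin oc_lin tA tA]) (auto simp: E_iff)
  also have "\<dots> = sw G t (\<lambda>x y. sw G (\<rho> y) (\<lambda>u v. sw G (\<rho> u) (\<lambda>y0 y1. g x y0 (Si v \<otimes>\<^bsub>H\<^esub> y1))))"
    using f by (intro t_cong sw_oc) (simp_all add: tri_def)
  also have "\<dots> = sw G t (\<lambda>x y. sw G (\<rho> y) (\<lambda>y0 u. sw G (comult H u) (\<lambda>y1 v. g x y0 (Si v \<otimes>\<^bsub>H\<^esub> y1))))"
    by (intro t_cong rho_coassoc) (auto intro!: lins)
  also have "\<dots> = sw G t (\<lambda>x y. sw G (\<rho> y) (\<lambda>y0 u. counit H u \<odot>\<^bsub>G\<^esub> g x y0 \<one>\<^bsub>H\<^esub>))"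
    by (intro t_cong rho_cong Si_left) (auto intro!: lins)
  also have "\<dots> = sw G t (\<lambda>x y. g x y \<one>\<^bsub>H\<^esub>)"
    by (intro t_cong rho_counit) (auto intro!: lins)
  finally show ?thesis .
qed

text \<open>If \<open>t = a \<otimes> b\<close> is coinvariant, then so are the slices of its image \<open>a\<^sub>-\<^sub>1 \<otimes> a\<^sub>0b\<close> in \<open>L \<otimes> A\<close>.
  Hence that image is of the form \<open>l \<otimes> 1\<close>.\<close>

lemma E_image: assumes t: "t \<in> carrier E" shows "\<exists>l\<in>carrier L. t = \<delta> l"
proof -
  have tA: "t \<in> carrier (tn A A)" using t by (simp add: E_iff)
  note t_cong = sw_cong[OF A.A_module A.A_module tA] and t_push = sw_push[OF _ A.A_module A.A_module tA]
  define u where "u = left_can K L A lam t"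
  have u: "u \<in> carrier (tn L A)" unfolding u_def using linD(3)[OF lcan_lin tA] .
  \<comment> \<open>the factors are exchanged because slices are taken along the right factor\<close>
  define u' where "u' = sw (tn A L) u (\<lambda>l a. pure K A L a l)"
  have u': "u' \<in> carrier (tn A L)" unfolding u'_def using u by (intro sw_in[of L A]) (auto intro!: pure_in)
  have sw_u': "sw G u' f = sw G u (\<lambda>l a. f a l)" if f: "bil A L G f" for G :: "('k, 'g, 'y) module_scheme" and f
  proof -
    have "sw G u' f = sw G u (\<lambda>l a. sw G (pure K A L a l) f)"
      unfolding u'_def using u by (intro sw_sw[OF f, of L A]) (auto intro!: pure_in)
    also have "\<dots> = sw G u (\<lambda>l a. f a l)" by (intro sw_cong[OF L.H.A_module A.A_module u] sw_pure[OF f])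
    finally show ?thesis .
  qed
  let ?W = "(\<lambda>c. c \<odot>\<^bsub>A\<^esub> \<one>\<^bsub>A\<^esub>) ` carrier K"
  have W: "subsp A ?W"
  proof (rule subspI)
    show "\<zero>\<^bsub>A\<^esub> \<in> ?W" by (rule image_eqI[of _ _ \<zero>]) simp_all
  next
    fix x y assume "x \<in> ?W" "y \<in> ?W"
    then obtain c d where h: "c \<in> carrier K" "d \<in> carrier K" "x = c \<odot>\<^bsub>A\<^esub> \<one>\<^bsub>A\<^esub>" "y = d \<odot>\<^bsub>A\<^esub> \<one>\<^bsub>A\<^esub>" by auto
    then show "x \<oplus>\<^bsub>A\<^esub> y \<in> ?W" by (intro image_eqI[of _ _ "c \<oplus> d"]) (simp_all add: A.Am.smult_l_distr)
  next
    fix c x assume c: "c \<in> carrier K" and "x \<in> ?W"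
    then obtain d where h: "d \<in> carrier K" "x = d \<odot>\<^bsub>A\<^esub> \<one>\<^bsub>A\<^esub>" by auto
    then show "c \<odot>\<^bsub>A\<^esub> x \<in> ?W" using c by (intro image_eqI[of _ _ "c \<otimes> d"]) (simp_all add: A.Am.smult_assoc1)
  qed auto
  have slices: "sw A u' (\<lambda>a l. \<phi> l \<odot>\<^bsub>A\<^esub> a) \<in> ?W" if \<phi>: "lin L k \<phi>" for \<phi>
  proof -
    have [simp]: "\<And>l. l \<in> carrier L \<Longrightarrow> \<phi> l \<in> carrier K" using linD(3)[OF \<phi>] by simp
    note [lins] = lin_comp[OF \<phi>]
    let ?G = "tn A H"
    define y where "y = sw A t (\<lambda>a b. sw A (lam a) (\<lambda>l x. \<phi> l \<odot>\<^bsub>A\<^esub> (x \<otimes>\<^bsub>A\<^esub> b)))"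
    have yu: "sw A u' (\<lambda>a l. \<phi> l \<odot>\<^bsub>A\<^esub> a) = y"
    proof -
      have "sw A u' (\<lambda>a l. \<phi> l \<odot>\<^bsub>A\<^esub> a) = sw A u (\<lambda>l a. \<phi> l \<odot>\<^bsub>A\<^esub> a)" by (rule sw_u') (auto intro!: lins)
      also have "\<dots> = y" unfolding u_def y_def by (rule sw_lcan[OF _ tA]) (auto intro!: lins)
      finally show ?thesis .
    qed
    have y_in: "y \<in> carrier A" unfolding y_def using tA by (auto intro!: lins)
    let ?g = "\<lambda>x y h. sw ?G (lam x) (\<lambda>l v. \<phi> l \<odot>\<^bsub>?G\<^esub> pure K A H (v \<otimes>\<^bsub>A\<^esub> y) h)"
    have pt: "\<rho> (sw A (lam a) (\<lambda>l x. \<phi> l \<odot>\<^bsub>A\<^esub> (x \<otimes>\<^bsub>A\<^esub> b))) = sw ?G (\<rho> a) (\<lambda>x0 x1. sw ?G (\<rho> b) (\<lambda>y0 y1. ?g x0 y0 (x1 \<otimes>\<^bsub>H\<^esub> y1)))"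
      if h: "a \<in> carrier A" "b \<in> carrier A" for a b
    proof -
      have "\<rho> (sw A (lam a) (\<lambda>l x. \<phi> l \<odot>\<^bsub>A\<^esub> (x \<otimes>\<^bsub>A\<^esub> b))) = sw ?G (lam a) (\<lambda>l x. \<rho> (\<phi> l \<odot>\<^bsub>A\<^esub> (x \<otimes>\<^bsub>A\<^esub> b)))"
        using h by (intro lam_push[OF rho_lin]) auto
      also have "\<dots> = sw ?G (lam a) (\<lambda>l x. \<phi> l \<odot>\<^bsub>?G\<^esub> sw ?G (\<rho> (x \<otimes>\<^bsub>A\<^esub> b)) (pure K A H))"
        using h by (intro lam_cong) (simp_all add: linD(5)[OF rho_lin] rho_sum[symmetric])
      also have "\<dots> = sw ?G (lam a) (\<lambda>l x. \<phi> l \<odot>\<^bsub>?G\<^esub> sw ?G (\<rho> x) (\<lambda>x0 x1. sw ?G (\<rho> b) (\<lambda>b0 b1. pure K A H (x0 \<otimes>\<^bsub>A\<^esub> b0) (x1 \<otimes>\<^bsub>H\<^esub> b1))))"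
        using h by (intro lam_cong arg_cong[where f = "\<lambda>z. _ \<odot>\<^bsub>?G\<^esub> z"] rho_mult bil_pure) auto
      also have "\<dots> = sw ?G (lam a) (\<lambda>l x. sw ?G (\<rho> x) (\<lambda>x0 x1. \<phi> l \<odot>\<^bsub>?G\<^esub> sw ?G (\<rho> b) (\<lambda>b0 b1. pure K A H (x0 \<otimes>\<^bsub>A\<^esub> b0) (x1 \<otimes>\<^bsub>H\<^esub> b1))))"
        using h by (intro lam_cong rho_push[where F = "\<lambda>z. _ \<odot>\<^bsub>?G\<^esub> z"]) (auto intro!: lins)
      also have "\<dots> = sw ?G (lam a) (\<lambda>l x. sw ?G (\<rho> x) (\<lambda>x0 x1. sw ?G (\<rho> b) (\<lambda>b0 b1. \<phi> l \<odot>\<^bsub>?G\<^esub> pure K A H (x0 \<otimes>\<^bsub>A\<^esub> b0) (x1 \<otimes>\<^bsub>H\<^esub> b1))))"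
        using h by (intro lam_cong rho_cong rho_push[where F = "\<lambda>z. _ \<odot>\<^bsub>?G\<^esub> z"]) (auto intro!: lins)
      also have "\<dots> = sw ?G (\<rho> a) (\<lambda>x x1. sw ?G (lam x) (\<lambda>l x0. sw ?G (\<rho> b) (\<lambda>b0 b1. \<phi> l \<odot>\<^bsub>?G\<^esub> pure K A H (x0 \<otimes>\<^bsub>A\<^esub> b0) (x1 \<otimes>\<^bsub>H\<^esub> b1))))"
        using h by (intro bicomod[symmetric]) (auto intro!: lins)
      also have "\<dots> = sw ?G (\<rho> a) (\<lambda>x x1. sw ?G (\<rho> b) (\<lambda>b0 b1. sw ?G (lam x) (\<lambda>l x0. \<phi> l \<odot>\<^bsub>?G\<^esub> pure K A H (x0 \<otimes>\<^bsub>A\<^esub> b0) (x1 \<otimes>\<^bsub>H\<^esub> b1))))"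
        using h by (intro rho_cong sw_swap[of L A A H]) (auto intro!: lins module.smult_closed[OF module_tens])
      finally show ?thesis .
    qed
    have "\<rho> y = sw ?G t (\<lambda>a b. \<rho> (sw A (lam a) (\<lambda>l x. \<phi> l \<odot>\<^bsub>A\<^esub> (x \<otimes>\<^bsub>A\<^esub> b))))"
      unfolding y_def by (intro t_push[OF rho_lin]) (auto intro!: lins)
    also have "\<dots> = sw ?G t (\<lambda>a b. sw ?G (\<rho> a) (\<lambda>x0 x1. sw ?G (\<rho> b) (\<lambda>y0 y1. ?g x0 y0 (x1 \<otimes>\<^bsub>H\<^esub> y1))))"
      by (intro t_cong pt)
    also have "\<dots> = sw ?G t (\<lambda>a b. ?g a b \<one>\<^bsub>H\<^esub>)"
      by (rule E_coinv[OF t]) (auto intro!: lins)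
    also have "\<dots> = sw ?G t (\<lambda>a b. sw ?G (lam a) (\<lambda>l x. pure K A H (\<phi> l \<odot>\<^bsub>A\<^esub> (x \<otimes>\<^bsub>A\<^esub> b)) \<one>\<^bsub>H\<^esub>))"
      using linD(5)[OF pure_lins(1)[OF A.A_module H.H.A_module lin_id[OF A.A_module] H.H.A.one_closed]]
      by (intro t_cong lam_cong) simp_all
    also have "\<dots> = sw ?G t (\<lambda>a b. pure K A H (sw A (lam a) (\<lambda>l x. \<phi> l \<odot>\<^bsub>A\<^esub> (x \<otimes>\<^bsub>A\<^esub> b))) \<one>\<^bsub>H\<^esub>)"
      by (intro t_cong lam_push[symmetric, where F = "\<lambda>z. pure K A H z \<one>\<^bsub>H\<^esub>"]) (auto intro!: lins)
    also have "\<dots> = pure K A H y \<one>\<^bsub>H\<^esub>"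
      unfolding y_def by (intro t_push[symmetric, where F = "\<lambda>z. pure K A H z \<one>\<^bsub>H\<^esub>"]) (auto intro!: lins)
    finally show ?thesis using coinv_scalar[OF y_in] yu by auto
  qed
  obtain ys where ys: "set ys \<subseteq> ?W \<times> carrier L" "u' = pair_sum (tn A L) (pure K A L) ys"
    by (rule slice_tensor[OF A.A_module L.H.A_module W u' slices])
  note pl = pure_lins(2)[OF A.A_module L.H.A_module A.A.one_closed lin_id[OF L.H.A_module]]
  note pl' = pure_lins(1)[OF A.A_module L.H.A_module lin_id[OF A.A_module]]
  have "\<exists>l\<in>carrier L. pair_sum (tn A L) (pure K A L) ys = pure K A L \<one>\<^bsub>A\<^esub> l"
    using ys(1)
  proof (induction ys)
    case Nil
    show ?case using lin_zero[OF pl] by (intro bexI[of _ "\<zero>\<^bsub>L\<^esub>"]) (simp_all add: pair_sum_simps)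
  next
    case (Cons p ys)
    then obtain c l m where h: "p = (c \<odot>\<^bsub>A\<^esub> \<one>\<^bsub>A\<^esub>, l)" "c \<in> carrier K" "l \<in> carrier L" "m \<in> carrier L"
      "pair_sum (tn A L) (pure K A L) ys = pure K A L \<one>\<^bsub>A\<^esub> m" by auto
    have "pure K A L (c \<odot>\<^bsub>A\<^esub> \<one>\<^bsub>A\<^esub>) l = pure K A L \<one>\<^bsub>A\<^esub> (c \<odot>\<^bsub>L\<^esub> l)"
      using linD(5)[OF pl'[OF h(3)] h(2), of "\<one>\<^bsub>A\<^esub>"] linD(5)[OF pl h(2,3)] by simp
    then show ?case using h linD(4)[OF pl, of "c \<odot>\<^bsub>L\<^esub> l" m]
      by (intro bexI[of _ "c \<odot>\<^bsub>L\<^esub> l \<oplus>\<^bsub>L\<^esub> m"]) (simp_all add: pair_sum_simps)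
  qed
  then obtain l where l: "l \<in> carrier L" "u' = pure K A L \<one>\<^bsub>A\<^esub> l" using ys(2) by auto
  have b: "bil A L (tn L A) (\<lambda>a l. pure K L A l a)" by (auto intro!: lins)
  have "u = sw (tn L A) u (pure K L A)" by (rule sw_id[symmetric]) (use u in simp_all)
  also have "\<dots> = sw (tn L A) u' (\<lambda>a l. pure K L A l a)" using sw_u'[OF b] by simp
  also have "\<dots> = pure K L A l \<one>\<^bsub>A\<^esub>" unfolding l(2) using l(1) by (intro sw_pure[OF b]) simp_all
  finally have "t = \<delta> l" unfolding u_def using l(1) tA by (intro lcan_inj) (simp_all add: lcan_delta)
  then show ?thesis using l(1) by (rule_tac bexI)
qed

lemma carrier_E: "carrier E = \<delta> ` carrier L"
  using E_image delta_E by auto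

text \<open>The linear map \<open>a \<otimes> b \<mapsto> \<phi>(a\<^sub>0b) a\<^sub>-\<^sub>1\<close> retracts \<open>\<delta>\<close> if \<open>\<phi>(1) = 1\<close>.\<close>

lemma delta_retraction: "\<exists>r. lin (tn A A) L r \<and> (\<forall>l\<in>carrier L. r (\<delta> l) = l)"
proof -
  have z: "subsp A {\<zero>\<^bsub>A\<^esub>}" by (intro subspI) auto
  obtain \<phi> where \<phi>: "lin A k \<phi>" "\<phi> \<one>\<^bsub>A\<^esub> = \<one>"
    using functional_exists[OF A.A_module z A.A.one_closed] A_nontrivial by auto
  have [simp]: "\<And>a. a \<in> carrier A \<Longrightarrow> \<phi> a \<in> carrier K" using linD(3)[OF \<phi>(1)] by simp
  note [lins] = lin_comp[OF \<phi>(1)]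
  have b: "bil L A L (\<lambda>l a. \<phi> a \<odot>\<^bsub>L\<^esub> l)" by (auto intro!: lins)
  let ?r = "\<lambda>t. sw L (left_can K L A lam t) (\<lambda>l a. \<phi> a \<odot>\<^bsub>L\<^esub> l)"
  have "lin (tn A A) L ?r" by (rule lin_comp[OF lin_sw[OF b] lcan_lin])
  moreover have "?r (\<delta> l) = l" if "l \<in> carrier L" for l
    using that sw_pure[OF b that A.A.one_closed] \<phi>(2) by (simp add: lcan_delta)
  ultimately show ?thesis by auto
qed

lemma delta_bij: "bij_betw \<delta> (carrier L) (carrier E)"
proof -
  obtain r where r: "\<forall>l\<in>carrier L. r (\<delta> l) = l" using delta_retraction by auto
  have "inj_on \<delta> (carrier L)" by (rule inj_on_inverseI[of _ r]) (use r in simp)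
  then show ?thesis by (simp add: bij_betw_def carrier_E)
qed

lemma E_module: "module K E"
proof -
  have "subsp (tn A A) (carrier E)"
  proof (rule subspI)
    show "carrier E \<subseteq> carrier (tn A A)" by (auto simp: E_iff)
    show "\<zero>\<^bsub>tn A A\<^esub> \<in> carrier E" unfolding carrier_E
      using lin_zero[OF delta_lin] by (intro image_eqI[of _ _ "\<zero>\<^bsub>L\<^esub>"]) simp_all
  next
    fix x y assume "x \<in> carrier E" "y \<in> carrier E"
    then obtain l m where "l \<in> carrier L" "m \<in> carrier L" "x = \<delta> l" "y = \<delta> m" unfolding carrier_E by auto
    then show "x \<oplus>\<^bsub>tn A A\<^esub> y \<in> carrier E" unfolding carrier_E
      by (intro image_eqI[of _ _ "l \<oplus>\<^bsub>L\<^esub> m"]) (simp_all add: linD(4)[OF delta_lin])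
  next
    fix c x assume c: "c \<in> carrier K" and "x \<in> carrier E"
    then obtain l where "l \<in> carrier L" "x = \<delta> l" unfolding carrier_E by auto
    then show "c \<odot>\<^bsub>tn A A\<^esub> x \<in> carrier E" unfolding carrier_E using c
      by (intro image_eqI[of _ _ "c \<odot>\<^bsub>L\<^esub> l"]) (simp_all add: linD(5)[OF delta_lin])
  qed
  from subsp_module[OF _ this] have "module K ((tn A A)\<lparr>carrier := carrier E\<rparr>)" by simp
  then show ?thesis by (rule same_module[rotated]) (simp add: same_sp_def E_fields)
qed

lemma delta_lin_E: "lin L E \<delta>"
  using E_module linD[OF delta_lin] delta_E by (intro linI) (simp_all add: E_fields)

lemma E_incl: "lin E (tn A A) (\<lambda>x. x)"
  using E_module by (intro linI) (simp_all add: E_fields E_iff)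

lemma T_module: "module K T" by (rule same_module[OF same_T]) simp

lemma delta_lin_T: "lin L T \<delta>" by (rule same_lin[OF same_refl same_T delta_lin])
lemma E_incl_T: "lin E T (\<lambda>x. x)" by (rule same_lin[OF same_refl same_T E_incl])

lemma E_mult: assumes "l \<in> carrier L" "m \<in> carrier L" shows "\<delta> l \<otimes>\<^bsub>E\<^esub> \<delta> m = \<delta> (l \<otimes>\<^bsub>L\<^esub> m)"
  unfolding E_fields delta_mult[OF assms] tens_mult same_lift[OF same_T] same_pure[OF same_refl same_opp]
  by (simp add: opp_def)

lemma E_one: "\<one>\<^bsub>E\<^esub> = \<delta> \<one>\<^bsub>L\<^esub>" by (simp add: E_fields delta_one)

lemma cotens_eval_delta: assumes "l \<in> carrier L" shows "cotens_eval K A (\<delta> l) = counit L l"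
  unfolding cotens_eval_def delta_eval[OF assms]
  by (rule the_equality) (use assms in \<open>auto intro: scalar_one_inj\<close>)

text \<open>By \<open>delta_comult\<close> the element on the right has the required image in the tensor square of
  \<open>A \<otimes> A\<^sup>o\<^sup>p\<close>. It is the only one, because a retraction of \<open>\<delta>\<close> gives a left inverse of
  \<open>E \<otimes> E \<rightarrow> (A \<otimes> A\<^sup>o\<^sup>p) \<otimes> (A \<otimes> A\<^sup>o\<^sup>p)\<close>.\<close>

lemma cotens_split_delta: assumes l: "l \<in> carrier L"
  shows "cotens_split K H A \<rho> (\<delta> l) = tmap K E E \<delta> \<delta> (comult L l)"
proof -
  let ?TT = "tn T T" let ?w = "tmap K E E \<delta> \<delta> (comult L l)"
  note [simp] = T_module E_module
  have D: "comult L l \<in> carrier (tn L L)" using l by simp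
  have w: "?w \<in> carrier (tn E E)" by (rule tmap_in[OF delta_lin_E delta_lin_E D])
  note bp = same_lin[OF same_refl same_T]
  have pl: "lin X T (\<lambda>x. pure K A (opp A) (f x) b)" if "lin X A f" "b \<in> carrier A" for X :: "('k, 'x, 'y) module_scheme" and f b
    unfolding same_pure[OF same_refl same_opp] using that by (intro bp[OF pure_lins(1)]) simp_all
  have pr: "lin X T (\<lambda>x. pure K A (opp A) b (f x))" if "lin X A f" "b \<in> carrier A" for X :: "('k, 'x, 'y) module_scheme" and f b
    unfolding same_pure[OF same_refl same_opp] using that by (intro bp[OF pure_lins(2)]) simp_all
  have pin: "pure K A (opp A) a b \<in> carrier T" if "a \<in> carrier A" "b \<in> carrier A" for a b
    unfolding same_pure[OF same_refl same_opp] same_spD[OF same_T] using that by (intro pure_in) simp_all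
  let ?g = "\<lambda>x y z w. pure K T T (pure K A (opp A) x y) (pure K A (opp A) z w)"
  have g: "quad A A A A ?TT ?g" by (auto intro!: lins pl pr pin)
  have d: "sw T (\<delta> m) (\<lambda>x y. pure K A (opp A) x y) = \<delta> m" if "m \<in> carrier L" for m
    unfolding same_pure[OF same_refl same_opp] same_lift[OF same_T] using that by (intro sw_id) simp_all
  have "cotens_split_raw K H A \<rho> (\<delta> l) = sw ?TT (\<delta> l) (\<lambda>a b. sw ?TT (\<rho> a) (\<lambda>a0 a1. sw ?TT (\<tau> a1) (\<lambda>p q. ?g a0 p q b)))"
    by (simp add: cotens_split_raw_def Let_def)
  also have "\<dots> = sw ?TT (comult L l) (\<lambda>l1 l2. sw ?TT (\<delta> l1) (\<lambda>x y. sw ?TT (\<delta> l2) (\<lambda>z w. ?g x y z w)))"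
    by (rule delta_comult[OF g l])
  also have "\<dots> = sw ?TT (comult L l) (\<lambda>l1 l2. sw ?TT (\<delta> l1) (\<lambda>x y. pure K T T (pure K A (opp A) x y) (sw T (\<delta> l2) (\<lambda>z w. pure K A (opp A) z w))))"
    using l by (intro L.D_cong delta_cong delta_push[symmetric, where F = "\<lambda>u. pure K T T (pure K A (opp A) _ _) u"])
      (auto intro!: lins pin)
  also have "\<dots> = sw ?TT (comult L l) (\<lambda>l1 l2. sw ?TT (\<delta> l1) (\<lambda>x y. pure K T T (pure K A (opp A) x y) (\<delta> l2)))"
    using l by (intro L.D_cong delta_cong) (simp_all add: d)
  also have "\<dots> = sw ?TT (comult L l) (\<lambda>l1 l2. pure K T T (sw T (\<delta> l1) (\<lambda>x y. pure K A (opp A) x y)) (\<delta> l2))"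
    using l linD(3)[OF delta_lin_T] by (intro L.D_cong delta_push[symmetric, where F = "\<lambda>u. pure K T T u (\<delta> _)"])
      (auto intro!: lins pin)
  also have "\<dots> = tmap K T T \<delta> \<delta> (comult L l)"
    unfolding tmap_def using l by (intro L.D_cong) (simp_all add: d)
  also have "\<dots> = tmap K T T (\<lambda>x. x) (\<lambda>x. x) ?w"
    by (rule tmap_tmap[OF delta_lin_E delta_lin_E E_incl_T E_incl_T D, symmetric])
  finally have raw: "cotens_split_raw K H A \<rho> (\<delta> l) = tmap K T T (\<lambda>x. x) (\<lambda>x. x) ?w" .
  obtain r where r: "lin (tn A A) L r" "\<forall>l\<in>carrier L. r (\<delta> l) = l" using delta_retraction by auto
  have r': "lin T E (\<lambda>x. \<delta> (r x))" by (rule lin_comp[OF delta_lin_E same_lin[OF same_T same_refl r(1)]])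
  have retr: "tmap K E E (\<lambda>x. \<delta> (r x)) (\<lambda>x. \<delta> (r x)) (tmap K T T (\<lambda>x. x) (\<lambda>x. x) v) = v" if v: "v \<in> carrier (tn E E)" for v
  proof -
    have "tmap K E E (\<lambda>x. \<delta> (r x)) (\<lambda>x. \<delta> (r x)) (tmap K T T (\<lambda>x. x) (\<lambda>x. x) v) = tmap K E E (\<lambda>x. \<delta> (r x)) (\<lambda>x. \<delta> (r x)) v"
      by (rule tmap_tmap[OF E_incl_T E_incl_T r' r' v])
    also have "\<dots> = tmap K E E (\<lambda>x. x) (\<lambda>x. x) v"
      using r(2) by (intro tmap_cong[OF E_module E_module v]) (auto simp: carrier_E)
    also have "\<dots> = v" by (rule tmap_id[OF E_module E_module v])
    finally show ?thesis .
  qed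
  show ?thesis unfolding cotens_split_def Let_def raw
  proof (rule the_equality)
    show "?w \<in> carrier (tn E E) \<and> tmap K T T (\<lambda>x. x) (\<lambda>x. x) ?w = tmap K T T (\<lambda>x. x) (\<lambda>x. x) ?w" using w by simp
    fix v assume v: "v \<in> carrier (tn E E) \<and> tmap K T T (\<lambda>x. x) (\<lambda>x. x) v = tmap K T T (\<lambda>x. x) (\<lambda>x. x) ?w"
    then have "v = tmap K E E (\<lambda>x. \<delta> (r x)) (\<lambda>x. \<delta> (r x)) (tmap K T T (\<lambda>x. x) (\<lambda>x. x) ?w)" using retr[of v] by simp
    then show "v = ?w" using retr[OF w] by simp
  qed
qed

end

section \<open>Groups of isomorphism classes\<close>

text \<open>Sending \<open>g\<close> to the class of all strict objects with invariant \<open>g\<close> is a bijection onto the classes.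
  It transports the group structure, since the premises on \<open>m\<close> and \<open>u\<close> say that products and units
  of classes are read off from the invariants.\<close>

lemma class_group_iso:
  fixes G :: "('g, 'z) monoid_scheme"
  and eqv :: "'x \<Rightarrow> 'x \<Rightarrow> bool" and strict :: "'x \<Rightarrow> bool"
  assumes G: "group G"
    and ex: "\<And>X. strict X \<Longrightarrow> \<exists>g\<in>carrier G. R X g"
    and rep: "\<And>g. g \<in> carrier G \<Longrightarrow> \<exists>X. strict X \<and> R X g"
    and eqv: "\<And>X Y g h. strict X \<Longrightarrow> strict Y \<Longrightarrow> g \<in> carrier G \<Longrightarrow> h \<in> carrier G \<Longrightarrow> R X g \<Longrightarrow> R Y h \<Longrightarrow> eqv X Y \<longleftrightarrow> g = h"
    and m: "\<And>X Y Z g h j. strict X \<Longrightarrow> strict Y \<Longrightarrow> strict Z \<Longrightarrow> g \<in> carrier G \<Longrightarrow> h \<in> carrier G \<Longrightarrow> j \<in> carrier G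
      \<Longrightarrow> R X g \<Longrightarrow> R Y h \<Longrightarrow> R Z j \<Longrightarrow> m X Y Z \<longleftrightarrow> g \<otimes>\<^bsub>G\<^esub> h = j"
    and u: "\<And>Z j. strict Z \<Longrightarrow> j \<in> carrier G \<Longrightarrow> R Z j \<Longrightarrow> u Z \<longleftrightarrow> \<one>\<^bsub>G\<^esub> = j"
    and P: "P = \<lparr>carrier = {X. strict X} // {(X, Y). strict X \<and> strict Y \<and> eqv X Y},
      monoid.mult = (\<lambda>C D. {Z. strict Z \<and> (\<exists>X\<in>C. \<exists>Y\<in>D. m X Y Z)}), one = {Z. strict Z \<and> u Z}\<rparr>"
  shows "group P \<and> G \<cong> P"
proof -
  interpret G: group G by fact
  define cl where "cl g = {X. strict X \<and> R X g}" for g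
  let ?rel = "{(X, Y). strict X \<and> strict Y \<and> eqv X Y}"
  have img: "?rel `` {X} = cl g" if X: "strict X" "R X g" "g \<in> carrier G" for X g
  proof (rule Set.set_eqI)
    fix Y
    show "Y \<in> ?rel `` {X} \<longleftrightarrow> Y \<in> cl g"
    proof (cases "strict Y")
      case True
      obtain h where h: "h \<in> carrier G" "R Y h" using ex[OF True] by auto
      have "R Y g \<longleftrightarrow> g = h"
        using eqv[OF True True X(3) h(1) _ h(2)] eqv[OF True True h(1,1) h(2,2)] h(2) by auto
      then show ?thesis using eqv[OF X(1) True X(3) h(1) X(2) h(2)] X True by (simp add: cl_def)
    qed (simp add: cl_def)
  qed
  have cl_carr: "carrier P = cl ` carrier G"
  proof
    show "carrier P \<subseteq> cl ` carrier G"
    proof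
      fix C assume "C \<in> carrier P"
      then obtain X where X: "strict X" "C = ?rel `` {X}" by (auto simp: P quotient_def)
      obtain g where "g \<in> carrier G" "R X g" using ex[OF X(1)] by auto
      then show "C \<in> cl ` carrier G" using img X by auto
    qed
    show "cl ` carrier G \<subseteq> carrier P"
    proof
      fix C assume "C \<in> cl ` carrier G"
      then obtain g where g: "g \<in> carrier G" "C = cl g" by auto
      obtain X where X: "strict X" "R X g" using rep[OF g(1)] by auto
      then have "C = ?rel `` {X}" using img[OF X g(1)] g(2) by simp
      then show "C \<in> carrier P" using X(1) by (auto simp: P quotient_def)
    qed
  qed
  have "inj_on cl (carrier G)"
  proof (rule inj_onI)
    fix g h assume g: "g \<in> carrier G" and h: "h \<in> carrier G" and eq: "cl g = cl h"
    obtain X where X: "strict X" "R X g" using rep[OF g] by auto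
    then have "R X h" using eq by (auto simp: cl_def)
    then show "g = h" using eqv[OF X(1,1) g g X(2,2)] eqv[OF X(1,1) g h X(2)] by simp
  qed
  have mult: "cl g \<otimes>\<^bsub>P\<^esub> cl h = cl (g \<otimes>\<^bsub>G\<^esub> h)" if g: "g \<in> carrier G" and h: "h \<in> carrier G" for g h
  proof (rule Set.set_eqI)
    fix Z
    show "Z \<in> cl g \<otimes>\<^bsub>P\<^esub> cl h \<longleftrightarrow> Z \<in> cl (g \<otimes>\<^bsub>G\<^esub> h)"
    proof (cases "strict Z")
      case True
      obtain j where j: "j \<in> carrier G" "R Z j" using ex[OF True] by auto
      have Rj: "R Z g' \<longleftrightarrow> g' = j" if "g' \<in> carrier G" for g'
        using eqv[OF True True that j(1) _ j(2)] eqv[OF True True j(1,1) j(2,2)] j(2) by auto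
      obtain X where X: "strict X" "R X g" using rep[OF g] by auto
      obtain Y where Y: "strict Y" "R Y h" using rep[OF h] by auto
      have "Z \<in> cl g \<otimes>\<^bsub>P\<^esub> cl h \<longleftrightarrow> (\<exists>X\<in>cl g. \<exists>Y\<in>cl h. m X Y Z)" using True by (simp add: P)
      also have "\<dots> \<longleftrightarrow> g \<otimes>\<^bsub>G\<^esub> h = j"
        using m[OF _ _ True g h j(1) _ _ j(2)] X Y by (auto simp: cl_def)
      also have "\<dots> \<longleftrightarrow> Z \<in> cl (g \<otimes>\<^bsub>G\<^esub> h)" using Rj[of "g \<otimes>\<^bsub>G\<^esub> h"] g h True by (simp add: cl_def)
      finally show ?thesis .
    qed (simp add: P cl_def)
  qed
  have one: "\<one>\<^bsub>P\<^esub> = cl \<one>\<^bsub>G\<^esub>"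
  proof (rule Set.set_eqI)
    fix Z
    show "Z \<in> \<one>\<^bsub>P\<^esub> \<longleftrightarrow> Z \<in> cl \<one>\<^bsub>G\<^esub>"
    proof (cases "strict Z")
      case True
      obtain j where j: "j \<in> carrier G" "R Z j" using ex[OF True] by auto
      have "R Z \<one>\<^bsub>G\<^esub> \<longleftrightarrow> \<one>\<^bsub>G\<^esub> = j"
        using eqv[OF True True G.one_closed j(1) _ j(2)] eqv[OF True True j(1,1) j(2,2)] j(2) by auto
      then show ?thesis using u[OF True j] True by (simp add: P cl_def)
    qed (simp add: P cl_def)
  qed
  have hom: "cl \<in> hom G P" using mult cl_carr by (auto simp: hom_def)
  have "cl \<in> iso G P" using hom \<open>inj_on cl (carrier G)\<close> cl_carr by (simp add: iso_def bij_betw_def)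
  moreover have "group P"
  proof -
    have "P = P\<lparr>carrier := cl ` carrier G, one := cl \<one>\<^bsub>G\<^esub>\<rparr>" using cl_carr one by simp
    then show ?thesis using G.hom_imp_img_group[OF hom] by simp
  qed
  ultimately show ?thesis by (auto simp: is_iso_def)
qed

context fieldK
begin

lemma transport_module:
  assumes M: "module K M" and inj: "inj_on e (carrier M)" and c: "carrier N = e ` carrier M"
    and z: "\<zero>\<^bsub>N\<^esub> = e \<zero>\<^bsub>M\<^esub>" and a: "\<And>x y. x \<in> carrier M \<Longrightarrow> y \<in> carrier M \<Longrightarrow> e x \<oplus>\<^bsub>N\<^esub> e y = e (x \<oplus>\<^bsub>M\<^esub> y)"
    and s: "\<And>c x. c \<in> carrier K \<Longrightarrow> x \<in> carrier M \<Longrightarrow> c \<odot>\<^bsub>N\<^esub> e x = e (c \<odot>\<^bsub>M\<^esub> x)"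
  shows "lin M N e" "bij_betw e (carrier M) (carrier N)"
proof -
  interpret M: module K M by fact
  have "abelian_group N"
  proof (rule abelian_groupI)
    fix x assume "x \<in> carrier N"
    then obtain m where m: "m \<in> carrier M" "x = e m" using c by auto
    have "e (\<ominus>\<^bsub>M\<^esub> m) \<oplus>\<^bsub>N\<^esub> x = \<zero>\<^bsub>N\<^esub>" using m by (simp add: a z M.l_neg)
    then show "\<exists>y\<in>carrier N. y \<oplus>\<^bsub>N\<^esub> x = \<zero>\<^bsub>N\<^esub>" using c m by auto
  qed (auto simp: c z a M.a_ac)
  moreover have "module_axioms K N"
    by (auto simp: module_axioms_def c a s M.smult_l_distr M.smult_r_distr M.smult_assoc1)
  ultimately have "module K N" using is_cring by (simp add: module_def)
  then show "lin M N e" using M c by (intro linI) (auto simp: a s)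
  show "bij_betw e (carrier M) (carrier N)" using inj c by (simp add: bij_betw_def)
qed

end

context galoisK
begin

section \<open>The group \<open>Pic\<^sup>\<box>\<^sup>H(k)\<close>\<close>

text \<open>\<open>M\<close> is the line on which \<open>E\<close>, identified with \<open>L\<close>, acts by the character \<open>f\<close>.\<close>

definition line_mod where
  "line_mod f M e \<longleftrightarrow> lin k M e \<and> bij_betw e (carrier K) (carrier M) \<and>
    (\<forall>l\<in>carrier L. \<forall>c\<in>carrier K. eact M (\<delta> l) (e c) = e (f l \<otimes> c))"

text \<open>Coordinates are chosen so that both pairings become the multiplication of \<open>k\<close>.\<close>

definition line_context where
  "line_context X f \<longleftrightarrow> (\<exists>e e'. line_mod f (mP X) e \<and> line_mod (inv\<^bsub>Alg K L\<^esub> f) (mQ X) e' \<and>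
    (\<forall>c\<in>carrier K. \<forall>d\<in>carrier K. malpha X (pure K (mP X) (mQ X) (e c) (e' d)) = c \<otimes> d \<and>
      mbeta X (pure K (mQ X) (mP X) (e' d) (e c)) = c \<otimes> d))"

lemma Alg_inv: "f \<in> carrier (Alg K L) \<Longrightarrow> inv\<^bsub>Alg K L\<^esub> f \<in> carrier (Alg K L)"
  by (rule group.inv_closed[OF L.Alg_group])

lemma line_modD:
  assumes "line_mod f M e"
  shows "lin k M e" "module K M" "c \<in> carrier K \<Longrightarrow> e c \<in> carrier M" "x \<in> carrier M \<Longrightarrow> \<exists>c\<in>carrier K. x = e c"
    "c \<in> carrier K \<Longrightarrow> d \<in> carrier K \<Longrightarrow> e c = e d \<Longrightarrow> c = d"
    "c \<in> carrier K \<Longrightarrow> d \<in> carrier K \<Longrightarrow> e (c \<otimes> d) = c \<odot>\<^bsub>M\<^esub> e d"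
    "l \<in> carrier L \<Longrightarrow> c \<in> carrier K \<Longrightarrow> eact M (\<delta> l) (e c) = e (f l \<otimes> c)"
    "lin M k (inv_into (carrier K) e)" "c \<in> carrier K \<Longrightarrow> inv_into (carrier K) e (e c) = c"
proof -
  have e: "lin k M e" "bij_betw e (carrier K) (carrier M)" using assms by (auto simp: line_mod_def)
  show "lin k M e" by fact
  show "module K M" by (rule linD(2)[OF e(1)])
  show "c \<in> carrier K \<Longrightarrow> e c \<in> carrier M" using linD(3)[OF e(1)] by simp
  show "x \<in> carrier M \<Longrightarrow> \<exists>c\<in>carrier K. x = e c" using e(2) by (auto simp: bij_betw_def)
  show "c \<in> carrier K \<Longrightarrow> d \<in> carrier K \<Longrightarrow> e c = e d \<Longrightarrow> c = d" using e(2) by (auto simp: bij_betw_def dest: inj_onD)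
  show "c \<in> carrier K \<Longrightarrow> d \<in> carrier K \<Longrightarrow> e (c \<otimes> d) = c \<odot>\<^bsub>M\<^esub> e d" using linD(5)[OF e(1), of c d] by simp
  show "l \<in> carrier L \<Longrightarrow> c \<in> carrier K \<Longrightarrow> eact M (\<delta> l) (e c) = e (f l \<otimes> c)" using assms by (simp add: line_mod_def)
  show "lin M k (inv_into (carrier K) e)" using lin_inv_into[OF e(1)] e(2) by simp
  show "c \<in> carrier K \<Longrightarrow> inv_into (carrier K) e (e c) = c" using e(2) by (simp add: bij_betw_def)
qed

lemma line_left_module:
  fixes M :: "('k, 'a, 'm) cotens_mod"
  assumes f: "f \<in> carrier (Alg K L)" and M: "line_mod f M e"
  shows "left_module K E M"
proof -
  note D = line_modD[OF M] and f_in = L.AlgD(3)[OF f]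
  interpret M: module K M by (rule D(2))
  have el: "eact M (\<delta> l) (e c) = f l \<odot>\<^bsub>M\<^esub> e c" if "l \<in> carrier L" "c \<in> carrier K" for l c
    using D(6,7) that f_in by simp
  have sc: "a \<odot>\<^bsub>M\<^esub> (b \<odot>\<^bsub>M\<^esub> m) = b \<odot>\<^bsub>M\<^esub> (a \<odot>\<^bsub>M\<^esub> m)"
    if "a \<in> carrier K" "b \<in> carrier K" "m \<in> carrier M" for a b m
    using that M.smult_assoc1[of a b m] M.smult_assoc1[of b a m] m_comm[of a b] by simp
  have act: "eact M (\<delta> l) m = f l \<odot>\<^bsub>M\<^esub> m" if l: "l \<in> carrier L" and m: "m \<in> carrier M" for l m
    using D(4)[OF m] el[OF l] by auto
  have 1: "k_linear K M M (eact M (\<delta> l))" if l: "l \<in> carrier L" for l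
    using f_in[OF l] by (auto simp: k_linear_def act[OF l] M.smult_r_distr sc)
  have add: "\<delta> l \<oplus>\<^bsub>E\<^esub> \<delta> m = \<delta> (l \<oplus>\<^bsub>L\<^esub> m)" if "l \<in> carrier L" "m \<in> carrier L" for l m
    using linD(4)[OF delta_lin_E that] by simp
  have sm: "c \<odot>\<^bsub>E\<^esub> \<delta> l = \<delta> (c \<odot>\<^bsub>L\<^esub> l)" if "c \<in> carrier K" "l \<in> carrier L" for c l
    using linD(5)[OF delta_lin_E that] by simp
  note fl = linD(4,5)[OF L.AlgD(1)[OF f]]
  have 2: "k_linear K E M (\<lambda>x. eact M x m)" if m: "m \<in> carrier M" for m
    using m f_in by (auto simp: k_linear_def carrier_E add sm act fl M.smult_l_distr M.smult_assoc1)
  show ?thesis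
    using 1 2 D(2) f_in
    by (auto simp: left_module_def carrier_E E_mult E_one act L.AlgD(4,5)[OF f] M.smult_assoc1)
qed

lemma same_cotens_tens: "same_sp (tn M N) (cotens_tens K H A \<rho> M N)"
  by (simp add: same_sp_def cotens_tens_def module.defs)

lemma same_cotens_base: "same_sp k (cotens_base K A)"
  by (simp add: same_sp_def cotens_base_def module.defs)

lemma left_moduleD: assumes "left_module K E M"
  shows "module K M" "x \<in> carrier E \<Longrightarrow> lin M M (eact M x)" "m \<in> carrier M \<Longrightarrow> lin E M (\<lambda>x. eact M x m)"
    "l \<in> carrier L \<Longrightarrow> m \<in> carrier M \<Longrightarrow> eact M (\<delta> l) m \<in> carrier M"
    "l \<in> carrier L \<Longrightarrow> l' \<in> carrier L \<Longrightarrow> m \<in> carrier M \<Longrightarrow> eact M (\<delta> (l \<otimes>\<^bsub>L\<^esub> l')) m = eact M (\<delta> l) (eact M (\<delta> l') m)"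
    "m \<in> carrier M \<Longrightarrow> eact M (\<delta> \<one>\<^bsub>L\<^esub>) m = m"
proof -
  show m: "module K M" using assms by (simp add: left_module_def)
  show l: "x \<in> carrier E \<Longrightarrow> lin M M (eact M x)" for x using assms m by (simp add: left_module_def lin_def)
  show "m \<in> carrier M \<Longrightarrow> lin E M (\<lambda>x. eact M x m)" using assms m E_module by (simp add: left_module_def lin_def)
  show "l \<in> carrier L \<Longrightarrow> m \<in> carrier M \<Longrightarrow> eact M (\<delta> l) m \<in> carrier M" using linD(3)[OF l[OF delta_E]] .
  show "l \<in> carrier L \<Longrightarrow> l' \<in> carrier L \<Longrightarrow> m \<in> carrier M \<Longrightarrow> eact M (\<delta> (l \<otimes>\<^bsub>L\<^esub> l')) m = eact M (\<delta> l) (eact M (\<delta> l') m)"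
    using assms delta_E by (simp add: left_module_def E_mult[symmetric])
  show "m \<in> carrier M \<Longrightarrow> eact M (\<delta> \<one>\<^bsub>L\<^esub>) m = m"
    using assms by (simp add: left_module_def E_one[symmetric])
qed

text \<open>The action on a tensor product is the diagonal one of \<open>L\<close>-modules.\<close>

lemma eact_tens:
  assumes M: "left_module K E M" and N: "left_module K E N" and l: "l \<in> carrier L"
    and h: "m \<in> carrier M" "n \<in> carrier N"
  shows "eact (cotens_tens K H A \<rho> M N) (\<delta> l) (pure K M N m n)
     = sw (tn M N) (comult L l) (\<lambda>l1 l2. pure K M N (eact M (\<delta> l1) m) (eact N (\<delta> l2) n))"
proof -
  note M = left_moduleD[OF M] and N = left_moduleD[OF N]
  have D: "tmap K E E \<delta> \<delta> (comult L l) \<in> carrier (tn E E)" using l by (intro tmap_in[OF delta_lin_E delta_lin_E]) simp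
  have b: "bil E E (tn M N) (\<lambda>x y. pure K M N (eact M x m) (eact N y n))"
    using M(1) N(1) E_module linD(3)[OF M(3)[OF h(1)]] linD(3)[OF N(3)[OF h(2)]]
    by (intro bilI module_tens pure_lins M(3) N(3) h) auto
  have "eact (cotens_tens K H A \<rho> M N) (\<delta> l) (pure K M N m n)
     = sw (tn M N) (tmap K E E \<delta> \<delta> (comult L l)) (\<lambda>x y. tmap K M N (eact M x) (eact N y) (pure K M N m n))"
    using l by (simp add: cotens_tens_def module.defs left_mod.defs cotens_split_delta)
  also have "\<dots> = sw (tn M N) (tmap K E E \<delta> \<delta> (comult L l)) (\<lambda>x y. pure K M N (eact M x m) (eact N y n))"
    using h by (intro sw_cong[OF E_module E_module D] tmap_pure M(2) N(2))
  also have "\<dots> = sw (tn M N) (comult L l) (\<lambda>l1 l2. pure K M N (eact M (\<delta> l1) m) (eact N (\<delta> l2) n))"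
    using l by (intro sw_tmap[OF delta_lin_E delta_lin_E _ b]) simp
  finally show ?thesis .
qed

lemma line_pure: assumes M: "line_mod f M e" and N: "line_mod g N e'" and c: "c \<in> carrier K" "d \<in> carrier K"
  shows "pure K M N (e c) (e' d) = pure K M N (e (c \<otimes> d)) (e' \<one>)"
proof -
  note M = line_modD[OF M] and N = line_modD[OF N]
  have "pure K M N (e c) (d \<odot>\<^bsub>N\<^esub> e' \<one>) = pure K M N (d \<odot>\<^bsub>M\<^esub> e c) (e' \<one>)"
    using linD(5)[OF pure_lins(2)[OF M(2) N(2) M(3)[OF c(1)] lin_id[OF N(2)]] c(2) N(3)[OF one_closed]]
      linD(5)[OF pure_lins(1)[OF M(2) N(2) lin_id[OF M(2)] N(3)[OF one_closed]] c(2) M(3)[OF c(1)]] by simp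
  then show ?thesis using M(6)[of d c] N(6)[of d \<one>] c by (simp add: m_comm)
qed

text \<open>All scalars can be collected in the left factor.\<close>

lemma line_tens: assumes M: "line_mod f M e" and N: "line_mod g N e'" and t: "t \<in> carrier (tn M N)"
  shows "\<exists>c\<in>carrier K. t = pure K M N (e c) (e' \<one>)"
proof -
  note M' = line_modD[OF M] and N' = line_modD[OF N]
  note pl = lin_comp[OF pure_lins(1)[OF M'(2) N'(2) lin_id[OF M'(2)] N'(3)[OF one_closed]] M'(1)]
  show ?thesis using M'(2) N'(2) t
  proof (induction rule: tens_induct)
    case zero
    show ?case using lin_zero[OF pl] by (intro bexI[of _ \<zero>]) simp_all
  next
    case (pure m n)
    obtain c d where "c \<in> carrier K" "m = e c" "d \<in> carrier K" "n = e' d" using M'(4)[OF pure(1)] N'(4)[OF pure(2)] by auto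
    then show ?case using line_pure[OF M N, of c d] by (intro bexI[of _ "c \<otimes> d"]) auto
  next
    case (add s t)
    then obtain c d where "c \<in> carrier K" "d \<in> carrier K" "s = pure K M N (e c) (e' \<one>)" "t = pure K M N (e d) (e' \<one>)" by auto
    then show ?case using linD(4)[OF pl, of c d] by (intro bexI[of _ "c \<oplus> d"]) simp_all
  qed
qed

lemma line_coord: assumes M: "line_mod f M e" and N: "line_mod g N e'"
  shows "bil M N k (\<lambda>x y. inv_into (carrier K) e x \<otimes> inv_into (carrier K) e' y)"
proof -
  note M = line_modD[OF M] and N = line_modD[OF N]
  have "\<And>x. x \<in> carrier M \<Longrightarrow> inv_into (carrier K) e x \<in> carrier K" "\<And>x. x \<in> carrier N \<Longrightarrow> inv_into (carrier K) e' x \<in> carrier K"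
    using linD(3)[OF M(8)] linD(3)[OF N(8)] by auto
  then show ?thesis using M(2,8) N(2,8) by (intro bilI lin_mult_K) auto
qed

text \<open>The action is diagonal, so that the two characters are convolved.\<close>

lemma line_mod_tens: fixes M :: "('k, 'a, 'm) cotens_mod" and N :: "('k, 'a, 'n) cotens_mod"
  assumes f: "f \<in> carrier (Alg K L)" and g: "g \<in> carrier (Alg K L)" and M: "line_mod f M e" and N: "line_mod g N e'"
  shows "line_mod (f \<otimes>\<^bsub>Alg K L\<^esub> g) (cotens_tens K H A \<rho> M N) (\<lambda>c. pure K M N (e c) (e' \<one>))" (is "line_mod _ ?C ?e")
proof -
  note M' = line_modD[OF M] and N' = line_modD[OF N]
  note [simp] = L.AlgD(3)[OF f] L.AlgD(3)[OF g] M'(2) N'(2)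
    and [lins] = lin_comp[OF L.AlgD(1)[OF f]] lin_comp[OF L.AlgD(1)[OF g]]
  note pl = lin_comp[OF pure_lins(1)[OF M'(2) N'(2) lin_id[OF M'(2)] N'(3)[OF one_closed]] M'(1)]
  have l: "lin k ?C ?e" by (rule same_lin[OF same_refl same_cotens_tens pl])
  have inj: "inj_on ?e (carrier K)"
  proof (rule inj_on_inverseI)
    fix c assume c: "c \<in> carrier K"
    show "sw k (?e c) (\<lambda>x y. inv_into (carrier K) e x \<otimes> inv_into (carrier K) e' y) = c"
      using sw_pure[OF line_coord[OF M N] M'(3)[OF c] N'(3)[OF one_closed]] c M'(9) N'(9) by simp
  qed
  have "?e ` carrier K = carrier ?C"
  proof -
    have "carrier ?C = carrier (tn M N)" by (rule same_spD(1)[OF same_cotens_tens])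
    then show ?thesis using line_tens[OF M N] linD(3)[OF pl] by auto
  qed
  moreover have "eact ?C (\<delta> l) (?e c) = ?e ((f \<otimes>\<^bsub>Alg K L\<^esub> g) l \<otimes> c)" if h: "l \<in> carrier L" "c \<in> carrier K" for l c
  proof -
    have "eact ?C (\<delta> l) (?e c) = sw (tn M N) (comult L l) (\<lambda>l1 l2. pure K M N (eact M (\<delta> l1) (e c)) (eact N (\<delta> l2) (e' \<one>)))"
      using h M'(3) N'(3) by (intro eact_tens line_left_module[OF f M] line_left_module[OF g N]) simp_all
    also have "\<dots> = sw (tn M N) (comult L l) (\<lambda>l1 l2. ?e ((f l1 \<otimes> g l2) \<otimes> c))"
    proof (intro L.D_cong h(1))
      fix l1 l2 assume l12: "l1 \<in> carrier L" "l2 \<in> carrier L"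
      have "(f l1 \<otimes> c) \<otimes> g l2 = (f l1 \<otimes> g l2) \<otimes> c" using l12 h by (simp add: m_ac)
      then show "pure K M N (eact M (\<delta> l1) (e c)) (eact N (\<delta> l2) (e' \<one>)) = ?e ((f l1 \<otimes> g l2) \<otimes> c)"
        using line_pure[OF M N, of "f l1 \<otimes> c" "g l2"] l12 h M'(7) N'(7) by simp
    qed
    also have "\<dots> = ?e (sw k (comult L l) (\<lambda>l1 l2. f l1 \<otimes> g l2) \<otimes> c)"
      using h by (intro L.D_push[symmetric, where F = "\<lambda>z. ?e (z \<otimes> c)"] lin_comp[OF pl]) (auto intro!: lins)
    finally show ?thesis using h by (simp add: L.Alg_mult)
  qed
  ultimately show ?thesis using l inj by (simp add: line_mod_def bij_betw_def)
qed

text \<open>On the image of a basis vector, which is not zero, \<open>\<delta> l\<close> acts by both \<open>f l\<close> and \<open>g l\<close>.\<close>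

lemma line_iso_eq:
  fixes M :: "('k, 'a, 'm) cotens_mod" and N :: "('k, 'a, 'n) cotens_mod"
  assumes f: "f \<in> carrier (Alg K L)" and g: "g \<in> carrier (Alg K L)" and M: "line_mod f M e" and N: "line_mod g N e'"
    and \<phi>: "left_module_hom K E M N \<phi>" "bij_betw \<phi> (carrier M) (carrier N)"
  shows "f = g"
proof (rule L.Alg_eqI[OF f g])
  note M' = line_modD[OF M] and N' = line_modD[OF N]
  fix l assume l: "l \<in> carrier L"
  have pl: "lin M N \<phi>" using \<phi>(1) M'(2) N'(2) by (simp add: left_module_hom_def lin_def)
  have e1: "e \<one> \<in> carrier M" using M'(3) by simp
  have ne: "\<phi> (e \<one>) \<noteq> \<zero>\<^bsub>N\<^esub>"
  proof
    assume "\<phi> (e \<one>) = \<zero>\<^bsub>N\<^esub>"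
    then have "\<phi> (e \<one>) = \<phi> (e \<zero>)" using lin_zero[OF pl] lin_zero[OF M'(1)] by simp
    then have "e \<one> = e \<zero>" using \<phi>(2) M'(3) by (auto simp: bij_betw_def dest!: inj_onD)
    then show False using M'(5)[of \<one> \<zero>] by simp
  qed
  obtain c where c: "c \<in> carrier K" "\<phi> (e \<one>) = e' c" using N'(4)[OF linD(3)[OF pl e1]] by auto
  have "f l \<odot>\<^bsub>N\<^esub> \<phi> (e \<one>) = \<phi> (eact M (\<delta> l) (e \<one>))"
    using l e1 linD(5)[OF pl] M'(6,7) L.AlgD(3)[OF f] by simp
  also have "\<dots> = eact N (\<delta> l) (\<phi> (e \<one>))" using \<phi>(1) l e1 delta_E by (simp add: left_module_hom_def)
  also have "\<dots> = g l \<odot>\<^bsub>N\<^esub> \<phi> (e \<one>)" using c l N'(6,7) L.AlgD(3)[OF g] by simp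
  finally show "f l = g l"
    using l L.AlgD(3)[OF f] L.AlgD(3)[OF g] linD(3)[OF pl e1] ne by (intro scalar_inj[OF N'(2)]) auto
qed

lemma line_transfer:
  fixes M :: "('k, 'a, 'm) cotens_mod" and N :: "('k, 'a, 'n) cotens_mod"
  assumes f: "f \<in> carrier (Alg K L)" and M: "line_mod f M e" and N: "line_mod f N e'"
  shows "left_module_hom K E M N (\<lambda>x. e' (inv_into (carrier K) e x))" "bij_betw (\<lambda>x. e' (inv_into (carrier K) e x)) (carrier M) (carrier N)"
proof -
  note M' = line_modD[OF M] and N' = line_modD[OF N] and [simp] = L.AlgD(3)[OF f]
  have l: "lin M N (\<lambda>x. e' (inv_into (carrier K) e x))" by (rule lin_comp[OF N'(1) M'(8)])
  have "e' (inv_into (carrier K) e (eact M x m)) = eact N x (e' (inv_into (carrier K) e m))" if x: "x \<in> carrier E" and m: "m \<in> carrier M" for x m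
  proof -
    obtain l where "l \<in> carrier L" "x = \<delta> l" using x by (auto simp: carrier_E)
    moreover obtain c where "c \<in> carrier K" "m = e c" using M'(4)[OF m] by auto
    ultimately show ?thesis by (simp add: M'(7,9) N'(7))
  qed
  then show "left_module_hom K E M N (\<lambda>x. e' (inv_into (carrier K) e x))"
    using l by (simp add: left_module_hom_def lin_def)
  have "bij_betw (inv_into (carrier K) e) (carrier M) (carrier K)" using M by (intro bij_betw_inv_into) (simp add: line_mod_def)
  moreover have "bij_betw e' (carrier K) (carrier N)" using N by (simp add: line_mod_def)
  ultimately show "bij_betw (\<lambda>x. e' (inv_into (carrier K) e x)) (carrier M) (carrier N)"
    using bij_betw_trans by (fastforce simp: comp_def)
qed

lemma line_context_iso:
  fixes X :: "('k, 'a, 'm) cotens_morita" and Y :: "('k, 'a, 'n) cotens_morita"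
  assumes f: "f \<in> carrier (Alg K L)" and g: "g \<in> carrier (Alg K L)" and X: "line_context X f" and Y: "line_context Y g"
  shows "cotens_morita_iso K H A \<rho> X Y \<longleftrightarrow> f = g"
proof
  obtain e e' where e: "line_mod f (mP X) e" "line_mod (inv\<^bsub>Alg K L\<^esub> f) (mQ X) e'"
    "\<And>c d. c \<in> carrier K \<Longrightarrow> d \<in> carrier K \<Longrightarrow> malpha X (pure K (mP X) (mQ X) (e c) (e' d)) = c \<otimes> d \<and>
      mbeta X (pure K (mQ X) (mP X) (e' d) (e c)) = c \<otimes> d" using X by (auto simp: line_context_def)
  obtain i i' where i: "line_mod g (mP Y) i" "line_mod (inv\<^bsub>Alg K L\<^esub> g) (mQ Y) i'"
    "\<And>c d. c \<in> carrier K \<Longrightarrow> d \<in> carrier K \<Longrightarrow> malpha Y (pure K (mP Y) (mQ Y) (i c) (i' d)) = c \<otimes> d \<and>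
      mbeta Y (pure K (mQ Y) (mP Y) (i' d) (i c)) = c \<otimes> d" using Y by (auto simp: line_context_def)
  show "f = g" if "cotens_morita_iso K H A \<rho> X Y"
    using that line_iso_eq[OF f g e(1) i(1)] by (auto simp: cotens_morita_iso_def Let_def)
  show "cotens_morita_iso K H A \<rho> X Y" if fg: "f = g"
    unfolding cotens_morita_iso_def Let_def
  proof (intro exI conjI ballI)
    note t = line_transfer[OF f e(1)] line_transfer[OF Alg_inv[OF f] e(2)]
    show "left_module_hom K E (mP X) (mP Y) (\<lambda>x. i (inv_into (carrier K) e x))"
      "bij_betw (\<lambda>x. i (inv_into (carrier K) e x)) (carrier (mP X)) (carrier (mP Y))"
      "left_module_hom K E (mQ X) (mQ Y) (\<lambda>x. i' (inv_into (carrier K) e' x))"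
      "bij_betw (\<lambda>x. i' (inv_into (carrier K) e' x)) (carrier (mQ X)) (carrier (mQ Y))"
      using t i(1,2) fg by auto
    fix m n assume "m \<in> carrier (mP X)" "n \<in> carrier (mQ X)"
    then obtain c d where "c \<in> carrier K" "m = e c" "d \<in> carrier K" "n = e' d"
      using line_modD(4)[OF e(1)] line_modD(4)[OF e(2)] by metis
    then show "malpha Y (pure K (mP Y) (mQ Y) (i (inv_into (carrier K) e m)) (i' (inv_into (carrier K) e' n))) = malpha X (pure K (mP X) (mQ X) m n)"
      "mbeta Y (pure K (mQ Y) (mP Y) (i' (inv_into (carrier K) e' n)) (i (inv_into (carrier K) e m))) = mbeta X (pure K (mQ X) (mP X) n m)"
      using e(3) i(3) by (simp_all add: line_modD(9)[OF e(1)] line_modD(9)[OF e(2)])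
  qed
qed

text \<open>In coordinates every map in the definition of the product is a product of four scalars.\<close>

lemma line_context_mult:
  fixes X Y :: "('k, 'a, 'm) cotens_morita"
  assumes f: "f \<in> carrier (Alg K L)" and g: "g \<in> carrier (Alg K L)" and X: "line_context X f" and Y: "line_context Y g"
  shows "line_context (cotens_morita_mult K H A \<rho> X Y) (f \<otimes>\<^bsub>Alg K L\<^esub> g)"
proof -
  interpret G: group "Alg K L" by (rule L.Alg_group)
  obtain e e' where e: "line_mod f (mP X) e" "line_mod (inv\<^bsub>Alg K L\<^esub> f) (mQ X) e'"
    and eX: "\<And>c d. c \<in> carrier K \<Longrightarrow> d \<in> carrier K \<Longrightarrow> malpha X (pure K (mP X) (mQ X) (e c) (e' d)) = c \<otimes> d"
      "\<And>c d. c \<in> carrier K \<Longrightarrow> d \<in> carrier K \<Longrightarrow> mbeta X (pure K (mQ X) (mP X) (e' d) (e c)) = c \<otimes> d"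
    using X by (auto simp: line_context_def)
  obtain i i' where i: "line_mod g (mP Y) i" "line_mod (inv\<^bsub>Alg K L\<^esub> g) (mQ Y) i'"
    and iY: "\<And>c d. c \<in> carrier K \<Longrightarrow> d \<in> carrier K \<Longrightarrow> malpha Y (pure K (mP Y) (mQ Y) (i c) (i' d)) = c \<otimes> d"
      "\<And>c d. c \<in> carrier K \<Longrightarrow> d \<in> carrier K \<Longrightarrow> mbeta Y (pure K (mQ Y) (mP Y) (i' d) (i c)) = c \<otimes> d"
    using Y by (auto simp: line_context_def)
  let ?M = "mP X" and ?N = "mQ X" and ?M' = "mP Y" and ?N' = "mQ Y"
  let ?d = "inv_into (carrier K) e" and ?d' = "inv_into (carrier K) e'"
  let ?j = "inv_into (carrier K) i" and ?j' = "inv_into (carrier K) i'"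
  note eD = line_modD[OF e(1)] and e'D = line_modD[OF e(2)] and iD = line_modD[OF i(1)] and i'D = line_modD[OF i(2)]
  note [lins] = lin_comp[OF eD(8)] lin_comp[OF e'D(8)] lin_comp[OF iD(8)] lin_comp[OF i'D(8)]
  have [simp]: "\<And>x. x \<in> carrier ?M \<Longrightarrow> ?d x \<in> carrier K" "\<And>x. x \<in> carrier ?N \<Longrightarrow> ?d' x \<in> carrier K"
    "\<And>x. x \<in> carrier ?M' \<Longrightarrow> ?j x \<in> carrier K" "\<And>x. x \<in> carrier ?N' \<Longrightarrow> ?j' x \<in> carrier K"
    using linD(3)[OF eD(8)] linD(3)[OF e'D(8)] linD(3)[OF iD(8)] linD(3)[OF i'D(8)] by simp_all
  note [simp] = eD(2,3,9) e'D(2,3,9) iD(2,3,9) i'D(2,3,9)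
  define s where "s c = pure K ?M ?M' (e c) (i \<one>)" for c
  define t where "t c = pure K ?N' ?N (i' c) (e' \<one>)" for c
  have lP: "line_mod (f \<otimes>\<^bsub>Alg K L\<^esub> g) (cotens_tens K H A \<rho> ?M ?M') s"
    unfolding s_def by (rule line_mod_tens[OF f g e(1) i(1)])
  have "line_mod (inv\<^bsub>Alg K L\<^esub> g \<otimes>\<^bsub>Alg K L\<^esub> inv\<^bsub>Alg K L\<^esub> f) (cotens_tens K H A \<rho> ?N' ?N) t"
    unfolding t_def by (rule line_mod_tens[OF Alg_inv[OF g] Alg_inv[OF f] i(2) e(2)])
  then have lQ: "line_mod (inv\<^bsub>Alg K L\<^esub> (f \<otimes>\<^bsub>Alg K L\<^esub> g)) (cotens_tens K H A \<rho> ?N' ?N) t"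
    by (simp add: G.inv_mult_group[OF f g])
  have s_in: "s c \<in> carrier (tn ?M ?M')" and t_in: "t c \<in> carrier (tn ?N' ?N)" if "c \<in> carrier K" for c
    unfolding s_def t_def using that by (auto intro!: pure_in)
  define F where "F m m' n' n = ((?j m' \<otimes> ?j' n') \<otimes> ?d m) \<otimes> ?d' n" for m m' n' n
  have F_eq: "malpha X (pure K ?M ?N (malpha Y (pure K ?M' ?N' m' n') \<odot>\<^bsub>?M\<^esub> m) n) = F m m' n' n"
    if h: "m \<in> carrier ?M" "m' \<in> carrier ?M'" "n' \<in> carrier ?N'" "n \<in> carrier ?N" for m m' n' n
  proof -
    obtain a b p q where "a \<in> carrier K" "b \<in> carrier K" "p \<in> carrier K" "q \<in> carrier K" "m = e a" "m' = i b" "n' = i' p" "n = e' q"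
      using eD(4)[OF h(1)] iD(4)[OF h(2)] i'D(4)[OF h(3)] e'D(4)[OF h(4)] by metis
    then show ?thesis by (simp add: F_def iY eX eD(6)[symmetric])
  qed
  define F' where "F' n' n m m' = ?j m' \<otimes> ((?d m \<otimes> ?d' n) \<otimes> ?j' n')" for n' n m m'
  have F'_eq: "mbeta Y (pure K ?N' ?M' (mbeta X (pure K ?N ?M n m) \<odot>\<^bsub>?N'\<^esub> n') m') = F' n' n m m'"
    if h: "m \<in> carrier ?M" "m' \<in> carrier ?M'" "n' \<in> carrier ?N'" "n \<in> carrier ?N" for m m' n' n
  proof -
    obtain a b p q where "a \<in> carrier K" "b \<in> carrier K" "p \<in> carrier K" "q \<in> carrier K" "m = e a" "m' = i b" "n' = i' p" "n = e' q"
      using eD(4)[OF h(1)] iD(4)[OF h(2)] i'D(4)[OF h(3)] e'D(4)[OF h(4)] by metis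
    then show ?thesis by (simp add: F'_def iY eX i'D(6)[symmetric])
  qed
  have qF: "quad ?M ?M' ?N' ?N k F" unfolding F_def by (auto intro!: lins)
  have qF': "quad ?N' ?N ?M ?M' k F'" unfolding F'_def by (auto intro!: lins)
  note [lins] = quadD[OF qF] quadD[OF qF']
  have alpha: "malpha (cotens_morita_mult K H A \<rho> X Y) (pure K (cotens_tens K H A \<rho> ?M ?M') (cotens_tens K H A \<rho> ?N' ?N) (s c) (t d)) = c \<otimes> d"
    if h: "c \<in> carrier K" "d \<in> carrier K" for c d
  proof -
    let ?S = "tn ?M ?M'" and ?T = "tn ?N' ?N"
    have b: "bil ?S ?T k (\<lambda>x y. sw k x (\<lambda>m m'. sw k y (\<lambda>n' n. F m m' n' n)))" by (auto intro!: lins)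
    have "malpha (cotens_morita_mult K H A \<rho> X Y) (pure K (cotens_tens K H A \<rho> ?M ?M') (cotens_tens K H A \<rho> ?N' ?N) (s c) (t d))
      = sw k (pure K ?S ?T (s c) (t d)) (\<lambda>x y. sw k x (\<lambda>m m'. sw k y (\<lambda>n' n.
         malpha X (pure K ?M ?N (malpha Y (pure K ?M' ?N' m' n') \<odot>\<^bsub>?M\<^esub> m) n))))"
      by (simp add: cotens_morita_mult_def sw_K same_pure[OF same_cotens_tens same_cotens_tens])
    also have "\<dots> = sw k (pure K ?S ?T (s c) (t d)) (\<lambda>x y. sw k x (\<lambda>m m'. sw k y (\<lambda>n' n. F m m' n' n)))"
    proof (rule sw_cong[of ?S ?T])
      fix x y assume "x \<in> carrier ?S" "y \<in> carrier ?T"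
      then show "sw k x (\<lambda>m m'. sw k y (\<lambda>n' n. malpha X (pure K ?M ?N (malpha Y (pure K ?M' ?N' m' n') \<odot>\<^bsub>?M\<^esub> m) n)))
        = sw k x (\<lambda>m m'. sw k y (\<lambda>n' n. F m m' n' n))"
        by (intro sw_cong[of ?M ?M' x] sw_cong[of ?N' ?N y] F_eq) simp_all
    qed (use h s_in t_in in \<open>simp_all add: pure_in\<close>)
    also have "\<dots> = sw k (s c) (\<lambda>m m'. sw k (t d) (\<lambda>n' n. F m m' n' n))"
      using h by (intro sw_pure[OF b] s_in t_in)
    also have "\<dots> = sw k (t d) (\<lambda>n' n. F (e c) (i \<one>) n' n)"
      unfolding s_def using h t_in by (intro sw_pure) (auto intro!: lins)
    also have "\<dots> = F (e c) (i \<one>) (i' d) (e' \<one>)"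
      unfolding t_def using h by (intro sw_pure) (auto intro!: lins)
    finally show ?thesis using h by (simp add: F_def m_comm)
  qed
  have beta: "mbeta (cotens_morita_mult K H A \<rho> X Y) (pure K (cotens_tens K H A \<rho> ?N' ?N) (cotens_tens K H A \<rho> ?M ?M') (t d) (s c)) = c \<otimes> d"
    if h: "c \<in> carrier K" "d \<in> carrier K" for c d
  proof -
    let ?S = "tn ?M ?M'" and ?T = "tn ?N' ?N"
    have b: "bil ?T ?S k (\<lambda>x y. sw k x (\<lambda>n' n. sw k y (\<lambda>m m'. F' n' n m m')))" by (auto intro!: lins)
    have sc: "s c \<in> carrier ?S" by (rule s_in[OF h(1)])
    have b2: "bil ?N' ?N k (\<lambda>n' n. sw k (s c) (\<lambda>m m'. F' n' n m m'))" using sc by (auto intro!: lins)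
    have b3: "bil ?M ?M' k (\<lambda>m m'. F' (i' d) (e' \<one>) m m')" using h by (auto intro!: lins)
    have "mbeta (cotens_morita_mult K H A \<rho> X Y) (pure K (cotens_tens K H A \<rho> ?N' ?N) (cotens_tens K H A \<rho> ?M ?M') (t d) (s c))
      = sw k (pure K ?T ?S (t d) (s c)) (\<lambda>x y. sw k x (\<lambda>n' n. sw k y (\<lambda>m m'.
         mbeta Y (pure K ?N' ?M' (mbeta X (pure K ?N ?M n m) \<odot>\<^bsub>?N'\<^esub> n') m'))))"
      by (simp add: cotens_morita_mult_def sw_K same_pure[OF same_cotens_tens same_cotens_tens])
    also have "\<dots> = sw k (pure K ?T ?S (t d) (s c)) (\<lambda>x y. sw k x (\<lambda>n' n. sw k y (\<lambda>m m'. F' n' n m m')))"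
    proof (rule sw_cong[of ?T ?S])
      fix x y assume "x \<in> carrier ?T" "y \<in> carrier ?S"
      then show "sw k x (\<lambda>n' n. sw k y (\<lambda>m m'. mbeta Y (pure K ?N' ?M' (mbeta X (pure K ?N ?M n m) \<odot>\<^bsub>?N'\<^esub> n') m')))
        = sw k x (\<lambda>n' n. sw k y (\<lambda>m m'. F' n' n m m'))"
        by (intro sw_cong[of ?N' ?N x] sw_cong[of ?M ?M' y] F'_eq) simp_all
    qed (use h s_in t_in in \<open>simp_all add: pure_in\<close>)
    also have "\<dots> = sw k (t d) (\<lambda>n' n. sw k (s c) (\<lambda>m m'. F' n' n m m'))"
      using h by (intro sw_pure[OF b] s_in t_in)
    also have "\<dots> = sw k (s c) (\<lambda>m m'. F' (i' d) (e' \<one>) m m')"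
      unfolding t_def using h by (intro sw_pure[OF b2]) simp_all
    also have "\<dots> = F' (i' d) (e' \<one>) (e c) (i \<one>)"
      unfolding s_def using h by (intro sw_pure[OF b3]) simp_all
    finally show ?thesis using h by (simp add: F'_def m_comm)
  qed
  show ?thesis unfolding line_context_def
    using lP lQ alpha beta by (intro exI[of _ s] exI[of _ t]) (simp add: cotens_morita_mult_def)
qed

lemma line_context_unit: "line_context (cotens_morita_unit K A) \<one>\<^bsub>Alg K L\<^esub>"
proof -
  interpret G: group "Alg K L" by (rule L.Alg_group)
  have l: "lin k (cotens_base K A) (\<lambda>c. c)" by (rule same_lin[OF same_refl same_cotens_base lin_id[OF module_k]])
  have "eact (cotens_base K A) (\<delta> l) c = \<one>\<^bsub>Alg K L\<^esub> l \<otimes> c" if "l \<in> carrier L" for l c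
    using that by (simp add: cotens_base_def module.defs left_mod.defs cotens_eval_delta L.Alg_one)
  then have m: "line_mod \<one>\<^bsub>Alg K L\<^esub> (cotens_base K A) (\<lambda>c. c)"
    using l by (simp add: line_mod_def same_spD(1)[OF same_cotens_base] bij_betw_def)
  have b: "bil k k k (\<lambda>x y. x \<otimes> y)" by (auto intro!: lins)
  have "tensor_lift K (\<otimes>) (pure K (cotens_base K A) (cotens_base K A) c d) = c \<otimes> d"
    if "c \<in> carrier K" "d \<in> carrier K" for c d
    using sw_pure[OF b, of c d] that by (simp add: same_pure[OF same_cotens_base same_cotens_base] sw_K)
  then show ?thesis unfolding line_context_def using m
    by (intro exI[of _ "\<lambda>c. c"]) (simp add: cotens_morita_unit_def m_comm)
qed

lemma line_context_strict:
  fixes X :: "('k, 'a, 'm) cotens_morita"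
  assumes f: "f \<in> carrier (Alg K L)" and X: "line_context X f"
    and alpha: "lin (tn (mP X) (mQ X)) k (malpha X)" and beta: "lin (tn (mQ X) (mP X)) k (mbeta X)"
  shows "strict_cotens_morita K H A \<rho> X"
proof -
  interpret G: group "Alg K L" by (rule L.Alg_group)
  obtain e e' where e: "line_mod f (mP X) e" "line_mod (inv\<^bsub>Alg K L\<^esub> f) (mQ X) e'"
    and eX: "\<And>c d. c \<in> carrier K \<Longrightarrow> d \<in> carrier K \<Longrightarrow> malpha X (pure K (mP X) (mQ X) (e c) (e' d)) = c \<otimes> d"
      "\<And>c d. c \<in> carrier K \<Longrightarrow> d \<in> carrier K \<Longrightarrow> mbeta X (pure K (mQ X) (mP X) (e' d) (e c)) = c \<otimes> d"
    using X by (auto simp: line_context_def)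
  note eD = line_modD[OF e(1)] and e'D = line_modD[OF e(2)]
  have one: "f \<otimes>\<^bsub>Alg K L\<^esub> inv\<^bsub>Alg K L\<^esub> f = \<one>\<^bsub>Alg K L\<^esub>" "inv\<^bsub>Alg K L\<^esub> f \<otimes>\<^bsub>Alg K L\<^esub> f = \<one>\<^bsub>Alg K L\<^esub>"
    using f by simp_all
  note lP = line_mod_tens[OF f Alg_inv[OF f] e, unfolded one] and lQ = line_mod_tens[OF Alg_inv[OF f] f e(2,1), unfolded one]
  note tP = line_tens[OF e] and tQ = line_tens[OF e(2,1)]
  have base: "eact (cotens_base K A) (\<delta> l) c = counit L l \<otimes> c" if "l \<in> carrier L" for l c
    using that by (simp add: cotens_base_def module.defs left_mod.defs cotens_eval_delta)
  have 1: "left_module_hom K E (cotens_tens K H A \<rho> (mP X) (mQ X)) (cotens_base K A) (malpha X)"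
  proof -
    have "lin (cotens_tens K H A \<rho> (mP X) (mQ X)) (cotens_base K A) (malpha X)"
      by (rule same_lin[OF same_cotens_tens same_cotens_base alpha])
    moreover have "malpha X (eact (cotens_tens K H A \<rho> (mP X) (mQ X)) x t) = eact (cotens_base K A) x (malpha X t)"
      if x: "x \<in> carrier E" and t: "t \<in> carrier (cotens_tens K H A \<rho> (mP X) (mQ X))" for x t
    proof -
      obtain l where l: "l \<in> carrier L" "x = \<delta> l" using x by (auto simp: carrier_E)
      obtain c where c: "c \<in> carrier K" "t = pure K (mP X) (mQ X) (e c) (e' \<one>)"
        using tP t by (auto simp: same_spD(1)[OF same_cotens_tens])
      show ?thesis using l c by (simp add: line_modD(7)[OF lP] L.Alg_one eX base)
    qed
    ultimately show ?thesis by (simp add: left_module_hom_def lin_def)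
  qed
  have 2: "left_module_hom K E (cotens_tens K H A \<rho> (mQ X) (mP X)) (cotens_base K A) (mbeta X)"
  proof -
    have "lin (cotens_tens K H A \<rho> (mQ X) (mP X)) (cotens_base K A) (mbeta X)"
      by (rule same_lin[OF same_cotens_tens same_cotens_base beta])
    moreover have "mbeta X (eact (cotens_tens K H A \<rho> (mQ X) (mP X)) x t) = eact (cotens_base K A) x (mbeta X t)"
      if x: "x \<in> carrier E" and t: "t \<in> carrier (cotens_tens K H A \<rho> (mQ X) (mP X))" for x t
    proof -
      obtain l where l: "l \<in> carrier L" "x = \<delta> l" using x by (auto simp: carrier_E)
      obtain c where c: "c \<in> carrier K" "t = pure K (mQ X) (mP X) (e' c) (e \<one>)"
        using tQ t by (auto simp: same_spD(1)[OF same_cotens_tens])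
      show ?thesis using l c by (simp add: line_modD(7)[OF lQ] L.Alg_one eX base)
    qed
    ultimately show ?thesis by (simp add: left_module_hom_def lin_def)
  qed
  have 3: "malpha X (pure K (mP X) (mQ X) m n) \<odot>\<^bsub>mP X\<^esub> m' = mbeta X (pure K (mQ X) (mP X) n m') \<odot>\<^bsub>mP X\<^esub> m"
    if h: "m \<in> carrier (mP X)" "n \<in> carrier (mQ X)" "m' \<in> carrier (mP X)" for m n m'
  proof -
    obtain a b c where "a \<in> carrier K" "b \<in> carrier K" "c \<in> carrier K" "m = e a" "n = e' b" "m' = e c"
      using eD(4)[OF h(1)] e'D(4)[OF h(2)] eD(4)[OF h(3)] by metis
    then show ?thesis by (simp add: eX eD(6)[symmetric] m_ac)
  qed
  have 4: "mbeta X (pure K (mQ X) (mP X) n m) \<odot>\<^bsub>mQ X\<^esub> n' = malpha X (pure K (mP X) (mQ X) m n') \<odot>\<^bsub>mQ X\<^esub> n"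
    if h: "n \<in> carrier (mQ X)" "m \<in> carrier (mP X)" "n' \<in> carrier (mQ X)" for m n n'
  proof -
    obtain a b c where "a \<in> carrier K" "b \<in> carrier K" "c \<in> carrier K" "m = e a" "n = e' b" "n' = e' c"
      using e'D(4)[OF h(1)] eD(4)[OF h(2)] e'D(4)[OF h(3)] by metis
    then show ?thesis by (simp add: eX e'D(6)[symmetric] m_ac)
  qed
  have 5: "bij_betw (malpha X) (carrier (tn (mP X) (mQ X))) (carrier K)"
  proof (rule bij_betw_byWitness[where f' = "\<lambda>c. pure K (mP X) (mQ X) (e c) (e' \<one>)"])
    show "\<forall>t\<in>carrier (tn (mP X) (mQ X)). pure K (mP X) (mQ X) (e (malpha X t)) (e' \<one>) = t"
    proof
      fix t assume "t \<in> carrier (tn (mP X) (mQ X))"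
      then obtain c where "c \<in> carrier K" "t = pure K (mP X) (mQ X) (e c) (e' \<one>)" using tP by auto
      then show "pure K (mP X) (mQ X) (e (malpha X t)) (e' \<one>) = t" by (simp add: eX)
    qed
    show "\<forall>c\<in>carrier K. malpha X (pure K (mP X) (mQ X) (e c) (e' \<one>)) = c" by (simp add: eX)
    show "malpha X ` carrier (tn (mP X) (mQ X)) \<subseteq> carrier K" using linD(3)[OF alpha] by auto
    show "(\<lambda>c. pure K (mP X) (mQ X) (e c) (e' \<one>)) ` carrier K \<subseteq> carrier (tn (mP X) (mQ X))"
      using eD(2,3) e'D(2,3) by (auto intro!: pure_in)
  qed
  have 6: "bij_betw (mbeta X) (carrier (tn (mQ X) (mP X))) (carrier K)"
  proof (rule bij_betw_byWitness[where f' = "\<lambda>c. pure K (mQ X) (mP X) (e' c) (e \<one>)"])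
    show "\<forall>t\<in>carrier (tn (mQ X) (mP X)). pure K (mQ X) (mP X) (e' (mbeta X t)) (e \<one>) = t"
    proof
      fix t assume "t \<in> carrier (tn (mQ X) (mP X))"
      then obtain c where "c \<in> carrier K" "t = pure K (mQ X) (mP X) (e' c) (e \<one>)" using tQ by auto
      then show "pure K (mQ X) (mP X) (e' (mbeta X t)) (e \<one>) = t" by (simp add: eX)
    qed
    show "\<forall>c\<in>carrier K. mbeta X (pure K (mQ X) (mP X) (e' c) (e \<one>)) = c" by (simp add: eX)
    show "mbeta X ` carrier (tn (mQ X) (mP X)) \<subseteq> carrier K" using linD(3)[OF beta] by auto
    show "(\<lambda>c. pure K (mQ X) (mP X) (e' c) (e \<one>)) ` carrier K \<subseteq> carrier (tn (mQ X) (mP X))"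
      using eD(2,3) e'D(2,3) by (auto intro!: pure_in)
  qed
  show ?thesis unfolding strict_cotens_morita_def Let_def
    using line_left_module[OF f e(1)] line_left_module[OF Alg_inv[OF f] e(2)] 1 2 3 4 5 6 by simp
qed

lemma line_context_exists:
  fixes v :: "'k \<Rightarrow> 'v"
  assumes f: "f \<in> carrier (Alg K L)" and v: "inj_on v (carrier K)"
  shows "\<exists>X :: ('k, 'a, 'v) cotens_morita. strict_cotens_morita K H A \<rho> X \<and> line_context X f"
proof -
  let ?d = "inv_into (carrier K) v" and ?di = "inv_into (carrier L) \<delta>"
  have [simp]: "?d (v c) = c" if "c \<in> carrier K" for c using v that by simp
  have [simp]: "?di (\<delta> l) = l" if "l \<in> carrier L" for l using delta_bij that by (simp add: bij_betw_def)
  define N :: "('l \<Rightarrow> 'k) \<Rightarrow> ('k, 'a, 'v) cotens_mod" where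
    "N g = \<lparr>carrier = v ` carrier K, monoid.mult = undefined, one = undefined, zero = v \<zero>,
      add = (\<lambda>x y. v (?d x \<oplus> ?d y)), smult = (\<lambda>c x. v (c \<otimes> ?d x)), eact = (\<lambda>x m. v (g (?di x) \<otimes> ?d m))\<rparr>" for g
  have N: "line_mod g (N g) v" if g: "g \<in> carrier (Alg K L)" for g
  proof -
    have "lin k (N g) v" "bij_betw v (carrier k) (carrier (N g))"
      by (rule transport_module; use v in \<open>simp add: N_def\<close>)+
    then show ?thesis by (simp add: line_mod_def N_def)
  qed
  define X where "X = \<lparr>mP = N f, mQ = N (inv\<^bsub>Alg K L\<^esub> f), malpha = (\<lambda>t. sw k t (\<lambda>x y. ?d x \<otimes> ?d y)),
     mbeta = (\<lambda>t. sw k t (\<lambda>x y. ?d x \<otimes> ?d y))\<rparr>"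
  note l = N[OF f] N[OF Alg_inv[OF f]]
  note b = line_coord[OF l] line_coord[OF l(2,1)]
  have X: "line_context X f" unfolding line_context_def
    using l sw_pure[OF b(1)] sw_pure[OF b(2)] line_modD(3)[OF l(1)] line_modD(3)[OF l(2)]
    by (intro exI[of _ v]) (simp add: X_def m_comm)
  moreover have "strict_cotens_morita K H A \<rho> X"
    by (rule line_context_strict[OF f X]) (simp_all add: X_def lin_sw[OF b(1)] lin_sw[OF b(2)])
  ultimately show ?thesis by auto
qed

text \<open>\<open>E\<close> acts on a module generated by a nonzero vector by scalars, which are multiplicative in \<open>L\<close>.\<close>

lemma character_exists:
  fixes M :: "('k, 'a, 'm) cotens_mod"
  assumes M: "left_module K E M" and m: "m \<in> carrier M" "m \<noteq> \<zero>\<^bsub>M\<^esub>"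
    and gen: "\<And>x. x \<in> carrier M \<Longrightarrow> \<exists>c\<in>carrier K. x = c \<odot>\<^bsub>M\<^esub> m"
  shows "\<exists>f\<in>carrier (Alg K L). line_mod f M (\<lambda>c. c \<odot>\<^bsub>M\<^esub> m)"
proof -
  note MD = left_moduleD[OF M]
  interpret M: module K M by (rule MD(1))
  let ?e = "\<lambda>c. c \<odot>\<^bsub>M\<^esub> m"
  have e_lin: "lin k M ?e" using m MD(1) by (auto intro!: lins)
  have e_bij: "bij_betw ?e (carrier K) (carrier M)"
  proof -
    have "inj_on ?e (carrier K)" by (rule inj_onI) (rule scalar_inj[OF MD(1) m])
    moreover have "?e ` carrier K = carrier M" using gen m by auto
    ultimately show ?thesis by (simp add: bij_betw_def)
  qed
  let ?d = "inv_into (carrier K) ?e"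
  have d_lin: "lin M k ?d" using lin_inv_into[OF e_lin] e_bij by simp
  have d: "?d (c \<odot>\<^bsub>M\<^esub> m) = c" if "c \<in> carrier K" for c
    using e_bij that inv_into_f_f[of ?e "carrier K" c] by (simp add: bij_betw_def)
  have d': "?d x \<odot>\<^bsub>M\<^esub> m = x" if "x \<in> carrier M" for x
    using e_bij that f_inv_into_f[of x ?e "carrier K"] by (simp add: bij_betw_def)
  define f where "f l = ?d (eact M (\<delta> l) m)" for l
  have am: "eact M (\<delta> l) m \<in> carrier M" if "l \<in> carrier L" for l by (rule MD(4)[OF that m(1)])
  have f_in: "f l \<in> carrier K" if "l \<in> carrier L" for l using linD(3)[OF d_lin am[OF that]] by (simp add: f_def)
  have act: "eact M (\<delta> l) (c \<odot>\<^bsub>M\<^esub> m) = (f l \<otimes> c) \<odot>\<^bsub>M\<^esub> m" if "l \<in> carrier L" "c \<in> carrier K" for l c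
    using that linD(5)[OF MD(2)[OF delta_E[OF that(1)]] that(2) m(1)] f_in[OF that(1)] d'[OF am[OF that(1)]] m(1)
    by (simp add: f_def[symmetric] m_comm[of "f l"] M.smult_assoc1)
  have f_lin: "lin L k f" unfolding f_def
    by (rule lin_comp[OF d_lin lin_comp[OF MD(3)[OF m(1)] delta_lin_E]])
  have f_mult: "f (x \<otimes>\<^bsub>L\<^esub> y) = f x \<otimes> f y" if h: "x \<in> carrier L" "y \<in> carrier L" for x y
    using MD(5)[OF h m(1)] act[OF h(1) f_in[OF h(2)]] d'[OF am[OF h(2)]] f_in h
    by (simp add: f_def[of "x \<otimes>\<^bsub>L\<^esub> y"] f_def[of y, symmetric] d)
  have f_one: "f \<one>\<^bsub>L\<^esub> = \<one>" using d[of \<one>] MD(6)[OF m(1)] m(1) by (simp add: f_def)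
  have "restrict f (carrier L) \<in> carrier (Alg K L)" by (rule L.AlgI[OF f_lin f_mult f_one])
  moreover have "line_mod (restrict f (carrier L)) M ?e"
    using e_lin e_bij act by (simp add: line_mod_def)
  ultimately show ?thesis by auto
qed

text \<open>As \<open>\<alpha> \<noteq> 0\<close>, there are \<open>m\<close> and \<open>n\<close> with \<open>\<alpha>(m \<otimes> n) = 1\<close>. The associativity conditions of the
  context express every element of \<open>M\<close> as a multiple of \<open>m\<close>, and every element of \<open>N\<close> as a multiple
  of \<open>n\<close>. Linearity of \<open>\<alpha>\<close> over \<open>E\<close> makes the two characters inverse to each other.\<close>

lemma strict_line_context:
  fixes X :: "('k, 'a, 'm) cotens_morita"
  assumes X: "strict_cotens_morita K H A \<rho> X"
  shows "\<exists>f\<in>carrier (Alg K L). line_context X f"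
proof -
  interpret G: group "Alg K L" by (rule L.Alg_group)
  let ?M = "mP X" and ?N = "mQ X" and ?\<alpha> = "malpha X" and ?\<beta> = "mbeta X"
  have M: "left_module K E ?M" and N: "left_module K E ?N"
    and ah: "left_module_hom K E (cotens_tens K H A \<rho> ?M ?N) (cotens_base K A) ?\<alpha>"
    and bh: "left_module_hom K E (cotens_tens K H A \<rho> ?N ?M) (cotens_base K A) ?\<beta>"
    and as1: "\<And>m n m'. m \<in> carrier ?M \<Longrightarrow> n \<in> carrier ?N \<Longrightarrow> m' \<in> carrier ?M \<Longrightarrow>
       ?\<alpha> (pure K ?M ?N m n) \<odot>\<^bsub>?M\<^esub> m' = ?\<beta> (pure K ?N ?M n m') \<odot>\<^bsub>?M\<^esub> m"
    and as2: "\<And>n m n'. n \<in> carrier ?N \<Longrightarrow> m \<in> carrier ?M \<Longrightarrow> n' \<in> carrier ?N \<Longrightarrow>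
       ?\<beta> (pure K ?N ?M n m) \<odot>\<^bsub>?N\<^esub> n' = ?\<alpha> (pure K ?M ?N m n') \<odot>\<^bsub>?N\<^esub> n"
    and ab: "bij_betw ?\<alpha> (carrier (tn ?M ?N)) (carrier K)"
    using X by (simp_all add: strict_cotens_morita_def Let_def)
  note MD = left_moduleD[OF M] and ND = left_moduleD[OF N]
  interpret M: module K ?M by (rule MD(1))
  interpret N: module K ?N by (rule ND(1))
  note [simp] = MD(1) ND(1)
  have al: "lin (tn ?M ?N) k ?\<alpha>" and bl: "lin (tn ?N ?M) k ?\<beta>"
    using ah bh by (simp_all add: left_module_hom_def lin_def k_linear_def same_spD[OF same_cotens_tens] same_spD[OF same_cotens_base])
  have bA: "bil ?M ?N k (\<lambda>m n. ?\<alpha> (pure K ?M ?N m n))" by (intro bilI) (auto intro!: lin_comp[OF al] lins)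
  have bB: "bil ?N ?M k (\<lambda>n m. ?\<beta> (pure K ?N ?M n m))" by (intro bilI) (auto intro!: lin_comp[OF bl] lins)
  note A_in = bilD(3)[OF bA, simplified] and B_in = bilD(3)[OF bB, simplified]
  have "\<exists>m\<in>carrier ?M. \<exists>n\<in>carrier ?N. ?\<alpha> (pure K ?M ?N m n) \<noteq> \<zero>"
  proof (rule ccontr)
    assume "\<not> ?thesis"
    then have z: "?\<alpha> (pure K ?M ?N m n) = \<zero>" if "m \<in> carrier ?M" "n \<in> carrier ?N" for m n using that by auto
    have "\<one> \<in> ?\<alpha> ` carrier (tn ?M ?N)" using ab by (simp add: bij_betw_def)
    then obtain t where t: "t \<in> carrier (tn ?M ?N)" "?\<alpha> t = \<one>" by auto
    have "lin (tn ?M ?N) k (\<lambda>t. \<zero>)" by (rule linI) simp_all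
    from tens_ext[OF MD(1) ND(1) al this t(1)] have "?\<alpha> t = \<zero>" using z by simp
    then show False using t(2) by simp
  qed
  then obtain m0 n where m0: "m0 \<in> carrier ?M" and n: "n \<in> carrier ?N" and ne: "?\<alpha> (pure K ?M ?N m0 n) \<noteq> \<zero>" by auto
  define a where "a = ?\<alpha> (pure K ?M ?N m0 n)"
  have a: "a \<in> carrier K" "a \<noteq> \<zero>" using A_in[OF m0 n] ne by (simp_all add: a_def)
  then have ia: "inv a \<in> carrier K" "inv a \<otimes> a = \<one>" using field_Units by auto
  define m where "m = inv a \<odot>\<^bsub>?M\<^esub> m0"
  have m: "m \<in> carrier ?M" using m0 ia by (simp add: m_def)
  have A1: "?\<alpha> (pure K ?M ?N m n) = \<one>"
    using linD(5)[OF bilD(1)[OF bA lin_id[OF MD(1)] n] ia(1) m0] ia(2) by (simp add: m_def a_def)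
  have mz: "m \<noteq> \<zero>\<^bsub>?M\<^esub>" using A1 lin_zero[OF bilD(1)[OF bA lin_id[OF MD(1)] n]] by auto
  have nz: "n \<noteq> \<zero>\<^bsub>?N\<^esub>" using A1 lin_zero[OF bilD(2)[OF bA m lin_id[OF ND(1)]]] by auto
  have genM: "x = ?\<beta> (pure K ?N ?M n x) \<odot>\<^bsub>?M\<^esub> m" if "x \<in> carrier ?M" for x
    using as1[OF m n that] A1 that by simp
  have B1: "?\<beta> (pure K ?N ?M n m) = \<one>"
    using genM[OF m] B_in[OF n m] m by (intro scalar_inj[OF MD(1) m mz]) simp_all
  have genN: "x = ?\<alpha> (pure K ?M ?N m x) \<odot>\<^bsub>?N\<^esub> n" if "x \<in> carrier ?N" for x
    using as2[OF n m that] B1 that by simp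
  have gM: "\<exists>c\<in>carrier K. x = c \<odot>\<^bsub>?M\<^esub> m" if "x \<in> carrier ?M" for x
    by (rule bexI[OF _ B_in[OF n that]]) (rule genM[OF that])
  have gN: "\<exists>c\<in>carrier K. x = c \<odot>\<^bsub>?N\<^esub> n" if "x \<in> carrier ?N" for x
    by (rule bexI[OF _ A_in[OF m that]]) (rule genN[OF that])
  obtain f where f: "f \<in> carrier (Alg K L)" and eM: "line_mod f ?M (\<lambda>c. c \<odot>\<^bsub>?M\<^esub> m)"
    using character_exists[OF M m mz gM] by auto
  obtain g where g: "g \<in> carrier (Alg K L)" and eN: "line_mod g ?N (\<lambda>c. c \<odot>\<^bsub>?N\<^esub> n)"
    using character_exists[OF N n nz gN] by auto
  have Ac: "?\<alpha> (pure K ?M ?N (c \<odot>\<^bsub>?M\<^esub> m) (d \<odot>\<^bsub>?N\<^esub> n)) = c \<otimes> d" if "c \<in> carrier K" "d \<in> carrier K" for c d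
    using linD(5)[OF bilD(1)[OF bA lin_id[OF MD(1)]], of "d \<odot>\<^bsub>?N\<^esub> n" c m] linD(5)[OF bilD(2)[OF bA m lin_id[OF ND(1)]], of d n] that A1 m n
    by simp
  have Bc: "?\<beta> (pure K ?N ?M (d \<odot>\<^bsub>?N\<^esub> n) (c \<odot>\<^bsub>?M\<^esub> m)) = c \<otimes> d" if "c \<in> carrier K" "d \<in> carrier K" for c d
    using linD(5)[OF bilD(1)[OF bB lin_id[OF ND(1)]], of "c \<odot>\<^bsub>?M\<^esub> m" d n] linD(5)[OF bilD(2)[OF bB n lin_id[OF MD(1)]], of c m] that B1 m n
    by (simp add: m_comm)
  have "f \<otimes>\<^bsub>Alg K L\<^esub> g = \<one>\<^bsub>Alg K L\<^esub>"
  proof (rule L.Alg_eqI)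
    fix l assume l: "l \<in> carrier L"
    let ?p = "pure K ?M ?N (\<one> \<odot>\<^bsub>?M\<^esub> m) (\<one> \<odot>\<^bsub>?N\<^esub> n)"
    have fg: "(f \<otimes>\<^bsub>Alg K L\<^esub> g) l \<in> carrier K" using L.AlgD(3)[OF L.Alg_mult_in[OF f g] l] .
    have p: "?p \<in> carrier (cotens_tens K H A \<rho> ?M ?N)" using m n by (auto simp: same_spD[OF same_cotens_tens] intro!: pure_in)
    have "?\<alpha> (eact (cotens_tens K H A \<rho> ?M ?N) (\<delta> l) ?p) = eact (cotens_base K A) (\<delta> l) (?\<alpha> ?p)"
      using ah delta_E[OF l] p by (simp add: left_module_hom_def)
    also have "\<dots> = counit L l"
      using l Ac[of \<one> \<one>] by (simp add: cotens_base_def module.defs left_mod.defs cotens_eval_delta)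
    finally show "(f \<otimes>\<^bsub>Alg K L\<^esub> g) l = \<one>\<^bsub>Alg K L\<^esub> l"
      using line_modD(7)[OF line_mod_tens[OF f g eM eN] l one_closed] fg Ac[OF fg one_closed] l by (simp add: L.Alg_one)
  qed (use f g in simp_all)
  then have "g = inv\<^bsub>Alg K L\<^esub> f" using G.inv_equality[of f g] f g by (metis G.inv_inv)
  then have "line_context X f" unfolding line_context_def using eM eN Ac Bc
    by (intro exI[of _ "\<lambda>c. c \<odot>\<^bsub>?M\<^esub> m"] exI[of _ "\<lambda>c. c \<odot>\<^bsub>?N\<^esub> n"]) simp
  then show ?thesis using f by auto
qed

lemma PicSq_iso:
  fixes v :: "'k \<Rightarrow> 'v"
  assumes v: "inj_on v (carrier K)"
  shows "group (PicSq K H A \<rho> :: ('k, 'a, 'v) cotens_morita set monoid) \<and>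
    Alg K L \<cong> (PicSq K H A \<rho> :: ('k, 'a, 'v) cotens_morita set monoid)"
proof (rule class_group_iso[where R = line_context and strict = "strict_cotens_morita K H A \<rho>"
    and eqv = "cotens_morita_iso K H A \<rho>" and m = "\<lambda>X Y Z. cotens_morita_iso K H A \<rho> (cotens_morita_mult K H A \<rho> X Y) Z"
    and u = "cotens_morita_iso K H A \<rho> (cotens_morita_unit K A)"])
  interpret G: group "Alg K L" by (rule L.Alg_group)
  show "group (Alg K L)" by (rule L.Alg_group)
  fix X Y Z :: "('k, 'a, 'v) cotens_morita" and f g j
  show "strict_cotens_morita K H A \<rho> X \<Longrightarrow> \<exists>f\<in>carrier (Alg K L). line_context X f" by (rule strict_line_context)
  show "f \<in> carrier (Alg K L) \<Longrightarrow> \<exists>X :: ('k, 'a, 'v) cotens_morita. strict_cotens_morita K H A \<rho> X \<and> line_context X f"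
    by (rule line_context_exists[OF _ v])
  assume f: "f \<in> carrier (Alg K L)" and g: "g \<in> carrier (Alg K L)"
  show "line_context X f \<Longrightarrow> line_context Y g \<Longrightarrow> cotens_morita_iso K H A \<rho> X Y \<longleftrightarrow> f = g"
    by (rule line_context_iso[OF f g])
  assume j: "j \<in> carrier (Alg K L)"
  show "line_context X f \<Longrightarrow> line_context Y g \<Longrightarrow> line_context Z j \<Longrightarrow>
     cotens_morita_iso K H A \<rho> (cotens_morita_mult K H A \<rho> X Y) Z \<longleftrightarrow> f \<otimes>\<^bsub>Alg K L\<^esub> g = j"
    by (rule line_context_iso[OF L.Alg_mult_in[OF f g] j line_context_mult[OF f g]])
next
  fix Z :: "('k, 'a, 'v) cotens_morita" and j
  assume "j \<in> carrier (Alg K L)" "line_context Z j"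
  then show "cotens_morita_iso K H A \<rho> (cotens_morita_unit K A) Z \<longleftrightarrow> \<one>\<^bsub>Alg K L\<^esub> = j"
    using line_context_iso[OF _ _ line_context_unit] group.is_monoid[OF L.Alg_group] by (simp add: monoid.one_closed)
qed (simp add: PicSq_def)

section \<open>Hopf bimodules and their tensor products over \<open>A\<close>\<close>

lemma bimodD: assumes "bimodule K A P"
  shows "module K P" "a \<in> carrier A \<Longrightarrow> lin P P (lact P a)" "a \<in> carrier A \<Longrightarrow> lin P P (\<lambda>p. ract P p a)"
    "p \<in> carrier P \<Longrightarrow> lin A P (\<lambda>a. lact P a p)" "p \<in> carrier P \<Longrightarrow> lin A P (ract P p)"
    "p \<in> carrier P \<Longrightarrow> lact P \<one>\<^bsub>A\<^esub> p = p" "p \<in> carrier P \<Longrightarrow> ract P p \<one>\<^bsub>A\<^esub> = p"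
    "a \<in> carrier A \<Longrightarrow> b \<in> carrier A \<Longrightarrow> p \<in> carrier P \<Longrightarrow> lact P (a \<otimes>\<^bsub>A\<^esub> b) p = lact P a (lact P b p)"
    "a \<in> carrier A \<Longrightarrow> b \<in> carrier A \<Longrightarrow> p \<in> carrier P \<Longrightarrow> ract P p (a \<otimes>\<^bsub>A\<^esub> b) = ract P (ract P p a) b"
    "a \<in> carrier A \<Longrightarrow> b \<in> carrier A \<Longrightarrow> p \<in> carrier P \<Longrightarrow> ract P (lact P a p) b = lact P a (ract P p b)"
  using assms by (simp_all add: bimodule_def lin_def)

lemma bimod_in: assumes "bimodule K A P" "a \<in> carrier A" "p \<in> carrier P"
  shows "lact P a p \<in> carrier P" "ract P p a \<in> carrier P"
  using linD(3)[OF bimodD(2)[OF assms(1,2)] assms(3)] linD(3)[OF bimodD(3)[OF assms(1,2)] assms(3)] by auto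

lemma bimod_lins: assumes "bimodule K A P"
  shows "lin X A u \<Longrightarrow> p \<in> carrier P \<Longrightarrow> lin X P (\<lambda>x. lact P (u x) p)"
    "a \<in> carrier A \<Longrightarrow> lin X P w \<Longrightarrow> lin X P (\<lambda>x. lact P a (w x))"
    "p \<in> carrier P \<Longrightarrow> lin X A u \<Longrightarrow> lin X P (\<lambda>x. ract P p (u x))"
    "lin X P w \<Longrightarrow> a \<in> carrier A \<Longrightarrow> lin X P (\<lambda>x. ract P (w x) a)"
  using lin_comp[OF bimodD(4)[OF assms]] lin_comp[OF bimodD(2)[OF assms]] lin_comp[OF bimodD(5)[OF assms]]
    lin_comp[OF bimodD(3)[OF assms]] by auto

abbreviation "bt P Q \<equiv> balanced_tensor (carrier A) (ract P) (lact Q) P Q"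

lemma balanced_A: assumes P: "bimodule K A P" and Q: "bimodule K A Q"
  shows "balanced_pair K (carrier A) (ract P) (lact Q) P Q"
  using bimodD(1)[OF P] abelian_group_of_module[OF bimodD(1)[OF Q]] bimod_in[OF P] bimod_in[OF Q] linD(5)[OF bimodD(3)[OF P]]
  by (intro balanced_pair.intro) simp_all

text \<open>The \<open>K\<close>-bilinear maps that are balanced over \<open>A\<close>.\<close>

definition abal where
  "abal P Q G f \<longleftrightarrow> bil P Q G f \<and> (\<forall>p\<in>carrier P. \<forall>a\<in>carrier A. \<forall>q\<in>carrier Q. f (ract P p a) q = f p (lact Q a q))"

lemma abalI: "bil P Q G f \<Longrightarrow> (\<And>p a q. p \<in> carrier P \<Longrightarrow> a \<in> carrier A \<Longrightarrow> q \<in> carrier Q \<Longrightarrow> f (ract P p a) q = f p (lact Q a q))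
  \<Longrightarrow> abal P Q G f"
  by (simp add: abal_def)

lemma abal_comp: assumes "abal P Q G f" "lin G G' h" shows "abal P Q G' (\<lambda>p q. h (f p q))"
  using assms linD(2)[OF assms(2)] by (auto simp: abal_def bil_def intro!: lin_comp[OF assms(2)])

context
  fixes P :: "('k, 'a, 'h, 'm) hopf_bimod" and Q :: "('k, 'a, 'h, 'n) hopf_bimod"
  assumes P: "bimodule K A P" and Q: "bimodule K A Q"
begin

interpretation B: balanced_pair K "carrier A" "ract P" "lact Q" P Q by (rule balanced_A[OF P Q])

lemma bt_module: "module K (bt P Q)" by (rule B.module_B)

lemma pureA_pu: "pureA A P Q p q = B.pu p q" by (simp add: pureA_def)

lemma pureA_in: "p \<in> carrier P \<Longrightarrow> q \<in> carrier Q \<Longrightarrow> pureA A P Q p q \<in> carrier (bt P Q)"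
  unfolding pureA_pu by (rule B.pu_in)

lemma pureA_bal: "p \<in> carrier P \<Longrightarrow> a \<in> carrier A \<Longrightarrow> q \<in> carrier Q \<Longrightarrow> pureA A P Q (ract P p a) q = pureA A P Q p (lact Q a q)"
  unfolding pureA_pu by (rule B.pu_balanced)

text \<open>A scalar \<open>c\<close> acts on both sides as \<open>c \<cdot> 1\<close>, so it may be moved across the tensor sign over \<open>A\<close>.\<close>

lemma bil_pureA: "bil P Q (bt P Q) (pureA A P Q)"
proof -
  note PD = bimodD[OF P] and QD = bimodD[OF Q]
  have s: "pureA A P Q p (c \<odot>\<^bsub>Q\<^esub> q) = c \<odot>\<^bsub>bt P Q\<^esub> pureA A P Q p q"
    if h: "p \<in> carrier P" "q \<in> carrier Q" "c \<in> carrier K" for p q c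
  proof -
    let ?a = "c \<odot>\<^bsub>A\<^esub> \<one>\<^bsub>A\<^esub>"
    have a: "?a \<in> carrier A" using h by simp
    have "c \<odot>\<^bsub>Q\<^esub> q = lact Q ?a q" using linD(5)[OF QD(4)[OF h(2)] h(3) A.A.one_closed] QD(6)[OF h(2)] by simp
    moreover have "c \<odot>\<^bsub>P\<^esub> p = ract P p ?a" using linD(5)[OF PD(5)[OF h(1)] h(3) A.A.one_closed] PD(7)[OF h(1)] by simp
    ultimately show ?thesis using pureA_bal[OF h(1) a h(2)] B.pu_smult[OF h] by (simp add: pureA_pu)
  qed
  show ?thesis
    using B.pu_in B.pu_add_left B.pu_add_right B.pu_smult s[unfolded pureA_pu] PD(1) QD(1) bt_module
    by (intro bilI linI) (simp_all only: pureA_pu)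
qed

lemma btA_induct [consumes 1, case_names zero pure add]:
  assumes "t \<in> carrier (bt P Q)" "R \<zero>\<^bsub>bt P Q\<^esub>"
    "\<And>p q. p \<in> carrier P \<Longrightarrow> q \<in> carrier Q \<Longrightarrow> R (pureA A P Q p q)"
    "\<And>s t. s \<in> carrier (bt P Q) \<Longrightarrow> t \<in> carrier (bt P Q) \<Longrightarrow> R s \<Longrightarrow> R t \<Longrightarrow> R (s \<oplus>\<^bsub>bt P Q\<^esub> t)"
  shows "R t"
  using assms unfolding pureA_pu by (rule B.tensor_induct)

lemma abal_map: assumes "abal P Q G f" shows "B.balanced_map G f"
proof -
  have b: "bil P Q G f" using assms by (simp add: abal_def)
  have 1: "lin Q G (f m)" if "m \<in> carrier P" for m using b that by (simp add: bil_def)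
  have 2: "lin P G (\<lambda>m. f m n)" if "n \<in> carrier Q" for n using b that by (simp add: bil_def)
  have "abelian_group G" by (rule abelian_group_of_module[OF bil_mods(3)[OF b]])
  then show ?thesis using assms unfolding B.balanced_map_def by (simp add: linD[OF 1] linD[OF 2] abal_def)
qed

lemma liftA_pure: "abal P Q G f \<Longrightarrow> p \<in> carrier P \<Longrightarrow> q \<in> carrier Q \<Longrightarrow> tensor_lift G f (pureA A P Q p q) = f p q"
  unfolding pureA_pu by (rule B.lift_pu[OF abal_map])

lemma liftA_cong: assumes "t \<in> carrier (bt P Q)" "\<And>p q. p \<in> carrier P \<Longrightarrow> q \<in> carrier Q \<Longrightarrow> f p q = g p q"
  shows "tensor_lift G f t = tensor_lift G g t"
  using B.rep(1)[OF assms(1)] assms(2) by (intro sw_rep_cong) auto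

lemma btA_ext: assumes "lin (bt P Q) G f" "lin (bt P Q) G g" "t \<in> carrier (bt P Q)"
    "\<And>p q. p \<in> carrier P \<Longrightarrow> q \<in> carrier Q \<Longrightarrow> f (pureA A P Q p q) = g (pureA A P Q p q)"
  shows "f t = g t"
  using assms(3)
  by (induction rule: btA_induct) (simp_all add: assms linD[OF assms(1)] linD[OF assms(2)] lin_zero[OF assms(1)] lin_zero[OF assms(2)])

lemma same_tensA: "same_sp (bt P Q) (tensA K H A P Q)"
  by (simp add: same_sp_def tensA_def Let_def module.defs)

lemma tensA_lact: assumes a: "a \<in> carrier A" and h: "p \<in> carrier P" "q \<in> carrier Q"
  shows "lact (tensA K H A P Q) a (pureA A P Q p q) = pureA A P Q (lact P a p) q"
proof -
  have "abal P Q (bt P Q) (\<lambda>p q. pureA A P Q (lact P a p) q)"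
    using a bimod_in[OF P] bimodD(1)[OF P] bimodD(1)[OF Q] bt_module
    by (intro abalI bilI bilD(1,2)[OF bil_pureA] bimod_lins[OF P] lin_id) (simp_all add: bimodD(10)[OF P, symmetric] pureA_bal)
  from liftA_pure[OF this h] show ?thesis by (simp add: tensA_def Let_def module.defs hopf_bimod.defs)
qed

lemma tensA_ract: assumes a: "a \<in> carrier A" and h: "p \<in> carrier P" "q \<in> carrier Q"
  shows "ract (tensA K H A P Q) (pureA A P Q p q) a = pureA A P Q p (ract Q q a)"
proof -
  have "abal P Q (bt P Q) (\<lambda>p q. pureA A P Q p (ract Q q a))"
    using a bimod_in[OF Q] bimodD(1)[OF P] bimodD(1)[OF Q] bt_module
    by (intro abalI bilI bilD(1,2)[OF bil_pureA] bimod_lins[OF Q] lin_id) (simp_all add: bimodD(10)[OF Q] pureA_bal)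
  from liftA_pure[OF this h] show ?thesis by (simp add: tensA_def Let_def module.defs hopf_bimod.defs)
qed

end

lemma hopf_bimodD: assumes "hopf_bimodule K H A \<rho> P"
  shows "bimodule K A P" "right_comodule K H P (coact P)" "module K P" "lin P (tn P H) (coact P)"
    "p \<in> carrier P \<Longrightarrow> coact P p \<in> carrier (tn P H)"
proof -
  show b: "bimodule K A P" and r: "right_comodule K H P (coact P)" using assms by (simp_all add: hopf_bimodule_def)
  show "module K P" by (rule bimodD(1)[OF b])
  then show l: "lin P (tn P H) (coact P)" using r by (simp add: right_comodule_def lin_def)
  show "p \<in> carrier P \<Longrightarrow> coact P p \<in> carrier (tn P H)" by (rule linD(3)[OF l])
qed

lemma coact_coassoc: assumes P: "hopf_bimodule K H A \<rho> P" and f: "tri P H H G f" and p: "p \<in> carrier P"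
  shows "sw G (coact P p) (\<lambda>x c. sw G (coact P x) (\<lambda>a b. f a b c)) = sw G (coact P p) (\<lambda>a x. sw G (comult H x) (\<lambda>b c. f a b c))"
  using hopf_bimodD(2)[OF P] hopf_bimodD(5)[OF P] f p
  by (intro assoc_eqD[OF hopf_bimodD(4)[OF P] H.comult_lin]) (auto simp: right_comodule_def)

lemma coact_biact:
  assumes P: "hopf_bimodule K H A \<rho> P" and f: "bil P H G f" and h: "a \<in> carrier A" "p \<in> carrier P" "b \<in> carrier A"
  shows "sw G (coact P (ract P (lact P a p) b)) f = sw G (\<rho> a) (\<lambda>a0 a1. sw G (coact P p) (\<lambda>p0 p1. sw G (\<rho> b) (\<lambda>b0 b1.
     f (ract P (lact P a0 p0) b0) ((a1 \<otimes>\<^bsub>H\<^esub> p1) \<otimes>\<^bsub>H\<^esub> b1))))"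
proof -
  note B = hopf_bimodD(1)[OF P] and m = hopf_bimodD(3)[OF P]
  note [simp] = m bimod_in[OF B] hopf_bimodD(5)[OF P]
  let ?G = "tn P H"
  let ?q = "\<lambda>a0 a1 p0 p1 b0 b1. pure K P H (ract P (lact P a0 p0) b0) ((a1 \<otimes>\<^bsub>H\<^esub> p1) \<otimes>\<^bsub>H\<^esub> b1)"
  have "sw G (coact P (ract P (lact P a p) b)) f = sw G (sw ?G (\<rho> a) (\<lambda>a0 a1. sw ?G (coact P p) (\<lambda>p0 p1. sw ?G (\<rho> b) (\<lambda>b0 b1. ?q a0 a1 p0 p1 b0 b1)))) f"
    using P h by (simp add: hopf_bimodule_def Let_def)
  also have "\<dots> = sw G (\<rho> a) (\<lambda>a0 a1. sw G (sw ?G (coact P p) (\<lambda>p0 p1. sw ?G (\<rho> b) (\<lambda>b0 b1. ?q a0 a1 p0 p1 b0 b1))) f)"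
    using h by (intro sw_sw[OF f, of A H]) (auto intro!: sw_in[of A H] sw_in[of P H] pure_in)
  also have "\<dots> = sw G (\<rho> a) (\<lambda>a0 a1. sw G (coact P p) (\<lambda>p0 p1. sw G (sw ?G (\<rho> b) (\<lambda>b0 b1. ?q a0 a1 p0 p1 b0 b1)) f))"
    using h by (intro rho_cong sw_sw[OF f, of P H]) (auto intro!: sw_in[of A H] pure_in)
  also have "\<dots> = sw G (\<rho> a) (\<lambda>a0 a1. sw G (coact P p) (\<lambda>p0 p1. sw G (\<rho> b) (\<lambda>b0 b1. sw G (?q a0 a1 p0 p1 b0 b1) f)))"
    using h by (intro rho_cong sw_cong[OF m H.H.A_module hopf_bimodD(5)[OF P]] sw_sw[OF f, of A H]) (auto intro!: pure_in)
  also have "\<dots> = sw G (\<rho> a) (\<lambda>a0 a1. sw G (coact P p) (\<lambda>p0 p1. sw G (\<rho> b) (\<lambda>b0 b1.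
     f (ract P (lact P a0 p0) b0) ((a1 \<otimes>\<^bsub>H\<^esub> p1) \<otimes>\<^bsub>H\<^esub> b1))))"
    using h by (intro rho_cong sw_cong[OF m H.H.A_module hopf_bimodD(5)[OF P]] sw_pure[OF f]) auto
  finally show ?thesis .
qed

lemma coact_ract:
  assumes P: "hopf_bimodule K H A \<rho> P" and f: "bil P H G f" and h: "p \<in> carrier P" "b \<in> carrier A"
  shows "sw G (coact P (ract P p b)) f = sw G (coact P p) (\<lambda>p0 p1. sw G (\<rho> b) (\<lambda>b0 b1. f (ract P p0 b0) (p1 \<otimes>\<^bsub>H\<^esub> b1)))"
proof -
  note B = hopf_bimodD(1)[OF P] and m = hopf_bimodD(3)[OF P]
  note [simp] = m bimod_in[OF B] hopf_bimodD(5)[OF P] bilD(4)[OF f] and [lins] = hopf_bimodD(5)[OF P] bilD[OF f] bimod_lins[OF B] lin_comp[OF hopf_bimodD(4)[OF P]]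
  have "sw G (coact P (ract P p b)) f = sw G (coact P (ract P (lact P \<one>\<^bsub>A\<^esub> p) b)) f" using h bimodD(6)[OF B] by simp
  also have "\<dots> = sw G (\<rho> \<one>\<^bsub>A\<^esub>) (\<lambda>a0 a1. sw G (coact P p) (\<lambda>p0 p1. sw G (\<rho> b) (\<lambda>b0 b1.
     f (ract P (lact P a0 p0) b0) ((a1 \<otimes>\<^bsub>H\<^esub> p1) \<otimes>\<^bsub>H\<^esub> b1))))"
    by (rule coact_biact[OF P f A.A.one_closed h])
  also have "\<dots> = sw G (coact P p) (\<lambda>p0 p1. sw G (\<rho> b) (\<lambda>b0 b1. f (ract P (lact P \<one>\<^bsub>A\<^esub> p0) b0) ((\<one>\<^bsub>H\<^esub> \<otimes>\<^bsub>H\<^esub> p1) \<otimes>\<^bsub>H\<^esub> b1)))"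
    using h by (intro rho_one) (auto intro!: lins)
  also have "\<dots> = sw G (coact P p) (\<lambda>p0 p1. sw G (\<rho> b) (\<lambda>b0 b1. f (ract P p0 b0) (p1 \<otimes>\<^bsub>H\<^esub> b1)))"
    using h bimodD(6)[OF B] by (intro sw_cong[OF m H.H.A_module hopf_bimodD(5)[OF P]] rho_cong) simp_all
  finally show ?thesis .
qed

lemma coact_lact:
  assumes P: "hopf_bimodule K H A \<rho> P" and f: "bil P H G f" and h: "p \<in> carrier P" "a \<in> carrier A"
  shows "sw G (coact P (lact P a p)) f = sw G (\<rho> a) (\<lambda>a0 a1. sw G (coact P p) (\<lambda>p0 p1. f (lact P a0 p0) (a1 \<otimes>\<^bsub>H\<^esub> p1)))"
proof -
  note B = hopf_bimodD(1)[OF P] and m = hopf_bimodD(3)[OF P]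
  note [simp] = m bimod_in[OF B] hopf_bimodD(5)[OF P] bilD(4)[OF f] and [lins] = hopf_bimodD(5)[OF P] bilD[OF f] bimod_lins[OF B] lin_comp[OF hopf_bimodD(4)[OF P]]
  have "sw G (coact P (lact P a p)) f = sw G (coact P (ract P (lact P a p) \<one>\<^bsub>A\<^esub>)) f" using h bimodD(7)[OF B] by simp
  also have "\<dots> = sw G (\<rho> a) (\<lambda>a0 a1. sw G (coact P p) (\<lambda>p0 p1. sw G (\<rho> \<one>\<^bsub>A\<^esub>) (\<lambda>b0 b1.
     f (ract P (lact P a0 p0) b0) ((a1 \<otimes>\<^bsub>H\<^esub> p1) \<otimes>\<^bsub>H\<^esub> b1))))"
    by (rule coact_biact[OF P f h(2,1) A.A.one_closed])
  also have "\<dots> = sw G (\<rho> a) (\<lambda>a0 a1. sw G (coact P p) (\<lambda>p0 p1. f (ract P (lact P a0 p0) \<one>\<^bsub>A\<^esub>) ((a1 \<otimes>\<^bsub>H\<^esub> p1) \<otimes>\<^bsub>H\<^esub> \<one>\<^bsub>H\<^esub>)))"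
    using h by (intro rho_cong sw_cong[OF m H.H.A_module hopf_bimodD(5)[OF P]] rho_one) (auto intro!: lins)
  also have "\<dots> = sw G (\<rho> a) (\<lambda>a0 a1. sw G (coact P p) (\<lambda>p0 p1. f (lact P a0 p0) (a1 \<otimes>\<^bsub>H\<^esub> p1)))"
    using h bimodD(7)[OF B] by (intro rho_cong sw_cong[OF m H.H.A_module hopf_bimodD(5)[OF P]]) simp_all
  finally show ?thesis .
qed

text \<open>The formula is balanced over \<open>A\<close> because the coactions are compatible with the actions and \<open>H\<close> is
  associative.\<close>

lemma tensA_coact:
  assumes P: "hopf_bimodule K H A \<rho> P" and Q: "hopf_bimodule K H A \<rho> Q" and h: "p \<in> carrier P" "q \<in> carrier Q"
  shows "coact (tensA K H A P Q) (pureA A P Q p q) = sw (tn (bt P Q) H) (coact P p) (\<lambda>p0 p1. sw (tn (bt P Q) H) (coact Q q) (\<lambda>q0 q1.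
     pure K (bt P Q) H (pureA A P Q p0 q0) (p1 \<otimes>\<^bsub>H\<^esub> q1)))"
proof -
  let ?T = "tn (bt P Q) H"
  note BP = hopf_bimodD(1)[OF P] and BQ = hopf_bimodD(1)[OF Q]
  note mP = hopf_bimodD(3)[OF P] and mQ = hopf_bimodD(3)[OF Q]
  note [simp] = mP mQ bimod_in[OF BP] bimod_in[OF BQ] hopf_bimodD(5)[OF P] hopf_bimodD(5)[OF Q] bt_module[OF BP BQ]
    and [lins] = hopf_bimodD(5)[OF P] hopf_bimodD(5)[OF Q] bilD[OF bil_pureA[OF BP BQ]] bimod_lins[OF BP] bimod_lins[OF BQ] lin_comp[OF hopf_bimodD(4)[OF P]] lin_comp[OF hopf_bimodD(4)[OF Q]]
  let ?f = "\<lambda>p q. sw ?T (coact P p) (\<lambda>p0 p1. sw ?T (coact Q q) (\<lambda>q0 q1. pure K (bt P Q) H (pureA A P Q p0 q0) (p1 \<otimes>\<^bsub>H\<^esub> q1)))"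
  have "abal P Q ?T ?f"
  proof (rule abalI)
    show "bil P Q ?T ?f" by (auto intro!: lins)
    fix p a q assume h: "p \<in> carrier P" "a \<in> carrier A" "q \<in> carrier Q"
    note Pc = sw_cong[OF mP H.H.A_module hopf_bimodD(5)[OF P]] and Qc = sw_cong[OF mQ H.H.A_module hopf_bimodD(5)[OF Q]]
    have "?f (ract P p a) q = sw ?T (coact P p) (\<lambda>p0 p1. sw ?T (\<rho> a) (\<lambda>a0 a1. sw ?T (coact Q q) (\<lambda>q0 q1.
        pure K (bt P Q) H (pureA A P Q (ract P p0 a0) q0) ((p1 \<otimes>\<^bsub>H\<^esub> a1) \<otimes>\<^bsub>H\<^esub> q1))))"
      using h by (intro coact_ract[OF P]) (auto intro!: lins)
    also have "\<dots> = sw ?T (coact P p) (\<lambda>p0 p1. sw ?T (\<rho> a) (\<lambda>a0 a1. sw ?T (coact Q q) (\<lambda>q0 q1.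
        pure K (bt P Q) H (pureA A P Q p0 (lact Q a0 q0)) (p1 \<otimes>\<^bsub>H\<^esub> (a1 \<otimes>\<^bsub>H\<^esub> q1)))))"
      using h by (intro Pc rho_cong Qc) (simp_all add: pureA_bal[OF BP BQ] H.H.A.m_assoc)
    also have "\<dots> = ?f p (lact Q a q)"
      using h by (intro Pc coact_lact[OF Q, symmetric]) (auto intro!: lins)
    finally show "?f (ract P p a) q = ?f p (lact Q a q)" .
  qed
  from liftA_pure[OF BP BQ this h] show ?thesis
    by (simp add: tensA_def Let_def module.defs hopf_bimod.defs)
qed

section \<open>The group \<open>Pic\<^sup>H(A)\<close>\<close>

text \<open>\<open>P\<close> is the regular right Hopf module \<open>A\<close>, on which \<open>A\<close> acts from the left through the
  endomorphism \<open>th\<close>.\<close>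

definition line_bim where
  "line_bim th P e \<longleftrightarrow> lin A P e \<and> bij_betw e (carrier A) (carrier P) \<and>
    (\<forall>a\<in>carrier A. \<forall>x\<in>carrier A. lact P a (e x) = e (th a \<otimes>\<^bsub>A\<^esub> x) \<and> ract P (e x) a = e (x \<otimes>\<^bsub>A\<^esub> a)) \<and>
    (\<forall>x\<in>carrier A. coact P (e x) = tmap K P H e (\<lambda>h. h) (\<rho> x))"

text \<open>In the coordinates \<open>e\<close> and \<open>e'\<close> the pairing \<open>\<alpha>\<close> is the multiplication of \<open>A\<close> preceded by the twist
  that arises when \<open>x\<close> is moved across in \<open>e x \<otimes> e' y = e 1 \<otimes> x \<cdot> e' y\<close>; likewise for \<open>\<beta>\<close>.\<close>

definition line_hctx where
  "line_hctx X f \<longleftrightarrow> (\<exists>e e'. line_bim (\<theta> f) (mP X) e \<and> line_bim (\<theta> (inv\<^bsub>Alg K L\<^esub> f)) (mQ X) e' \<and>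
    (\<forall>x\<in>carrier A. \<forall>y\<in>carrier A.
      malpha X (pureA A (mP X) (mQ X) (e x) (e' y)) = \<theta> (inv\<^bsub>Alg K L\<^esub> f) x \<otimes>\<^bsub>A\<^esub> y \<and>
      mbeta X (pureA A (mQ X) (mP X) (e' y) (e x)) = \<theta> f y \<otimes>\<^bsub>A\<^esub> x))"

abbreviation "dec e \<equiv> inv_into (carrier A) e"

lemma line_bimD:
  assumes "line_bim th P e"
  shows "lin A P e" "module K P" "x \<in> carrier A \<Longrightarrow> e x \<in> carrier P" "p \<in> carrier P \<Longrightarrow> \<exists>x\<in>carrier A. p = e x"
    "a \<in> carrier A \<Longrightarrow> x \<in> carrier A \<Longrightarrow> lact P a (e x) = e (th a \<otimes>\<^bsub>A\<^esub> x)"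
    "a \<in> carrier A \<Longrightarrow> x \<in> carrier A \<Longrightarrow> ract P (e x) a = e (x \<otimes>\<^bsub>A\<^esub> a)"
    "x \<in> carrier A \<Longrightarrow> coact P (e x) = tmap K P H e (\<lambda>h. h) (\<rho> x)"
    "lin P A (dec e)" "x \<in> carrier A \<Longrightarrow> dec e (e x) = x" "p \<in> carrier P \<Longrightarrow> dec e p \<in> carrier A"
    "p \<in> carrier P \<Longrightarrow> e (dec e p) = p"
proof -
  have e: "lin A P e" "bij_betw e (carrier A) (carrier P)" using assms by (auto simp: line_bim_def)
  show "lin A P e" by fact
  show "module K P" by (rule linD(2)[OF e(1)])
  show "x \<in> carrier A \<Longrightarrow> e x \<in> carrier P" by (rule linD(3)[OF e(1)])
  show "p \<in> carrier P \<Longrightarrow> \<exists>x\<in>carrier A. p = e x" using e(2) by (auto simp: bij_betw_def)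
  show "a \<in> carrier A \<Longrightarrow> x \<in> carrier A \<Longrightarrow> lact P a (e x) = e (th a \<otimes>\<^bsub>A\<^esub> x)"
    "a \<in> carrier A \<Longrightarrow> x \<in> carrier A \<Longrightarrow> ract P (e x) a = e (x \<otimes>\<^bsub>A\<^esub> a)"
    "x \<in> carrier A \<Longrightarrow> coact P (e x) = tmap K P H e (\<lambda>h. h) (\<rho> x)" using assms by (auto simp: line_bim_def)
  show d: "lin P A (dec e)" by (rule lin_inv_into[OF e])
  show "x \<in> carrier A \<Longrightarrow> dec e (e x) = x" using e(2) by (simp add: bij_betw_def)
  show "p \<in> carrier P \<Longrightarrow> dec e p \<in> carrier A" by (rule linD(3)[OF d])
  show "p \<in> carrier P \<Longrightarrow> e (dec e p) = p" using e(2) by (auto simp: bij_betw_def f_inv_into_f)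
qed

lemma line_bimodule:
  assumes f: "f \<in> carrier (Alg K L)" and P: "line_bim (\<theta> f) P e" shows "bimodule K A P"
proof -
  note D = line_bimD[OF P] and [simp] = theta_in[OF f] theta_one[OF f] theta_mult[OF f]
  note [lins] = lin_comp[OF theta_lin[OF f]] lin_comp[OF D(1)] lin_comp[OF D(8)]
  have la: "lact P a p = e (\<theta> f a \<otimes>\<^bsub>A\<^esub> dec e p)" and ra: "ract P p a = e (dec e p \<otimes>\<^bsub>A\<^esub> a)"
    if "a \<in> carrier A" "p \<in> carrier P" for a p
    using D(5)[OF that(1) D(10)[OF that(2)]] D(6)[OF that(1) D(10)[OF that(2)]] D(11)[OF that(2)] by simp_all
  have 1: "lin P P (lact P a)" if a: "a \<in> carrier A" for a
    by (rule lin_cong[of P P "\<lambda>p. e (\<theta> f a \<otimes>\<^bsub>A\<^esub> dec e p)"]) (use a D(2) la in \<open>auto intro!: lins\<close>)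
  have 2: "lin P P (\<lambda>p. ract P p a)" if a: "a \<in> carrier A" for a
    by (rule lin_cong[of P P "\<lambda>p. e (dec e p \<otimes>\<^bsub>A\<^esub> a)"]) (use a D(2) ra in \<open>auto intro!: lins\<close>)
  have 3: "lin A P (\<lambda>a. lact P a p)" if p: "p \<in> carrier P" for p
    by (rule lin_cong[of A P "\<lambda>a. e (\<theta> f a \<otimes>\<^bsub>A\<^esub> dec e p)"]) (use p D(10) la in \<open>auto intro!: lins\<close>)
  have 4: "lin A P (ract P p)" if p: "p \<in> carrier P" for p
    by (rule lin_cong[of A P "\<lambda>a. e (dec e p \<otimes>\<^bsub>A\<^esub> a)"]) (use p D(10) ra in \<open>auto intro!: lins\<close>)
  show ?thesis unfolding bimodule_def
  proof (intro conjI ballI)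
    fix p assume p: "p \<in> carrier P"
    show "lact P \<one>\<^bsub>A\<^esub> p = p" "ract P p \<one>\<^bsub>A\<^esub> = p" using p by (simp_all add: la ra D(10,11))
    fix a b assume h: "a \<in> carrier A" "b \<in> carrier A"
    show "lact P (a \<otimes>\<^bsub>A\<^esub> b) p = lact P a (lact P b p)" "ract P p (a \<otimes>\<^bsub>A\<^esub> b) = ract P (ract P p a) b"
      "ract P (lact P a p) b = lact P a (ract P p b)"
      using p h by (simp_all add: la ra D(5,6,10) A.A.m_assoc)
  qed (use 1 2 3 4 D(2) in \<open>simp_all add: lin_def\<close>)
qed

lemma sw_coact_line: assumes P: "line_bim th P e" and g: "bil P H G g" and x: "x \<in> carrier A"
  shows "sw G (coact P (e x)) g = sw G (\<rho> x) (\<lambda>x0 x1. g (e x0) x1)"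
  unfolding line_bimD(7)[OF P x] using x by (intro sw_tmap[OF line_bimD(1)[OF P] lin_id _ g]) simp_all

lemma line_coact_lin: assumes P: "line_bim th P e" shows "lin P (tn P H) (coact P)"
proof -
  note D = line_bimD[OF P]
  have "lin P (tn P H) (\<lambda>p. tmap K P H e (\<lambda>h. h) (\<rho> (dec e p)))"
    by (rule lin_comp[OF lin_tmap[OF D(1) lin_id[OF H.H.A_module]] lin_comp[OF rho_lin D(8)]])
  then show ?thesis by (rule lin_cong) (metis D(7,10,11))
qed

text \<open>Colinearity of \<open>\<theta> f\<close> makes the twisted left action compatible with the coaction.\<close>

lemma line_hopf_bimodule:
  assumes f: "f \<in> carrier (Alg K L)" and P: "line_bim (\<theta> f) P e" shows "hopf_bimodule K H A \<rho> P"
proof -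
  note D = line_bimD[OF P] and B = line_bimodule[OF f P] and cl = line_coact_lin[OF P]
  have c_in: "coact P p \<in> carrier (tn P H)" if "p \<in> carrier P" for p by (rule linD(3)[OF cl that])
  note [simp] = D(2,3) bimod_in[OF B] theta_in[OF f] and [lins] = lin_comp[OF D(1)] bimod_lins[OF B] lin_comp[OF cl] c_in lin_comp[OF theta_lin[OF f]]
  have "right_comodule K H P (coact P)" unfolding right_comodule_def
  proof (intro conjI ballI)
    show "module K P" "k_linear K P (tn P H) (coact P)" using cl by (simp_all add: lin_def)
    fix p assume p: "p \<in> carrier P"
    then obtain x where x: "x \<in> carrier A" "p = e x" using D(4) by auto
    show "tassoc K P H H (tmap K (tn P H) H (coact P) (\<lambda>h. h) (coact P p)) = tmap K P (tn H H) (\<lambda>m. m) (comult H) (coact P p)"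
    proof (rule assoc_eqI[OF cl H.comult_lin c_in[OF p] c_in[OF p]])
      fix g assume g: "tri P H H (tn P (tn H H)) g"
      let ?G = "tn P (tn H H)"
      note [lins] = triD[OF g]
      have b: "bil P H ?G (\<lambda>a b. g a b c)" if "c \<in> carrier H" for c using that by (auto intro!: lins)
      have "sw ?G (coact P p) (\<lambda>m c. sw ?G (coact P m) (\<lambda>a b. g a b c)) = sw ?G (\<rho> x) (\<lambda>x0 c. sw ?G (coact P (e x0)) (\<lambda>a b. g a b c))"
        unfolding x(2) using x(1) by (intro sw_coact_line[OF P]) (auto intro!: lins)
      also have "\<dots> = sw ?G (\<rho> x) (\<lambda>x0 c. sw ?G (\<rho> x0) (\<lambda>a b. g (e a) b c))"
        using x(1) by (intro rho_cong sw_coact_line[OF P b])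
      also have "\<dots> = sw ?G (\<rho> x) (\<lambda>a n. sw ?G (comult H n) (\<lambda>b c. g (e a) b c))"
        using x(1) by (intro rho_coassoc) (auto intro!: lins)
      also have "\<dots> = sw ?G (coact P p) (\<lambda>a n. sw ?G (comult H n) (g a))"
        unfolding x(2) using x(1) by (intro sw_coact_line[OF P, symmetric]) (auto intro!: lins)
      finally show "sw ?G (coact P p) (\<lambda>m c. sw ?G (coact P m) (\<lambda>a b. g a b c)) = sw ?G (coact P p) (\<lambda>a n. sw ?G (comult H n) (g a))" .
    qed simp_all
    have "tensor_lift P (\<lambda>m' h. counit H h \<odot>\<^bsub>P\<^esub> m') (coact P p) = sw P (\<rho> x) (\<lambda>x0 h. counit H h \<odot>\<^bsub>P\<^esub> e x0)"
      unfolding x(2) using x(1) by (intro sw_coact_line[OF P]) (auto intro!: lins)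
    then show "tensor_lift P (\<lambda>m' h. counit H h \<odot>\<^bsub>P\<^esub> m') (coact P p) = p"
      using rho_counit[OF D(1) x(1)] x(2) by simp
  qed
  moreover have "coact P (ract P (lact P a p) b) =
        (let T = tens K P H in
         tensor_lift T (\<lambda>a0 a1. tensor_lift T (\<lambda>p0 p1. tensor_lift T (\<lambda>b0 b1.
           pure K P H (ract P (lact P a0 p0) b0) (a1 \<otimes>\<^bsub>H\<^esub> p1 \<otimes>\<^bsub>H\<^esub> b1))
             (\<rho> b)) (coact P p)) (\<rho> a))" if h: "a \<in> carrier A" "p \<in> carrier P" "b \<in> carrier A" for a p b
  proof -
    obtain x where x: "x \<in> carrier A" "p = e x" using D(4)[OF h(2)] by auto
    let ?T = "tn P H"
    have y: "\<theta> f a \<otimes>\<^bsub>A\<^esub> x \<otimes>\<^bsub>A\<^esub> b \<in> carrier A" using h x by simp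
    have "coact P (ract P (lact P a p) b) = sw ?T (\<rho> (\<theta> f a \<otimes>\<^bsub>A\<^esub> x \<otimes>\<^bsub>A\<^esub> b)) (\<lambda>z0 z1. pure K P H (e z0) z1)"
      using h x D(7)[OF y] by (simp add: D(5,6) tmap_def)
    also have "\<dots> = sw ?T (\<rho> (\<theta> f a \<otimes>\<^bsub>A\<^esub> x)) (\<lambda>y0 y1. sw ?T (\<rho> b) (\<lambda>b0 b1. pure K P H (e (y0 \<otimes>\<^bsub>A\<^esub> b0)) (y1 \<otimes>\<^bsub>H\<^esub> b1)))"
      using h x by (intro rho_mult) (auto intro!: lins)
    also have "\<dots> = sw ?T (\<rho> (\<theta> f a)) (\<lambda>a0 a1. sw ?T (\<rho> x) (\<lambda>x0 x1. sw ?T (\<rho> b) (\<lambda>b0 b1. pure K P H (e ((a0 \<otimes>\<^bsub>A\<^esub> x0) \<otimes>\<^bsub>A\<^esub> b0)) ((a1 \<otimes>\<^bsub>H\<^esub> x1) \<otimes>\<^bsub>H\<^esub> b1))))"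
      using h x by (intro rho_mult) (auto intro!: lins)
    also have "\<dots> = sw ?T (\<rho> a) (\<lambda>a0 a1. sw ?T (\<rho> x) (\<lambda>x0 x1. sw ?T (\<rho> b) (\<lambda>b0 b1. pure K P H (e ((\<theta> f a0 \<otimes>\<^bsub>A\<^esub> x0) \<otimes>\<^bsub>A\<^esub> b0)) ((a1 \<otimes>\<^bsub>H\<^esub> x1) \<otimes>\<^bsub>H\<^esub> b1))))"
      using h x by (intro sw_rho_theta[OF f]) (auto intro!: lins)
    also have "\<dots> = sw ?T (\<rho> a) (\<lambda>a0 a1. sw ?T (\<rho> x) (\<lambda>x0 x1. sw ?T (\<rho> b) (\<lambda>b0 b1. pure K P H (ract P (lact P a0 (e x0)) b0) ((a1 \<otimes>\<^bsub>H\<^esub> x1) \<otimes>\<^bsub>H\<^esub> b1))))"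
      using h x by (intro rho_cong) (simp_all add: D(5,6))
    also have "\<dots> = sw ?T (\<rho> a) (\<lambda>a0 a1. sw ?T (coact P p) (\<lambda>p0 p1. sw ?T (\<rho> b) (\<lambda>b0 b1. pure K P H (ract P (lact P a0 p0) b0) ((a1 \<otimes>\<^bsub>H\<^esub> p1) \<otimes>\<^bsub>H\<^esub> b1))))"
      unfolding x(2) using h x(1) by (intro rho_cong sw_coact_line[OF P, symmetric]) (auto intro!: lins)
    finally show ?thesis by (simp add: Let_def)
  qed
  ultimately show ?thesis using B by (simp add: hopf_bimodule_def)
qed

text \<open>The coordinate on the tensor product of two lines: \<open>e x \<otimes> e' y\<close> has coordinate \<open>\<theta>\<^sub>g(x) y\<close>.\<close>

lemma line_coordA:
  assumes f: "f \<in> carrier (Alg K L)" and g: "g \<in> carrier (Alg K L)" and P: "line_bim (\<theta> f) P e" and Q: "line_bim (\<theta> g) Q e'"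
  shows "abal P Q A (\<lambda>p q. \<theta> g (dec e p) \<otimes>\<^bsub>A\<^esub> dec e' q)"
proof -
  note PD = line_bimD[OF P] and QD = line_bimD[OF Q] and [simp] = theta_in[OF g] theta_in[OF f]
  note [lins] = lin_comp[OF theta_lin[OF g]] lin_comp[OF PD(8)] lin_comp[OF QD(8)] and [simp] = PD(2,10) QD(2,10)
  show ?thesis
  proof (rule abalI)
    show "bil P Q A (\<lambda>p q. \<theta> g (dec e p) \<otimes>\<^bsub>A\<^esub> dec e' q)" by (auto intro!: lins)
    fix p a q assume h: "p \<in> carrier P" "a \<in> carrier A" "q \<in> carrier Q"
    obtain x y where xy: "x \<in> carrier A" "p = e x" "y \<in> carrier A" "q = e' y" using PD(4)[OF h(1)] QD(4)[OF h(3)] by auto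
    then show "\<theta> g (dec e (ract P p a)) \<otimes>\<^bsub>A\<^esub> dec e' q = \<theta> g (dec e p) \<otimes>\<^bsub>A\<^esub> dec e' (lact Q a q)"
      using h(2) by (simp add: PD(6,9) QD(5,9) theta_mult[OF g] A.A.m_assoc)
  qed
qed

lemma line_pureA:
  assumes f: "f \<in> carrier (Alg K L)" and g: "g \<in> carrier (Alg K L)" and P: "line_bim (\<theta> f) P e" and Q: "line_bim (\<theta> g) Q e'"
    and h: "x \<in> carrier A" "y \<in> carrier A"
  shows "pureA A P Q (e x) (e' y) = pureA A P Q (e \<one>\<^bsub>A\<^esub>) (e' (\<theta> g x \<otimes>\<^bsub>A\<^esub> y))"
  using pureA_bal[OF line_bimodule[OF f P] line_bimodule[OF g Q] line_bimD(3)[OF P A.A.one_closed] h(1) line_bimD(3)[OF Q h(2)]]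
    line_bimD(6)[OF P h(1) A.A.one_closed] line_bimD(5)[OF Q h] h by simp

text \<open>Every tensor has the form \<open>e 1 \<otimes> e' x\<close>. The left action of \<open>a\<close> becomes \<open>\<theta>\<^sub>f(a)\<close> on \<open>P\<close> and, moved
  across, \<open>\<theta>\<^sub>g(\<theta>\<^sub>f(a))\<close> on \<open>Q\<close>, which belongs to the convolution product by \<open>theta_comp\<close>.\<close>

lemma line_bim_tens:
  fixes P :: "('k, 'a, 'h, 'm) hopf_bimod" and Q :: "('k, 'a, 'h, 'n) hopf_bimod"
  assumes f: "f \<in> carrier (Alg K L)" and g: "g \<in> carrier (Alg K L)" and P: "line_bim (\<theta> f) P e" and Q: "line_bim (\<theta> g) Q e'"
  shows "line_bim (\<theta> (f \<otimes>\<^bsub>Alg K L\<^esub> g)) (tensA K H A P Q) (\<lambda>x. pureA A P Q (e \<one>\<^bsub>A\<^esub>) (e' x))" (is "line_bim _ ?C ?e")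
proof -
  note PD = line_bimD[OF P] and QD = line_bimD[OF Q] and [simp] = theta_in[OF g] theta_in[OF f]
  note BP = line_bimodule[OF f P] and BQ = line_bimodule[OF g Q]
  note hP = line_hopf_bimodule[OF f P] and hQ = line_hopf_bimodule[OF g Q]
  note bp = bil_pureA[OF BP BQ] and same = same_tensA[OF BP BQ] and lp = line_pureA[OF f g P Q]
  note [simp] = PD(2,3) QD(2,3) bt_module[OF BP BQ]
  have e1: "e \<one>\<^bsub>A\<^esub> \<in> carrier P" by simp
  have l: "lin A (bt P Q) ?e" by (rule bilD(2)[OF bp e1 QD(1)])
  have sur: "\<exists>x\<in>carrier A. t = ?e x" if "t \<in> carrier (bt P Q)" for t
    using that
  proof (induction rule: btA_induct[OF BP BQ, consumes 1, case_names zero pure add])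
    case zero
    show ?case using lin_zero[OF l] by (intro bexI[of _ "\<zero>\<^bsub>A\<^esub>"]) simp_all
  next
    case (pure p q)
    obtain x y where xy: "x \<in> carrier A" "p = e x" "y \<in> carrier A" "q = e' y" using PD(4)[OF pure(1)] QD(4)[OF pure(2)] by auto
    show ?case unfolding xy(2,4) using lp[OF xy(1,3)] xy by (intro bexI[of _ "\<theta> g x \<otimes>\<^bsub>A\<^esub> y"]) simp_all
  next
    case (add s t)
    then obtain x y where "x \<in> carrier A" "y \<in> carrier A" "s = ?e x" "t = ?e y" by auto
    then show ?case using linD(4)[OF l, of x y] by (intro bexI[of _ "x \<oplus>\<^bsub>A\<^esub> y"]) simp_all
  qed
  have "inj_on ?e (carrier A)"
  proof (rule inj_on_inverseI)
    fix x assume x: "x \<in> carrier A"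
    show "tensor_lift A (\<lambda>p q. \<theta> g (dec e p) \<otimes>\<^bsub>A\<^esub> dec e' q) (?e x) = x"
      using liftA_pure[OF BP BQ line_coordA[OF f g P Q] e1 QD(3)[OF x]] x by (simp add: PD(9) QD(9) theta_one[OF g])
  qed
  then have bij: "bij_betw ?e (carrier A) (carrier ?C)"
    using sur linD(3)[OF l] by (auto simp: bij_betw_def same_spD(1)[OF same])
  have la: "lact ?C a (?e x) = ?e (\<theta> (f \<otimes>\<^bsub>Alg K L\<^esub> g) a \<otimes>\<^bsub>A\<^esub> x)" if h: "a \<in> carrier A" "x \<in> carrier A" for a x
  proof -
    have "lact ?C a (?e x) = pureA A P Q (e (\<theta> f a)) (e' x)"
      using tensA_lact[OF BP BQ h(1) e1 QD(3)[OF h(2)]] h PD(5)[OF h(1) A.A.one_closed] by simp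
    also have "\<dots> = ?e (\<theta> g (\<theta> f a) \<otimes>\<^bsub>A\<^esub> x)" using h by (intro lp) simp_all
    finally show ?thesis using h by (simp add: theta_comp[OF g f])
  qed
  have ra: "ract ?C (?e x) a = ?e (x \<otimes>\<^bsub>A\<^esub> a)" if h: "a \<in> carrier A" "x \<in> carrier A" for a x
    using tensA_ract[OF BP BQ h(1) e1 QD(3)[OF h(2)]] h QD(6)[OF h] by simp
  have co: "coact ?C (?e x) = tmap K ?C H ?e (\<lambda>h. h) (\<rho> x)" if x: "x \<in> carrier A" for x
  proof -
    let ?T = "tn (bt P Q) H"
    note [lins] = bilD[OF bp] hopf_bimodD(5)[OF hP] hopf_bimodD(5)[OF hQ] lin_comp[OF hopf_bimodD(4)[OF hP]] lin_comp[OF hopf_bimodD(4)[OF hQ]]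
      lin_comp[OF PD(1)] lin_comp[OF QD(1)]
    have "coact ?C (?e x) = sw ?T (coact P (e \<one>\<^bsub>A\<^esub>)) (\<lambda>p0 p1. sw ?T (coact Q (e' x)) (\<lambda>q0 q1. pure K (bt P Q) H (pureA A P Q p0 q0) (p1 \<otimes>\<^bsub>H\<^esub> q1)))"
      by (rule tensA_coact[OF hP hQ e1 QD(3)[OF x]])
    also have "\<dots> = sw ?T (\<rho> \<one>\<^bsub>A\<^esub>) (\<lambda>p0 p1. sw ?T (coact Q (e' x)) (\<lambda>q0 q1. pure K (bt P Q) H (pureA A P Q (e p0) q0) (p1 \<otimes>\<^bsub>H\<^esub> q1)))"
      using x by (intro sw_coact_line[OF P]) (auto intro!: lins)
    also have "\<dots> = sw ?T (coact Q (e' x)) (\<lambda>q0 q1. pure K (bt P Q) H (pureA A P Q (e \<one>\<^bsub>A\<^esub>) q0) (\<one>\<^bsub>H\<^esub> \<otimes>\<^bsub>H\<^esub> q1))"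
      using x by (intro rho_one) (auto intro!: lins)
    also have "\<dots> = sw ?T (\<rho> x) (\<lambda>q0 q1. pure K (bt P Q) H (pureA A P Q (e \<one>\<^bsub>A\<^esub>) (e' q0)) (\<one>\<^bsub>H\<^esub> \<otimes>\<^bsub>H\<^esub> q1))"
      using x by (intro sw_coact_line[OF Q]) (auto intro!: lins)
    also have "\<dots> = sw ?T (\<rho> x) (\<lambda>q0 q1. pure K (bt P Q) H (?e q0) q1)"
      using x by (intro rho_cong) simp_all
    finally show ?thesis unfolding same_tmap[OF same same_refl] by (simp add: tmap_def)
  qed
  show ?thesis unfolding line_bim_def
    using same_lin[OF same_refl same l] bij la ra co by simp
qed

lemma rho_A_one: "\<rho> \<one>\<^bsub>A\<^esub> = pure K A H \<one>\<^bsub>A\<^esub> \<one>\<^bsub>H\<^esub>"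
  using rho_hom by (simp add: alg_hom_def tens_mult)

text \<open>An isomorphism sends the coinvariant generator \<open>e 1\<close> to a coinvariant, that is, to \<open>c \<cdot> i 1\<close> with a
  nonzero scalar \<open>c\<close>. Comparing the left actions on both generators gives \<open>\<theta>\<^sub>f = \<theta>\<^sub>g\<close>.\<close>

lemma line_hom_eq:
  fixes P :: "('k, 'a, 'h, 'm) hopf_bimod" and Q :: "('k, 'a, 'h, 'n) hopf_bimod"
  assumes f: "f \<in> carrier (Alg K L)" and g: "g \<in> carrier (Alg K L)" and P: "line_bim (\<theta> f) P e" and Q: "line_bim (\<theta> g) Q i"
    and \<phi>: "hopf_bimod_hom K H A P Q \<phi>" "bij_betw \<phi> (carrier P) (carrier Q)"
  shows "f = g"
proof -
  note PD = line_bimD[OF P] and QD = line_bimD[OF Q] and [simp] = theta_in[OF g] theta_in[OF f]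
  interpret Q: module K Q by (rule QD(2))
  have pl: "lin P Q \<phi>" using \<phi>(1) PD(2) QD(2) by (simp add: hopf_bimod_hom_def lin_def)
  have e1: "e \<one>\<^bsub>A\<^esub> \<in> carrier P" by (simp add: PD(3))
  obtain u where u: "u \<in> carrier A" "\<phi> (e \<one>\<^bsub>A\<^esub>) = i u" using QD(4)[OF linD(3)[OF pl e1]] by auto
  note idH = lin_id[OF H.H.A_module]
  have "tmap K Q H i (\<lambda>h. h) (\<rho> u) = coact Q (\<phi> (e \<one>\<^bsub>A\<^esub>))" using u QD(7) by simp
  also have "\<dots> = tmap K Q H \<phi> (\<lambda>h. h) (coact P (e \<one>\<^bsub>A\<^esub>))" using \<phi>(1) e1 by (simp add: hopf_bimod_hom_def)
  also have "\<dots> = tmap K Q H \<phi> (\<lambda>h. h) (pure K P H (e \<one>\<^bsub>A\<^esub>) \<one>\<^bsub>H\<^esub>)"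
    using tmap_pure[OF PD(1) idH, of "\<one>\<^bsub>A\<^esub>" "\<one>\<^bsub>H\<^esub>"] by (simp add: PD(7) rho_A_one)
  also have "\<dots> = pure K Q H (i u) \<one>\<^bsub>H\<^esub>" using tmap_pure[OF pl idH e1, of "\<one>\<^bsub>H\<^esub>"] u(2) by simp
  also have "\<dots> = tmap K Q H i (\<lambda>h. h) (pure K A H u \<one>\<^bsub>H\<^esub>)" using tmap_pure[OF QD(1) idH u(1), of "\<one>\<^bsub>H\<^esub>"] by simp
  finally have eq: "tmap K Q H i (\<lambda>h. h) (\<rho> u) = tmap K Q H i (\<lambda>h. h) (pure K A H u \<one>\<^bsub>H\<^esub>)" .
  have retr: "tmap K A H (dec i) (\<lambda>h. h) (tmap K Q H i (\<lambda>h. h) t) = t" if t: "t \<in> carrier (tn A H)" for t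
  proof -
    have "tmap K A H (dec i) (\<lambda>h. h) (tmap K Q H i (\<lambda>h. h) t) = tmap K A H (\<lambda>x. dec i (i x)) (\<lambda>h. h) t"
      by (rule tmap_tmap[OF QD(1) idH QD(8) idH t])
    also have "\<dots> = tmap K A H (\<lambda>x. x) (\<lambda>h. h) t" using t QD(9) by (intro tmap_cong[of A H]) auto
    finally show ?thesis using tmap_id[OF A.A_module H.H.A_module t] by simp
  qed
  have "\<rho> u = pure K A H u \<one>\<^bsub>H\<^esub>"
    using arg_cong[OF eq, of "tmap K A H (dec i) (\<lambda>h. h)"] u(1) by (simp add: retr pure_in)
  then obtain c where c: "c \<in> carrier K" "u = c \<odot>\<^bsub>A\<^esub> \<one>\<^bsub>A\<^esub>" using coinv_scalar[OF u(1)] by auto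
  have cz: "c \<noteq> \<zero>"
  proof
    assume "c = \<zero>"
    then have "\<phi> (e \<one>\<^bsub>A\<^esub>) = \<phi> (e \<zero>\<^bsub>A\<^esub>)" using u c lin_zero[OF QD(1)] lin_zero[OF PD(1)] lin_zero[OF pl] by simp
    then have "e \<one>\<^bsub>A\<^esub> = e \<zero>\<^bsub>A\<^esub>" using \<phi>(2) PD(3) by (auto simp: bij_betw_def dest!: inj_onD)
    then show False using PD(9)[of "\<one>\<^bsub>A\<^esub>"] PD(9)[of "\<zero>\<^bsub>A\<^esub>"] A_nontrivial by simp
  qed
  then have ic: "inv c \<in> carrier K" "inv c \<otimes> c = \<one>" using c field_Units by auto
  show ?thesis
  proof (rule theta_inj[OF f g])
    fix a assume a: "a \<in> carrier A"
    have "i (u \<otimes>\<^bsub>A\<^esub> \<theta> f a) = ract Q (\<phi> (e \<one>\<^bsub>A\<^esub>)) (\<theta> f a)" using a u by (simp add: QD(6))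
    also have "\<dots> = \<phi> (ract P (e \<one>\<^bsub>A\<^esub>) (\<theta> f a))" using \<phi>(1) e1 a by (simp add: hopf_bimod_hom_def)
    also have "\<dots> = \<phi> (lact P a (e \<one>\<^bsub>A\<^esub>))" using a by (simp add: PD(5,6))
    also have "\<dots> = lact Q a (\<phi> (e \<one>\<^bsub>A\<^esub>))" using \<phi>(1) e1 a by (simp add: hopf_bimod_hom_def)
    also have "\<dots> = i (\<theta> g a \<otimes>\<^bsub>A\<^esub> u)" using a u by (simp add: QD(5))
    finally have "dec i (i (u \<otimes>\<^bsub>A\<^esub> \<theta> f a)) = dec i (i (\<theta> g a \<otimes>\<^bsub>A\<^esub> u))" by simp
    then have "c \<odot>\<^bsub>A\<^esub> \<theta> f a = c \<odot>\<^bsub>A\<^esub> \<theta> g a" using a u(1) c by (simp add: QD(9) A.A_smult)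
    then have "inv c \<odot>\<^bsub>A\<^esub> (c \<odot>\<^bsub>A\<^esub> \<theta> f a) = inv c \<odot>\<^bsub>A\<^esub> (c \<odot>\<^bsub>A\<^esub> \<theta> g a)" by simp
    then show "\<theta> f a = \<theta> g a" using a c ic by (simp add: A.Am.smult_assoc1[symmetric])
  qed
qed

lemma line_bim_transfer:
  fixes P :: "('k, 'a, 'h, 'm) hopf_bimod" and Q :: "('k, 'a, 'h, 'n) hopf_bimod"
  assumes f: "f \<in> carrier (Alg K L)" and P: "line_bim (\<theta> f) P e" and Q: "line_bim (\<theta> f) Q i"
    and \<phi>: "\<And>x. x \<in> carrier A \<Longrightarrow> \<phi> (e x) = i x"
  shows "hopf_bimod_hom K H A P Q \<phi>" "bij_betw \<phi> (carrier P) (carrier Q)"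
proof -
  note PD = line_bimD[OF P] and QD = line_bimD[OF Q] and [simp] = theta_in[OF f]
  note idH = lin_id[OF H.H.A_module]
  have l: "lin P Q \<phi>"
    by (rule lin_cong[OF lin_comp[OF QD(1) PD(8)]]) (use \<phi>[OF PD(10)] PD(11) in simp)
  have co: "coact Q (\<phi> p) = tmap K Q H \<phi> (\<lambda>h. h) (coact P p)" if p: "p \<in> carrier P" for p
  proof -
    obtain x where x: "x \<in> carrier A" "p = e x" using PD(4)[OF p] by auto
    have "tmap K Q H \<phi> (\<lambda>h. h) (coact P p) = tmap K Q H (\<lambda>x. \<phi> (e x)) (\<lambda>h. h) (\<rho> x)"
      unfolding x(2) PD(7)[OF x(1)] by (rule tmap_tmap[OF PD(1) idH l idH rho_in[OF x(1)]])
    also have "\<dots> = tmap K Q H i (\<lambda>h. h) (\<rho> x)" using x(1) by (intro tmap_cong[of A H]) (simp_all add: \<phi>)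
    finally show ?thesis using x by (simp add: \<phi> QD(7))
  qed
  have la: "\<phi> (lact P a p) = lact Q a (\<phi> p) \<and> \<phi> (ract P p a) = ract Q (\<phi> p) a"
    if a: "a \<in> carrier A" and p: "p \<in> carrier P" for a p
  proof -
    obtain x where x: "x \<in> carrier A" "p = e x" using PD(4)[OF p] by auto
    then show ?thesis using a by (simp add: PD(5,6) QD(5,6) \<phi>)
  qed
  show "hopf_bimod_hom K H A P Q \<phi>"
    using l co la by (simp add: hopf_bimod_hom_def lin_def)
  show "bij_betw \<phi> (carrier P) (carrier Q)"
  proof (rule bij_betw_byWitness[where f' = "\<lambda>q. e (dec i q)"])
    show "\<forall>p\<in>carrier P. e (dec i (\<phi> p)) = p"
    proof
      fix p assume "p \<in> carrier P"
      then obtain x where "x \<in> carrier A" "p = e x" using PD(4) by auto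
      then show "e (dec i (\<phi> p)) = p" by (simp add: \<phi> QD(9))
    qed
    show "\<forall>q\<in>carrier Q. \<phi> (e (dec i q)) = q" by (simp add: \<phi> QD(10,11))
    show "\<phi> ` carrier P \<subseteq> carrier Q" using linD(3)[OF l] by auto
    show "(\<lambda>q. e (dec i q)) ` carrier Q \<subseteq> carrier P" by (auto simp: PD(3) QD(10))
  qed
qed

lemma line_hctx_iso:
  fixes X :: "('k, 'a, 'h, 'm) bimod_morita" and Y :: "('k, 'a, 'h, 'n) bimod_morita"
  assumes f: "f \<in> carrier (Alg K L)" and g: "g \<in> carrier (Alg K L)" and X: "line_hctx X f" and Y: "line_hctx Y g"
  shows "hopf_morita_iso K H A X Y \<longleftrightarrow> f = g"
proof
  obtain e e' where e: "line_bim (\<theta> f) (mP X) e" "line_bim (\<theta> (inv\<^bsub>Alg K L\<^esub> f)) (mQ X) e'"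
    "\<And>x y. x \<in> carrier A \<Longrightarrow> y \<in> carrier A \<Longrightarrow> malpha X (pureA A (mP X) (mQ X) (e x) (e' y)) = \<theta> (inv\<^bsub>Alg K L\<^esub> f) x \<otimes>\<^bsub>A\<^esub> y \<and>
      mbeta X (pureA A (mQ X) (mP X) (e' y) (e x)) = \<theta> f y \<otimes>\<^bsub>A\<^esub> x" using X by (auto simp: line_hctx_def)
  obtain i i' where i: "line_bim (\<theta> g) (mP Y) i" "line_bim (\<theta> (inv\<^bsub>Alg K L\<^esub> g)) (mQ Y) i'"
    "\<And>x y. x \<in> carrier A \<Longrightarrow> y \<in> carrier A \<Longrightarrow> malpha Y (pureA A (mP Y) (mQ Y) (i x) (i' y)) = \<theta> (inv\<^bsub>Alg K L\<^esub> g) x \<otimes>\<^bsub>A\<^esub> y \<and>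
      mbeta Y (pureA A (mQ Y) (mP Y) (i' y) (i x)) = \<theta> g y \<otimes>\<^bsub>A\<^esub> x" using Y by (auto simp: line_hctx_def)
  show "f = g" if "hopf_morita_iso K H A X Y"
    using that line_hom_eq[OF f g e(1) i(1)] by (auto simp: hopf_morita_iso_def)
  show "hopf_morita_iso K H A X Y" if fg: "f = g"
    unfolding hopf_morita_iso_def
  proof (intro exI conjI ballI)
    have "line_bim (\<theta> f) (mP Y) i" "line_bim (\<theta> (inv\<^bsub>Alg K L\<^esub> f)) (mQ Y) i'" using i(1,2) fg by simp_all
    note t = line_bim_transfer[OF f e(1) this(1), of "\<lambda>x. i (dec e x)"]
      line_bim_transfer[OF Alg_inv[OF f] e(2) this(2), of "\<lambda>x. i' (dec e' x)"]
    show "hopf_bimod_hom K H A (mP X) (mP Y) (\<lambda>x. i (dec e x))"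
      "bij_betw (\<lambda>x. i (dec e x)) (carrier (mP X)) (carrier (mP Y))"
      "hopf_bimod_hom K H A (mQ X) (mQ Y) (\<lambda>x. i' (dec e' x))"
      "bij_betw (\<lambda>x. i' (dec e' x)) (carrier (mQ X)) (carrier (mQ Y))"
      using t by (simp_all add: line_bimD(9)[OF e(1)] line_bimD(9)[OF e(2)])
    fix p q assume h: "p \<in> carrier (mP X)" "q \<in> carrier (mQ X)"
    obtain x y where "x \<in> carrier A" "p = e x" "y \<in> carrier A" "q = e' y"
      using line_bimD(4)[OF e(1) h(1)] line_bimD(4)[OF e(2) h(2)] by auto
    then show "malpha Y (pureA A (mP Y) (mQ Y) (i (dec e p)) (i' (dec e' q))) = malpha X (pureA A (mP X) (mQ X) p q)"
      "mbeta Y (pureA A (mQ Y) (mP Y) (i' (dec e' q)) (i (dec e p))) = mbeta X (pureA A (mQ X) (mP X) q p)"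
      using e(3) i(3) fg by (simp_all add: line_bimD(9)[OF e(1)] line_bimD(9)[OF e(2)])
  qed
qed

lemma theta_inv: assumes f: "f \<in> carrier (Alg K L)" and x: "x \<in> carrier A"
  shows "\<theta> (inv\<^bsub>Alg K L\<^esub> f) (\<theta> f x) = x" "\<theta> f (\<theta> (inv\<^bsub>Alg K L\<^esub> f) x) = x"
proof -
  interpret G: group "Alg K L" by (rule L.Alg_group)
  show "\<theta> (inv\<^bsub>Alg K L\<^esub> f) (\<theta> f x) = x" "\<theta> f (\<theta> (inv\<^bsub>Alg K L\<^esub> f) x) = x"
    using f x by (simp_all add: theta_comp theta_id)
qed

text \<open>This covers both pairings of a product of contexts: the one named \<open>\<beta>\<close> is obtained by exchanging the
  roles of \<open>(P, P')\<close> and \<open>(Q', Q)\<close>.\<close>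

lemma line_pairing_mult:
  fixes P :: "('k, 'a, 'h, 'm) hopf_bimod" and Q :: "('k, 'a, 'h, 'm) hopf_bimod"
    and P' :: "('k, 'a, 'h, 'n) hopf_bimod" and Q' :: "('k, 'a, 'h, 'n) hopf_bimod"
  assumes f: "f \<in> carrier (Alg K L)" and g: "g \<in> carrier (Alg K L)"
    and P: "line_bim (\<theta> f) P e" and Q: "line_bim (\<theta> (inv\<^bsub>Alg K L\<^esub> f)) Q e'"
    and P': "line_bim (\<theta> g) P' i" and Q': "line_bim (\<theta> (inv\<^bsub>Alg K L\<^esub> g)) Q' i'"
    and \<alpha>: "\<And>x y. x \<in> carrier A \<Longrightarrow> y \<in> carrier A \<Longrightarrow> \<alpha> (pureA A P Q (e x) (e' y)) = \<theta> (inv\<^bsub>Alg K L\<^esub> f) x \<otimes>\<^bsub>A\<^esub> y"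
    and \<alpha>': "\<And>x y. x \<in> carrier A \<Longrightarrow> y \<in> carrier A \<Longrightarrow> \<alpha>' (pureA A P' Q' (i x) (i' y)) = \<theta> (inv\<^bsub>Alg K L\<^esub> g) x \<otimes>\<^bsub>A\<^esub> y"
    and x: "x \<in> carrier A" and y: "y \<in> carrier A"
  shows "tensor_lift A (\<lambda>s t. tensor_lift A (\<lambda>p p'. tensor_lift A (\<lambda>q' q.
       \<alpha> (pureA A P Q (ract P p (\<alpha>' (pureA A P' Q' p' q'))) q)) t) s)
     (pureA A (tensA K H A P P') (tensA K H A Q' Q) (pureA A P P' (e \<one>\<^bsub>A\<^esub>) (i x)) (pureA A Q' Q (i' \<one>\<^bsub>A\<^esub>) (e' y)))
   = \<theta> (inv\<^bsub>Alg K L\<^esub> (f \<otimes>\<^bsub>Alg K L\<^esub> g)) x \<otimes>\<^bsub>A\<^esub> y"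
proof -
  interpret G: group "Alg K L" by (rule L.Alg_group)
  let ?f = "inv\<^bsub>Alg K L\<^esub> f" and ?g = "inv\<^bsub>Alg K L\<^esub> g" and ?h = "f \<otimes>\<^bsub>Alg K L\<^esub> g"
  have fi: "?f \<in> carrier (Alg K L)" "?g \<in> carrier (Alg K L)" "?h \<in> carrier (Alg K L)" using f g by simp_all
  have hi: "inv\<^bsub>Alg K L\<^esub> ?h \<in> carrier (Alg K L)" "inv\<^bsub>Alg K L\<^esub> ?h = ?g \<otimes>\<^bsub>Alg K L\<^esub> ?f"
    using f g by (simp_all add: G.inv_mult_group)
  note [simp] = theta_in[OF f] theta_in[OF g] theta_in[OF fi(1)] theta_in[OF fi(2)] theta_in[OF hi(1)] theta_one[OF fi(1)] theta_one[OF g]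
  note PD = line_bimD[OF P] and QD = line_bimD[OF Q] and P'D = line_bimD[OF P'] and Q'D = line_bimD[OF Q']
  note [simp] = PD(3,9) QD(3,9) P'D(3,9) Q'D(3,9)
  note BP = line_bimodule[OF f P] and BQ = line_bimodule[OF fi(1) Q] and BP' = line_bimodule[OF g P'] and BQ' = line_bimodule[OF fi(2) Q']
  let ?S = "tensA K H A P P'" and ?T = "tensA K H A Q' Q"
  let ?s = "\<lambda>x. pureA A P P' (e \<one>\<^bsub>A\<^esub>) (i x)" and ?t = "\<lambda>y. pureA A Q' Q (i' \<one>\<^bsub>A\<^esub>) (e' y)"
  have S: "line_bim (\<theta> ?h) ?S ?s" by (rule line_bim_tens[OF f g P P'])
  have T: "line_bim (\<theta> (inv\<^bsub>Alg K L\<^esub> ?h)) ?T ?t" unfolding hi(2) by (rule line_bim_tens[OF fi(2,1) Q' Q])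
  note SD = line_bimD[OF S] and TD = line_bimD[OF T]
  have cS: "carrier (bt P P') = carrier ?S" and cT: "carrier (bt Q' Q) = carrier ?T"
    using same_spD(1)[OF same_tensA[OF BP BP']] same_spD(1)[OF same_tensA[OF BQ' BQ]] by simp_all
  let ?S' = "\<lambda>p p'. \<theta> g (dec e p) \<otimes>\<^bsub>A\<^esub> dec i p'" and ?T' = "\<lambda>q' q. \<theta> ?f (dec i' q') \<otimes>\<^bsub>A\<^esub> dec e' q"
  let ?w = "\<lambda>u. \<theta> ?f (\<theta> ?g u)"
  have w: "lin A A ?w" by (rule lin_comp[OF theta_lin[OF fi(1)] theta_lin[OF fi(2)]])
  note bS = line_coordA[OF f g P P'] and bT = line_coordA[OF fi(2,1) Q' Q]
  \<comment> \<open>the pairing depends only on the coordinates of \<open>p \<otimes> p'\<close> and \<open>q' \<otimes> q\<close>\<close>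
  have F: "\<alpha> (pureA A P Q (ract P p (\<alpha>' (pureA A P' Q' p' q'))) q) = ?w (?S' p p') \<otimes>\<^bsub>A\<^esub> ?T' q' q"
    if h: "p \<in> carrier P" "p' \<in> carrier P'" "q' \<in> carrier Q'" "q \<in> carrier Q" for p p' q' q
  proof -
    obtain a b c d where "a \<in> carrier A" "p = e a" "b \<in> carrier A" "p' = i b" "c \<in> carrier A" "q' = i' c" "d \<in> carrier A" "q = e' d"
      using PD(4)[OF h(1)] P'D(4)[OF h(2)] Q'D(4)[OF h(3)] QD(4)[OF h(4)] by auto
    then show ?thesis
      by (simp add: \<alpha> \<alpha>' PD(6) theta_mult[OF fi(1)] theta_mult[OF fi(2)] theta_inv[OF g] A.A.m_assoc)
  qed
  have val: "tensor_lift A (\<lambda>p p'. tensor_lift A (\<lambda>q' q. \<alpha> (pureA A P Q (ract P p (\<alpha>' (pureA A P' Q' p' q'))) q)) \<tau>') \<sigma>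
      = \<theta> (inv\<^bsub>Alg K L\<^esub> ?h) (dec ?s \<sigma>) \<otimes>\<^bsub>A\<^esub> dec ?t \<tau>'" (is "?l \<tau>' \<sigma> = _")
    if \<sigma>: "\<sigma> \<in> carrier ?S" and \<tau>': "\<tau>' \<in> carrier ?T" for \<sigma> \<tau>'
  proof -
    obtain c d where c: "c \<in> carrier A" "\<sigma> = ?s c" and d: "d \<in> carrier A" "\<tau>' = ?t d" using SD(4)[OF \<sigma>] TD(4)[OF \<tau>'] by auto
    have inner: "tensor_lift A (\<lambda>q' q. \<alpha> (pureA A P Q (ract P p (\<alpha>' (pureA A P' Q' p' q'))) q)) \<tau>' = ?w (?S' p p') \<otimes>\<^bsub>A\<^esub> d"
      if h: "p \<in> carrier P" "p' \<in> carrier P'" for p p'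
    proof -
      have u: "?w (?S' p p') \<in> carrier A" using h by (simp add: PD(10) P'D(10))
      have "tensor_lift A (\<lambda>q' q. \<alpha> (pureA A P Q (ract P p (\<alpha>' (pureA A P' Q' p' q'))) q)) \<tau>'
         = tensor_lift A (\<lambda>q' q. ?w (?S' p p') \<otimes>\<^bsub>A\<^esub> ?T' q' q) \<tau>'"
        by (rule liftA_cong[OF BQ' BQ]) (use \<tau>' cT F h in auto)
      also have "\<dots> = ?w (?S' p p') \<otimes>\<^bsub>A\<^esub> ?T' (i' \<one>\<^bsub>A\<^esub>) (e' d)"
        unfolding d(2) using d u by (intro liftA_pure[OF BQ' BQ] abal_comp[OF bT]) (auto intro!: lins)
      finally show ?thesis using d by simp
    qed
    have b: "abal P P' A (\<lambda>p p'. ?w (?S' p p') \<otimes>\<^bsub>A\<^esub> d)"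
      by (rule abal_comp[OF bS]) (use d w in \<open>auto intro!: lins\<close>)
    have "?l \<tau>' \<sigma> = tensor_lift A (\<lambda>p p'. ?w (?S' p p') \<otimes>\<^bsub>A\<^esub> d) \<sigma>"
      by (rule liftA_cong[OF BP BP']) (use \<sigma> cS inner in auto)
    also have "\<dots> = ?w (?S' (e \<one>\<^bsub>A\<^esub>) (i c)) \<otimes>\<^bsub>A\<^esub> d"
      unfolding c(2) using c by (intro liftA_pure[OF BP BP' b]) simp_all
    also have "\<dots> = \<theta> (inv\<^bsub>Alg K L\<^esub> ?h) c \<otimes>\<^bsub>A\<^esub> d" using c by (simp add: hi(2) theta_comp[OF fi(1,2)])
    finally show ?thesis using SD(9)[OF c(1)] TD(9)[OF d(1)] c(2) d(2) by simp
  qed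
  note BS = line_bimodule[OF fi(3) S] and BT = line_bimodule[OF hi(1) T]
  have "tensor_lift A (\<lambda>s t. ?l t s) (pureA A ?S ?T (?s x) (?t y))
    = tensor_lift A (\<lambda>\<sigma> \<tau>'. \<theta> (inv\<^bsub>Alg K L\<^esub> ?h) (dec ?s \<sigma>) \<otimes>\<^bsub>A\<^esub> dec ?t \<tau>') (pureA A ?S ?T (?s x) (?t y))"
    by (rule liftA_cong[OF BS BT pureA_in[OF BS BT SD(3)[OF x] TD(3)[OF y]]]) (rule val)
  also have "\<dots> = \<theta> (inv\<^bsub>Alg K L\<^esub> ?h) (dec ?s (?s x)) \<otimes>\<^bsub>A\<^esub> dec ?t (?t y)"
    by (rule liftA_pure[OF BS BT line_coordA[OF fi(3) hi(1) S T] SD(3)[OF x] TD(3)[OF y]])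
  finally show ?thesis using SD(9)[OF x] TD(9)[OF y] by simp
qed

lemma line_hctx_mult:
  fixes X Y :: "('k, 'a, 'h, 'm) bimod_morita"
  assumes f: "f \<in> carrier (Alg K L)" and g: "g \<in> carrier (Alg K L)" and X: "line_hctx X f" and Y: "line_hctx Y g"
  shows "line_hctx (hopf_morita_mult K H A X Y) (f \<otimes>\<^bsub>Alg K L\<^esub> g)"
proof -
  interpret G: group "Alg K L" by (rule L.Alg_group)
  obtain e e' where e: "line_bim (\<theta> f) (mP X) e" "line_bim (\<theta> (inv\<^bsub>Alg K L\<^esub> f)) (mQ X) e'"
    and eX: "\<And>x y. x \<in> carrier A \<Longrightarrow> y \<in> carrier A \<Longrightarrow> malpha X (pureA A (mP X) (mQ X) (e x) (e' y)) = \<theta> (inv\<^bsub>Alg K L\<^esub> f) x \<otimes>\<^bsub>A\<^esub> y"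
      "\<And>x y. x \<in> carrier A \<Longrightarrow> y \<in> carrier A \<Longrightarrow> mbeta X (pureA A (mQ X) (mP X) (e' y) (e x)) = \<theta> f y \<otimes>\<^bsub>A\<^esub> x"
    using X by (auto simp: line_hctx_def)
  obtain i i' where i: "line_bim (\<theta> g) (mP Y) i" "line_bim (\<theta> (inv\<^bsub>Alg K L\<^esub> g)) (mQ Y) i'"
    and iY: "\<And>x y. x \<in> carrier A \<Longrightarrow> y \<in> carrier A \<Longrightarrow> malpha Y (pureA A (mP Y) (mQ Y) (i x) (i' y)) = \<theta> (inv\<^bsub>Alg K L\<^esub> g) x \<otimes>\<^bsub>A\<^esub> y"
      "\<And>x y. x \<in> carrier A \<Longrightarrow> y \<in> carrier A \<Longrightarrow> mbeta Y (pureA A (mQ Y) (mP Y) (i' y) (i x)) = \<theta> g y \<otimes>\<^bsub>A\<^esub> x"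
    using Y by (auto simp: line_hctx_def)
  note fi = Alg_inv[OF f] and gi = Alg_inv[OF g]
  have inv: "inv\<^bsub>Alg K L\<^esub> (f \<otimes>\<^bsub>Alg K L\<^esub> g) = inv\<^bsub>Alg K L\<^esub> g \<otimes>\<^bsub>Alg K L\<^esub> inv\<^bsub>Alg K L\<^esub> f"
    "inv\<^bsub>Alg K L\<^esub> (inv\<^bsub>Alg K L\<^esub> f) = f" "inv\<^bsub>Alg K L\<^esub> (inv\<^bsub>Alg K L\<^esub> g) = g" using f g by (simp_all add: G.inv_mult_group)
  let ?s = "\<lambda>x. pureA A (mP X) (mP Y) (e \<one>\<^bsub>A\<^esub>) (i x)" and ?t = "\<lambda>y. pureA A (mQ Y) (mQ X) (i' \<one>\<^bsub>A\<^esub>) (e' y)"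
  have "line_bim (\<theta> (f \<otimes>\<^bsub>Alg K L\<^esub> g)) (tensA K H A (mP X) (mP Y)) ?s" by (rule line_bim_tens[OF f g e(1) i(1)])
  moreover have "line_bim (\<theta> (inv\<^bsub>Alg K L\<^esub> (f \<otimes>\<^bsub>Alg K L\<^esub> g))) (tensA K H A (mQ Y) (mQ X)) ?t"
    unfolding inv by (rule line_bim_tens[OF gi fi i(2) e(2)])
  moreover note line_pairing_mult[OF f g e i eX(1) iY(1)]
  moreover have "mbeta (hopf_morita_mult K H A X Y) (pureA A (tensA K H A (mQ Y) (mQ X)) (tensA K H A (mP X) (mP Y)) (?t y) (?s x))
      = \<theta> (f \<otimes>\<^bsub>Alg K L\<^esub> g) y \<otimes>\<^bsub>A\<^esub> x" if h: "x \<in> carrier A" "y \<in> carrier A" for x y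
  proof -
    have "line_bim (\<theta> (inv\<^bsub>Alg K L\<^esub> (inv\<^bsub>Alg K L\<^esub> g))) (mP Y) i" "line_bim (\<theta> (inv\<^bsub>Alg K L\<^esub> (inv\<^bsub>Alg K L\<^esub> f))) (mP X) e"
      using e i by (simp_all add: inv)
    note line_pairing_mult[OF gi fi i(2) this(1) e(2) this(2), of "mbeta Y" "mbeta X" y x]
    moreover have "inv\<^bsub>Alg K L\<^esub> (inv\<^bsub>Alg K L\<^esub> g \<otimes>\<^bsub>Alg K L\<^esub> inv\<^bsub>Alg K L\<^esub> f) = f \<otimes>\<^bsub>Alg K L\<^esub> g" using f g by (simp add: G.inv_mult_group)
    ultimately show ?thesis using h by (simp add: inv eX iY hopf_morita_mult_def)
  qed
  ultimately show ?thesis unfolding line_hctx_def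
    by (intro exI[of _ ?s] exI[of _ ?t]) (simp add: hopf_morita_mult_def)
qed

lemma line_bim_regular: "line_bim (\<theta> \<one>\<^bsub>Alg K L\<^esub>) (regular_bimod A \<rho>) (\<lambda>x. x)"
proof -
  have same: "same_sp A (regular_bimod A \<rho>)" by (simp add: same_sp_def regular_bimod_def module.defs)
  have "lin A (regular_bimod A \<rho>) (\<lambda>x. x)" by (rule same_lin[OF same_refl same lin_id[OF A.A_module]])
  then show ?thesis unfolding line_bim_def same_tmap[OF same same_refl] same_spD(1)[OF same]
    by (simp add: regular_bimod_def module.defs hopf_bimod.defs theta_id tmap_id bij_betw_def)
qed

lemma line_hctx_unit: "line_hctx (hopf_morita_unit A \<rho>) \<one>\<^bsub>Alg K L\<^esub>"
proof -
  interpret G: group "Alg K L" by (rule L.Alg_group)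
  let ?R = "regular_bimod A \<rho>"
  note R = line_bim_regular and D = line_bimD[OF line_bim_regular]
  note B = line_bimodule[OF G.one_closed R]
  have "abal ?R ?R A (\<otimes>\<^bsub>A\<^esub>)"
  proof (rule abalI)
    have i: "lin ?R A (\<lambda>x. x)" by (rule lin_cong[OF D(8)]) (use D(9,10,11) in simp)
    have x: "x \<in> carrier A" if "x \<in> carrier ?R" for x using linD(3)[OF i that] .
    note [lins] = A.A_mult(1)[OF i] A.A_mult(2)[OF _ i]
    show "bil ?R ?R A (\<otimes>\<^bsub>A\<^esub>)" using x D(2) by (intro bilI) (auto intro!: lins)
    show "ract ?R p a \<otimes>\<^bsub>A\<^esub> q = p \<otimes>\<^bsub>A\<^esub> lact ?R a q" if "p \<in> carrier ?R" "a \<in> carrier A" "q \<in> carrier ?R" for p a q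
      using that x by (simp add: regular_bimod_def module.defs hopf_bimod.defs A.A.m_assoc)
  qed
  from liftA_pure[OF B B this D(3) D(3)]
  show ?thesis unfolding line_hctx_def using R
    by (intro exI[of _ "\<lambda>x. x"]) (simp add: hopf_morita_unit_def theta_id)
qed

text \<open>The pairings are the inverses of the coordinates on \<open>P \<otimes>\<^sub>A Q\<close> and \<open>Q \<otimes>\<^sub>A P\<close>, which are lines of
  trivial character and therefore regular bimodules.\<close>

lemma line_hctx_strict:
  fixes X :: "('k, 'a, 'h, 'm) bimod_morita"
  assumes f: "f \<in> carrier (Alg K L)" and X: "line_hctx X f"
  shows "strict_hopf_morita K H A \<rho> X"
proof -
  interpret G: group "Alg K L" by (rule L.Alg_group)
  note fi = Alg_inv[OF f]
  note [simp] = theta_in[OF f] theta_in[OF fi] theta_mult[OF f] theta_mult[OF fi] theta_inv[OF f] theta_one[OF f] theta_one[OF fi]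
  obtain e e' where e: "line_bim (\<theta> f) (mP X) e" "line_bim (\<theta> (inv\<^bsub>Alg K L\<^esub> f)) (mQ X) e'"
    and eX: "\<And>x y. x \<in> carrier A \<Longrightarrow> y \<in> carrier A \<Longrightarrow> malpha X (pureA A (mP X) (mQ X) (e x) (e' y)) = \<theta> (inv\<^bsub>Alg K L\<^esub> f) x \<otimes>\<^bsub>A\<^esub> y"
      "\<And>x y. x \<in> carrier A \<Longrightarrow> y \<in> carrier A \<Longrightarrow> mbeta X (pureA A (mQ X) (mP X) (e' y) (e x)) = \<theta> f y \<otimes>\<^bsub>A\<^esub> x"
    using X by (auto simp: line_hctx_def)
  note PD = line_bimD[OF e(1)] and QD = line_bimD[OF e(2)]
  let ?R = "regular_bimod A \<rho>"
  have one: "f \<otimes>\<^bsub>Alg K L\<^esub> inv\<^bsub>Alg K L\<^esub> f = \<one>\<^bsub>Alg K L\<^esub>" "inv\<^bsub>Alg K L\<^esub> f \<otimes>\<^bsub>Alg K L\<^esub> f = \<one>\<^bsub>Alg K L\<^esub>" using f by simp_all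
  have cR: "carrier ?R = carrier A" by (simp add: regular_bimod_def module.defs)
  note a = line_bim_transfer[OF G.one_closed line_bim_tens[OF f fi e, unfolded one] line_bim_regular, of "malpha X", unfolded cR]
  note b = line_bim_transfer[OF G.one_closed line_bim_tens[OF fi f e(2,1), unfolded one] line_bim_regular, of "mbeta X", unfolded cR]
  have 1: "lact (mP X) (malpha X (pureA A (mP X) (mQ X) p q)) p' = ract (mP X) p (mbeta X (pureA A (mQ X) (mP X) q p'))"
    if h: "p \<in> carrier (mP X)" "q \<in> carrier (mQ X)" "p' \<in> carrier (mP X)" for p q p'
  proof -
    obtain x y z where "x \<in> carrier A" "p = e x" "y \<in> carrier A" "q = e' y" "z \<in> carrier A" "p' = e z"
      using PD(4)[OF h(1)] QD(4)[OF h(2)] PD(4)[OF h(3)] by auto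
    then show ?thesis by (simp add: eX PD(5,6) A.A.m_assoc)
  qed
  have 2: "lact (mQ X) (mbeta X (pureA A (mQ X) (mP X) q p)) q' = ract (mQ X) q (malpha X (pureA A (mP X) (mQ X) p q'))"
    if h: "q \<in> carrier (mQ X)" "p \<in> carrier (mP X)" "q' \<in> carrier (mQ X)" for p q q'
  proof -
    obtain x y z where "x \<in> carrier A" "p = e x" "y \<in> carrier A" "q = e' y" "z \<in> carrier A" "q' = e' z"
      using PD(4)[OF h(2)] QD(4)[OF h(1)] QD(4)[OF h(3)] by auto
    then show ?thesis by (simp add: eX QD(5,6) A.A.m_assoc)
  qed
  show ?thesis unfolding strict_hopf_morita_def Let_def
    using line_hopf_bimodule[OF f e(1)] line_hopf_bimodule[OF fi e(2)] a b 1 2 by (simp add: eX)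
qed

text \<open>The line is \<open>A\<close> itself, copied into the universe by \<open>x \<mapsto> u [x]\<close>.\<close>

lemma line_hctx_exists:
  fixes u :: "'a list \<Rightarrow> 'u"
  assumes f: "f \<in> carrier (Alg K L)" and u: "inj_on u (lists (carrier A))"
  shows "\<exists>X :: ('k, 'a, 'h, 'u) bimod_morita. strict_hopf_morita K H A \<rho> X \<and> line_hctx X f"
proof -
  define e where "e x = u [x]" for x
  have inj: "inj_on e (carrier A)" using inj_onD[OF u] by (fastforce simp: e_def inj_on_def)
  then have [simp]: "dec e (e x) = x" if "x \<in> carrier A" for x using that by simp
  define M :: "('k, 'u) module" where "M = \<lparr>carrier = e ` carrier A, monoid.mult = undefined, one = undefined,
      zero = e \<zero>\<^bsub>A\<^esub>, add = (\<lambda>x y. e (dec e x \<oplus>\<^bsub>A\<^esub> dec e y)), smult = (\<lambda>c x. e (c \<odot>\<^bsub>A\<^esub> dec e x))\<rparr>"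
  define N :: "('a \<Rightarrow> 'a) \<Rightarrow> ('k, 'a, 'h, 'u) hopf_bimod" where
    "N th = module.extend M (hopf_bimod.fields (\<lambda>a x. e (th a \<otimes>\<^bsub>A\<^esub> dec e x)) (\<lambda>x a. e (dec e x \<otimes>\<^bsub>A\<^esub> a))
       (\<lambda>x. tmap K M H e (\<lambda>h. h) (\<rho> (dec e x))))" for th
  have same: "same_sp M (N th)" for th by (simp add: same_sp_def N_def module.defs)
  have l: "lin A M e" "bij_betw e (carrier A) (carrier M)"
    by (rule transport_module; use inj in \<open>simp add: M_def\<close>)+
  have N: "line_bim th (N th) e" for th
    unfolding line_bim_def same_tmap[OF same same_refl] same_spD(1)[OF same]
    using same_lin[OF same_refl same l(1)] l(2) by (simp add: N_def module.defs hopf_bimod.defs)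
  let ?f = "inv\<^bsub>Alg K L\<^esub> f"
  note fi = Alg_inv[OF f]
  define X where "X = \<lparr>mP = N (\<theta> f), mQ = N (\<theta> ?f), malpha = tensor_lift A (\<lambda>p q. \<theta> ?f (dec e p) \<otimes>\<^bsub>A\<^esub> dec e q),
     mbeta = tensor_lift A (\<lambda>q p. \<theta> f (dec e q) \<otimes>\<^bsub>A\<^esub> dec e p)\<rparr>"
  note P = N[of "\<theta> f"] and Q = N[of "\<theta> ?f"]
  note BP = line_bimodule[OF f P] and BQ = line_bimodule[OF fi Q]
  have X: "line_hctx X f" unfolding line_hctx_def
    using P Q liftA_pure[OF BP BQ line_coordA[OF f fi P Q]] liftA_pure[OF BQ BP line_coordA[OF fi f Q P]]
      line_bimD(3)[OF P] line_bimD(3)[OF Q]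
    by (intro exI[of _ e]) (simp add: X_def)
  then show ?thesis using line_hctx_strict[OF f] by auto
qed

definition coinv where "coinv P = {p \<in> carrier P. coact P p = pure K P H p \<one>\<^bsub>H\<^esub>}"

lemma coinvD: "p \<in> coinv P \<Longrightarrow> p \<in> carrier P" "p \<in> coinv P \<Longrightarrow> coact P p = pure K P H p \<one>\<^bsub>H\<^esub>"
  by (simp_all add: coinv_def)

lemma subsp_coinv: assumes P: "hopf_bimodule K H A \<rho> P" shows "subsp P (coinv P)"
proof -
  note m = hopf_bimodD(3)[OF P] and c = hopf_bimodD(4)[OF P]
  interpret P: module K P by (rule m)
  have l: "lin P (tn P H) (\<lambda>p. pure K P H p \<one>\<^bsub>H\<^esub>)" using m by (auto intro!: lins)
  show ?thesis
    by (rule subspI) (auto simp: coinv_def lin_zero[OF c] lin_zero[OF l, symmetric] linD(4)[OF c] linD(4)[OF l] linD(5)[OF c] linD(5)[OF l])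
qed

text \<open>Galois descent: \<open>p = \<Sum> (p\<^sub>0 l(p\<^sub>1)) r(p\<^sub>1)\<close>, and \<open>tau_coinv\<close> shows that the slices of the tensor
  \<open>\<Sum> p\<^sub>0 l(p\<^sub>1) \<otimes> r(p\<^sub>1)\<close> are coinvariant.\<close>

lemma coinv_generate:
  assumes P: "hopf_bimodule K H A \<rho> P" and p: "p \<in> carrier P"
  obtains ys where "set ys \<subseteq> coinv P \<times> carrier A" "p = pair_sum P (ract P) ys"
proof -
  note B = hopf_bimodD(1)[OF P] and m = hopf_bimodD(3)[OF P] and cin = hopf_bimodD(5)[OF P]
  interpret P: module K P by (rule m)
  note [simp] = m bimod_in[OF B] cin
    and [lins] = cin bimod_in[OF B] bimod_lins[OF B] lin_comp[OF hopf_bimodD(4)[OF P]]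
  note Pc = sw_cong[OF m H.H.A_module cin]
  define t where "t = sw (tn P A) (coact P p) (\<lambda>p0 p1. sw (tn P A) (\<tau> p1) (\<lambda>l r. pure K P A (ract P p0 l) r))"
  have t: "t \<in> carrier (tn P A)" unfolding t_def using p by (auto intro!: lins)
  have eval: "sw G t f = sw G (coact P p) (\<lambda>p0 p1. sw G (\<tau> p1) (\<lambda>l r. f (ract P p0 l) r))" if f: "bil P A G f" for G :: "('k, 'b, 'c) module_scheme" and f
  proof -
    have "sw G t f = sw G (coact P p) (\<lambda>p0 p1. sw G (sw (tn P A) (\<tau> p1) (\<lambda>l r. pure K P A (ract P p0 l) r)) f)"
      unfolding t_def using p by (intro sw_sw[OF f, of P H]) (auto intro!: lins)
    also have "\<dots> = sw G (coact P p) (\<lambda>p0 p1. sw G (\<tau> p1) (\<lambda>l r. sw G (pure K P A (ract P p0 l) r) f))"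
      using p by (intro Pc sw_sw[OF f, of A A]) (auto intro!: lins)
    also have "\<dots> = sw G (coact P p) (\<lambda>p0 p1. sw G (\<tau> p1) (\<lambda>l r. f (ract P p0 l) r))"
      using p by (intro Pc tau_cong sw_pure[OF f]) auto
    finally show ?thesis .
  qed
  have slice: "sw P t (\<lambda>x a. \<phi> a \<odot>\<^bsub>P\<^esub> x) \<in> coinv P" if \<phi>: "lin A k \<phi>" for \<phi>
  proof -
    note [lins] = lin_comp[OF \<phi>] and [simp] = linD(3)[OF \<phi>, simplified]
    let ?T = "tn P H"
    let ?m = "sw P (coact P p) (\<lambda>p0 p1. sw P (\<tau> p1) (\<lambda>l r. \<phi> r \<odot>\<^bsub>P\<^esub> ract P p0 l))"
    have m_eq: "sw P t (\<lambda>x a. \<phi> a \<odot>\<^bsub>P\<^esub> x) = ?m" by (intro eval) (auto intro!: lins)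
    have m_in: "?m \<in> carrier P" using p by (auto intro!: lins)
    have single: "coact P (\<phi> r \<odot>\<^bsub>P\<^esub> ract P p0 l) = sw ?T (coact P p0) (\<lambda>a b. sw ?T (\<rho> l) (\<lambda>l0 l1. pure K P H (\<phi> r \<odot>\<^bsub>P\<^esub> ract P a l0) (b \<otimes>\<^bsub>H\<^esub> l1)))"
      if h: "p0 \<in> carrier P" "l \<in> carrier A" "r \<in> carrier A" for p0 l r
    proof -
      have b: "bil P H ?T (\<lambda>x h. pure K P H (\<phi> r \<odot>\<^bsub>P\<^esub> x) h)" using h by (auto intro!: lins)
      have lm: "lin P P (\<lambda>x. \<phi> r \<odot>\<^bsub>P\<^esub> x)" using h by (auto intro!: lins)
      have "coact P (\<phi> r \<odot>\<^bsub>P\<^esub> ract P p0 l) = \<phi> r \<odot>\<^bsub>?T\<^esub> coact P (ract P p0 l)"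
        using h by (intro linD(5)[OF hopf_bimodD(4)[OF P]]) simp_all
      also have "\<dots> = \<phi> r \<odot>\<^bsub>?T\<^esub> sw ?T (coact P (ract P p0 l)) (pure K P H)"
        using h by (simp add: sw_id)
      also have "\<dots> = sw ?T (coact P (ract P p0 l)) (\<lambda>x h. \<phi> r \<odot>\<^bsub>?T\<^esub> pure K P H x h)"
        using h by (intro sw_push[of ?T ?T _ P H]) (auto intro!: lins)
      also have "\<dots> = sw ?T (coact P (ract P p0 l)) (\<lambda>x h. pure K P H (\<phi> r \<odot>\<^bsub>P\<^esub> x) h)"
        using h by (intro Pc linD(5)[OF pure_lins(1)[OF m H.H.A_module lin_id[OF m]], symmetric]) simp_all
      also have "\<dots> = sw ?T (coact P p0) (\<lambda>a b. sw ?T (\<rho> l) (\<lambda>l0 l1. pure K P H (\<phi> r \<odot>\<^bsub>P\<^esub> ract P a l0) (b \<otimes>\<^bsub>H\<^esub> l1)))"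
        using h by (intro coact_ract[OF P b])
      finally show ?thesis .
    qed
    have "coact P ?m = sw ?T (coact P p) (\<lambda>p0 p1. coact P (sw P (\<tau> p1) (\<lambda>l r. \<phi> r \<odot>\<^bsub>P\<^esub> ract P p0 l)))"
      using p by (intro sw_push[OF hopf_bimodD(4)[OF P] m H.H.A_module]) (auto intro!: lins)
    also have "\<dots> = sw ?T (coact P p) (\<lambda>p0 p1. sw ?T (\<tau> p1) (\<lambda>l r. coact P (\<phi> r \<odot>\<^bsub>P\<^esub> ract P p0 l)))"
      using p by (intro Pc tau_push[OF hopf_bimodD(4)[OF P]]) (auto intro!: lins)
    also have "\<dots> = sw ?T (coact P p) (\<lambda>p0 p1. sw ?T (\<tau> p1) (\<lambda>l r. sw ?T (coact P p0) (\<lambda>a b. sw ?T (\<rho> l) (\<lambda>l0 l1. pure K P H (\<phi> r \<odot>\<^bsub>P\<^esub> ract P a l0) (b \<otimes>\<^bsub>H\<^esub> l1)))))"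
      using p by (intro Pc tau_cong single)
    also have "\<dots> = sw ?T (coact P p) (\<lambda>p0 p1. sw ?T (coact P p0) (\<lambda>a b. sw ?T (\<tau> p1) (\<lambda>l r. sw ?T (\<rho> l) (\<lambda>l0 l1. pure K P H (\<phi> r \<odot>\<^bsub>P\<^esub> ract P a l0) (b \<otimes>\<^bsub>H\<^esub> l1)))))"
      using p by (intro Pc sw_swap[of A A P H]) (auto intro!: lins)
    also have "\<dots> = sw ?T (coact P p) (\<lambda>a x. sw ?T (comult H x) (\<lambda>b c. sw ?T (\<tau> c) (\<lambda>l r. sw ?T (\<rho> l) (\<lambda>l0 l1. pure K P H (\<phi> r \<odot>\<^bsub>P\<^esub> ract P a l0) (b \<otimes>\<^bsub>H\<^esub> l1)))))"
      using p by (intro coact_coassoc[OF P]) (auto intro!: lins)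
    also have "\<dots> = sw ?T (coact P p) (\<lambda>a x. sw ?T (\<tau> x) (\<lambda>l r. pure K P H (\<phi> r \<odot>\<^bsub>P\<^esub> ract P a l) \<one>\<^bsub>H\<^esub>))"
      using p by (intro Pc tau_coinv) (auto intro!: lins)
    also have "\<dots> = sw ?T (coact P p) (\<lambda>a x. pure K P H (sw P (\<tau> x) (\<lambda>l r. \<phi> r \<odot>\<^bsub>P\<^esub> ract P a l)) \<one>\<^bsub>H\<^esub>)"
      using p by (intro Pc tau_push[symmetric]) (auto intro!: lins)
    also have "\<dots> = pure K P H ?m \<one>\<^bsub>H\<^esub>"
      using p by (intro sw_push[symmetric, of P ?T _ P H]) (auto intro!: lins)
    finally show ?thesis unfolding m_eq using m_in by (simp add: coinv_def)
  qed
  obtain ys where ys: "set ys \<subseteq> coinv P \<times> carrier A" "t = pair_sum (tn P A) (pure K P A) ys"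
    using slice_tensor[OF m A.A_module subsp_coinv[OF P] t slice] by auto
  have b: "bil P A P (ract P)" by (intro bilI bimod_lins[OF B] lin_id) simp_all
  have "sw P t (ract P) = sw P (coact P p) (\<lambda>p0 p1. sw P (\<tau> p1) (\<lambda>l r. ract P (ract P p0 l) r))" by (rule eval[OF b])
  also have "\<dots> = sw P (coact P p) (\<lambda>p0 p1. counit H p1 \<odot>\<^bsub>P\<^esub> p0)"
  proof (rule Pc[OF p])
    fix p0 p1 assume h: "p0 \<in> carrier P" "p1 \<in> carrier H"
    have "sw P (\<tau> p1) (\<lambda>l r. ract P (ract P p0 l) r) = sw P (\<tau> p1) (\<lambda>l r. ract P p0 (l \<otimes>\<^bsub>A\<^esub> r))"
      using h by (intro tau_cong) (simp_all add: bimodD(9)[OF B])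
    also have "\<dots> = ract P p0 (sw A (\<tau> p1) (\<lambda>l r. l \<otimes>\<^bsub>A\<^esub> r))"
      using h by (intro tau_push[symmetric] bimodD(5)[OF B]) simp_all
    also have "\<dots> = counit H p1 \<odot>\<^bsub>P\<^esub> p0"
      using h by (simp add: tau_eval linD(5)[OF bimodD(5)[OF B]] bimodD(7)[OF B])
    finally show "sw P (\<tau> p1) (\<lambda>l r. ract P (ract P p0 l) r) = counit H p1 \<odot>\<^bsub>P\<^esub> p0" .
  qed
  also have "\<dots> = p" using hopf_bimodD(2)[OF P] p by (simp add: right_comodule_def)
  finally have "pair_sum P (ract P) ys = p"
    using sw_pair_sum[OF b, of ys] ys coinvD(1) by fastforce
  then show ?thesis using that ys(1) by auto
qed

text \<open>The map \<open>d\<close> gives coordinates for the free generator \<open>p\<close>. The equation \<open>a p = p T(a)\<close> defines an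
  algebra endomorphism \<open>T\<close>, which is colinear because \<open>p\<close> is coinvariant.\<close>

lemma coinv_line:
  fixes P :: "('k, 'a, 'h, 'm) hopf_bimod"
  assumes P: "hopf_bimodule K H A \<rho> P" and p: "p \<in> coinv P" and d: "lin P A d"
    and d1: "\<And>x. x \<in> carrier A \<Longrightarrow> d (ract P p x) = x" and d2: "\<And>q. q \<in> carrier P \<Longrightarrow> ract P p (d q) = q"
  shows "\<exists>f\<in>carrier (Alg K L). line_bim (\<theta> f) P (ract P p)"
proof -
  note B = hopf_bimodD(1)[OF P] and m = hopf_bimodD(3)[OF P] and cin = hopf_bimodD(5)[OF P]
  note p' = coinvD[OF p]
  note [simp] = m bimod_in[OF B] cin p'(1) linD(3)[OF d]
  note idH = lin_id[OF H.H.A_module]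
  define T where "T a = d (lact P a p)" for a
  have T: "ract P p (T a) = lact P a p" if "a \<in> carrier A" for a using d2 that by (simp add: T_def)
  have Tin: "T a \<in> carrier A" if "a \<in> carrier A" for a using that by (simp add: T_def)
  have Tl: "lin A A T" unfolding T_def by (rule lin_comp[OF d bimodD(4)[OF B p'(1)]])
  have el: "lin A P (ract P p)" by (rule bimodD(5)[OF B p'(1)])
  have inj: "x = y" if "x \<in> carrier A" "y \<in> carrier A" "ract P p x = ract P p y" for x y
    using arg_cong[OF that(3), of d] unfolding d1[OF that(1)] d1[OF that(2)] .
  have act: "lact P a (ract P p x) = ract P p (T a \<otimes>\<^bsub>A\<^esub> x)" if h: "a \<in> carrier A" "x \<in> carrier A" for a x
    using h Tin by (simp add: bimodD(9)[OF B] T bimodD(10)[OF B])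
  have Tm: "T (a \<otimes>\<^bsub>A\<^esub> b) = T a \<otimes>\<^bsub>A\<^esub> T b" if h: "a \<in> carrier A" "b \<in> carrier A" for a b
  proof (rule inj)
    have "ract P p (T (a \<otimes>\<^bsub>A\<^esub> b)) = lact P a (ract P p (T b))" using h by (simp add: T bimodD(8)[OF B])
    then show "ract P p (T (a \<otimes>\<^bsub>A\<^esub> b)) = ract P p (T a \<otimes>\<^bsub>A\<^esub> T b)" using h Tin by (simp add: act)
  qed (use h Tin in auto)
  have T1: "T \<one>\<^bsub>A\<^esub> = \<one>\<^bsub>A\<^esub>" using d1[of "\<one>\<^bsub>A\<^esub>"] by (simp add: T_def bimodD(6,7)[OF B])
  let ?T = "tn P H"
  note bp = bil_pure[OF m H.H.A_module]
  note [lins] = bimod_in[OF B] bimod_lins[OF B] cin p'(1) lin_comp[OF hopf_bimodD(4)[OF P]]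
  have cr: "coact P (ract P p x) = tmap K P H (ract P p) (\<lambda>h. h) (\<rho> x)" if x: "x \<in> carrier A" for x
  proof -
    have "coact P (ract P p x) = sw ?T (coact P (ract P p x)) (pure K P H)" using x by (simp add: sw_id)
    also have "\<dots> = sw ?T (coact P p) (\<lambda>p0 p1. sw ?T (\<rho> x) (\<lambda>b0 b1. pure K P H (ract P p0 b0) (p1 \<otimes>\<^bsub>H\<^esub> b1)))"
      by (rule coact_ract[OF P bp p'(1) x])
    also have "\<dots> = sw ?T (\<rho> x) (\<lambda>b0 b1. pure K P H (ract P p b0) (\<one>\<^bsub>H\<^esub> \<otimes>\<^bsub>H\<^esub> b1))"
      unfolding p'(2) using x by (intro sw_pure) (auto intro!: lins)
    also have "\<dots> = tmap K P H (ract P p) (\<lambda>h. h) (\<rho> x)" unfolding tmap_def using x by (intro rho_cong) simp_all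
    finally show ?thesis .
  qed
  have cl: "coact P (lact P a p) = tmap K P H (\<lambda>a. lact P a p) (\<lambda>h. h) (\<rho> a)" if a: "a \<in> carrier A" for a
  proof -
    have "coact P (lact P a p) = sw ?T (coact P (lact P a p)) (pure K P H)" using a by (simp add: sw_id)
    also have "\<dots> = sw ?T (\<rho> a) (\<lambda>a0 a1. sw ?T (coact P p) (\<lambda>p0 p1. pure K P H (lact P a0 p0) (a1 \<otimes>\<^bsub>H\<^esub> p1)))"
      by (rule coact_lact[OF P bp p'(1) a])
    also have "\<dots> = sw ?T (\<rho> a) (\<lambda>a0 a1. pure K P H (lact P a0 p) (a1 \<otimes>\<^bsub>H\<^esub> \<one>\<^bsub>H\<^esub>))"
      unfolding p'(2) using a by (intro rho_cong sw_pure) (auto intro!: lins)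
    also have "\<dots> = tmap K P H (\<lambda>a. lact P a p) (\<lambda>h. h) (\<rho> a)" unfolding tmap_def using a by (intro rho_cong) simp_all
    finally show ?thesis .
  qed
  have Tr: "\<rho> (T a) = tmap K A H T (\<lambda>h. h) (\<rho> a)" if a: "a \<in> carrier A" for a
  proof -
    have "\<rho> (T a) = tmap K A H (\<lambda>x. x) (\<lambda>h. h) (\<rho> (T a))" using Tin[OF a] by (simp add: tmap_id)
    also have "\<dots> = tmap K A H (\<lambda>x. d (ract P p x)) (\<lambda>h. h) (\<rho> (T a))"
      using Tin[OF a] d1 by (intro tmap_cong[of A H]) simp_all
    also have "\<dots> = tmap K A H d (\<lambda>h. h) (coact P (ract P p (T a)))"
      unfolding cr[OF Tin[OF a]] using Tin[OF a] by (intro tmap_tmap[OF el idH d idH, symmetric]) simp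
    also have "\<dots> = tmap K A H d (\<lambda>h. h) (tmap K P H (\<lambda>a. lact P a p) (\<lambda>h. h) (\<rho> a))" using a by (simp add: T cl)
    also have "\<dots> = tmap K A H T (\<lambda>h. h) (\<rho> a)"
      unfolding T_def using a by (intro tmap_tmap[OF bimodD(4)[OF B p'(1)] idH d idH]) simp
    finally show ?thesis .
  qed
  obtain f where f: "f \<in> carrier (Alg K L)" "\<And>a. a \<in> carrier A \<Longrightarrow> T a = \<theta> f a"
    using theta_surj[OF Tl Tm T1 Tr] by auto
  have "bij_betw (ract P p) (carrier A) (carrier P)"
    by (rule bij_betw_byWitness[where f' = d]) (use d1 d2 in auto)
  then have "line_bim (\<theta> f) P (ract P p)"
    unfolding line_bim_def using el act f(2) cr by (simp add: bimodD(9)[OF B])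
  then show ?thesis using f(1) by auto
qed

text \<open>The tensor product of coinvariants is coinvariant, and so is its image in \<open>A\<close>.\<close>

lemma colinear_scalar:
  fixes P :: "('k, 'a, 'h, 'm) hopf_bimod" and Q :: "('k, 'a, 'h, 'n) hopf_bimod"
  assumes P: "hopf_bimodule K H A \<rho> P" and Q: "hopf_bimodule K H A \<rho> Q"
    and a: "hopf_bimod_hom K H A (tensA K H A P Q) (regular_bimod A \<rho>) \<alpha>" and l: "lin (bt P Q) A \<alpha>"
    and p: "p \<in> coinv P" and q: "q \<in> coinv Q"
  shows "\<exists>c\<in>carrier K. \<alpha> (pureA A P Q p q) = c \<odot>\<^bsub>A\<^esub> \<one>\<^bsub>A\<^esub>"
proof -
  note BP = hopf_bimodD(1)[OF P] and BQ = hopf_bimodD(1)[OF Q] and mP = hopf_bimodD(3)[OF P] and mQ = hopf_bimodD(3)[OF Q]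
  note [simp] = mP mQ bt_module[OF BP BQ] and pD = coinvD[OF p] and qD = coinvD[OF q] and same = same_tensA[OF BP BQ]
  note [lins] = bilD[OF bil_pureA[OF BP BQ]]
  have sameR: "same_sp A (regular_bimod A \<rho>)" by (simp add: same_sp_def regular_bimod_def module.defs)
  have t: "pureA A P Q p q \<in> carrier (bt P Q)" by (rule pureA_in[OF BP BQ pD(1) qD(1)])
  let ?T = "tn (bt P Q) H"
  have "coact (tensA K H A P Q) (pureA A P Q p q) = sw ?T (pure K P H p \<one>\<^bsub>H\<^esub>) (\<lambda>p0 p1. sw ?T (pure K Q H q \<one>\<^bsub>H\<^esub>) (\<lambda>q0 q1.
     pure K (bt P Q) H (pureA A P Q p0 q0) (p1 \<otimes>\<^bsub>H\<^esub> q1)))"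
    using tensA_coact[OF P Q pD(1) qD(1)] by (simp add: pD qD)
  also have "\<dots> = sw ?T (pure K Q H q \<one>\<^bsub>H\<^esub>) (\<lambda>q0 q1. pure K (bt P Q) H (pureA A P Q p q0) (\<one>\<^bsub>H\<^esub> \<otimes>\<^bsub>H\<^esub> q1))"
    using pD(1) qD(1) by (intro sw_pure) (auto intro!: lins)
  also have "\<dots> = pure K (bt P Q) H (pureA A P Q p q) (\<one>\<^bsub>H\<^esub> \<otimes>\<^bsub>H\<^esub> \<one>\<^bsub>H\<^esub>)"
    using pD(1) qD(1) by (intro sw_pure) (auto intro!: lins)
  finally have c: "coact (tensA K H A P Q) (pureA A P Q p q) = pure K (bt P Q) H (pureA A P Q p q) \<one>\<^bsub>H\<^esub>" by simp
  have "\<rho> (\<alpha> (pureA A P Q p q)) = tmap K A H \<alpha> (\<lambda>h. h) (coact (tensA K H A P Q) (pureA A P Q p q))"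
    using a t unfolding hopf_bimod_hom_def same_tmap[OF sameR same_refl] same_spD(1)[OF same_tensA[OF BP BQ]]
    by (simp add: regular_bimod_def module.defs hopf_bimod.defs)
  also have "\<dots> = pure K A H (\<alpha> (pureA A P Q p q)) \<one>\<^bsub>H\<^esub>"
    unfolding c by (intro tmap_pure[OF l lin_id[OF H.H.A_module] t]) simp
  finally show ?thesis using linD(3)[OF l t] coinv_scalar by auto
qed

text \<open>Every element of \<open>P \<otimes>\<^sub>A Q\<close> is a sum of elements \<open>(p \<otimes> q) a\<close> with coinvariant \<open>p\<close> and \<open>q\<close>: write
  the left factor as \<open>p b\<close>, move \<open>b\<close> to the right factor and expand the latter.\<close>

lemma pairing_vanish:
  fixes P :: "('k, 'a, 'h, 'm) hopf_bimod" and Q :: "('k, 'a, 'h, 'n) hopf_bimod"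
  assumes P: "hopf_bimodule K H A \<rho> P" and Q: "hopf_bimodule K H A \<rho> Q" and l: "lin (bt P Q) A \<alpha>"
    and r: "\<And>p q a. p \<in> carrier P \<Longrightarrow> q \<in> carrier Q \<Longrightarrow> a \<in> carrier A \<Longrightarrow> \<alpha> (pureA A P Q p (ract Q q a)) = \<alpha> (pureA A P Q p q) \<otimes>\<^bsub>A\<^esub> a"
    and z: "\<And>p q. p \<in> coinv P \<Longrightarrow> q \<in> coinv Q \<Longrightarrow> \<alpha> (pureA A P Q p q) = \<zero>\<^bsub>A\<^esub>"
    and t: "t \<in> carrier (bt P Q)"
  shows "\<alpha> t = \<zero>\<^bsub>A\<^esub>"
proof -
  note BP = hopf_bimodD(1)[OF P] and BQ = hopf_bimodD(1)[OF Q] and mP = hopf_bimodD(3)[OF P] and mQ = hopf_bimodD(3)[OF Q]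
  note bp = bil_pureA[OF BP BQ]
  have 1: "\<alpha> (pureA A P Q p q) = \<zero>\<^bsub>A\<^esub>" if p: "p \<in> coinv P" and q: "q \<in> carrier Q" for p q
  proof -
    note p' = coinvD(1)[OF p]
    obtain ys where ys: "set ys \<subseteq> coinv Q \<times> carrier A" "q = pair_sum Q (ract Q) ys" by (rule coinv_generate[OF Q q])
    have f: "m \<in> coinv Q" "n \<in> carrier A" "m \<in> carrier Q" if "(m, n) \<in> set ys" for m n using ys(1) that coinvD(1)[of m Q] by auto
    have "\<alpha> (pureA A P Q p q) = pair_sum A (\<lambda>m n. \<alpha> (pureA A P Q p (ract Q m n))) ys"
      unfolding ys(2) using f by (intro pair_sum_push[OF lin_comp[OF l bilD(2)[OF bp p' lin_id[OF mQ]]]] bimod_in[OF BQ])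
    also have "\<dots> = \<zero>\<^bsub>A\<^esub>" using f p' z[OF p] by (intro pair_sum_zero) (simp_all add: r)
    finally show ?thesis .
  qed
  have 2: "\<alpha> (pureA A P Q p q) = \<zero>\<^bsub>A\<^esub>" if p: "p \<in> carrier P" and q: "q \<in> carrier Q" for p q
  proof -
    obtain ys where ys: "set ys \<subseteq> coinv P \<times> carrier A" "p = pair_sum P (ract P) ys" by (rule coinv_generate[OF P p])
    have f: "m \<in> coinv P" "n \<in> carrier A" "m \<in> carrier P" if "(m, n) \<in> set ys" for m n using ys(1) that coinvD(1)[of m P] by auto
    have "\<alpha> (pureA A P Q p q) = pair_sum A (\<lambda>m n. \<alpha> (pureA A P Q (ract P m n) q)) ys"
      unfolding ys(2) using f q by (intro pair_sum_push[OF lin_comp[OF l bilD(1)[OF bp lin_id[OF mP] q]]] bimod_in[OF BP])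
    also have "\<dots> = \<zero>\<^bsub>A\<^esub>" using f q by (intro pair_sum_zero) (simp_all add: pureA_bal[OF BP BQ] 1 bimod_in[OF BQ])
    finally show ?thesis .
  qed
  have "lin (bt P Q) A (\<lambda>t. \<zero>\<^bsub>A\<^esub>)" using bt_module[OF BP BQ] by (intro linI) simp_all
  from btA_ext[OF BP BQ l this t] show ?thesis using 2 by simp
qed

text \<open>By \<open>pairing_vanish\<close> there are coinvariants with \<open>\<alpha>(p \<otimes> q) \<noteq> 0\<close>, which is a scalar and may be taken
  to be \<open>1\<close>. Then \<open>x = p \<beta>(q \<otimes> x)\<close> on \<open>P\<close>; at \<open>x = p\<close> this gives \<open>\<beta>(q \<otimes> p) = 1\<close>, hence
  \<open>x = q \<alpha>(p \<otimes> x)\<close> on \<open>Q\<close>. So \<open>p\<close> and \<open>q\<close> are free generators. The two characters are inverse to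
  each other because \<open>\<alpha>\<close> identifies \<open>P \<otimes>\<^sub>A Q\<close> with the regular bimodule.\<close>

lemma strict_line_hctx:
  fixes X :: "('k, 'a, 'h, 'm) bimod_morita"
  assumes X: "strict_hopf_morita K H A \<rho> X"
  shows "\<exists>f\<in>carrier (Alg K L). line_hctx X f"
proof -
  interpret G: group "Alg K L" by (rule L.Alg_group)
  let ?P = "mP X" and ?Q = "mQ X" and ?\<alpha> = "malpha X" and ?\<beta> = "mbeta X" and ?R = "regular_bimod A \<rho>"
  have P: "hopf_bimodule K H A \<rho> ?P" and Q: "hopf_bimodule K H A \<rho> ?Q"
    and ah: "hopf_bimod_hom K H A (tensA K H A ?P ?Q) ?R ?\<alpha>"
    and bh: "hopf_bimod_hom K H A (tensA K H A ?Q ?P) ?R ?\<beta>"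
    and as1: "\<And>p q p'. p \<in> carrier ?P \<Longrightarrow> q \<in> carrier ?Q \<Longrightarrow> p' \<in> carrier ?P \<Longrightarrow>
       lact ?P (?\<alpha> (pureA A ?P ?Q p q)) p' = ract ?P p (?\<beta> (pureA A ?Q ?P q p'))"
    and as2: "\<And>q p q'. q \<in> carrier ?Q \<Longrightarrow> p \<in> carrier ?P \<Longrightarrow> q' \<in> carrier ?Q \<Longrightarrow>
       lact ?Q (?\<beta> (pureA A ?Q ?P q p)) q' = ract ?Q q (?\<alpha> (pureA A ?P ?Q p q'))"
    and ab: "bij_betw ?\<alpha> (carrier (tensA K H A ?P ?Q)) (carrier A)"
    using X by (simp_all add: strict_hopf_morita_def Let_def)
  note BP = hopf_bimodD(1)[OF P] and BQ = hopf_bimodD(1)[OF Q] and mP = hopf_bimodD(3)[OF P] and mQ = hopf_bimodD(3)[OF Q]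
  interpret P: module K ?P by (rule mP)
  note sA = same_tensA[OF BP BQ] and sB = same_tensA[OF BQ BP]
  have sameR: "same_sp A ?R" by (simp add: same_sp_def regular_bimod_def module.defs)
  have Rr: "ract ?R x a = x \<otimes>\<^bsub>A\<^esub> a" for x a by (simp add: regular_bimod_def module.defs hopf_bimod.defs)
  have al: "lin (bt ?P ?Q) A ?\<alpha>" and bl: "lin (bt ?Q ?P) A ?\<beta>"
    using ah bh bt_module[OF BP BQ] bt_module[OF BQ BP]
    by (simp_all add: hopf_bimod_hom_def lin_def k_linear_def same_spD[OF sA] same_spD[OF sB] same_spD[OF sameR])
  note bA = bil_pureA[OF BP BQ] and bB = bil_pureA[OF BQ BP]
  have ar: "?\<alpha> (pureA A ?P ?Q p (ract ?Q q a)) = ?\<alpha> (pureA A ?P ?Q p q) \<otimes>\<^bsub>A\<^esub> a"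
    if "p \<in> carrier ?P" "q \<in> carrier ?Q" "a \<in> carrier A" for p q a
  proof -
    have "?\<alpha> (ract (tensA K H A ?P ?Q) (pureA A ?P ?Q p q) a) = ?\<alpha> (pureA A ?P ?Q p q) \<otimes>\<^bsub>A\<^esub> a"
      using ah that(3) pureA_in[OF BP BQ that(1,2)] by (simp add: hopf_bimod_hom_def same_spD[OF sA] Rr)
    then show ?thesis using tensA_ract[OF BP BQ that(3,1,2)] by simp
  qed
  have br: "?\<beta> (pureA A ?Q ?P q (ract ?P p a)) = ?\<beta> (pureA A ?Q ?P q p) \<otimes>\<^bsub>A\<^esub> a"
    if "q \<in> carrier ?Q" "p \<in> carrier ?P" "a \<in> carrier A" for p q a
  proof -
    have "?\<beta> (ract (tensA K H A ?Q ?P) (pureA A ?Q ?P q p) a) = ?\<beta> (pureA A ?Q ?P q p) \<otimes>\<^bsub>A\<^esub> a"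
      using bh that(3) pureA_in[OF BQ BP that(1,2)] by (simp add: hopf_bimod_hom_def same_spD[OF sB] Rr)
    then show ?thesis using tensA_ract[OF BQ BP that(3,1,2)] by simp
  qed
  have "\<exists>p\<in>coinv ?P. \<exists>q\<in>coinv ?Q. ?\<alpha> (pureA A ?P ?Q p q) \<noteq> \<zero>\<^bsub>A\<^esub>"
  proof (rule ccontr)
    assume "\<not> ?thesis"
    then have z: "?\<alpha> (pureA A ?P ?Q p q) = \<zero>\<^bsub>A\<^esub>" if "p \<in> coinv ?P" "q \<in> coinv ?Q" for p q using that by auto
    have "\<one>\<^bsub>A\<^esub> \<in> ?\<alpha> ` carrier (bt ?P ?Q)" using ab by (simp add: bij_betw_def same_spD[OF sA])
    then obtain t where "t \<in> carrier (bt ?P ?Q)" "?\<alpha> t = \<one>\<^bsub>A\<^esub>" by auto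
    then show False using pairing_vanish[OF P Q al ar z] A_nontrivial by simp
  qed
  then obtain p0 q where p0: "p0 \<in> coinv ?P" and q: "q \<in> coinv ?Q" and ne: "?\<alpha> (pureA A ?P ?Q p0 q) \<noteq> \<zero>\<^bsub>A\<^esub>" by auto
  obtain c where c: "c \<in> carrier K" "?\<alpha> (pureA A ?P ?Q p0 q) = c \<odot>\<^bsub>A\<^esub> \<one>\<^bsub>A\<^esub>"
    using colinear_scalar[OF P Q ah al p0 q] by auto
  then have "c \<noteq> \<zero>" using ne by auto
  then have ic: "inv c \<in> carrier K" "inv c \<otimes> c = \<one>" using c field_Units by auto
  define p where "p = inv c \<odot>\<^bsub>?P\<^esub> p0"
  have p: "p \<in> coinv ?P" unfolding p_def by (rule subspD(4)[OF subsp_coinv[OF P] ic(1) p0])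
  note p' = coinvD(1)[OF p] and q' = coinvD(1)[OF q]
  have A1: "?\<alpha> (pureA A ?P ?Q p q) = \<one>\<^bsub>A\<^esub>"
    using linD(5)[OF lin_comp[OF al bilD(1)[OF bA lin_id[OF mP] q']] ic(1) coinvD(1)[OF p0]] c ic
    by (simp add: p_def A.Am.smult_assoc1[symmetric])
  have genP: "ract ?P p (?\<beta> (pureA A ?Q ?P q x)) = x" if "x \<in> carrier ?P" for x
    using as1[OF p' q' that] A1 that by (simp add: bimodD(6)[OF BP])
  obtain d where d: "d \<in> carrier K" "?\<beta> (pureA A ?Q ?P q p) = d \<odot>\<^bsub>A\<^esub> \<one>\<^bsub>A\<^esub>"
    using colinear_scalar[OF Q P bh bl q p] by auto
  have pz: "p \<noteq> \<zero>\<^bsub>?P\<^esub>"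
    using A1 lin_zero[OF lin_comp[OF al bilD(1)[OF bA lin_id[OF mP] q']]] A_nontrivial by auto
  have "d = \<one>"
  proof (rule scalar_inj[OF mP p' pz d(1) one_closed])
    show "d \<odot>\<^bsub>?P\<^esub> p = \<one> \<odot>\<^bsub>?P\<^esub> p"
      using genP[OF p'] d linD(5)[OF bimodD(5)[OF BP p'] d(1) A.A.one_closed] p' by (simp add: bimodD(7)[OF BP])
  qed
  then have B1: "?\<beta> (pureA A ?Q ?P q p) = \<one>\<^bsub>A\<^esub>" using d by simp
  have genQ: "ract ?Q q (?\<alpha> (pureA A ?P ?Q p x)) = x" if "x \<in> carrier ?Q" for x
    using as2[OF q' p' that] B1 that by (simp add: bimodD(6)[OF BQ])
  note dP = lin_comp[OF bl bilD(2)[OF bB q' lin_id[OF mP]]] and dQ = lin_comp[OF al bilD(2)[OF bA p' lin_id[OF mQ]]]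
  have dP1: "?\<beta> (pureA A ?Q ?P q (ract ?P p x)) = x" and dQ1: "?\<alpha> (pureA A ?P ?Q p (ract ?Q q x)) = x" if "x \<in> carrier A" for x
    using br[OF q' p' that] ar[OF p' q' that] that by (simp_all add: A1 B1)
  obtain f where f: "f \<in> carrier (Alg K L)" and eP: "line_bim (\<theta> f) ?P (ract ?P p)"
    using coinv_line[OF P p dP dP1 genP] by auto
  obtain g where g: "g \<in> carrier (Alg K L)" and eQ: "line_bim (\<theta> g) ?Q (ract ?Q q)"
    using coinv_line[OF Q q dQ dQ1 genQ] by auto
  have "f \<otimes>\<^bsub>Alg K L\<^esub> g = \<one>\<^bsub>Alg K L\<^esub>"
    using ab by (intro line_hom_eq[OF L.Alg_mult_in[OF f g] G.one_closed line_bim_tens[OF f g eP eQ] line_bim_regular ah])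
      (simp add: same_spD(1)[OF sameR])
  then have gf: "g = inv\<^bsub>Alg K L\<^esub> f" using G.inv_equality[of f g] f g by (metis G.inv_inv)
  have "?\<alpha> (pureA A ?P ?Q (ract ?P p x) (ract ?Q q y)) = \<theta> g x \<otimes>\<^bsub>A\<^esub> y"
    "?\<beta> (pureA A ?Q ?P (ract ?Q q y) (ract ?P p x)) = \<theta> f y \<otimes>\<^bsub>A\<^esub> x" if h: "x \<in> carrier A" "y \<in> carrier A" for x y
  proof -
    show "?\<alpha> (pureA A ?P ?Q (ract ?P p x) (ract ?Q q y)) = \<theta> g x \<otimes>\<^bsub>A\<^esub> y"
      using h p' q' theta_in[OF g h(1)] by (simp add: pureA_bal[OF BP BQ] bimod_in[OF BQ] line_bimD(5)[OF eQ] dQ1)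
    show "?\<beta> (pureA A ?Q ?P (ract ?Q q y) (ract ?P p x)) = \<theta> f y \<otimes>\<^bsub>A\<^esub> x"
      using h p' q' theta_in[OF f h(2)] by (simp add: pureA_bal[OF BQ BP] bimod_in[OF BP] line_bimD(5)[OF eP] dP1)
  qed
  then have "line_hctx X f" unfolding line_hctx_def using eP eQ gf
    by (intro exI[of _ "ract ?P p"] exI[of _ "ract ?Q q"]) simp
  then show ?thesis using f by auto
qed

lemma PicH_iso:
  fixes u :: "'a list \<Rightarrow> 'u"
  assumes u: "inj_on u (lists (carrier A))"
  shows "group (PicH K H A \<rho> :: ('k, 'a, 'h, 'u) bimod_morita set monoid) \<and>
    Alg K L \<cong> (PicH K H A \<rho> :: ('k, 'a, 'h, 'u) bimod_morita set monoid)"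
proof (rule class_group_iso[where R = line_hctx and strict = "strict_hopf_morita K H A \<rho>"
    and eqv = "hopf_morita_iso K H A" and m = "\<lambda>X Y Z. hopf_morita_iso K H A (hopf_morita_mult K H A X Y) Z"
    and u = "hopf_morita_iso K H A (hopf_morita_unit A \<rho>)"])
  show "group (Alg K L)" by (rule L.Alg_group)
  fix X Y Z :: "('k, 'a, 'h, 'u) bimod_morita" and f g j
  show "strict_hopf_morita K H A \<rho> X \<Longrightarrow> \<exists>f\<in>carrier (Alg K L). line_hctx X f" by (rule strict_line_hctx)
  show "f \<in> carrier (Alg K L) \<Longrightarrow> \<exists>X :: ('k, 'a, 'h, 'u) bimod_morita. strict_hopf_morita K H A \<rho> X \<and> line_hctx X f"
    by (rule line_hctx_exists[OF _ u])
  assume f: "f \<in> carrier (Alg K L)" and g: "g \<in> carrier (Alg K L)"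
  show "line_hctx X f \<Longrightarrow> line_hctx Y g \<Longrightarrow> hopf_morita_iso K H A X Y \<longleftrightarrow> f = g"
    by (rule line_hctx_iso[OF f g])
  assume j: "j \<in> carrier (Alg K L)"
  show "line_hctx X f \<Longrightarrow> line_hctx Y g \<Longrightarrow> line_hctx Z j \<Longrightarrow>
     hopf_morita_iso K H A (hopf_morita_mult K H A X Y) Z \<longleftrightarrow> f \<otimes>\<^bsub>Alg K L\<^esub> g = j"
    by (rule line_hctx_iso[OF L.Alg_mult_in[OF f g] j line_hctx_mult[OF f g]])
next
  fix Z :: "('k, 'a, 'h, 'u) bimod_morita" and j
  assume "j \<in> carrier (Alg K L)" "line_hctx Z j"
  then show "hopf_morita_iso K H A (hopf_morita_unit A \<rho>) Z \<longleftrightarrow> \<one>\<^bsub>Alg K L\<^esub> = j"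
    using line_hctx_iso[OF _ _ line_hctx_unit] group.is_monoid[OF L.Alg_group] by (simp add: monoid.one_closed)
qed (simp add: PicH_def)

end

theorem proposition9p1:
  fixes K :: "'k ring"
    and H :: "('k, 'h) hopf"
    and A :: "('k, 'a) module"
    and \<rho> :: "'a \<Rightarrow> ('a, 'h) tensor"
    and L :: "('k, 'l) hopf"
    and lam :: "'a \<Rightarrow> ('l, 'a) tensor"
    and u :: "'a list \<Rightarrow> 'u"
    and v :: "'k \<Rightarrow> 'v"
  assumes "field K"
    and "hopf_algebra K H"
    and "bij_betw (antipode H) (carrier H) (carrier H)"
    and "right_galois_object K H A \<rho>"
    and "hopf_algebra K L"
    and "bigalois_object K L H A lam \<rho>"
    and "inj_on u (lists (carrier A))"
    and "inj_on v (carrier K)"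
  shows "group (PicH K H A \<rho> :: ('k, 'a, 'h, 'u) bimod_morita set monoid) \<and>
    group (PicSq K H A \<rho> :: ('k, 'a, 'v) cotens_morita set monoid) \<and>
    group (Alg K L) \<and>
    (PicH K H A \<rho> :: ('k, 'a, 'h, 'u) bimod_morita set monoid)
      \<cong> (PicSq K H A \<rho> :: ('k, 'a, 'v) cotens_morita set monoid) \<and>
    (PicSq K H A \<rho> :: ('k, 'a, 'v) cotens_morita set monoid) \<cong> Alg K L"
proof -
  have "k_algebra K A" using assms(4) by (simp add: right_galois_object_def)
  then interpret galoisK K H L A \<rho> lam
    using assms by (intro galoisK.intro galoisK_axioms.intro hopfK.intro algK.intro fieldK.intro
      hopfK_axioms.intro algK_axioms.intro)
  note PH = PicH_iso[OF assms(7)] and PS = PicSq_iso[OF assms(8)] and G = L.Alg_group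
  note PH' = group.iso_sym[OF G conjunct2[OF PH]] and PS' = group.iso_sym[OF G conjunct2[OF PS]]
  show ?thesis
    using PH PS G PS' iso_trans[OF PH' conjunct2[OF PS]] by simp
qed

end
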